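(* The operad $\mathtt{PaPB}$ is isomorphic to the fundamental groupoid of $\mathtt{SC}$ restricted to the image of the embedding $\mathtt{\Omega\Omega}\hookrightarrow\mathtt{SC}$, and there is a zigzag of categorical equivalences of operads in groupoids $$\pi\mathtt{SC}\xleftarrow{\sim}\pi\mathtt{SC}_{|\mathtt{\Omega\Omega}}\cong\mathtt{PaPB}\xrightarrow{\sim}\mathtt{CoPB}.$$
   Context: **Relative operads.** A relative operad over a one-colored symmetric operad $P$ is a symmetric operad $Q$ with two colors $c$ ("closed") and $o$ ("open") such that $Q(x_1,\dots,x_n;c)=P(n)$ if $x_1=\dots=x_n=c$ and is empty otherwise. Write $Q(n,m)=Q(o^n,c^m;o)$ and $Q^c(m)=P(m)$. In $\circ_i^o:Q(n,m)\times Q(n',m')\to Q(n+n'-1,m+m')$ (insertion in the $i$-th open input) the closed inputs of the first factor are numbered $1,\dots,m$ and those of the second $m+1,\dots,m+m'$; $\circ_i^c$ is insertion in the $i$-th closed input. **Swiss-Cheese operad.** Let $D$ be the closed unit disk of $\mathbb C$ and $D^+=\{z\in D:\operatorname{Im}z\ge 0\}$. For $m\ge1$, $\mathtt D_2(m)$ is the space of $m$-tuples of maps $D\to D$, $z\mapsto\lambda z+b$ ($\lambda>0$), whose images have disjoint interiors. For $n+m\ge1$, $\mathtt{SC}(n,m)$ is the space of tuples of $n$ maps $D^+\to D^+$, $z\mapsto\lambda z+b$ ($\lambda>0$, $b\in\mathbb R$), and $m$ maps $D\to D^+$, $z\mapsto\lambda z+b$ ($\lambda>0$), whose images all have disjoint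 interiors ($n=0$ is allowed). Set $\mathtt D_2(0)=\mathtt{SC}(0,0)=\varnothing$. With composition of embeddings, $\mathtt{SC}$ is a relative operad over $\mathtt D_2$. $\pi$ denotes the fundamental groupoid, applied aritywise. **Magmas.** $\mathtt{\Omega\Omega}$ is the free two-colored symmetric operad in sets on $\mu_c\in\mathtt{\Omega\Omega}(c,c;c)$, $f\in\mathtt{\Omega\Omega}(c;o)$, $\mu_o\in\mathtt{\Omega\Omega}(o,o;o)$ (with free $\Sigma_2$-actions on $\mu_c,\mu_o$); its closed part is the free operad $\mathtt\Omega$ on $\mu_c$. The embedding $\mathtt{\Omega\Omega}\hookrightarrow\mathtt{SC}$ sends $\mu_c$ to $(z\mapsto\frac{z-1}2,z\mapsto\frac{z+1}2)\in\mathtt D_2(2)$, $\mu_o$ to the pair of half-disk embeddings given by the same formulas in $\mathtt{SC}(2,0)$, and $f$ to $(z\mapsto\frac{z+i}2)\in\mathtt{SC}(0,1)$. $\pi\mathtt{SC}_{|\mathtt{\Omega\Omega}}$ is the full suboperad in groupoids of $\pi\mathtt{SC}$ whose objects are in the image. **Colored (permutations and) braids.** $\mathtt{CoB}(m)$ ($m\geq 1$) is the groupoid whose objects are the orderings (words) $w$ of $\{1,\dots,m\}$, and whose morphisms $w\to w'$ are homotopy classes of paths of $m$ labeled distinct points in the open unit disk, from a configuration whose real parts are distinct and in the left-to-right order $w$ to one whose real parts are distinct and in order $w'$ (endpoints may vary inside these contractible sets). $\mathtt{CoPB}(n,m)$ ($n+m\ge1$) is defined likewise: let $\operatorname{Conf}(n,m)$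 be the space of $(z_1,\dots,z_n,u_1,\dots,u_m)$ of pairwise distinct points in $D^+$ with $\operatorname{Im}z_i=0$ (terrestrial, open points), $\operatorname{Im}u_j>0$ (aerial, closed points). Objects are words containing each open letter $1,\dots,n$ and each closed letter $1,\dots,m$ exactly once, and morphisms are homotopy classes of paths in $\operatorname{Conf}(n,m)$ between configurations with distinct real parts in the prescribed left-to-right orders; equivalently it is the fundamental groupoid of $\operatorname{Conf}(n,m)$ restricted to a choice of one base configuration per word. Operadic composition substitutes words in objects; on morphisms it replaces a moving point by a very small copy of another moving configuration ($\mathtt{CoB}$ inserted at aerial points, $\mathtt{CoPB}$ inserted at terrestrial points; paths are chosen in $|z|<1$). $\mathtt{CoPB}$ is a relative operad over $\mathtt{CoB}$. **$\mathtt{PaPB}$.** Let $\omega:\mathtt{\Omega\Omega}\to\operatorname{ob}\mathtt{CoPB}$ be the operad morphism sending $\mu_c$ to the word $12$ of $\mathtt{CoB}(2)$, $f$ to the word with one closed letter, and $\mu_o$ to the word $12$ of open letters. $\mathtt{PaPB}:=\omega^*\mathtt{CoPB}$ has objects $\mathtt{\Omega\Omega}$ and $\operatorname{Hom}_{\mathtt{PaPB}}(u,v)=\operatorname{Hom}_{\mathtt{CoPB}}(\omega(u),\omega(v))$. The morphism $\mathtt{PaPB}\to\mathtt{CoPB}$ is $\omega$ on objects. A categorical equivalence is a morphism of operads in groupoids that is an equivalence of categories in each arity. *)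

theory Defs
  imports "HOL-Analysis.Analysis" "HOL-Combinatorics.Permutations"
begin

section \<open>Groupoids\<close>

record ('a, 'b) groupoid_data =
  Obj :: "'a set"
  Arr :: "'b set"
  src :: "'b \<Rightarrow> 'a"
  tgt :: "'b \<Rightarrow> 'a"
  idn :: "'a \<Rightarrow> 'b"
  cmp :: "'b \<Rightarrow> 'b \<Rightarrow> 'b"  \<comment> \<open>\<open>cmp G g f\<close> is \<open>g\<close> after \<open>f\<close>\<close>

definition hom :: "('a, 'b) groupoid_data \<Rightarrow> 'a \<Rightarrow> 'a \<Rightarrow> 'b set" where
  "hom G a b = {f \<in> Arr G. src G f = a \<and> tgt G f = b}"

locale groupoid =
  fixes G :: "('a, 'b) groupoid_data"
  assumes src_closed: "f \<in> Arr G \<Longrightarrow> src G f \<in> Obj G"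
    and tgt_closed: "f \<in> Arr G \<Longrightarrow> tgt G f \<in> Obj G"
    and idn_hom: "a \<in> Obj G \<Longrightarrow> idn G a \<in> hom G a a"
    and cmp_hom: "\<lbrakk>f \<in> hom G a b; g \<in> hom G b c\<rbrakk> \<Longrightarrow> cmp G g f \<in> hom G a c"
    and cmp_assoc: "\<lbrakk>f \<in> hom G a b; g \<in> hom G b c; h \<in> hom G c d\<rbrakk>
      \<Longrightarrow> cmp G h (cmp G g f) = cmp G (cmp G h g) f"
    and cmp_idn: "f \<in> hom G a b \<Longrightarrow> cmp G f (idn G a) = f"
    and idn_cmp: "f \<in> hom G a b \<Longrightarrow> cmp G (idn G b) f = f"
    and inverse_ex: "f \<in> hom G a b
      \<Longrightarrow> \<exists>g \<in> hom G b a. cmp G g f = idn G a \<and> cmp G f g = idn G b"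

definition prod_groupoid ::
  "('a, 'b) groupoid_data \<Rightarrow> ('c, 'd) groupoid_data \<Rightarrow> ('a \<times> 'c, 'b \<times> 'd) groupoid_data" where
  "prod_groupoid G H = \<lparr>
     Obj = Obj G \<times> Obj H, Arr = Arr G \<times> Arr H,
     src = map_prod (src G) (src H), tgt = map_prod (tgt G) (tgt H),
     idn = map_prod (idn G) (idn H),
     cmp = (\<lambda>(g, g') (f, f'). (cmp G g f, cmp H g' f')) \<rparr>"

locale groupoid_functor = A: groupoid A + B: groupoid B
  for A :: "('a, 'b) groupoid_data" and B :: "('c, 'd) groupoid_data" +
  fixes Fo :: "'a \<Rightarrow> 'c" and Fa :: "'b \<Rightarrow> 'd"
  assumes map_obj: "a \<in> Obj A \<Longrightarrow> Fo a \<in> Obj B"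
    and map_hom: "f \<in> hom A a b \<Longrightarrow> Fa f \<in> hom B (Fo a) (Fo b)"
    and map_idn: "a \<in> Obj A \<Longrightarrow> Fa (idn A a) = idn B (Fo a)"
    and map_cmp: "\<lbrakk>f \<in> hom A a b; g \<in> hom A b c\<rbrakk> \<Longrightarrow> Fa (cmp A g f) = cmp B (Fa g) (Fa f)"

text \<open>Invertibility of the components is automatic, because the target is a groupoid.\<close>

definition natural_iso ::
  "('a, 'b) groupoid_data \<Rightarrow> ('c, 'd) groupoid_data \<Rightarrow> ('a \<Rightarrow> 'c) \<Rightarrow> ('b \<Rightarrow> 'd) \<Rightarrow>
   ('a \<Rightarrow> 'c) \<Rightarrow> ('b \<Rightarrow> 'd) \<Rightarrow> ('a \<Rightarrow> 'd) \<Rightarrow> bool" where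
  "natural_iso A B Fo Fa Go Ga \<eta> \<longleftrightarrow>
     (\<forall>a \<in> Obj A. \<eta> a \<in> hom B (Fo a) (Go a)) \<and>
     (\<forall>a b. \<forall>f \<in> hom A a b. cmp B (\<eta> b) (Fa f) = cmp B (Ga f) (\<eta> a))"

definition equivalence_of_groupoids ::
  "('a, 'b) groupoid_data \<Rightarrow> ('c, 'd) groupoid_data \<Rightarrow> ('a \<Rightarrow> 'c) \<Rightarrow> ('b \<Rightarrow> 'd) \<Rightarrow> bool" where
  "equivalence_of_groupoids A B Fo Fa \<longleftrightarrow>
     groupoid_functor A B Fo Fa \<and>
     (\<exists>Go Ga \<eta> \<theta>. groupoid_functor B A Go Ga \<and>
        natural_iso A A (\<lambda>a. a) (\<lambda>f. f) (Go \<circ> Fo) (Ga \<circ> Fa) \<eta> \<and>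
        natural_iso B B (Fo \<circ> Go) (Fa \<circ> Ga) (\<lambda>b. b) (\<lambda>g. g) \<theta>)"


section \<open>Two-colored symmetric operads\<close>

text \<open>
  Inputs are numbered from \<open>0\<close>, and the component \<open>Q(x\<^sub>0,\<dots>,x\<^sub>k\<^sub>-\<^sub>1;x)\<close> of an operad \<open>Q\<close> is indexed by
  the list of its input colors and its output color. Thus \<open>Q(n,m)\<close> is the component at
  \<open>replicate n Op @ replicate m Cl\<close> and \<open>Op\<close>. With arbitrary profiles available, grafting does not
  renumber the inputs by color: the composition of \<open>Q(n,m)\<close> with \<open>Q(n',m')\<close> at an open input that
  lands in \<open>Q(n+n'-1,m+m')\<close> is the one below followed by the action of the evident shuffle.
\<close>

datatype color = Cl | Op

definition graft :: "'x list \<Rightarrow> nat \<Rightarrow> 'x list \<Rightarrow> 'x list" where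
  "graft xs i ys = take i xs @ ys @ drop (Suc i) xs"

text \<open>
  The renumbering of an input \<open>l \<noteq> i\<close> when \<open>m\<close> inputs are inserted in place of \<open>i\<close>; in particular
  \<open>block_perm i m \<sigma> \<tau>\<close> is the operadic composition of permutations.
\<close>

definition renumber :: "nat \<Rightarrow> nat \<Rightarrow> nat \<Rightarrow> nat" where
  "renumber i m l = (if l < i then l else l + m - 1)"

definition splice :: "nat \<Rightarrow> nat \<Rightarrow> (nat \<Rightarrow> 'z) \<Rightarrow> (nat \<Rightarrow> 'z) \<Rightarrow> nat \<Rightarrow> 'z" where
  "splice i m f g j = (if j < i then f j else if j < i + m then g (j - i) else f (j + 1 - m))"

definition block_perm :: "nat \<Rightarrow> nat \<Rightarrow> (nat \<Rightarrow> nat) \<Rightarrow> (nat \<Rightarrow> nat) \<Rightarrow> nat \<Rightarrow> nat" where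
  "block_perm i m \<sigma> \<tau> = splice i m (\<lambda>l. renumber (\<sigma> i) m (\<sigma> l)) (\<lambda>r. \<sigma> i + \<tau> r)"

record 'e operad_data =
  elems :: "color list \<Rightarrow> color \<Rightarrow> 'e set"
  one :: "color \<Rightarrow> 'e"
  \<comment> \<open>\<open>ins P xs x i ys\<close> is the composition \<open>P(xs;x) \<times> P(ys;xs!i) \<rightarrow> P(graft xs i ys;x)\<close>\<close>
  ins :: "color list \<Rightarrow> color \<Rightarrow> nat \<Rightarrow> color list \<Rightarrow> 'e \<Rightarrow> 'e \<Rightarrow> 'e"
  \<comment> \<open>\<open>act P xs x \<sigma>\<close> is the right action \<open>P(xs;x) \<rightarrow> P(permute_list \<sigma> xs;x)\<close>\<close>
  act :: "color list \<Rightarrow> color \<Rightarrow> (nat \<Rightarrow> nat) \<Rightarrow> 'e \<Rightarrow> 'e"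

locale symmetric_operad =
  fixes P :: "'e operad_data"
  assumes one_closed: "one P x \<in> elems P [x] x"
    and ins_closed: "\<lbrakk>a \<in> elems P xs x; i < length xs; b \<in> elems P ys (xs ! i)\<rbrakk>
      \<Longrightarrow> ins P xs x i ys a b \<in> elems P (graft xs i ys) x"
    and act_closed: "\<lbrakk>a \<in> elems P xs x; \<sigma> permutes {..<length xs}\<rbrakk>
      \<Longrightarrow> act P xs x \<sigma> a \<in> elems P (permute_list \<sigma> xs) x"
    and ins_one: "\<lbrakk>a \<in> elems P xs x; i < length xs\<rbrakk>
      \<Longrightarrow> ins P xs x i [xs ! i] a (one P (xs ! i)) = a"
    and one_ins: "a \<in> elems P xs x \<Longrightarrow> ins P [x] x 0 xs (one P x) a = a"
    and ins_sequential:
      "\<lbrakk>a \<in> elems P xs x; i < length xs; b \<in> elems P ys (xs ! i);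
        j < length ys; c \<in> elems P zs (ys ! j)\<rbrakk>
      \<Longrightarrow> ins P (graft xs i ys) x (i + j) zs (ins P xs x i ys a b) c
        = ins P xs x i (graft ys j zs) a (ins P ys (xs ! i) j zs b c)"
    and ins_parallel:
      "\<lbrakk>a \<in> elems P xs x; i < k; k < length xs; b \<in> elems P ys (xs ! i);
        c \<in> elems P zs (xs ! k)\<rbrakk>
      \<Longrightarrow> ins P (graft xs i ys) x (k + length ys - 1) zs (ins P xs x i ys a b) c
        = ins P (graft xs k zs) x i ys (ins P xs x k zs a c) b"
    and act_id: "a \<in> elems P xs x \<Longrightarrow> act P xs x id a = a"
    and act_act:
      "\<lbrakk>a \<in> elems P xs x; \<sigma> permutes {..<length xs}; \<tau> permutes {..<length xs}\<rbrakk>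
      \<Longrightarrow> act P (permute_list \<sigma> xs) x \<tau> (act P xs x \<sigma> a) = act P xs x (\<sigma> \<circ> \<tau>) a"
    and ins_act:
      "\<lbrakk>a \<in> elems P xs x; \<sigma> permutes {..<length xs}; i < length xs;
        b \<in> elems P ys (xs ! \<sigma> i); \<tau> permutes {..<length ys}\<rbrakk>
      \<Longrightarrow> ins P (permute_list \<sigma> xs) x i (permute_list \<tau> ys)
            (act P xs x \<sigma> a) (act P ys (xs ! \<sigma> i) \<tau> b)
        = act P (graft xs (\<sigma> i) ys) x (block_perm i (length ys) \<sigma> \<tau>) (ins P xs x (\<sigma> i) ys a b)"

definition operad_hom ::
  "'e operad_data \<Rightarrow> 'f operad_data \<Rightarrow> (color list \<Rightarrow> color \<Rightarrow> 'e \<Rightarrow> 'f) \<Rightarrow> bool" where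
  "operad_hom P Q F \<longleftrightarrow>
     (\<forall>xs x. \<forall>a \<in> elems P xs x. F xs x a \<in> elems Q xs x) \<and>
     (\<forall>x. F [x] x (one P x) = one Q x) \<and>
     (\<forall>xs x i ys. \<forall>a \<in> elems P xs x. \<forall>b \<in> elems P ys (xs ! i). i < length xs \<longrightarrow>
        F (graft xs i ys) x (ins P xs x i ys a b)
          = ins Q xs x i ys (F xs x a) (F ys (xs ! i) b)) \<and>
     (\<forall>xs x \<sigma>. \<forall>a \<in> elems P xs x. \<sigma> permutes {..<length xs} \<longrightarrow>
        F (permute_list \<sigma> xs) x (act P xs x \<sigma> a) = act Q xs x \<sigma> (F xs x a))"


section \<open>Relative operads in groupoids\<close>

record ('a, 'b) groupoid_operad_data =
  ar :: "color list \<Rightarrow> color \<Rightarrow> ('a, 'b) groupoid_data"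
  oone :: "color \<Rightarrow> 'a"
  oins :: "color list \<Rightarrow> color \<Rightarrow> nat \<Rightarrow> color list \<Rightarrow> 'a \<Rightarrow> 'a \<Rightarrow> 'a"
  oact :: "color list \<Rightarrow> color \<Rightarrow> (nat \<Rightarrow> nat) \<Rightarrow> 'a \<Rightarrow> 'a"
  ains :: "color list \<Rightarrow> color \<Rightarrow> nat \<Rightarrow> color list \<Rightarrow> 'b \<Rightarrow> 'b \<Rightarrow> 'b"
  aact :: "color list \<Rightarrow> color \<Rightarrow> (nat \<Rightarrow> nat) \<Rightarrow> 'b \<Rightarrow> 'b"

definition ob :: "('a, 'b) groupoid_operad_data \<Rightarrow> 'a operad_data" where
  "ob P = \<lparr> elems = (\<lambda>xs x. Obj (ar P xs x)), one = oone P, ins = oins P, act = oact P \<rparr>"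

definition mor :: "('a, 'b) groupoid_operad_data \<Rightarrow> 'b operad_data" where
  "mor P = \<lparr> elems = (\<lambda>xs x. Arr (ar P xs x)), one = (\<lambda>x. idn (ar P [x] x) (oone P x)),
             ins = ains P, act = aact P \<rparr>"

text \<open>
  An operad in groupoids: the operad axioms hold for objects and for arrows, and all structure maps
  are functors. It is relative, over its part with only closed colors, if no operation with closed
  output has an open input.
\<close>

locale relative_groupoid_operad =
  fixes P :: "('a, 'b) groupoid_operad_data"
  assumes arity_groupoid: "groupoid (ar P xs x)"
    and ob_operad: "symmetric_operad (ob P)"
    and mor_operad: "symmetric_operad (mor P)"
    and ins_functor: "i < length xs \<Longrightarrow>
      groupoid_functor (prod_groupoid (ar P xs x) (ar P ys (xs ! i))) (ar P (graft xs i ys) x)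
        (\<lambda>(a, b). oins P xs x i ys a b) (\<lambda>(f, g). ains P xs x i ys f g)"
    and act_functor: "\<sigma> permutes {..<length xs} \<Longrightarrow>
      groupoid_functor (ar P xs x) (ar P (permute_list \<sigma> xs) x) (oact P xs x \<sigma>) (aact P xs x \<sigma>)"
    and relative: "Op \<in> set xs \<Longrightarrow> Obj (ar P xs Cl) = {}"

definition operad_morphism ::
  "('a, 'b) groupoid_operad_data \<Rightarrow> ('c, 'd) groupoid_operad_data \<Rightarrow>
   (color list \<Rightarrow> color \<Rightarrow> 'a \<Rightarrow> 'c) \<Rightarrow> (color list \<Rightarrow> color \<Rightarrow> 'b \<Rightarrow> 'd) \<Rightarrow> bool" where
  "operad_morphism P Q Fo Fa \<longleftrightarrow>
     relative_groupoid_operad P \<and> relative_groupoid_operad Q \<and>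
     operad_hom (ob P) (ob Q) Fo \<and> operad_hom (mor P) (mor Q) Fa \<and>
     (\<forall>xs x. groupoid_functor (ar P xs x) (ar Q xs x) (Fo xs x) (Fa xs x))"

definition operads_isomorphic ::
  "('a, 'b) groupoid_operad_data \<Rightarrow> ('c, 'd) groupoid_operad_data \<Rightarrow> bool" where
  "operads_isomorphic P Q \<longleftrightarrow>
     (\<exists>Fo Fa Go Ga. operad_morphism P Q Fo Fa \<and> operad_morphism Q P Go Ga \<and>
        (\<forall>xs x. (\<forall>a \<in> Obj (ar P xs x). Go xs x (Fo xs x a) = a) \<and>
                (\<forall>f \<in> Arr (ar P xs x). Ga xs x (Fa xs x f) = f) \<and>
                (\<forall>b \<in> Obj (ar Q xs x). Fo xs x (Go xs x b) = b) \<and>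
                (\<forall>g \<in> Arr (ar Q xs x). Fa xs x (Ga xs x g) = g)))"

definition categorical_equivalence ::
  "('a, 'b) groupoid_operad_data \<Rightarrow> ('c, 'd) groupoid_operad_data \<Rightarrow>
   (color list \<Rightarrow> color \<Rightarrow> 'a \<Rightarrow> 'c) \<Rightarrow> (color list \<Rightarrow> color \<Rightarrow> 'b \<Rightarrow> 'd) \<Rightarrow> bool" where
  "categorical_equivalence P Q Fo Fa \<longleftrightarrow>
     operad_morphism P Q Fo Fa \<and>
     (\<forall>xs x. equivalence_of_groupoids (ar P xs x) (ar Q xs x) (Fo xs x) (Fa xs x))"

definition full_suboperad ::
  "('a, 'b) groupoid_operad_data \<Rightarrow> (color list \<Rightarrow> color \<Rightarrow> 'a set) \<Rightarrow>
   ('a, 'b) groupoid_operad_data" where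
  "full_suboperad P X = P\<lparr> ar := \<lambda>xs x. (ar P xs x)\<lparr>
     Obj := {a \<in> Obj (ar P xs x). a \<in> X xs x},
     Arr := {f \<in> Arr (ar P xs x). src (ar P xs x) f \<in> X xs x \<and> tgt (ar P xs x) f \<in> X xs x} \<rparr> \<rparr>"

text \<open>
  The pullback \<open>\<phi>\<^sup>*Q\<close> along \<open>\<phi> : \<Omega> \<rightarrow> ob Q\<close>. Its arrows \<open>u \<rightarrow> v\<close> are those of \<open>Q\<close> from \<open>\<phi> u\<close> to \<open>\<phi> v\<close>,
  tagged with \<open>u\<close> and \<open>v\<close>.
\<close>

definition pullback_operad ::
  "'e operad_data \<Rightarrow> (color list \<Rightarrow> color \<Rightarrow> 'e \<Rightarrow> 'a) \<Rightarrow> ('a, 'b) groupoid_operad_data \<Rightarrow>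
   ('e, 'e \<times> 'b \<times> 'e) groupoid_operad_data" where
  "pullback_operad \<Omega> \<phi> Q = \<lparr>
     ar = (\<lambda>xs x. \<lparr>
       Obj = elems \<Omega> xs x,
       Arr = {(u, f, v). u \<in> elems \<Omega> xs x \<and> v \<in> elems \<Omega> xs x \<and>
                         f \<in> hom (ar Q xs x) (\<phi> xs x u) (\<phi> xs x v)},
       src = (\<lambda>(u, f, v). u), tgt = (\<lambda>(u, f, v). v),
       idn = (\<lambda>u. (u, idn (ar Q xs x) (\<phi> xs x u), u)),
       cmp = (\<lambda>(_, g, w) (u, f, _). (u, cmp (ar Q xs x) g f, w)) \<rparr>),
     oone = one \<Omega>, oins = ins \<Omega>, oact = act \<Omega>,
     ains = (\<lambda>xs x i ys (u, f, v) (u', f', v').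
       (ins \<Omega> xs x i ys u u', ains Q xs x i ys f f', ins \<Omega> xs x i ys v v')),
     aact = (\<lambda>xs x \<sigma> (u, f, v). (act \<Omega> xs x \<sigma> u, aact Q xs x \<sigma> f, act \<Omega> xs x \<sigma> v)) \<rparr>"


section \<open>Groupoids of homotopy classes of paths and fundamental groupoids of operads\<close>

text \<open>
  The groupoid with object set \<open>X\<close> whose arrows \<open>a \<rightarrow> b\<close> are the classes, for a homotopy relation \<open>R\<close>
  on paths, of the paths from the subset \<open>U a\<close> to the subset \<open>U b\<close>. The relation is reflexive
  exactly on admissible paths. As \<open>U b\<close> need not be a single point, composition concatenates
  representatives whose end points match.
\<close>

definition path_groupoid ::
  "((real \<Rightarrow> 'p::topological_space) \<Rightarrow> (real \<Rightarrow> 'p) \<Rightarrow> bool) \<Rightarrow> 'a set \<Rightarrow> ('a \<Rightarrow> 'p set) \<Rightarrow>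
   ('a, 'a \<times> (real \<Rightarrow> 'p) set \<times> 'a) groupoid_data" where
  "path_groupoid R X U = \<lparr>
     Obj = X,
     Arr = {(a, {q. R p q}, b) | a b p.
              a \<in> X \<and> b \<in> X \<and> R p p \<and> pathstart p \<in> U a \<and> pathfinish p \<in> U b},
     src = (\<lambda>(a, K, b). a), tgt = (\<lambda>(a, K, b). b),
     idn = (\<lambda>a. (a, {q. \<exists>z \<in> U a. R (\<lambda>_. z) q}, a)),
     cmp = (\<lambda>(_, L, c) (a, K, _).
       (a, {q. \<exists>p \<in> K. \<exists>r \<in> L. pathfinish p = pathstart r \<and> R (p +++ r) q}, c)) \<rparr>"

definition fundamental_groupoid ::
  "'p::topological_space set \<Rightarrow> ('p, 'p \<times> (real \<Rightarrow> 'p) set \<times> 'p) groupoid_data" where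
  "fundamental_groupoid S = path_groupoid (homotopic_paths S) S (\<lambda>a. {a})"

definition fundamental_groupoid_operad ::
  "'p::topological_space operad_data \<Rightarrow>
   ('p, 'p \<times> (real \<Rightarrow> 'p) set \<times> 'p) groupoid_operad_data" where
  "fundamental_groupoid_operad P = \<lparr>
     ar = (\<lambda>xs x. fundamental_groupoid (elems P xs x)),
     oone = one P, oins = ins P, oact = act P,
     ains = (\<lambda>xs x i ys (a, K, b) (a', L, b').
       (ins P xs x i ys a a',
        {h. \<exists>p \<in> K. \<exists>q \<in> L.
           homotopic_paths (elems P (graft xs i ys) x) (\<lambda>t. ins P xs x i ys (p t) (q t)) h},
        ins P xs x i ys b b')),
     aact = (\<lambda>xs x \<sigma> (a, K, b).
       (act P xs x \<sigma> a,
        {h. \<exists>p \<in> K. homotopic_paths (elems P (permute_list \<sigma> xs) x) (\<lambda>t. act P xs x \<sigma> (p t)) h},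
        act P xs x \<sigma> b)) \<rparr>"


section \<open>The Swiss-Cheese operad\<close>

text \<open>
  The map \<open>z \<mapsto> \<lambda>z + b\<close> is represented by the pair \<open>(\<lambda>, b)\<close>, and a tuple of \<open>k\<close> points or maps by a
  function on \<open>nat\<close> that is \<open>undefined\<close> outside \<open>{..<k}\<close>. The product topology on functions then
  induces the usual topology on tuples.
\<close>

definition affine_map :: "real \<times> complex \<Rightarrow> complex \<Rightarrow> complex" where
  "affine_map d z = of_real (fst d) * z + snd d"

definition affine_comp :: "real \<times> complex \<Rightarrow> real \<times> complex \<Rightarrow> real \<times> complex" where
  "affine_comp d e = (fst d * fst e, of_real (fst d) * snd e + snd d)"

lemma affine_map_comp: "affine_map (affine_comp d e) = affine_map d \<circ> affine_map e"
  by (auto simp: affine_map_def affine_comp_def algebra_simps)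

fun disk :: "color \<Rightarrow> complex set" where
  "disk Cl = cball 0 1"
| "disk Op = {z \<in> cball 0 1. Im z \<ge> 0}"

text \<open>Components of relative operads without nullary operations.\<close>

definition admissible :: "color list \<Rightarrow> color \<Rightarrow> bool" where
  "admissible xs x \<longleftrightarrow> xs \<noteq> [] \<and> (x = Cl \<longrightarrow> Op \<notin> set xs)"

definition swiss_cheese :: "color list \<Rightarrow> color \<Rightarrow> (nat \<Rightarrow> real \<times> complex) set" where
  "swiss_cheese xs x = {d \<in> extensional {..<length xs}.
     admissible xs x \<and>
     (\<forall>i<length xs. fst (d i) > 0 \<and> (xs ! i = Op \<longrightarrow> Im (snd (d i)) = 0) \<and>
        affine_map (d i) ` disk (xs ! i) \<subseteq> disk x) \<and>
     (\<forall>i<length xs. \<forall>j<length xs. i \<noteq> j \<longrightarrow>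
        interior (affine_map (d i) ` disk (xs ! i)) \<inter>
        interior (affine_map (d j) ` disk (xs ! j)) = {})}"

text \<open>The part of \<open>SC\<close> with closed output is the little disks operad.\<close>

definition SC :: "(nat \<Rightarrow> real \<times> complex) operad_data" where
  "SC = \<lparr>
     elems = swiss_cheese,
     one = (\<lambda>x. \<lambda>i\<in>{..<1}. (1, 0)),
     ins = (\<lambda>xs x i ys d e. splice i (length ys) d (\<lambda>r. affine_comp (d i) (e r))),
     act = (\<lambda>xs x \<sigma> d. d \<circ> \<sigma>) \<rparr>"

definition piSC where "piSC = fundamental_groupoid_operad SC"


section \<open>The free operad on the generators \<open>\<mu>\<^sub>c\<close>, \<open>f\<close>, \<open>\<mu>\<^sub>o\<close>\<close>

text \<open>
  As the symmetric groups act freely on the generators, the elements of the free operad are the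
  planar trees with nodes labeled by generators and leaves numbered by the inputs.
\<close>

datatype 'l tree = Leaf 'l | MuC "'l tree" "'l tree" | F "'l tree" | MuO "'l tree" "'l tree"

fun typed :: "color list \<Rightarrow> nat tree \<Rightarrow> color \<Rightarrow> bool" where
  "typed xs (Leaf i) x \<longleftrightarrow> i < length xs \<and> xs ! i = x"
| "typed xs (MuC s t) x \<longleftrightarrow> x = Cl \<and> typed xs s Cl \<and> typed xs t Cl"
| "typed xs (F s) x \<longleftrightarrow> x = Op \<and> typed xs s Cl"
| "typed xs (MuO s t) x \<longleftrightarrow> x = Op \<and> typed xs s Op \<and> typed xs t Op"

fun leaves :: "'l tree \<Rightarrow> 'l list" where
  "leaves (Leaf i) = [i]"
| "leaves (MuC s t) = leaves s @ leaves t"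
| "leaves (F s) = leaves s"
| "leaves (MuO s t) = leaves s @ leaves t"

fun subst_leaves :: "('l \<Rightarrow> 'k tree) \<Rightarrow> 'l tree \<Rightarrow> 'k tree" where
  "subst_leaves f (Leaf i) = f i"
| "subst_leaves f (MuC s t) = MuC (subst_leaves f s) (subst_leaves f t)"
| "subst_leaves f (F s) = F (subst_leaves f s)"
| "subst_leaves f (MuO s t) = MuO (subst_leaves f s) (subst_leaves f t)"

text \<open>
  In the action, input \<open>j\<close> of \<open>t \<cdot> \<sigma>\<close> is input \<open>\<sigma> j\<close> of \<open>t\<close>, so that labels are changed by the inverse
  of \<open>\<sigma>\<close>.
\<close>

definition OmegaOmega :: "nat tree operad_data" where
  "OmegaOmega = \<lparr>
     elems = (\<lambda>xs x. {t. typed xs t x \<and> distinct (leaves t) \<and> set (leaves t) = {..<length xs}}),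
     one = (\<lambda>x. Leaf 0),
     ins = (\<lambda>xs x i ys t s. subst_leaves
       (\<lambda>l. if l = i then map_tree (\<lambda>r. i + r) s else Leaf (renumber i (length ys) l)) t),
     act = (\<lambda>xs x \<sigma> t. map_tree (inv \<sigma>) t) \<rparr>"

text \<open>The operad morphism to \<open>SC\<close>: \<open>leaf_map t i\<close> is the embedding for the leaf \<open>i\<close> of \<open>t\<close>.\<close>

fun leaf_map :: "'l tree \<Rightarrow> 'l \<Rightarrow> real \<times> complex" where
  "leaf_map (Leaf j) i = (1, 0)"
| "leaf_map (MuC s t) i =
     (if i \<in> set (leaves s) then affine_comp (1/2, -1/2) (leaf_map s i)
      else affine_comp (1/2, 1/2) (leaf_map t i))"
| "leaf_map (F s) i = affine_comp (1/2, \<i>/2) (leaf_map s i)"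
| "leaf_map (MuO s t) i =
     (if i \<in> set (leaves s) then affine_comp (1/2, -1/2) (leaf_map s i)
      else affine_comp (1/2, 1/2) (leaf_map t i))"

definition embed :: "color list \<Rightarrow> color \<Rightarrow> nat tree \<Rightarrow> nat \<Rightarrow> real \<times> complex" where
  "embed xs x t = restrict (leaf_map t) {..<length xs}"

lemma embed_generators:
  "affine_map (embed [Cl, Cl] Cl (MuC (Leaf 0) (Leaf 1)) 0) = (\<lambda>z. (z - 1) / 2)"
  "affine_map (embed [Cl, Cl] Cl (MuC (Leaf 0) (Leaf 1)) 1) = (\<lambda>z. (z + 1) / 2)"
  "affine_map (embed [Op, Op] Op (MuO (Leaf 0) (Leaf 1)) 0) = (\<lambda>z. (z - 1) / 2)"
  "affine_map (embed [Op, Op] Op (MuO (Leaf 0) (Leaf 1)) 1) = (\<lambda>z. (z + 1) / 2)"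
  "affine_map (embed [Cl] Op (F (Leaf 0)) 0) = (\<lambda>z. (z + \<i>) / 2)"
  by (auto simp: embed_def affine_map_def affine_comp_def field_simps)

definition piSC_OmegaOmega where
  "piSC_OmegaOmega =
     full_suboperad piSC (\<lambda>xs x. embed xs x ` elems OmegaOmega xs x)"


section \<open>Colored (permutations and) braids\<close>

definition words :: "color list \<Rightarrow> color \<Rightarrow> nat list set" where
  "words xs x = {w. admissible xs x \<and> distinct w \<and> set w = {..<length xs}}"

fun place :: "color \<Rightarrow> color \<Rightarrow> complex set" where
  "place c Cl = ball 0 1"
| "place Cl Op = {z \<in> disk Op. Im z > 0}"
| "place Op Op = {z \<in> disk Op. Im z = 0}"

definition Conf :: "color list \<Rightarrow> color \<Rightarrow> (nat \<Rightarrow> complex) set" where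
  "Conf xs x = {z \<in> extensional {..<length xs}.
     admissible xs x \<and> inj_on z {..<length xs} \<and> (\<forall>i<length xs. z i \<in> place (xs ! i) x)}"

definition cell :: "color list \<Rightarrow> color \<Rightarrow> nat list \<Rightarrow> (nat \<Rightarrow> complex) set" where
  "cell xs x w = {z \<in> Conf xs x. sorted_wrt (\<lambda>i j. Re (z i) < Re (z j)) w}"

text \<open>Homotopy of paths in \<open>Conf xs x\<close> whose end points may move inside cells.\<close>

definition braid_homotopic ::
  "color list \<Rightarrow> color \<Rightarrow> (real \<Rightarrow> nat \<Rightarrow> complex) \<Rightarrow> (real \<Rightarrow> nat \<Rightarrow> complex) \<Rightarrow> bool" where
  "braid_homotopic xs x p q \<longleftrightarrow>
     (\<exists>w \<in> words xs x. \<exists>w' \<in> words xs x.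
        homotopic_with_canon (\<lambda>h. pathstart h \<in> cell xs x w \<and> pathfinish h \<in> cell xs x w')
          {0..1} (Conf xs x) p q)"

definition word_ins :: "nat \<Rightarrow> nat list \<Rightarrow> nat list \<Rightarrow> nat list" where
  "word_ins i w v = concat (map
     (\<lambda>l. if l = i then map (\<lambda>r. i + r) v else [renumber i (length v) l]) w)"

text \<open>The configuration \<open>z\<close> with the point \<open>i\<close> replaced by the copy, scaled by \<open>\<epsilon>\<close>, of \<open>u\<close>.\<close>

definition conf_ins ::
  "real \<Rightarrow> nat \<Rightarrow> nat \<Rightarrow> (nat \<Rightarrow> complex) \<Rightarrow> (nat \<Rightarrow> complex) \<Rightarrow> nat \<Rightarrow> complex" where
  "conf_ins \<epsilon> i m z u = splice i m z (\<lambda>r. z i + of_real \<epsilon> * u r)"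

text \<open>
  The part of \<open>CoPB\<close> with closed output is \<open>CoB\<close>. Arrows are composed operadically through
  representatives inside the open disk, for all sufficiently small scales.
\<close>

definition CoPB ::
  "(nat list, nat list \<times> (real \<Rightarrow> nat \<Rightarrow> complex) set \<times> nat list) groupoid_operad_data" where
  "CoPB = \<lparr>
     ar = (\<lambda>xs x. path_groupoid (braid_homotopic xs x) (words xs x) (cell xs x)),
     oone = (\<lambda>x. [0]),
     oins = (\<lambda>xs x i ys w v. word_ins i w v),
     oact = (\<lambda>xs x \<sigma> w. map (inv \<sigma>) w),
     ains = (\<lambda>xs x i ys (w, K, w') (v, L, v').
       (word_ins i w v,
        {h. \<exists>p \<in> K. \<exists>q \<in> L.
           (\<forall>t \<in> {0..1}. (\<forall>j<length xs. norm (p t j) < 1) \<and> (\<forall>j<length ys. norm (q t j) < 1)) \<and>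
           (\<forall>\<^sub>F \<epsilon> in at_right 0.
              braid_homotopic (graft xs i ys) x (\<lambda>t. conf_ins \<epsilon> i (length ys) (p t) (q t)) h)},
        word_ins i w' v')),
     aact = (\<lambda>xs x \<sigma> (w, K, w').
       (map (inv \<sigma>) w,
        {h. \<exists>p \<in> K. braid_homotopic (permute_list \<sigma> xs) x (\<lambda>t. p t \<circ> \<sigma>) h},
        map (inv \<sigma>) w')) \<rparr>"


section \<open>The operad \<open>PaPB\<close>\<close>

text \<open>
  The operad morphism to the objects of \<open>CoPB\<close> with \<open>\<mu>\<^sub>c \<mapsto> 01\<close>, \<open>f \<mapsto> 0\<close>, \<open>\<mu>\<^sub>o \<mapsto> 01\<close> reads off the
  leaves of a tree from left to right.
\<close>

definition omega :: "color list \<Rightarrow> color \<Rightarrow> nat tree \<Rightarrow> nat list" where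
  "omega xs x t = leaves t"

definition PaPB where "PaPB = pullback_operad OmegaOmega omega CoPB"

end

theory Submission
  imports Defs
begin

text \<open>
  Sending an operation of the Swiss-Cheese operad to the centers of its disks is, in each arity, a
  homotopy equivalence to the space of configurations: the disks with given centers form a convex set,
  and a continuous choice of small radii gives a section. On the objects of \<open>\<Omega>\<Omega>\<close>, the centers are
  ordered from left to right like the leaves of the tree. Hence taking centers induces bijections
  from the homotopy classes of paths between two trees to the colored braids between their words. These
  bijections respect insertion, because the scale at which a configuration is inserted can be shrunk
  from the radius of the disk to any small \<open>\<epsilon>\<close>. All operad axioms for \<open>PaPB\<close> and \<open>CoPB\<close> are therefore
  inherited from the fundamental groupoid of the topological operad \<open>SC\<close>. Finally, a shear moves any
  configuration into general position, so that every operation is connected to the image of a tree.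
\<close>

section \<open>Grafting and block permutations\<close>

text \<open>Two features of \<open>CoPB\<close> shape the proof. First, braids are inserted through
  germs at scale 0: at a fixed scale, insertion of configurations is neither associative nor unital,
  and how small the scale must be depends on the representatives. The axioms are therefore never
  checked on braids. They pass from \<open>piSC_OmegaOmega\<close> to \<open>PaPB\<close> and from
  there along \<open>omega\<close> to \<open>CoPB\<close>; each passage asks for surjectivity on
  objects, fullness and compatibility with the operations. Faithfulness of the centers map enters
  only at the end, when the first morphism is shown to be an isomorphism. Second, the end points of
  a braid move in cells, while arrows of \<open>piSC\<close> have fixed ends. The relation
  \<open>end_homotopic\<close> mediates: it confines the ends to given sets, and since cells are
  convex, pieces of path inside a cell can be absorbed, bridged or contracted. The geometry becomes
  elementary once images and interiors of disks are replaced by the inequalities of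
  \<open>disk_ok\<close> and a bound on the distances of centers.\<close>

lemma length_graft: "i < length xs \<Longrightarrow> length (graft xs i ys) = length xs + length ys - 1"
  by (simp add: graft_def)

lemma nth_graft:
  "i < length xs \<Longrightarrow> j < length xs + length ys - 1 \<Longrightarrow>
    graft xs i ys ! j = splice i (length ys) ((!) xs) ((!) ys) j"
  by (auto simp: graft_def splice_def nth_append min_def not_less not_le Suc_diff_le)

lemma graft_sequential:
  "i < length xs \<Longrightarrow> j < length ys \<Longrightarrow>
    graft (graft xs i ys) (i + j) zs = graft xs i (graft ys j zs)"
  by (simp add: graft_def min_def)

lemma graft_parallel:
  assumes "i < k" "k < length xs"
  shows "graft (graft xs i ys) (k + length ys - 1) zs = graft (graft xs k zs) i ys"
proof -
  have "take (k + length ys - 1) (graft xs i ys) = take i xs @ ys @ take (k - Suc i) (drop (Suc i) xs)"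
    "drop (Suc (k + length ys - 1)) (graft xs i ys) = drop (Suc k) xs"
    "drop (Suc i) (graft xs k zs) = take (k - Suc i) (drop (Suc i) xs) @ zs @ drop (Suc k) xs"
    "take i (graft xs k zs) = take i xs"
    using assms by (auto simp: graft_def drop_take min.absorb1 min.absorb2)
  then show ?thesis
    by (simp add: graft_def[of "graft xs i ys"] graft_def[of "graft xs k zs"])
qed

text \<open>The block \<open>{i..<i + m}\<close> goes to
  \<open>{\<sigma> i..<\<sigma> i + m}\<close> by \<tau>, while \<open>renumber\<close> skips
  exactly this interval. So equal values come from indices of the same kind, where \<sigma> or
  \<tau> separates them; surjectivity then follows by finiteness.\<close>

lemma block_perm_permutes:
  assumes s: "\<sigma> permutes {..<n}" and t: "\<tau> permutes {..<m}" and i: "i < n"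
  shows "block_perm i m \<sigma> \<tau> permutes {..<n + m - 1}"
proof -
  let ?p = "block_perm i m \<sigma> \<tau>"
  have sn: "\<sigma> j < n" if "j < n" for j using permutes_in_image[OF s] that by auto
  have tm: "\<tau> j < m" if "j < m" for j using permutes_in_image[OF t] that by auto
  have so: "\<sigma> j = j" if "n \<le> j" for j using permutes_not_in[OF s] that by auto
  have sinj: "\<sigma> a = \<sigma> b \<longleftrightarrow> a = b" for a b using permutes_inj[OF s] by (auto dest: injD)
  have tinj: "\<tau> a = \<tau> b \<longleftrightarrow> a = b" for a b using permutes_inj[OF t] by (auto dest: injD)
  have ri: "renumber a m x = renumber a m y \<longleftrightarrow> x = y" if "x \<noteq> a" "y \<noteq> a" for a x y
    using that by (auto simp: renumber_def)
  have rn: "renumber a m x \<notin> {a..<a + m}" if "x \<noteq> a" for a x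
    using that by (auto simp: renumber_def)
  have rb: "renumber a m x < n + m - 1" if "x \<noteq> a" "a < n" "x < n" for a x
    using that by (auto simp: renumber_def)
  have mid: "?p j = \<sigma> i + \<tau> (j - i)" "?p j \<in> {\<sigma> i..<\<sigma> i + m}" if "i \<le> j" "j < i + m" for j
    using that tm[of "j - i"] by (auto simp: block_perm_def splice_def)
  \<comment> \<open>Outside the block, \<open>l\<close> is the index before insertion:
    \<open>j + 1 - m\<close> undoes the shift by \<open>m - 1\<close>.\<close>
  have out: "\<exists>l. l \<noteq> i \<and> (j < n + m - 1 \<longrightarrow> l < n) \<and> ?p j = renumber (\<sigma> i) m (\<sigma> l) \<and>
      l = (if j < i then j else j + 1 - m)"
    if "\<not> (i \<le> j \<and> j < i + m)" for j
    using that i by (intro exI[of _ "if j < i then j else j + 1 - m"]) (auto simp: block_perm_def splice_def)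
  have "inj ?p"
  proof (rule injI)
    fix a b assume eq: "?p a = ?p b"
    show "a = b"
    proof (cases "i \<le> a \<and> a < i + m"; cases "i \<le> b \<and> b < i + m")
      assume "i \<le> a \<and> a < i + m" "i \<le> b \<and> b < i + m"
      then show ?thesis using mid(1) eq tinj by auto
    next
      assume "i \<le> a \<and> a < i + m" "\<not> (i \<le> b \<and> b < i + m)"
      then show ?thesis using mid(2)[of a] eq out[of b] rn sinj by metis
    next
      assume "\<not> (i \<le> a \<and> a < i + m)" "i \<le> b \<and> b < i + m"
      then show ?thesis using mid(2)[of b] eq out[of a] rn sinj by metis
    next
      assume a: "\<not> (i \<le> a \<and> a < i + m)" and b: "\<not> (i \<le> b \<and> b < i + m)"
      have "(if a < i then a else a + 1 - m) = (if b < i then b else b + 1 - m)"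
        using out[OF a] out[OF b] eq ri sinj by metis
      then show ?thesis using a b by (auto split: if_splits)
    qed
  qed
  moreover have "?p j < n + m - 1" if j: "j < n + m - 1" for j
  proof (cases "i \<le> j \<and> j < i + m")
    case True
    then show ?thesis using mid(2)[of j] sn[OF i] by auto
  next
    case False
    then show ?thesis using out[of j] rb sn i sinj j by metis
  qed
  moreover have "?p j = j" if "\<not> j < n + m - 1" for j
    using that i sn[OF i] by (auto simp: block_perm_def splice_def renumber_def so)
  moreover have "?p ` {..<n + m - 1} = {..<n + m - 1}"
    using calculation by (intro endo_inj_surj) (auto intro: inj_on_subset)
  ultimately show ?thesis
    by (intro bij_imp_permutes bij_betw_imageI) (auto intro: inj_on_subset)
qed

text \<open>The two sides of the equivariance axiom \<open>ins_act\<close> lie in components indexed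
  by these two color lists, so this identity is what types the axiom.\<close>

lemma permute_list_graft:
  assumes s: "\<sigma> permutes {..<length xs}" and t: "\<tau> permutes {..<length ys}" and i: "i < length xs"
  shows "permute_list (block_perm i (length ys) \<sigma> \<tau>) (graft xs (\<sigma> i) ys)
    = graft (permute_list \<sigma> xs) i (permute_list \<tau> ys)"
proof (rule nth_equalityI)
  have sn: "\<sigma> j < length xs" if "j < length xs" for j using permutes_in_image[OF s] that by auto
  have tm: "\<tau> j < length ys" if "j < length ys" for j using permutes_in_image[OF t] that by auto
  have sinj: "\<sigma> a = \<sigma> b \<longleftrightarrow> a = b" for a b using permutes_inj[OF s] by (auto dest: injD)
  note b = block_perm_permutes[OF s t i]
  show "length (permute_list (block_perm i (length ys) \<sigma> \<tau>) (graft xs (\<sigma> i) ys))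
    = length (graft (permute_list \<sigma> xs) i (permute_list \<tau> ys))"
    using i sn[OF i] by (simp add: length_graft)
  fix j assume "j < length (permute_list (block_perm i (length ys) \<sigma> \<tau>) (graft xs (\<sigma> i) ys))"
  then have j: "j < length xs + length ys - 1" using sn[OF i] by (simp add: length_graft)
  let ?k = "block_perm i (length ys) \<sigma> \<tau> j"
  have k: "?k < length xs + length ys - 1" using permutes_in_image[OF b] j by auto
  have "permute_list (block_perm i (length ys) \<sigma> \<tau>) (graft xs (\<sigma> i) ys) ! j
      = splice (\<sigma> i) (length ys) ((!) xs) ((!) ys) ?k"
    using b k j sn[OF i] by (subst permute_list_nth) (auto simp: length_graft nth_graft)
  also have "\<dots> = splice i (length ys) ((!) (permute_list \<sigma> xs)) ((!) (permute_list \<tau> ys)) j"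
  proof -
    consider "j < i" | "i \<le> j" "j < i + length ys" | "i + length ys \<le> j" by linarith
    then show ?thesis
    proof cases
      case 1
      then show ?thesis using sinj[of j i] s i
        by (auto simp: block_perm_def splice_def renumber_def permute_list_nth intro!: arg_cong[of _ _ "(!) xs"])
    next
      case 2
      then show ?thesis using tm[of "j - i"] t
        by (auto simp: block_perm_def splice_def permute_list_nth)
    next
      case 3
      then show ?thesis using sinj[of "j + 1 - length ys" i] s i j
        by (auto simp: block_perm_def splice_def renumber_def permute_list_nth intro!: arg_cong[of _ _ "(!) xs"])
    qed
  qed
  also have "\<dots> = graft (permute_list \<sigma> xs) i (permute_list \<tau> ys) ! j"
    using i j by (simp add: nth_graft)
  finally show "permute_list (block_perm i (length ys) \<sigma> \<tau>) (graft xs (\<sigma> i) ys) ! j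
    = graft (permute_list \<sigma> xs) i (permute_list \<tau> ys) ! j" .
qed

section \<open>Functors and operads in groupoids\<close>

lemma homI: "f \<in> Arr G \<Longrightarrow> src G f = a \<Longrightarrow> tgt G f = b \<Longrightarrow> f \<in> hom G a b"
  and homD: "f \<in> hom G a b \<Longrightarrow> f \<in> Arr G \<and> src G f = a \<and> tgt G f = b"
  by (auto simp: hom_def)

lemma groupoid_prod:
  assumes "groupoid G" "groupoid H"
  shows "groupoid (prod_groupoid G H)"
proof -
  interpret G: groupoid G by fact
  interpret H: groupoid H by fact
  have hom: "f \<in> hom (prod_groupoid G H) a b \<longleftrightarrow>
      fst f \<in> hom G (fst a) (fst b) \<and> snd f \<in> hom H (snd a) (snd b)" for f a b
    by (cases f; cases a; cases b) (auto simp: hom_def prod_groupoid_def)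
  show ?thesis
  proof
    fix f assume "f \<in> Arr (prod_groupoid G H)"
    then show "src (prod_groupoid G H) f \<in> Obj (prod_groupoid G H)"
      "tgt (prod_groupoid G H) f \<in> Obj (prod_groupoid G H)"
      by (auto simp: prod_groupoid_def G.src_closed H.src_closed G.tgt_closed H.tgt_closed)
  next
    fix a assume "a \<in> Obj (prod_groupoid G H)"
    then show "idn (prod_groupoid G H) a \<in> hom (prod_groupoid G H) a a"
      using G.idn_hom H.idn_hom unfolding hom by (auto simp: prod_groupoid_def)
  next
    fix f g a b c
    assume "f \<in> hom (prod_groupoid G H) a b" "g \<in> hom (prod_groupoid G H) b c"
    then show "cmp (prod_groupoid G H) g f \<in> hom (prod_groupoid G H) a c"
      unfolding hom using G.cmp_hom H.cmp_hom
      by (cases f; cases g) (auto simp: prod_groupoid_def)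
  next
    fix f g h a b c d
    assume "f \<in> hom (prod_groupoid G H) a b" "g \<in> hom (prod_groupoid G H) b c"
      "h \<in> hom (prod_groupoid G H) c d"
    then show "cmp (prod_groupoid G H) h (cmp (prod_groupoid G H) g f)
        = cmp (prod_groupoid G H) (cmp (prod_groupoid G H) h g) f"
      unfolding hom using G.cmp_assoc H.cmp_assoc
      by (cases f; cases g; cases h) (auto simp: prod_groupoid_def)
  next
    fix f a b
    assume f: "f \<in> hom (prod_groupoid G H) a b"
    then show "cmp (prod_groupoid G H) f (idn (prod_groupoid G H) a) = f"
      "cmp (prod_groupoid G H) (idn (prod_groupoid G H) b) f = f"
      unfolding hom using G.cmp_idn H.cmp_idn G.idn_cmp H.idn_cmp
      by (cases f; cases a; cases b; auto simp: prod_groupoid_def)+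
    obtain g g' where g:
      "g \<in> hom G (fst b) (fst a)" "cmp G g (fst f) = idn G (fst a)" "cmp G (fst f) g = idn G (fst b)"
      "g' \<in> hom H (snd b) (snd a)" "cmp H g' (snd f) = idn H (snd a)" "cmp H (snd f) g' = idn H (snd b)"
      using f G.inverse_ex H.inverse_ex unfolding hom by meson
    show "\<exists>g\<in>hom (prod_groupoid G H) b a.
        cmp (prod_groupoid G H) g f = idn (prod_groupoid G H) a \<and>
        cmp (prod_groupoid G H) f g = idn (prod_groupoid G H) b"
    proof
      show "(g, g') \<in> hom (prod_groupoid G H) b a" unfolding hom using g by simp
      show "cmp (prod_groupoid G H) (g, g') f = idn (prod_groupoid G H) a \<and>
        cmp (prod_groupoid G H) f (g, g') = idn (prod_groupoid G H) b"
        using g by (cases f; cases a; cases b) (simp add: prod_groupoid_def)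
    qed
  qed
qed

lemma hom_prod_groupoid:
  "(f, g) \<in> hom (prod_groupoid G H) a b \<longleftrightarrow>
    f \<in> hom G (fst a) (fst b) \<and> g \<in> hom H (snd a) (snd b)"
  by (cases a; cases b) (auto simp: hom_def prod_groupoid_def)

text \<open>Lifts of the objects are chosen first; \<open>full\<close> between the chosen objects
  then lifts a whole composable chain with matching ends. Each groupoid law of \<open>H\<close> is
  thus the image of the same law in \<open>G\<close>.\<close>

lemma groupoid_transfer:
  assumes G: "groupoid G"
    and obj: "Fo ` Obj G = Obj H"
    and closed: "\<And>f. f \<in> Arr H \<Longrightarrow> src H f \<in> Obj H \<and> tgt H f \<in> Obj H"
    and full: "\<And>u v. u \<in> Obj G \<Longrightarrow> v \<in> Obj G \<Longrightarrow> Fa ` hom G u v = hom H (Fo u) (Fo v)"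
    and idn: "\<And>u. u \<in> Obj G \<Longrightarrow> Fa (idn G u) = idn H (Fo u)"
    and cmp: "\<And>u v w f g. f \<in> hom G u v \<Longrightarrow> g \<in> hom G v w \<Longrightarrow>
      Fa (cmp G g f) = cmp H (Fa g) (Fa f)"
  shows "groupoid H" "groupoid_functor G H Fo Fa"
proof -
  interpret G: groupoid G by fact
  have hom_obj: "a \<in> Obj H \<and> b \<in> Obj H" if "f \<in> hom H a b" for f a b
    using closed that by (auto simp: hom_def)
  have Fhom: "Fa f \<in> hom H (Fo u) (Fo v)" if "f \<in> hom G u v" for f u v
    using full[of u v] that G.src_closed G.tgt_closed by (auto simp: hom_def)
  have lift: "\<exists>f'\<in>hom G u v. Fa f' = f"
    if "f \<in> hom H (Fo u) (Fo v)" "u \<in> Obj G" "v \<in> Obj G" for f u v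
    using that full[of u v] by (metis imageE)
  have ob_lift: "\<exists>u\<in>Obj G. Fo u = a" if "a \<in> Obj H" for a
    using that obj by (metis imageE)
  show H: "groupoid H"
  proof
    fix f assume "f \<in> Arr H"
    then show "src H f \<in> Obj H" "tgt H f \<in> Obj H" using closed by auto
  next
    fix a assume "a \<in> Obj H"
    then show "idn H a \<in> hom H a a"
      using Fhom G.idn_hom idn ob_lift by metis
  next
    fix f g a b c assume f: "f \<in> hom H a b" and g: "g \<in> hom H b c"
    obtain u v w where u: "u \<in> Obj G" "Fo u = a" "v \<in> Obj G" "Fo v = b" "w \<in> Obj G" "Fo w = c"
      using f g hom_obj ob_lift by metis
    then obtain f' g' where f': "f' \<in> hom G u v" "Fa f' = f" and g': "g' \<in> hom G v w" "Fa g' = g"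
      using f g lift[of f u v] lift[of g v w] by auto
    show "cmp H g f \<in> hom H a c" using Fhom[OF G.cmp_hom[OF f'(1) g'(1)]] cmp[OF f'(1) g'(1)] f' g' u by simp
  next
    fix f g h a b c d assume f: "f \<in> hom H a b" and g: "g \<in> hom H b c" and h: "h \<in> hom H c d"
    obtain u v w x where u: "u \<in> Obj G" "Fo u = a" "v \<in> Obj G" "Fo v = b" "w \<in> Obj G" "Fo w = c"
      "x \<in> Obj G" "Fo x = d"
      using f g h hom_obj ob_lift by metis
    then obtain f' g' h' where f': "f' \<in> hom G u v" "Fa f' = f" and g': "g' \<in> hom G v w" "Fa g' = g"
      and h': "h' \<in> hom G w x" "Fa h' = h"
      using f g h lift[of f u v] lift[of g v w] lift[of h w x] by auto
    have "Fa (cmp G h' (cmp G g' f')) = Fa (cmp G (cmp G h' g') f')"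
      by (simp add: G.cmp_assoc[OF f'(1) g'(1) h'(1)])
    then show "cmp H h (cmp H g f) = cmp H (cmp H h g) f"
      by (simp add: f' g' h' cmp[OF f'(1) g'(1)] cmp[OF g'(1) h'(1)]
          cmp[OF G.cmp_hom[OF f'(1) g'(1)] h'(1)] cmp[OF f'(1) G.cmp_hom[OF g'(1) h'(1)]])
  next
    fix f a b assume f: "f \<in> hom H a b"
    obtain u v where u: "u \<in> Obj G" "Fo u = a" "v \<in> Obj G" "Fo v = b"
      using f hom_obj ob_lift by metis
    then obtain f' where f': "f' \<in> hom G u v" "Fa f' = f"
      using f lift by metis
    show "cmp H f (idn H a) = f" using f' u cmp idn G.idn_hom G.cmp_idn by metis
    show "cmp H (idn H b) f = f" using f' u cmp idn G.idn_hom G.idn_cmp by metis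
    obtain g' where "g' \<in> hom G v u" "cmp G g' f' = idn G u" "cmp G f' g' = idn G v"
      using G.inverse_ex f' by metis
    then show "\<exists>g\<in>hom H b a. cmp H g f = idn H a \<and> cmp H f g = idn H b"
      using f' u cmp idn Fhom by metis
  qed
  show "groupoid_functor G H Fo Fa"
    unfolding groupoid_functor_def groupoid_functor_axioms_def
    using G H obj Fhom idn cmp by blast
qed

text \<open>\<open>equivalence_of_groupoids\<close> demands an explicit quasi-inverse. It is built
  by choice: \<open>Go b\<close> is a preimage of \<open>b\<close> up to an arrow
  \<open>\<theta> b\<close>, and an arrow is sent to the unique lift of its conjugate by
  \<theta>.\<close>

lemma equivalence_of_groupoidsI:
  assumes fct: "groupoid_functor A B Fo Fa"
    and ff: "\<And>a b. a \<in> Obj A \<Longrightarrow> b \<in> Obj A \<Longrightarrow> bij_betw Fa (hom A a b) (hom B (Fo a) (Fo b))"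
    and ess: "\<And>b. b \<in> Obj B \<Longrightarrow> \<exists>a\<in>Obj A. hom B (Fo a) b \<noteq> {}"
  shows "equivalence_of_groupoids A B Fo Fa"
proof -
  interpret groupoid_functor A B Fo Fa by fact
  define Go where "Go b = (SOME a. a \<in> Obj A \<and> hom B (Fo a) b \<noteq> {})" for b
  define \<theta> where "\<theta> b = (SOME f. f \<in> hom B (Fo (Go b)) b)" for b
  define iv where "iv f a b = (SOME g. g \<in> hom B b a \<and> cmp B g f = idn B a \<and> cmp B f g = idn B b)" for f a b
  have Go: "Go b \<in> Obj A \<and> hom B (Fo (Go b)) b \<noteq> {}" if "b \<in> Obj B" for b
    unfolding Go_def by (rule someI_ex) (use ess[OF that] in blast)
  have \<theta>: "\<theta> b \<in> hom B (Fo (Go b)) b" if "b \<in> Obj B" for b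
    unfolding \<theta>_def by (rule someI_ex) (use Go[OF that] in blast)
  have iv: "iv f a b \<in> hom B b a \<and> cmp B (iv f a b) f = idn B a \<and> cmp B f (iv f a b) = idn B b"
    if "f \<in> hom B a b" for f a b
    unfolding iv_def by (rule someI_ex) (use B.inverse_ex[OF that] in blast)
  \<comment> \<open>This transports \<open>g\<close> along \<theta> to an arrow between images of
    objects of \<open>A\<close>, where full faithfulness applies.\<close>
  define conj where "conj g = cmp B (iv (\<theta> (tgt B g)) (Fo (Go (tgt B g))) (tgt B g)) (cmp B g (\<theta> (src B g)))" for g
  define lift where "lift a b g = the_inv_into (hom A a b) Fa g" for a b g
  define Ga where "Ga g = lift (Go (src B g)) (Go (tgt B g)) (conj g)" for g
  have lift: "lift a b g \<in> hom A a b" "Fa (lift a b g) = g"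
    if "g \<in> hom B (Fo a) (Fo b)" "a \<in> Obj A" "b \<in> Obj A" for a b g
    using ff[of a b] that unfolding lift_def bij_betw_def
    by (auto intro: the_inv_into_into f_the_inv_into_f)
  have inj: "f = g" if "Fa f = Fa g" "f \<in> hom A a b" "g \<in> hom A a b" for f g a b
    using ff[of a b] that unfolding bij_betw_def
    by (metis A.src_closed A.tgt_closed homD inj_onD)
  have ob: "a \<in> Obj B" "b \<in> Obj B" if "g \<in> hom B a b" for g a b
    using that B.src_closed B.tgt_closed homD by metis+
  have obA: "a \<in> Obj A" "b \<in> Obj A" if "g \<in> hom A a b" for g a b
    using that A.src_closed A.tgt_closed homD by metis+
  have conj: "conj g \<in> hom B (Fo (Go a)) (Fo (Go b))" "cmp B (\<theta> b) (conj g) = cmp B g (\<theta> a)"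
    if g: "g \<in> hom B a b" for g a b
  proof -
    have st: "src B g = a" "tgt B g = b" using g homD by metis+
    have 1: "cmp B g (\<theta> a) \<in> hom B (Fo (Go a)) b" using B.cmp_hom[OF \<theta> g] ob[OF g] by simp
    note i = iv[OF \<theta>[OF ob(2)[OF g]]]
    show "conj g \<in> hom B (Fo (Go a)) (Fo (Go b))"
      unfolding conj_def st using B.cmp_hom[OF 1] i by blast
    show "cmp B (\<theta> b) (conj g) = cmp B g (\<theta> a)"
      unfolding conj_def st using B.cmp_assoc[OF 1] i \<theta>[OF ob(2)[OF g]] B.idn_cmp[OF 1] by metis
  qed
  have cancel: "f = f'" if h: "h \<in> hom B b c" and f: "f \<in> hom B a b" and f': "f' \<in> hom B a b"
    and eq: "cmp B h f = cmp B h f'" for f f' h a b c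
    using B.cmp_assoc[OF f h, of "iv h b c" b] B.cmp_assoc[OF f' h, of "iv h b c" b] iv[OF h]
      B.idn_cmp[OF f] B.idn_cmp[OF f'] eq by metis
  have Ga: "Ga g \<in> hom A (Go a) (Go b)" "cmp B (\<theta> b) (Fa (Ga g)) = cmp B g (\<theta> a)"
    if g: "g \<in> hom B a b" for g a b
  proof -
    have st: "src B g = a" "tgt B g = b" using g homD by metis+
    note l = lift[OF conj(1)[OF g] conjunct1[OF Go[OF ob(1)[OF g]]] conjunct1[OF Go[OF ob(2)[OF g]]]]
    show "Ga g \<in> hom A (Go a) (Go b)" unfolding Ga_def st by (rule l)
    show "cmp B (\<theta> b) (Fa (Ga g)) = cmp B g (\<theta> a)" unfolding Ga_def st l(2) by (rule conj(2)[OF g])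
  qed
  \<comment> \<open>The square with \<theta> determines \<open>Ga g\<close>, because \<theta>
    cancels on the left and \<open>Fa\<close> is injective on each hom-set. Both functor laws for
    \<open>Ga\<close> are instances.\<close>
  have Ga_eqI: "Ga g = h" if g: "g \<in> hom B a b" and h: "h \<in> hom A (Go a) (Go b)"
    and eq: "cmp B (\<theta> b) (Fa h) = cmp B g (\<theta> a)" for g h a b
    using inj[OF cancel[OF \<theta>[OF ob(2)[OF g]] map_hom[OF Ga(1)[OF g]] map_hom[OF h]] Ga(1)[OF g] h]
      Ga(2)[OF g] eq by simp
  have G: "groupoid_functor B A Go Ga"
  proof
    show "Go b \<in> Obj A" if "b \<in> Obj B" for b using Go that by blast
    show "Ga f \<in> hom A (Go a) (Go b)" if "f \<in> hom B a b" for f a b by (rule Ga[OF that])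
    show "Ga (idn B b) = idn A (Go b)" if b: "b \<in> Obj B" for b
      using Ga_eqI[OF B.idn_hom[OF b] A.idn_hom] Go[OF b] map_idn B.cmp_idn[OF \<theta>[OF b]]
        B.idn_cmp[OF \<theta>[OF b]] by metis
    show "Ga (cmp B g f) = cmp A (Ga g) (Ga f)" if f: "f \<in> hom B a b" and g: "g \<in> hom B b c" for f g a b c
    proof (rule Ga_eqI[OF B.cmp_hom[OF f g] A.cmp_hom[OF Ga(1)[OF f] Ga(1)[OF g]]])
      note Ff = map_hom[OF Ga(1)[OF f]] and Fg = map_hom[OF Ga(1)[OF g]]
      note ta = \<theta>[OF ob(1)[OF f]] and tb = \<theta>[OF ob(2)[OF f]] and tc = \<theta>[OF ob(2)[OF g]]
      have "cmp B (\<theta> c) (Fa (cmp A (Ga g) (Ga f))) = cmp B (\<theta> c) (cmp B (Fa (Ga g)) (Fa (Ga f)))"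
        by (simp add: map_cmp[OF Ga(1)[OF f] Ga(1)[OF g]])
      also have "\<dots> = cmp B (cmp B g (\<theta> b)) (Fa (Ga f))"
        by (simp add: B.cmp_assoc[OF Ff Fg tc] Ga(2)[OF g])
      also have "\<dots> = cmp B g (cmp B f (\<theta> a))"
        by (simp add: B.cmp_assoc[OF Ff tb g, symmetric] Ga(2)[OF f])
      also have "\<dots> = cmp B (cmp B g f) (\<theta> a)"
        by (rule B.cmp_assoc[OF ta f g])
      finally show "cmp B (\<theta> c) (Fa (cmp A (Ga g) (Ga f))) = cmp B (cmp B g f) (\<theta> a)" .
    qed
  qed
  \<comment> \<open>The unit is lifted from the inverse of \<theta> at \<open>Fo a\<close>, so that
    a triangle identity holds by construction.\<close>
  define \<eta> where "\<eta> a = lift a (Go (Fo a)) (iv (\<theta> (Fo a)) (Fo (Go (Fo a))) (Fo a))" for a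
  have \<eta>: "\<eta> a \<in> hom A a (Go (Fo a))" "cmp B (\<theta> (Fo a)) (Fa (\<eta> a)) = idn B (Fo a)"
    if a: "a \<in> Obj A" for a
  proof -
    note i = iv[OF \<theta>[OF map_obj[OF a]]]
    note l = lift[OF conjunct1[OF i] a conjunct1[OF Go[OF map_obj[OF a]]]]
    show "\<eta> a \<in> hom A a (Go (Fo a))" "cmp B (\<theta> (Fo a)) (Fa (\<eta> a)) = idn B (Fo a)"
      unfolding \<eta>_def using l i by auto
  qed
  have "natural_iso A A (\<lambda>a. a) (\<lambda>f. f) (Go \<circ> Fo) (Ga \<circ> Fa) \<eta>"
    unfolding natural_iso_def o_def
  proof (intro conjI ballI allI)
    show "\<eta> a \<in> hom A a (Go (Fo a))" if "a \<in> Obj A" for a by (rule \<eta>[OF that])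
    fix a b f assume f: "f \<in> hom A a b"
    note ea = \<eta>[OF obA(1)[OF f]] and eb = \<eta>[OF obA(2)[OF f]]
    note Ff = map_hom[OF f]
    note G' = Ga[OF Ff]
    note tb = \<theta>[OF ob(2)[OF Ff]] and ta = \<theta>[OF ob(1)[OF Ff]]
    show "cmp A (\<eta> b) f = cmp A (Ga (Fa f)) (\<eta> a)"
    proof (rule inj[OF cancel[OF tb]])
      show "cmp A (\<eta> b) f \<in> hom A a (Go (Fo b))" "cmp A (Ga (Fa f)) (\<eta> a) \<in> hom A a (Go (Fo b))"
        by (rule A.cmp_hom[OF f eb(1)], rule A.cmp_hom[OF ea(1) G'(1)])
      then show "Fa (cmp A (\<eta> b) f) \<in> hom B (Fo a) (Fo (Go (Fo b)))"
        "Fa (cmp A (Ga (Fa f)) (\<eta> a)) \<in> hom B (Fo a) (Fo (Go (Fo b)))"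
        by (auto intro: map_hom)
      have "cmp B (\<theta> (Fo b)) (Fa (cmp A (\<eta> b) f)) = Fa f"
        by (simp add: map_cmp[OF f eb(1)] B.cmp_assoc[OF Ff map_hom[OF eb(1)] tb] eb(2) B.idn_cmp[OF Ff])
      moreover have "cmp B (\<theta> (Fo b)) (Fa (cmp A (Ga (Fa f)) (\<eta> a))) = Fa f"
        by (simp add: map_cmp[OF ea(1) G'(1)] B.cmp_assoc[OF map_hom[OF ea(1)] map_hom[OF G'(1)] tb] G'(2)
            B.cmp_assoc[OF map_hom[OF ea(1)] ta Ff, symmetric] ea(2) B.cmp_idn[OF Ff])
      ultimately show "cmp B (\<theta> (Fo b)) (Fa (cmp A (\<eta> b) f)) =
          cmp B (\<theta> (Fo b)) (Fa (cmp A (Ga (Fa f)) (\<eta> a)))" by simp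
    qed
  qed
  moreover have "natural_iso B B (Fo \<circ> Go) (Fa \<circ> Ga) (\<lambda>b. b) (\<lambda>g. g) \<theta>"
    unfolding natural_iso_def o_def using \<theta> Ga(2) by blast
  ultimately show ?thesis
    unfolding equivalence_of_groupoids_def using fct G by blast
qed

text \<open>Elements of \<open>Q\<close> are images, so the arguments of an axiom are pulled back to
  \<open>P\<close>. Both sides are then the images of the two sides of the axiom in
  \<open>P\<close>, once the color lists are identified.\<close>

lemma symmetric_operad_transfer:
  assumes P: "symmetric_operad P" and hom: "operad_hom P Q \<phi>"
    and onto: "\<And>xs x. elems Q xs x = \<phi> xs x ` elems P xs x"
  shows "symmetric_operad Q"
proof -
  interpret symmetric_operad P by fact
  have cl: "\<phi> xs x a \<in> elems Q xs x" if "a \<in> elems P xs x" for xs x a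
    using that onto by auto
  have one: "one Q x = \<phi> [x] x (one P x)" for x
    using hom by (simp add: operad_hom_def)
  have ins: "ins Q xs x i ys (\<phi> xs x a) (\<phi> ys (xs ! i) b) = \<phi> (graft xs i ys) x (ins P xs x i ys a b)"
    if "a \<in> elems P xs x" "i < length xs" "b \<in> elems P ys (xs ! i)" for xs x i ys a b
    using that hom by (simp add: operad_hom_def)
  have act: "act Q xs x \<sigma> (\<phi> xs x a) = \<phi> (permute_list \<sigma> xs) x (act P xs x \<sigma> a)"
    if "a \<in> elems P xs x" "\<sigma> permutes {..<length xs}" for xs x \<sigma> a
    using that hom by (simp add: operad_hom_def)
  \<comment> \<open>This and the next color identities let the homomorphism property be applied to
    iterated operations, whose inner color is read off from a graft or a permuted list.\<close>
  have nth1: "graft xs i ys ! (i + j) = ys ! j" if "i < length xs" "j < length ys"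
    for xs ys :: "color list" and i j
    using that by (simp add: graft_def nth_append)
  have nth2: "graft xs i ys ! (k + length ys - 1) = xs ! k" if "i < k" "k < length xs"
    for xs ys :: "color list" and i k
    using that by (subst nth_graft) (auto simp: splice_def)
  have nth3: "graft xs k zs ! i = xs ! i" if "i < k" "k < length xs"
    for xs zs :: "color list" and i k
    using that by (simp add: graft_def nth_append)
  have pn: "permute_list \<sigma> xs ! i = xs ! \<sigma> i" if "i < length xs" "\<sigma> permutes {..<length xs}"
    for xs :: "color list" and \<sigma> i
    using that by (simp add: permute_list_nth)
  show ?thesis
  proof
    show "one Q x \<in> elems Q [x] x" for x unfolding one by (rule cl[OF one_closed])
  next
    fix xs x i ys a b
    assume "a \<in> elems Q xs x" "i < length xs" "b \<in> elems Q ys (xs ! i)"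
    then show "ins Q xs x i ys a b \<in> elems Q (graft xs i ys) x"
      unfolding onto by (auto simp: ins ins_closed)
  next
    fix xs x \<sigma> a
    assume "a \<in> elems Q xs x" "\<sigma> permutes {..<length xs}"
    then show "act Q xs x \<sigma> a \<in> elems Q (permute_list \<sigma> xs) x"
      unfolding onto by (auto simp: act act_closed)
  next
    fix xs x i a
    assume "a \<in> elems Q xs x" "i < length xs"
    then show "ins Q xs x i [xs ! i] a (one Q (xs ! i)) = a"
      using one_closed id_take_nth_drop[of i xs] unfolding onto one
      by (auto simp: ins ins_one graft_def)
  next
    fix xs x a
    assume "a \<in> elems Q xs x"
    then show "ins Q [x] x 0 xs (one Q x) a = a"
      using ins[of "one P x" "[x]" x 0 _ xs] one_closed unfolding onto one
      by (auto simp: one_ins graft_def)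
  next
    fix xs x i ys j zs a b c
    assume a: "a \<in> elems Q xs x" and i: "i < length xs" and b: "b \<in> elems Q ys (xs ! i)"
      and j: "j < length ys" and c: "c \<in> elems Q zs (ys ! j)"
    obtain a' b' c' where a': "a' \<in> elems P xs x" "a = \<phi> xs x a'"
      and b': "b' \<in> elems P ys (xs ! i)" "b = \<phi> ys (xs ! i) b'"
      and c': "c' \<in> elems P zs (ys ! j)" "c = \<phi> zs (ys ! j) c'"
      using a b c unfolding onto by auto
    note g = graft_sequential[OF i j, of zs]
    note L = ins[OF ins_closed[OF a'(1) i b'(1)], of "i + j" c' zs]
    note R = ins[OF a'(1) i ins_closed[OF b'(1) j c'(1)]]
    show "ins Q (graft xs i ys) x (i + j) zs (ins Q xs x i ys a b) c
        = ins Q xs x i (graft ys j zs) a (ins Q ys (xs ! i) j zs b c)"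
      using L R i j nth1[OF i j] c' ins_sequential[OF a'(1) i b'(1) j c'(1)] ins[OF a'(1) i b'(1)]
        ins[OF b'(1) j c'(1)]
      by (simp add: a' b' g length_graft)
  next
    fix xs x i ys k zs a b c
    assume a: "a \<in> elems Q xs x" and ik: "i < k" and k: "k < length xs" and b: "b \<in> elems Q ys (xs ! i)"
      and c: "c \<in> elems Q zs (xs ! k)"
    obtain a' b' c' where a': "a' \<in> elems P xs x" "a = \<phi> xs x a'"
      and b': "b' \<in> elems P ys (xs ! i)" "b = \<phi> ys (xs ! i) b'"
      and c': "c' \<in> elems P zs (xs ! k)" "c = \<phi> zs (xs ! k) c'"
      using a b c unfolding onto by auto
    have i: "i < length xs" using ik k by simp
    note g = graft_parallel[OF ik k, of ys zs]
    note L = ins[OF ins_closed[OF a'(1) i b'(1)], of "k + length ys - 1" c' zs]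
    note R = ins[OF ins_closed[OF a'(1) k c'(1)], of i b' ys]
    have "k + length ys - 1 < length (graft xs i ys)" using i ik k by (simp add: length_graft)
    moreover have "i < length (graft xs k zs)" using i ik k by (simp add: length_graft)
    ultimately
    show "ins Q (graft xs i ys) x (k + length ys - 1) zs (ins Q xs x i ys a b) c
        = ins Q (graft xs k zs) x i ys (ins Q xs x k zs a c) b"
      using L R nth2[OF ik k] nth3[OF ik k] c' b' ins_parallel[OF a'(1) ik k b'(1) c'(1)] ins[OF a'(1) i b'(1)]
        ins[OF a'(1) k c'(1)]
      by (simp add: a' g[simplified])
  next
    fix xs x a assume "a \<in> elems Q xs x"
    then show "act Q xs x id a = a"
      unfolding onto by (auto simp: act permutes_id act_id)
  next
    fix xs x \<sigma> \<tau> a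
    assume a: "a \<in> elems Q xs x" and s: "\<sigma> permutes {..<length xs}" and t: "\<tau> permutes {..<length xs}"
    obtain a' where a': "a' \<in> elems P xs x" "a = \<phi> xs x a'"
      using a unfolding onto by auto
    have "permute_list \<tau> (permute_list \<sigma> xs) = permute_list (\<sigma> \<circ> \<tau>) xs"
      using permute_list_compose[OF t] by simp
    then show "act Q (permute_list \<sigma> xs) x \<tau> (act Q xs x \<sigma> a) = act Q xs x (\<sigma> \<circ> \<tau>) a"
      using act[OF a'(1) s] act[OF act_closed[OF a'(1) s], of \<tau>] act[OF a'(1) permutes_compose[OF t s]]
        act_act[OF a'(1) s t] t
      by (simp add: a')
  next
    fix xs x \<sigma> i ys \<tau> a b
    assume a: "a \<in> elems Q xs x" and s: "\<sigma> permutes {..<length xs}" and i: "i < length xs"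
      and b: "b \<in> elems Q ys (xs ! \<sigma> i)" and t: "\<tau> permutes {..<length ys}"
    show "ins Q (permute_list \<sigma> xs) x i (permute_list \<tau> ys) (act Q xs x \<sigma> a) (act Q ys (xs ! \<sigma> i) \<tau> b)
        = act Q (graft xs (\<sigma> i) ys) x (block_perm i (length ys) \<sigma> \<tau>) (ins Q xs x (\<sigma> i) ys a b)"
    proof -
      have si: "\<sigma> i < length xs" using permutes_in_image[OF s] i by auto
      obtain a' b' where a': "a' \<in> elems P xs x" "a = \<phi> xs x a'"
        and b': "b' \<in> elems P ys (xs ! \<sigma> i)" "b = \<phi> ys (xs ! \<sigma> i) b'"
        using a b unfolding onto by auto
      have "block_perm i (length ys) \<sigma> \<tau> permutes {..<length (graft xs (\<sigma> i) ys)}"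
        using block_perm_permutes[OF s t i] si by (simp add: length_graft)
      note R = act[OF ins_closed[OF a'(1) si b'(1)] this]
      have "act P ys (xs ! \<sigma> i) \<tau> b' \<in> elems P (permute_list \<tau> ys) (permute_list \<sigma> xs ! i)"
        using act_closed[OF b'(1) t] pn[OF i s] by simp
      note L = ins[OF act_closed[OF a'(1) s] _ this]
      show ?thesis
        using L R ins_act[OF a'(1) s i b'(1) t] permute_list_graft[OF s t i] i
        by (simp add: a' b' act[OF a'(1) s] act[OF b'(1) t] ins[OF a'(1) si b'(1)] pn[OF i s])
    qed
  qed
qed

text \<open>This form is chosen for its stability under products: pairs of arrows lift as well,
  which is how the insertion functor with its two arguments descends.\<close>

definition full_onto ::
  "('a, 'b) groupoid_data \<Rightarrow> ('c, 'd) groupoid_data \<Rightarrow> ('a \<Rightarrow> 'c) \<Rightarrow> ('b \<Rightarrow> 'd) \<Rightarrow> bool" where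
  "full_onto A B Fo Fa \<longleftrightarrow> groupoid_functor A B Fo Fa \<and> Fo ` Obj A = Obj B \<and>
     (\<forall>u\<in>Obj A. \<forall>v\<in>Obj A. Fa ` hom A u v = hom B (Fo u) (Fo v))"

lemma full_onto_prod:
  assumes "full_onto A B Fo Fa" "full_onto C D Go Ga"
  shows "full_onto (prod_groupoid A C) (prod_groupoid B D) (map_prod Fo Go) (map_prod Fa Ga)"
proof -
  interpret F: groupoid_functor A B Fo Fa using assms by (simp add: full_onto_def)
  interpret G: groupoid_functor C D Go Ga using assms by (simp add: full_onto_def)
  have "groupoid_functor (prod_groupoid A C) (prod_groupoid B D) (map_prod Fo Go) (map_prod Fa Ga)"
  proof (intro groupoid_functor.intro groupoid_prod groupoid_functor_axioms.intro)
    show "map_prod Fo Go a \<in> Obj (prod_groupoid B D)" if "a \<in> Obj (prod_groupoid A C)" for a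
      using that by (auto simp: prod_groupoid_def F.map_obj G.map_obj)
    show "map_prod Fa Ga f \<in> hom (prod_groupoid B D) (map_prod Fo Go a) (map_prod Fo Go b)"
      if "f \<in> hom (prod_groupoid A C) a b" for f a b
      using that by (cases f) (auto simp: hom_prod_groupoid F.map_hom G.map_hom)
    show "map_prod Fa Ga (idn (prod_groupoid A C) a) = idn (prod_groupoid B D) (map_prod Fo Go a)"
      if "a \<in> Obj (prod_groupoid A C)" for a
      using that by (auto simp: prod_groupoid_def F.map_idn G.map_idn)
    show "map_prod Fa Ga (cmp (prod_groupoid A C) g f) =
        cmp (prod_groupoid B D) (map_prod Fa Ga g) (map_prod Fa Ga f)"
      if "f \<in> hom (prod_groupoid A C) a b" "g \<in> hom (prod_groupoid A C) b c" for f g a b c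
    proof -
      obtain f1 f2 g1 g2 where fg: "f = (f1, f2)" "g = (g1, g2)" by (cases f; cases g) auto
      then have "Fa (cmp A g1 f1) = cmp B (Fa g1) (Fa f1)" "Ga (cmp C g2 f2) = cmp D (Ga g2) (Ga f2)"
        using that F.map_cmp G.map_cmp by (auto simp: hom_prod_groupoid)
      then show ?thesis by (simp add: fg prod_groupoid_def)
    qed
  qed (rule F.A.groupoid_axioms F.B.groupoid_axioms G.A.groupoid_axioms G.B.groupoid_axioms)+
  moreover have "map_prod Fo Go ` Obj (prod_groupoid A C) = Obj (prod_groupoid B D)"
    using assms by (auto simp: full_onto_def prod_groupoid_def map_prod_surj_on)
  moreover have "hom (prod_groupoid A C) u v = hom A (fst u) (fst v) \<times> hom C (snd u) (snd v)"
    "hom (prod_groupoid B D) u' v' = hom B (fst u') (fst v') \<times> hom D (snd u') (snd v')" for u v u' v'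
    by (auto simp: hom_prod_groupoid)
  moreover have "map_prod Fa Ga ` (hom A (fst u) (fst v) \<times> hom C (snd u) (snd v)) =
      hom B (Fo (fst u)) (Fo (fst v)) \<times> hom D (Go (snd u)) (Go (snd v))"
    if "u \<in> Obj (prod_groupoid A C)" "v \<in> Obj (prod_groupoid A C)" for u v
    using assms that by (intro map_prod_surj_on) (auto simp: full_onto_def prod_groupoid_def F.map_hom G.map_hom)
  ultimately show ?thesis
    by (simp add: full_onto_def)
qed

text \<open>The composite of \<open>H\<close> and \<open>K\<close> is a functor out of
  \<open>A\<close>, and composable pairs in \<open>A'\<close> lift to \<open>A\<close>. So the map
  that completes the square inherits the functor laws.\<close>

lemma functor_transfer:
  assumes A: "full_onto A A' Fo Fa" and B: "groupoid_functor B B' Ko Ka"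
    and H: "groupoid_functor A B Ho Ha"
    and ob: "\<And>a. a \<in> Obj A \<Longrightarrow> Ho' (Fo a) = Ko (Ho a)"
    and ar: "\<And>f. f \<in> Arr A \<Longrightarrow> Ha' (Fa f) = Ka (Ha f)"
  shows "groupoid_functor A' B' Ho' Ha'"
proof -
  interpret F: groupoid_functor A A' Fo Fa using A by (simp add: full_onto_def)
  interpret K: groupoid_functor B B' Ko Ka by fact
  interpret H: groupoid_functor A B Ho Ha by fact
  have lift: "\<exists>f'\<in>hom A u v. Fa f' = f"
    if "f \<in> hom A' (Fo u) (Fo v)" "u \<in> Obj A" "v \<in> Obj A" for f u v
    using that A unfolding full_onto_def by (metis imageE)
  have ob_lift: "\<exists>u\<in>Obj A. Fo u = a" if "a \<in> Obj A'" for a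
    using that A unfolding full_onto_def by (metis imageE)
  have hom_obj: "a \<in> Obj A' \<and> b \<in> Obj A'" if "f \<in> hom A' a b" for f a b
    using F.B.src_closed F.B.tgt_closed that by (auto simp: hom_def)
  have arr: "f \<in> Arr A" if "f \<in> hom A u v" for f u v using that by (simp add: hom_def)
  show ?thesis
  proof
    show "Ho' a \<in> Obj B'" if "a \<in> Obj A'" for a
      using ob_lift[OF that] ob H.map_obj K.map_obj by metis
    show "Ha' f \<in> hom B' (Ho' a) (Ho' b)" if f: "f \<in> hom A' a b" for f a b
    proof -
      obtain u v where u: "u \<in> Obj A" "Fo u = a" "v \<in> Obj A" "Fo v = b"
        using hom_obj[OF f] ob_lift by metis
      then obtain f' where f': "f' \<in> hom A u v" "Fa f' = f" using lift f by metis
      then show ?thesis using K.map_hom[OF H.map_hom[OF f'(1)]] ob ar[OF arr] u by metis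
    qed
    show "Ha' (idn A' a) = idn B' (Ho' a)" if a: "a \<in> Obj A'" for a
    proof -
      obtain u where u: "u \<in> Obj A" "Fo u = a" using ob_lift[OF a] by blast
      show ?thesis
        using ar[OF arr[OF F.A.idn_hom[OF u(1)]]] F.map_idn[OF u(1)] H.map_idn[OF u(1)]
          K.map_idn[OF H.map_obj[OF u(1)]] ob[OF u(1)] u(2) by simp
    qed
    show "Ha' (cmp A' g f) = cmp B' (Ha' g) (Ha' f)"
      if f: "f \<in> hom A' a b" and g: "g \<in> hom A' b c" for f g a b c
    proof -
      obtain u v w where u: "u \<in> Obj A" "Fo u = a" "v \<in> Obj A" "Fo v = b" "w \<in> Obj A" "Fo w = c"
        using hom_obj[OF f] hom_obj[OF g] ob_lift by metis
      then obtain f' g' where f': "f' \<in> hom A u v" "Fa f' = f" and g': "g' \<in> hom A v w" "Fa g' = g"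
        using f g lift[of f u v] lift[of g v w] by auto
      show ?thesis
        using ar[OF arr[OF F.A.cmp_hom[OF f'(1) g'(1)]]] F.map_cmp[OF f'(1) g'(1)]
          H.map_cmp[OF f'(1) g'(1)] K.map_cmp[OF H.map_hom[OF f'(1)] H.map_hom[OF g'(1)]]
          ar[OF arr[OF f'(1)]] ar[OF arr[OF g'(1)]] f'(2) g'(2) by simp
    qed
  qed
qed

text \<open>
  An operad structure and all its axioms descend along a map that is onto on objects, full, and
  compatible with all operations, because finitely many arrows of the target can be lifted
  simultaneously with matching end points.
\<close>

lemma groupoid_operad_transfer:
  assumes P: "relative_groupoid_operad P"
    and obj: "\<And>xs x. Fo xs x ` Obj (ar P xs x) = Obj (ar Q xs x)"
    and closed: "\<And>xs x f. f \<in> Arr (ar Q xs x) \<Longrightarrow>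
      src (ar Q xs x) f \<in> Obj (ar Q xs x) \<and> tgt (ar Q xs x) f \<in> Obj (ar Q xs x)"
    and full: "\<And>xs x u v. u \<in> Obj (ar P xs x) \<Longrightarrow> v \<in> Obj (ar P xs x) \<Longrightarrow>
      Fa xs x ` hom (ar P xs x) u v = hom (ar Q xs x) (Fo xs x u) (Fo xs x v)"
    and idn: "\<And>xs x u. u \<in> Obj (ar P xs x) \<Longrightarrow>
      Fa xs x (idn (ar P xs x) u) = idn (ar Q xs x) (Fo xs x u)"
    and cmp: "\<And>xs x u v w f g. f \<in> hom (ar P xs x) u v \<Longrightarrow> g \<in> hom (ar P xs x) v w \<Longrightarrow>
      Fa xs x (cmp (ar P xs x) g f) = cmp (ar Q xs x) (Fa xs x g) (Fa xs x f)"
    and one: "\<And>x. Fo [x] x (oone P x) = oone Q x"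
    and oins: "\<And>xs x i ys a b. a \<in> Obj (ar P xs x) \<Longrightarrow> i < length xs \<Longrightarrow> b \<in> Obj (ar P ys (xs ! i)) \<Longrightarrow>
      Fo (graft xs i ys) x (oins P xs x i ys a b) = oins Q xs x i ys (Fo xs x a) (Fo ys (xs ! i) b)"
    and oact: "\<And>xs x \<sigma> a. a \<in> Obj (ar P xs x) \<Longrightarrow> \<sigma> permutes {..<length xs} \<Longrightarrow>
      Fo (permute_list \<sigma> xs) x (oact P xs x \<sigma> a) = oact Q xs x \<sigma> (Fo xs x a)"
    and ains: "\<And>xs x i ys a b. a \<in> Arr (ar P xs x) \<Longrightarrow> i < length xs \<Longrightarrow> b \<in> Arr (ar P ys (xs ! i)) \<Longrightarrow>
      Fa (graft xs i ys) x (ains P xs x i ys a b) = ains Q xs x i ys (Fa xs x a) (Fa ys (xs ! i) b)"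
    and aact: "\<And>xs x \<sigma> a. a \<in> Arr (ar P xs x) \<Longrightarrow> \<sigma> permutes {..<length xs} \<Longrightarrow>
      Fa (permute_list \<sigma> xs) x (aact P xs x \<sigma> a) = aact Q xs x \<sigma> (Fa xs x a)"
  shows "relative_groupoid_operad Q" "operad_morphism P Q Fo Fa"
proof -
  interpret P: relative_groupoid_operad P by fact
  have gQ: "groupoid (ar Q xs x)" and fct: "groupoid_functor (ar P xs x) (ar Q xs x) (Fo xs x) (Fa xs x)"
    for xs x
    by (rule groupoid_transfer[OF P.arity_groupoid obj closed full idn cmp]; assumption)+
  have onto: "full_onto (ar P xs x) (ar Q xs x) (Fo xs x) (Fa xs x)" for xs x
    by (simp add: full_onto_def fct obj full)
  have F_hom: "Fa xs x f \<in> hom (ar Q xs x) (Fo xs x a) (Fo xs x b)"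
    if "f \<in> hom (ar P xs x) a b" for xs x f a b
    using groupoid_functor.map_hom[OF fct that] .
  have Arr: "Arr (ar Q xs x) = Fa xs x ` Arr (ar P xs x)" for xs x
  proof (intro equalityI subsetI)
    fix f assume f: "f \<in> Arr (ar Q xs x)"
    then obtain u v where u: "u \<in> Obj (ar P xs x)" "Fo xs x u = src (ar Q xs x) f"
      "v \<in> Obj (ar P xs x)" "Fo xs x v = tgt (ar Q xs x) f"
      using closed[OF f] unfolding obj[of xs x, symmetric] by auto
    then have "f \<in> hom (ar Q xs x) (Fo xs x u) (Fo xs x v)" using f by (simp add: hom_def)
    then show "f \<in> Fa xs x ` Arr (ar P xs x)"
      using full[OF u(1,3)] by (auto simp: hom_def)
  next
    fix f assume "f \<in> Fa xs x ` Arr (ar P xs x)"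
    then obtain g where "g \<in> Arr (ar P xs x)" "f = Fa xs x g" by auto
    then show "f \<in> Arr (ar Q xs x)" using F_hom[OF homI[OF _ refl refl]] by (auto dest: homD)
  qed
  have hob: "operad_hom (ob P) (ob Q) Fo"
    using obj oins oact one by (auto simp: operad_hom_def ob_def)
  have "oone P x \<in> Obj (ar P [x] x)" for x
    using symmetric_operad.one_closed[OF P.ob_operad, of x] by (simp add: ob_def)
  then have hmor: "operad_hom (mor P) (mor Q) Fa"
    using Arr ains aact idn one by (auto simp: operad_hom_def mor_def)
  show rel: "relative_groupoid_operad Q"
  proof (rule relative_groupoid_operad.intro)
    show "groupoid (ar Q xs x)" for xs x by (rule gQ)
    show "symmetric_operad (ob Q)"
      by (rule symmetric_operad_transfer[OF P.ob_operad hob]) (simp add: ob_def obj)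
    show "symmetric_operad (mor Q)"
      by (rule symmetric_operad_transfer[OF P.mor_operad hmor]) (simp add: mor_def Arr)
    show "groupoid_functor (prod_groupoid (ar Q xs x) (ar Q ys (xs ! i))) (ar Q (graft xs i ys) x)
        (\<lambda>(a, b). oins Q xs x i ys a b) (\<lambda>(f, g). ains Q xs x i ys f g)"
      if "i < length xs" for i xs ys x
      by (rule functor_transfer[OF full_onto_prod[OF onto onto] fct P.ins_functor[OF that]])
        (use that in \<open>auto simp: prod_groupoid_def oins ains\<close>)
    show "groupoid_functor (ar Q xs x) (ar Q (permute_list \<sigma> xs) x) (oact Q xs x \<sigma>) (aact Q xs x \<sigma>)"
      if "\<sigma> permutes {..<length xs}" for \<sigma> xs x
      by (rule functor_transfer[OF onto fct P.act_functor[OF that]]) (simp_all add: oact aact that)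
    show "Obj (ar Q xs Cl) = {}" if "Op \<in> set xs" for xs
      using P.relative[OF that] obj[of xs Cl] by simp
  qed
  show "operad_morphism P Q Fo Fa"
    using P.relative_groupoid_operad_axioms rel hob hmor fct by (simp add: operad_morphism_def)
qed

text \<open>The set-theoretic inverses on objects and on arrows commute with every operation that
  the given morphism commutes with, so they form a morphism in the other direction.\<close>

lemma operads_isomorphicI:
  assumes F: "operad_morphism P Q Fo Fa"
    and ob: "\<And>xs x. bij_betw (Fo xs x) (Obj (ar P xs x)) (Obj (ar Q xs x))"
    and ar: "\<And>xs x. bij_betw (Fa xs x) (Arr (ar P xs x)) (Arr (ar Q xs x))"
  shows "operads_isomorphic Q P"
proof -
  define Go where "Go xs x = the_inv_into (Obj (ar P xs x)) (Fo xs x)" for xs x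
  define Ga where "Ga xs x = the_inv_into (Arr (ar P xs x)) (Fa xs x)" for xs x
  interpret P: relative_groupoid_operad P using F by (simp add: operad_morphism_def)
  interpret Q: relative_groupoid_operad Q using F by (simp add: operad_morphism_def)
  interpret pob: symmetric_operad "ob P" by (rule P.ob_operad)
  interpret pmor: symmetric_operad "mor P" by (rule P.mor_operad)
  have hob: "operad_hom (ob P) (ob Q) Fo" and hmor: "operad_hom (mor P) (mor Q) Fa"
    and fct: "\<And>xs x. groupoid_functor (ar P xs x) (ar Q xs x) (Fo xs x) (Fa xs x)"
    using F by (auto simp: operad_morphism_def)
  have Go: "Go xs x (Fo xs x a) = a" if "a \<in> Obj (ar P xs x)" for xs x a
    using ob[of xs x] that by (simp add: Go_def bij_betw_def the_inv_into_f_f)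
  have Ga: "Ga xs x (Fa xs x a) = a" if "a \<in> Arr (ar P xs x)" for xs x a
    using ar[of xs x] that by (simp add: Ga_def bij_betw_def the_inv_into_f_f)
  have iob: "Obj (ar Q xs x) = Fo xs x ` Obj (ar P xs x)" for xs x
    using ob[of xs x] by (simp add: bij_betw_def)
  have iar: "Arr (ar Q xs x) = Fa xs x ` Arr (ar P xs x)" for xs x
    using ar[of xs x] by (simp add: bij_betw_def)
  \<comment> \<open>Stated for operads in sets, so that one argument serves both \<open>ob\<close>
    and \<open>mor\<close>.\<close>
  have inv_hom: "operad_hom P' Q' (\<lambda>xs x. G xs x)"
    if P': "symmetric_operad Q'" and h: "operad_hom Q' P' H"
      and G: "\<And>xs x a. a \<in> elems Q' xs x \<Longrightarrow> G xs x (H xs x a) = a"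
      and im: "\<And>xs x. elems P' xs x = H xs x ` elems Q' xs x"
    for P' :: "'e operad_data" and Q' :: "'f operad_data" and G H
  proof -
    interpret symmetric_operad Q' by fact
    show ?thesis unfolding operad_hom_def
    proof (intro conjI allI ballI impI)
      fix xs x a assume "a \<in> elems P' xs x"
      then show "G xs x a \<in> elems Q' xs x" by (auto simp: im G)
    next
      fix x
      have "H [x] x (one Q' x) = one P' x" using h by (simp add: operad_hom_def)
      then show "G [x] x (one P' x) = one Q' x" using G[OF one_closed[of x]] by metis
    next
      fix xs x i ys a b assume "a \<in> elems P' xs x" "b \<in> elems P' ys (xs ! i)" and i: "i < length xs"
      then obtain a' b' where a: "a' \<in> elems Q' xs x" "a = H xs x a'"
        and b: "b' \<in> elems Q' ys (xs ! i)" "b = H ys (xs ! i) b'" by (auto simp: im)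
      have "ins P' xs x i ys a b = H (graft xs i ys) x (ins Q' xs x i ys a' b')"
        using h a b i by (simp add: operad_hom_def)
      then show "G (graft xs i ys) x (ins P' xs x i ys a b) = ins Q' xs x i ys (G xs x a) (G ys (xs ! i) b)"
        using G ins_closed[OF a(1) i b(1)] a b by simp
    next
      fix xs x \<sigma> a assume "a \<in> elems P' xs x" and s: "\<sigma> permutes {..<length xs}"
      then obtain a' where a: "a' \<in> elems Q' xs x" "a = H xs x a'" by (auto simp: im)
      have "act P' xs x \<sigma> a = H (permute_list \<sigma> xs) x (act Q' xs x \<sigma> a')"
        using h a s by (simp add: operad_hom_def)
      then show "G (permute_list \<sigma> xs) x (act P' xs x \<sigma> a) = act Q' xs x \<sigma> (G xs x a)"
        using G act_closed[OF a(1) s] a by simp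
    qed
  qed
  have fct': "groupoid_functor (ar Q xs x) (ar P xs x) (Go xs x) (Ga xs x)" for xs x
  proof -
    interpret F: groupoid_functor "ar P xs x" "ar Q xs x" "Fo xs x" "Fa xs x" by (rule fct)
    have lift: "\<exists>f'. f' \<in> hom (ar P xs x) (Go xs x a) (Go xs x b) \<and> f = Fa xs x f'"
      if f: "f \<in> hom (ar Q xs x) a b" for f a b
    proof -
      obtain f' where f': "f' \<in> Arr (ar P xs x)" "f = Fa xs x f'"
        using f iar by (auto simp: hom_def)
      then have h: "f' \<in> hom (ar P xs x) (src (ar P xs x) f') (tgt (ar P xs x) f')" by (simp add: hom_def)
      have "a = Fo xs x (src (ar P xs x) f')" "b = Fo xs x (tgt (ar P xs x) f')"
        using F.map_hom[OF h] f' f by (auto simp: hom_def)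
      then show ?thesis using h f' Go F.A.src_closed F.A.tgt_closed by metis
    qed
    show ?thesis
    proof
      show "Go xs x a \<in> Obj (ar P xs x)" if "a \<in> Obj (ar Q xs x)" for a
        using that by (auto simp: iob Go)
      show "Ga xs x f \<in> hom (ar P xs x) (Go xs x a) (Go xs x b)" if "f \<in> hom (ar Q xs x) a b" for f a b
        using lift[OF that] Ga homD by metis
      show "Ga xs x (idn (ar Q xs x) a) = idn (ar P xs x) (Go xs x a)" if a: "a \<in> Obj (ar Q xs x)" for a
      proof -
        obtain u where u: "u \<in> Obj (ar P xs x)" "a = Fo xs x u" using a by (auto simp: iob)
        then show ?thesis using Ga F.map_idn[OF u(1)] Go F.A.idn_hom[OF u(1)] homD by metis
      qed
      show "Ga xs x (cmp (ar Q xs x) g f) = cmp (ar P xs x) (Ga xs x g) (Ga xs x f)"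
        if f: "f \<in> hom (ar Q xs x) a b" and g: "g \<in> hom (ar Q xs x) b c" for f g a b c
      proof -
        obtain f' g' where f': "f' \<in> hom (ar P xs x) (Go xs x a) (Go xs x b)" "f = Fa xs x f'"
          and g': "g' \<in> hom (ar P xs x) (Go xs x b) (Go xs x c)" "g = Fa xs x g'"
          using lift[OF f] lift[OF g] by blast
        show ?thesis using F.map_cmp[OF f'(1) g'(1)] Ga F.A.cmp_hom[OF f'(1) g'(1)] f' g' homD by metis
      qed
    qed
  qed
  have "operad_morphism Q P Go Ga"
    unfolding operad_morphism_def
  proof (intro conjI allI)
    show "operad_hom (ob Q) (ob P) Go"
      by (rule inv_hom[OF P.ob_operad hob]) (simp_all add: ob_def Go iob)
    show "operad_hom (mor Q) (mor P) Ga"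
      by (rule inv_hom[OF P.mor_operad hmor]) (simp_all add: mor_def Ga iar)
  qed (rule Q.relative_groupoid_operad_axioms P.relative_groupoid_operad_axioms fct')+
  then show ?thesis
    unfolding operads_isomorphic_def using F Go Ga iob iar
    by (intro exI[of _ Go] exI[of _ Ga] exI[of _ Fo] exI[of _ Fa]) auto
qed

text \<open>Closure is asked for objects only. All arrows between retained objects are kept, and
  functoriality of insertion and action computes the end points of the resulting arrows, so closure
  on arrows follows.\<close>

lemma full_suboperad:
  assumes P: "relative_groupoid_operad P"
    and one: "\<And>x. oone P x \<in> X [x] x"
    and ins: "\<And>xs x i ys a b. a \<in> Obj (ar P xs x) \<inter> X xs x \<Longrightarrow> i < length xs \<Longrightarrow>
      b \<in> Obj (ar P ys (xs ! i)) \<inter> X ys (xs ! i) \<Longrightarrow> oins P xs x i ys a b \<in> X (graft xs i ys) x"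
    and act: "\<And>xs x \<sigma> a. a \<in> Obj (ar P xs x) \<inter> X xs x \<Longrightarrow> \<sigma> permutes {..<length xs} \<Longrightarrow>
      oact P xs x \<sigma> a \<in> X (permute_list \<sigma> xs) x"
  shows "relative_groupoid_operad (full_suboperad P X)"
    "operad_morphism (full_suboperad P X) P (\<lambda>xs x a. a) (\<lambda>xs x f. f)"
proof -
  interpret P: relative_groupoid_operad P by fact
  interpret pob: symmetric_operad "ob P" by (rule P.ob_operad)
  interpret pmor: symmetric_operad "mor P" by (rule P.mor_operad)
  let ?S = "full_suboperad P X"
  have hom: "f \<in> hom (ar ?S xs x) a b \<longleftrightarrow> f \<in> hom (ar P xs x) a b \<and> a \<in> X xs x \<and> b \<in> X xs x"
    for f a b xs x by (auto simp: full_suboperad_def hom_def)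
  have Obj: "Obj (ar ?S xs x) = Obj (ar P xs x) \<inter> X xs x" for xs x
    by (auto simp: full_suboperad_def)
  have eqs: "src (ar ?S xs x) = src (ar P xs x)" "tgt (ar ?S xs x) = tgt (ar P xs x)"
    "idn (ar ?S xs x) = idn (ar P xs x)" "cmp (ar ?S xs x) = cmp (ar P xs x)" "oone ?S = oone P"
    "oins ?S = oins P" "oact ?S = oact P" "ains ?S = ains P" "aact ?S = aact P" for xs x
    by (simp_all add: full_suboperad_def)
  have Arr: "Arr (ar ?S xs x) = {f \<in> Arr (ar P xs x). src (ar P xs x) f \<in> X xs x \<and> tgt (ar P xs x) f \<in> X xs x}"
    for xs x by (simp add: full_suboperad_def)
  have G: "groupoid (ar ?S xs x)" for xs x
  proof -
    interpret G: groupoid "ar P xs x" by (rule P.arity_groupoid)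
    show ?thesis
    proof
      show "src (ar ?S xs x) f \<in> Obj (ar ?S xs x)" "tgt (ar ?S xs x) f \<in> Obj (ar ?S xs x)"
        if "f \<in> Arr (ar ?S xs x)" for f
        using that by (auto simp: Obj Arr eqs G.src_closed G.tgt_closed)
      show "idn (ar ?S xs x) a \<in> hom (ar ?S xs x) a a" if "a \<in> Obj (ar ?S xs x)" for a
        using that by (auto simp: Obj hom eqs G.idn_hom)
      show "\<exists>g\<in>hom (ar ?S xs x) b a. cmp (ar ?S xs x) g f = idn (ar ?S xs x) a \<and>
          cmp (ar ?S xs x) f g = idn (ar ?S xs x) b"
        if "f \<in> hom (ar ?S xs x) a b" for f a b
        using that G.inverse_ex[of f a b] by (auto simp: hom eqs)
    qed (auto simp: hom eqs G.cmp_hom G.cmp_assoc G.cmp_idn G.idn_cmp)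
  qed
  have fst: "f \<in> hom (ar P xs x) (src (ar P xs x) f) (tgt (ar P xs x) f)" if "f \<in> Arr (ar P xs x)" for f xs x
    using that by (simp add: hom_def)
  have ains: "ains P xs x i ys f g \<in> hom (ar ?S (graft xs i ys) x) (oins P xs x i ys a a') (oins P xs x i ys b b')"
    if i: "i < length xs" and f: "f \<in> hom (ar ?S xs x) a b" and g: "g \<in> hom (ar ?S ys (xs ! i)) a' b'"
    for xs x i ys f g a b a' b'
  proof -
    interpret I: groupoid_functor "prod_groupoid (ar P xs x) (ar P ys (xs ! i))" "ar P (graft xs i ys) x"
      "\<lambda>(a, b). oins P xs x i ys a b" "\<lambda>(f, g). ains P xs x i ys f g" by (rule P.ins_functor[OF i])
    interpret S1: groupoid "ar ?S xs x" by (rule G)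
    interpret S2: groupoid "ar ?S ys (xs ! i)" by (rule G)
    have "(f, g) \<in> hom (prod_groupoid (ar P xs x) (ar P ys (xs ! i))) (a, a') (b, b')"
      using f g by (simp add: hom_prod_groupoid hom)
    from I.map_hom[OF this] show ?thesis
      using ins[of a xs x i a' ys] ins[of b xs x i b' ys] i f g
        S1.src_closed[of f] S1.tgt_closed[of f] S2.src_closed[of g] S2.tgt_closed[of g]
      unfolding hom by (auto simp: hom_def Obj Arr eqs)
  qed
  have aact: "aact P xs x \<sigma> f \<in> hom (ar ?S (permute_list \<sigma> xs) x) (oact P xs x \<sigma> a) (oact P xs x \<sigma> b)"
    if s: "\<sigma> permutes {..<length xs}" and f: "f \<in> hom (ar ?S xs x) a b" for xs x \<sigma> f a b
  proof -
    interpret I: groupoid_functor "ar P xs x" "ar P (permute_list \<sigma> xs) x" "oact P xs x \<sigma>" "aact P xs x \<sigma>"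
      by (rule P.act_functor[OF s])
    interpret S1: groupoid "ar ?S xs x" by (rule G)
    show ?thesis
      using I.map_hom[of f a b] act[of a xs x \<sigma>] act[of b xs x \<sigma>] s f
        S1.src_closed[of f] S1.tgt_closed[of f]
      unfolding hom by (auto simp: hom_def Obj Arr eqs)
  qed
  show rel: "relative_groupoid_operad ?S"
  proof (rule relative_groupoid_operad.intro)
    show "groupoid (ar ?S xs x)" for xs x by (rule G)
    show "symmetric_operad (ob ?S)"
    proof
      show "one (ob ?S) x \<in> elems (ob ?S) [x] x" for x
        using one pob.one_closed by (simp add: ob_def Obj eqs)
      show "ins (ob ?S) xs x i ys a b \<in> elems (ob ?S) (graft xs i ys) x"
        if "a \<in> elems (ob ?S) xs x" "i < length xs" "b \<in> elems (ob ?S) ys (xs ! i)" for xs x i ys a b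
        using that ins pob.ins_closed[of a xs x i b ys] by (simp add: ob_def Obj eqs)
      show "act (ob ?S) xs x \<sigma> a \<in> elems (ob ?S) (permute_list \<sigma> xs) x"
        if "a \<in> elems (ob ?S) xs x" "\<sigma> permutes {..<length xs}" for xs x \<sigma> a
        using that act pob.act_closed[of a xs x \<sigma>] by (simp add: ob_def Obj eqs)
    qed (use pob.ins_one pob.one_ins pob.ins_sequential pob.ins_parallel pob.act_id pob.act_act pob.ins_act
        in \<open>auto simp: ob_def Obj eqs\<close>)
    show "symmetric_operad (mor ?S)"
    proof
      show "one (mor ?S) x \<in> elems (mor ?S) [x] x" for x
        using groupoid.idn_hom[OF G, of "oone P x" "[x]" x] one pob.one_closed
        by (auto simp: mor_def ob_def Obj eqs dest: homD)
      show "ins (mor ?S) xs x i ys a b \<in> elems (mor ?S) (graft xs i ys) x"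
        if "a \<in> elems (mor ?S) xs x" "i < length xs" "b \<in> elems (mor ?S) ys (xs ! i)" for xs x i ys a b
        using that ains[OF that(2) homI[OF _ refl refl] homI[OF _ refl refl], of a x b ys] by (auto simp: mor_def eqs dest: homD)
      show "act (mor ?S) xs x \<sigma> a \<in> elems (mor ?S) (permute_list \<sigma> xs) x"
        if "a \<in> elems (mor ?S) xs x" "\<sigma> permutes {..<length xs}" for xs x \<sigma> a
        using that aact[OF that(2) homI[OF _ refl refl], of a x] by (auto simp: mor_def eqs dest: homD)
    qed (use pmor.ins_one pmor.one_ins pmor.ins_sequential pmor.ins_parallel pmor.act_id pmor.act_act pmor.ins_act
        in \<open>auto simp: mor_def Arr eqs\<close>)
    show "groupoid_functor (prod_groupoid (ar ?S xs x) (ar ?S ys (xs ! i))) (ar ?S (graft xs i ys) x)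
        (\<lambda>(a, b). oins ?S xs x i ys a b) (\<lambda>(f, g). ains ?S xs x i ys f g)"
      if i: "i < length xs" for i xs ys x
    proof -
      interpret I: groupoid_functor "prod_groupoid (ar P xs x) (ar P ys (xs ! i))" "ar P (graft xs i ys) x"
        "\<lambda>(a, b). oins P xs x i ys a b" "\<lambda>(f, g). ains P xs x i ys f g" by (rule P.ins_functor[OF i])
      show ?thesis
      proof (intro groupoid_functor.intro groupoid_prod G groupoid_functor_axioms.intro)
        show "(case a of (a, b) \<Rightarrow> oins ?S xs x i ys a b) \<in> Obj (ar ?S (graft xs i ys) x)"
          if "a \<in> Obj (prod_groupoid (ar ?S xs x) (ar ?S ys (xs ! i)))" for a
          using that I.map_obj[of a] ins i by (cases a) (auto simp: prod_groupoid_def Obj eqs)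
        show "(case f of (f, g) \<Rightarrow> ains ?S xs x i ys f g) \<in> hom (ar ?S (graft xs i ys) x)
            (case a of (a, b) \<Rightarrow> oins ?S xs x i ys a b) (case b of (a, b) \<Rightarrow> oins ?S xs x i ys a b)"
          if "f \<in> hom (prod_groupoid (ar ?S xs x) (ar ?S ys (xs ! i))) a b" for f a b
          using that ains i by (cases f; cases a; cases b) (simp add: hom_prod_groupoid eqs)
        show "(case idn (prod_groupoid (ar ?S xs x) (ar ?S ys (xs ! i))) a of (f, g) \<Rightarrow> ains ?S xs x i ys f g) =
            idn (ar ?S (graft xs i ys) x) (case a of (a, b) \<Rightarrow> oins ?S xs x i ys a b)"
          if "a \<in> Obj (prod_groupoid (ar ?S xs x) (ar ?S ys (xs ! i)))" for a
          using that I.map_idn[of a] by (cases a) (auto simp: prod_groupoid_def Obj eqs)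
        show "(case cmp (prod_groupoid (ar ?S xs x) (ar ?S ys (xs ! i))) g f of (f, g) \<Rightarrow> ains ?S xs x i ys f g) =
            cmp (ar ?S (graft xs i ys) x) (case g of (f, g) \<Rightarrow> ains ?S xs x i ys f g)
              (case f of (f, g) \<Rightarrow> ains ?S xs x i ys f g)"
          if "f \<in> hom (prod_groupoid (ar ?S xs x) (ar ?S ys (xs ! i))) a b"
            "g \<in> hom (prod_groupoid (ar ?S xs x) (ar ?S ys (xs ! i))) b c" for f g a b c
        proof -
          have "f \<in> hom (prod_groupoid (ar P xs x) (ar P ys (xs ! i))) a b"
            "g \<in> hom (prod_groupoid (ar P xs x) (ar P ys (xs ! i))) b c"
            using that by (cases f; cases g; simp add: hom_prod_groupoid hom)+
          from I.map_cmp[OF this] show ?thesis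
            by (cases f; cases g) (simp add: prod_groupoid_def eqs)
        qed
      qed
    qed
    show "groupoid_functor (ar ?S xs x) (ar ?S (permute_list \<sigma> xs) x) (oact ?S xs x \<sigma>) (aact ?S xs x \<sigma>)"
      if s: "\<sigma> permutes {..<length xs}" for \<sigma> xs x
    proof -
      interpret I: groupoid_functor "ar P xs x" "ar P (permute_list \<sigma> xs) x" "oact P xs x \<sigma>" "aact P xs x \<sigma>"
        by (rule P.act_functor[OF s])
      show ?thesis
      proof (intro groupoid_functor.intro G groupoid_functor_axioms.intro)
        show "oact ?S xs x \<sigma> a \<in> Obj (ar ?S (permute_list \<sigma> xs) x)" if "a \<in> Obj (ar ?S xs x)" for a
          using that I.map_obj act s by (auto simp: Obj eqs)
      qed (use aact[OF s] I.map_idn I.map_cmp in \<open>auto simp: hom eqs Obj\<close>)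
    qed
    show "Obj (ar ?S xs Cl) = {}" if "Op \<in> set xs" for xs
      using P.relative[OF that] by (simp add: Obj)
  qed
  show "operad_morphism ?S P (\<lambda>xs x a. a) (\<lambda>xs x f. f)"
    unfolding operad_morphism_def
  proof (intro conjI allI)
    show "operad_hom (ob ?S) (ob P) (\<lambda>xs x a. a)" "operad_hom (mor ?S) (mor P) (\<lambda>xs x f. f)"
      by (auto simp: operad_hom_def ob_def mor_def Obj Arr eqs)
    show "groupoid_functor (ar ?S xs x) (ar P xs x) (\<lambda>a. a) (\<lambda>f. f)" for xs x
      by (intro groupoid_functor.intro G P.arity_groupoid groupoid_functor_axioms.intro)
        (auto simp: Obj hom eqs)
  qed (rule rel P)+
qed

text \<open>The inclusion is bijective on hom-sets by construction; what remains is an arrow from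
  some retained object to each object.\<close>

lemma full_suboperad_equivalence:
  assumes P: "relative_groupoid_operad P"
    and S: "operad_morphism (full_suboperad P X) P (\<lambda>xs x a. a) (\<lambda>xs x f. f)"
    and ess: "\<And>xs x b. b \<in> Obj (ar P xs x) \<Longrightarrow> \<exists>a\<in>Obj (ar P xs x) \<inter> X xs x. hom (ar P xs x) a b \<noteq> {}"
  shows "categorical_equivalence (full_suboperad P X) P (\<lambda>xs x a. a) (\<lambda>xs x f. f)"
  unfolding categorical_equivalence_def
proof (intro conjI allI S equivalence_of_groupoidsI)
  fix xs x
  show "groupoid_functor (ar (full_suboperad P X) xs x) (ar P xs x) (\<lambda>a. a) (\<lambda>f. f)"
    using S by (simp add: operad_morphism_def)
  show "bij_betw (\<lambda>f. f) (hom (ar (full_suboperad P X) xs x) a b) (hom (ar P xs x) a b)"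
    if "a \<in> Obj (ar (full_suboperad P X) xs x)" "b \<in> Obj (ar (full_suboperad P X) xs x)" for a b
    using that by (auto simp: full_suboperad_def hom_def intro!: bij_betw_imageI)
  show "\<exists>a\<in>Obj (ar (full_suboperad P X) xs x). hom (ar P xs x) a b \<noteq> {}" if "b \<in> Obj (ar P xs x)" for b
    using ess[OF that] by (auto simp: full_suboperad_def)
qed


section \<open>Homotopies of paths in topological spaces\<close>

definition path_in :: "'a::topological_space set \<Rightarrow> (real \<Rightarrow> 'a) \<Rightarrow> bool" where
  "path_in S p \<longleftrightarrow> path p \<and> path_image p \<subseteq> S"

lemma path_inD: "path_in S p \<Longrightarrow> t \<in> {0..1} \<Longrightarrow> p t \<in> S"
  and path_in_iff: "path_in S p \<longleftrightarrow> continuous_on {0..1} p \<and> (\<forall>t\<in>{0..1}. p t \<in> S)"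
  and path_in_homotopic: "path_in S p \<longleftrightarrow> homotopic_paths S p p"
  by (auto simp: path_in_def path_def path_image_def)

lemma path_in_ends: "path_in S p \<Longrightarrow> pathstart p \<in> S \<and> pathfinish p \<in> S"
  by (auto simp: path_in_iff pathstart_def pathfinish_def)

lemma homotopic_paths_path_in: "homotopic_paths S p q \<Longrightarrow> path_in S p \<and> path_in S q"
  by (metis path_in_def homotopic_paths_imp_path homotopic_paths_imp_subset)

lemma path_in_join:
  "path_in S p \<Longrightarrow> path_in S q \<Longrightarrow> pathfinish p = pathstart q \<Longrightarrow> path_in S (p +++ q)"
  by (simp add: path_in_def path_image_join)

lemma path_in_reverse: "path_in S p \<Longrightarrow> path_in S (reversepath p)"
  by (simp add: path_in_def)

lemma path_in_const: "a \<in> S \<Longrightarrow> path_in S (\<lambda>_. a)"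
  by (auto simp: path_in_iff)

lemma path_in_compose:
  "path_in S p \<Longrightarrow> continuous_on S f \<Longrightarrow> f ` S \<subseteq> T \<Longrightarrow> path_in T (f \<circ> p)"
  unfolding path_in_iff o_def by (auto intro: continuous_on_compose2)

text \<open>
  The group laws for homotopy classes in the library are restricted to normed spaces. In general they
  are images of statements about paths in a convex set of parameters.
\<close>

lemma homotopic_paths_convex_image:
  fixes f :: "'a::real_normed_vector \<Rightarrow> 'b::topological_space"
  assumes "convex K" "continuous_on K f" "f ` K \<subseteq> S"
    and "path_in K g" "path_in K h" "pathstart g = pathstart h" "pathfinish g = pathfinish h"
  shows "homotopic_paths S (f \<circ> g) (f \<circ> h)"
proof (rule homotopic_paths_continuous_image[OF homotopic_paths_linear])
  show "closed_segment (g t) (h t) \<subseteq> K" if "t \<in> {0..1}" for t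
    using assms that by (intro closed_segment_subset) (auto simp: path_in_iff)
qed (use assms in \<open>auto simp: path_in_def\<close>)

lemma path_in_linepath: "convex K \<Longrightarrow> a \<in> K \<Longrightarrow> b \<in> K \<Longrightarrow> path_in K (linepath a b)"
  by (simp add: path_in_def closed_segment_subset)

lemma homotopic_paths_const_right:
  assumes "path_in S p"
  shows "homotopic_paths S (p +++ (\<lambda>_. pathfinish p)) p"
proof -
  have "homotopic_paths S (p \<circ> (linepath 0 1 +++ linepath 1 1)) (p \<circ> linepath 0 1)"
    by (rule homotopic_paths_convex_image[where K = "{0..1}"])
      (use assms in \<open>auto simp: path_in_iff intro!: path_in_linepath path_in_join
        simp del: path_in_iff simp: path_in_iff[of S]\<close>)
  moreover have "p \<circ> linepath 0 1 = p" "p \<circ> linepath 1 1 = (\<lambda>_. pathfinish p)"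
    by (auto simp: linepath_def pathfinish_def)
  ultimately show ?thesis by (simp add: path_compose_join)
qed

lemma homotopic_paths_const_left:
  assumes "path_in S p"
  shows "homotopic_paths S ((\<lambda>_. pathstart p) +++ p) p"
proof -
  have "homotopic_paths S (p \<circ> (linepath 0 0 +++ linepath 0 1)) (p \<circ> linepath 0 1)"
    by (rule homotopic_paths_convex_image[where K = "{0..1}"])
      (use assms in \<open>auto simp: path_in_iff[of S] intro!: path_in_linepath path_in_join\<close>)
  moreover have "p \<circ> linepath 0 1 = p" "p \<circ> linepath 0 0 = (\<lambda>_. pathstart p)"
    by (auto simp: linepath_def pathstart_def)
  ultimately show ?thesis by (simp add: path_compose_join)
qed

lemma homotopic_paths_inverse_right:
  assumes "path_in S p"
  shows "homotopic_paths S (p +++ reversepath p) (\<lambda>_. pathstart p)"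
proof -
  have "homotopic_paths S (p \<circ> (linepath 0 1 +++ linepath 1 0)) (p \<circ> linepath 0 0)"
    by (rule homotopic_paths_convex_image[where K = "{0..1}"])
      (use assms in \<open>auto simp: path_in_iff[of S] intro!: path_in_linepath path_in_join\<close>)
  moreover have "p \<circ> linepath 0 1 = p" "p \<circ> linepath 0 0 = (\<lambda>_. pathstart p)"
      "p \<circ> linepath 1 0 = reversepath p"
    by (auto simp: linepath_def pathstart_def reversepath_def)
  ultimately show ?thesis by (simp add: path_compose_join)
qed

lemma homotopic_paths_inverse_left:
  assumes "path_in S p"
  shows "homotopic_paths S (reversepath p +++ p) (\<lambda>_. pathfinish p)"
  using homotopic_paths_inverse_right[OF path_in_reverse[OF assms]] by simp

text \<open>The two ways around the boundary of the square from \<open>(0, 0)\<close> to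
  \<open>(1, 1)\<close> are homotopic inside the convex square, and \<open>h\<close> carries this
  homotopy to \<open>S\<close>.\<close>

lemma homotopic_paths_square:
  fixes h :: "real \<times> real \<Rightarrow> 'b::topological_space"
  assumes "continuous_on ({0..1} \<times> {0..1}) h" "h ` ({0..1} \<times> {0..1}) \<subseteq> S"
  shows "homotopic_paths S ((\<lambda>t. h (0, t)) +++ (\<lambda>s. h (s, 1))) ((\<lambda>s. h (s, 0)) +++ (\<lambda>t. h (1, t)))"
proof -
  have "homotopic_paths S (h \<circ> (linepath (0, 0) (0, 1) +++ linepath (0, 1) (1, 1)))
      (h \<circ> (linepath (0, 0) (1, 0) +++ linepath (1, 0) (1, 1)))"
    by (rule homotopic_paths_convex_image[OF _ assms])
      (auto intro!: path_in_linepath path_in_join convex_Times)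
  moreover have "h \<circ> linepath (0, 0) (0, 1) = (\<lambda>t. h (0, t))" "h \<circ> linepath (0, 1) (1, 1) = (\<lambda>s. h (s, 1))"
     "h \<circ> linepath (0, 0) (1, 0) = (\<lambda>s. h (s, 0))" "h \<circ> linepath (1, 0) (1, 1) = (\<lambda>t. h (1, t))"
    by (auto simp: linepath_def)
  ultimately show ?thesis by (simp add: path_compose_join)
qed

text \<open>Appending \<open>reversepath g\<close> contracts the common tail. In
  \<open>centers_faithful\<close> the tail is a thickening path.\<close>

lemma homotopic_paths_cancel_right:
  assumes h: "homotopic_paths S (p +++ g) (q +++ g)"
    and p: "path_in S p" "path_in S q" "path_in S g" "pathfinish p = pathstart g" "pathfinish q = pathstart g"
  shows "homotopic_paths S p q"
proof -
  note r = path_in_reverse[OF p(3)]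
  have *: "homotopic_paths S ((p +++ g) +++ reversepath g) p"
    if "path_in S p" "pathfinish p = pathstart g" for p
  proof -
    have "homotopic_paths S ((p +++ g) +++ reversepath g) (p +++ (g +++ reversepath g))"
      by (rule homotopic_paths_sym[OF homotopic_paths_assoc]) (use that p(3) r in \<open>auto simp: path_in_def\<close>)
    also have "homotopic_paths S \<dots> (p +++ (\<lambda>_. pathfinish p))"
      using homotopic_paths_inverse_right[OF p(3)] that
      by (intro homotopic_paths_join) (auto simp: path_in_homotopic)
    also have "homotopic_paths S \<dots> p"
      by (rule homotopic_paths_const_right) (rule that)
    finally show ?thesis .
  qed
  have "homotopic_paths S ((p +++ g) +++ reversepath g) ((q +++ g) +++ reversepath g)"
    using r p by (intro homotopic_paths_join h) (simp_all add: path_in_homotopic)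
  then show ?thesis
    using homotopic_paths_trans[OF homotopic_paths_sym[OF *[OF p(1) p(4)]]
        homotopic_paths_trans[OF _ *[OF p(2) p(5)]]] by blast
qed


section \<open>The fundamental groupoid of a topological operad\<close>

definition path_class :: "'p::topological_space set \<Rightarrow> (real \<Rightarrow> 'p) \<Rightarrow> 'p \<times> (real \<Rightarrow> 'p) set \<times> 'p" where
  "path_class S p = (pathstart p, {q. homotopic_paths S p q}, pathfinish p)"

lemma path_class_eqI: "homotopic_paths S p q \<Longrightarrow> path_class S p = path_class S q"
  unfolding path_class_def
  by (auto dest: homotopic_paths_imp_pathstart homotopic_paths_imp_pathfinish homotopic_paths_sym
      intro: homotopic_paths_trans)

text \<open>Paths are total functions on the reals, but the operad laws are available for their
  values on \<open>{0..1}\<close> only. The laws for arrows are therefore obtained as equalities of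
  classes, through this lemma.\<close>

lemma path_class_cong:
  "path_in S p \<Longrightarrow> (\<And>t. t \<in> {0..1} \<Longrightarrow> p t = q t) \<Longrightarrow> path_class S p = path_class S q"
  by (intro path_class_eqI homotopic_paths_eq) (auto simp: path_in_def)

lemma Arr_fundamental_groupoid: "Arr (fundamental_groupoid S) = path_class S ` Collect (path_in S)"
proof -
  have "Arr (fundamental_groupoid S) = {(a, {q. homotopic_paths S p q}, b) | a b p.
      a \<in> S \<and> b \<in> S \<and> path_in S p \<and> a = pathstart p \<and> b = pathfinish p}"
    unfolding fundamental_groupoid_def path_groupoid_def path_in_homotopic by auto
  also have "\<dots> = path_class S ` Collect (path_in S)"
    unfolding path_class_def by (auto dest: path_in_ends)
  finally show ?thesis .
qed

lemma hom_fundamental_groupoid: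
  "hom (fundamental_groupoid S) a b =
    path_class S ` {p. path_in S p \<and> pathstart p = a \<and> pathfinish p = b}"
  unfolding hom_def Arr_fundamental_groupoid
  by (auto simp: fundamental_groupoid_def path_groupoid_def path_class_def)

lemma src_fundamental_groupoid [simp]: "src (fundamental_groupoid S) (path_class S p) = pathstart p"
  and tgt_fundamental_groupoid [simp]: "tgt (fundamental_groupoid S) (path_class S p) = pathfinish p"
  and Obj_fundamental_groupoid [simp]: "Obj (fundamental_groupoid S) = S"
  by (simp_all add: fundamental_groupoid_def path_groupoid_def path_class_def)

lemma idn_fundamental_groupoid: "idn (fundamental_groupoid S) a = path_class S (\<lambda>_. a)"
  by (simp add: fundamental_groupoid_def path_groupoid_def path_class_def pathstart_def pathfinish_def)

text \<open>\<open>path_groupoid\<close> composes all representatives with matching ends; as the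
  join respects homotopy, every such pair gives the class of the chosen one.\<close>

lemma cmp_fundamental_groupoid:
  assumes "path_in S p" "path_in S q" "pathfinish p = pathstart q"
  shows "cmp (fundamental_groupoid S) (path_class S q) (path_class S p) = path_class S (p +++ q)"
proof -
  have "homotopic_paths S (p +++ q) h \<longleftrightarrow> (\<exists>p'\<in>{p'. homotopic_paths S p p'}. \<exists>q'\<in>{q'. homotopic_paths S q q'}.
      pathfinish p' = pathstart q' \<and> homotopic_paths S (p' +++ q') h)" for h
  proof
    assume "homotopic_paths S (p +++ q) h"
    then show "\<exists>p'\<in>{p'. homotopic_paths S p p'}. \<exists>q'\<in>{q'. homotopic_paths S q q'}.
      pathfinish p' = pathstart q' \<and> homotopic_paths S (p' +++ q') h"
      using assms by (intro bexI[of _ p] bexI[of _ q]) (auto simp: path_in_homotopic)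
  next
    assume "\<exists>p'\<in>{p'. homotopic_paths S p p'}. \<exists>q'\<in>{q'. homotopic_paths S q q'}.
      pathfinish p' = pathstart q' \<and> homotopic_paths S (p' +++ q') h"
    then show "homotopic_paths S (p +++ q) h"
      using assms(3) by (auto intro: homotopic_paths_trans homotopic_paths_join)
  qed
  then show ?thesis
    by (simp add: fundamental_groupoid_def path_groupoid_def path_class_def)
qed

lemma groupoid_fundamental_groupoid: "groupoid (fundamental_groupoid S)"
proof
  show "src (fundamental_groupoid S) f \<in> Obj (fundamental_groupoid S)"
    "tgt (fundamental_groupoid S) f \<in> Obj (fundamental_groupoid S)"
    if "f \<in> Arr (fundamental_groupoid S)" for f
    using that by (auto simp: Arr_fundamental_groupoid path_in_ends)
  show "idn (fundamental_groupoid S) a \<in> hom (fundamental_groupoid S) a a"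
    if "a \<in> Obj (fundamental_groupoid S)" for a
    using that path_in_const[of a S]
    by (auto simp: idn_fundamental_groupoid hom_fundamental_groupoid pathstart_def pathfinish_def)
  show "cmp (fundamental_groupoid S) g f \<in> hom (fundamental_groupoid S) a c"
    if "f \<in> hom (fundamental_groupoid S) a b" "g \<in> hom (fundamental_groupoid S) b c" for f g a b c
    using that by (auto simp: hom_fundamental_groupoid cmp_fundamental_groupoid path_in_join intro!: imageI)
  show "cmp (fundamental_groupoid S) h (cmp (fundamental_groupoid S) g f) =
      cmp (fundamental_groupoid S) (cmp (fundamental_groupoid S) h g) f"
    if "f \<in> hom (fundamental_groupoid S) a b" "g \<in> hom (fundamental_groupoid S) b c"
      "h \<in> hom (fundamental_groupoid S) c d" for f g h a b c d
  proof -
    note fgh = that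
    obtain p q r where p: "f = path_class S p" "path_in S p" and q: "g = path_class S q" "path_in S q"
      and r: "h = path_class S r" "path_in S r" and e: "pathfinish p = pathstart q" "pathfinish q = pathstart r"
      using fgh by (auto simp: hom_fundamental_groupoid)
    have "homotopic_paths S ((p +++ q) +++ r) (p +++ (q +++ r))"
      using p q r e by (intro homotopic_paths_sym[OF homotopic_paths_assoc]) (auto simp: path_in_def)
    then show ?thesis
      using p q r e by (simp add: cmp_fundamental_groupoid path_in_join path_class_eqI)
  qed
  show "cmp (fundamental_groupoid S) f (idn (fundamental_groupoid S) a) = f"
    "cmp (fundamental_groupoid S) (idn (fundamental_groupoid S) b) f = f"
    "\<exists>g\<in>hom (fundamental_groupoid S) b a.
      cmp (fundamental_groupoid S) g f = idn (fundamental_groupoid S) a \<and>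
      cmp (fundamental_groupoid S) f g = idn (fundamental_groupoid S) b"
    if f: "f \<in> hom (fundamental_groupoid S) a b" for f a b
  proof -
    obtain p where p: "f = path_class S p" "path_in S p" "pathstart p = a" "pathfinish p = b"
      using f by (auto simp: hom_fundamental_groupoid)
    have c: "path_in S (\<lambda>_. a)" "path_in S (\<lambda>_. b)" using path_in_ends[OF p(2)] p path_in_const by auto
    have e: "pathstart (\<lambda>_. x) = x" "pathfinish (\<lambda>_. x) = x" for x :: 'a
      by (auto simp: pathstart_def pathfinish_def)
    show "cmp (fundamental_groupoid S) f (idn (fundamental_groupoid S) a) = f"
      "cmp (fundamental_groupoid S) (idn (fundamental_groupoid S) b) f = f"
      using p c homotopic_paths_const_left[OF p(2)] homotopic_paths_const_right[OF p(2)]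
      by (simp_all add: idn_fundamental_groupoid cmp_fundamental_groupoid e path_class_eqI)
    show "\<exists>g\<in>hom (fundamental_groupoid S) b a.
      cmp (fundamental_groupoid S) g f = idn (fundamental_groupoid S) a \<and>
      cmp (fundamental_groupoid S) f g = idn (fundamental_groupoid S) b"
      using p path_in_reverse[OF p(2)] homotopic_paths_inverse_left[OF p(2)] homotopic_paths_inverse_right[OF p(2)]
      by (intro bexI[of _ "path_class S (reversepath p)"])
        (auto simp: idn_fundamental_groupoid cmp_fundamental_groupoid hom_fundamental_groupoid intro: path_class_eqI)
  qed
qed

text \<open>All components are subspaces of one space. Continuity on each of them is what turns
  pointwise insertion and relabeling of paths into operations on homotopy classes.\<close>

locale topological_operad = symmetric_operad P
  for P :: "'p::topological_space operad_data" +
  assumes continuous_ins: "i < length xs \<Longrightarrow>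
      continuous_on (elems P xs x \<times> elems P ys (xs ! i)) (\<lambda>(a, b). ins P xs x i ys a b)"
    and continuous_act: "\<sigma> permutes {..<length xs} \<Longrightarrow> continuous_on (elems P xs x) (act P xs x \<sigma>)"
    and relative: "Op \<in> set xs \<Longrightarrow> elems P xs Cl = {}"
begin

abbreviation "\<pi> \<equiv> fundamental_groupoid_operad P"

lemma path_in_ins:
  assumes i: "i < length xs" and p: "path_in (elems P xs x) p" and q: "path_in (elems P ys (xs ! i)) q"
  shows "path_in (elems P (graft xs i ys) x) (\<lambda>t. ins P xs x i ys (p t) (q t))"
proof -
  have "continuous_on {0..1} (\<lambda>t. case (p t, q t) of (a, b) \<Rightarrow> ins P xs x i ys a b)"
    using p q by (intro continuous_on_compose2[OF continuous_ins[OF i]] continuous_on_Pair)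
      (auto simp: path_in_iff)
  then show ?thesis
    using p q i by (auto simp: path_in_iff intro: ins_closed)
qed

text \<open>Inserting the two homotopies into each other at equal times gives a homotopy, whose ends
  are fixed because theirs are.\<close>

lemma homotopic_paths_ins:
  assumes i: "i < length xs" and p: "homotopic_paths (elems P xs x) p p'"
    and q: "homotopic_paths (elems P ys (xs ! i)) q q'"
  shows "homotopic_paths (elems P (graft xs i ys) x) (\<lambda>t. ins P xs x i ys (p t) (q t))
    (\<lambda>t. ins P xs x i ys (p' t) (q' t))"
proof -
  obtain h where h: "continuous_on ({0..1} \<times> {0..1}) h" "h \<in> {0..1} \<times> {0..1} \<rightarrow> elems P xs x"
    "\<forall>t\<in>{0..1}. h (0, t) = p t" "\<forall>t\<in>{0..1}. h (1, t) = p' t"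
    "\<forall>t\<in>{0..1::real}. pathstart (h \<circ> Pair t) = pathstart p \<and> pathfinish (h \<circ> Pair t) = pathfinish p"
    using p unfolding homotopic_paths by blast
  obtain k where k: "continuous_on ({0..1} \<times> {0..1}) k" "k \<in> {0..1} \<times> {0..1} \<rightarrow> elems P ys (xs ! i)"
    "\<forall>t\<in>{0..1}. k (0, t) = q t" "\<forall>t\<in>{0..1}. k (1, t) = q' t"
    "\<forall>t\<in>{0..1::real}. pathstart (k \<circ> Pair t) = pathstart q \<and> pathfinish (k \<circ> Pair t) = pathfinish q"
    using q unfolding homotopic_paths by blast
  have "continuous_on ({0..1} \<times> {0..1}) (\<lambda>y. case (h y, k y) of (a, b) \<Rightarrow> ins P xs x i ys a b)"
    using h k by (intro continuous_on_compose2[OF continuous_ins[OF i]] continuous_on_Pair) auto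
  moreover have "(\<lambda>y. ins P xs x i ys (h y) (k y)) \<in> {0..1} \<times> {0..1} \<rightarrow> elems P (graft xs i ys) x"
    using h(2) k(2) i by (auto simp: Pi_iff intro: ins_closed)
  ultimately show ?thesis
    unfolding homotopic_paths using h(3-5) k(3-5)
    by (intro exI[of _ "\<lambda>y. ins P xs x i ys (h y) (k y)"]) (auto simp: pathstart_def pathfinish_def)
qed

lemma path_in_act:
  assumes s: "\<sigma> permutes {..<length xs}" and p: "path_in (elems P xs x) p"
  shows "path_in (elems P (permute_list \<sigma> xs) x) (\<lambda>t. act P xs x \<sigma> (p t))"
  using path_in_compose[OF p continuous_act[OF s], of "elems P (permute_list \<sigma> xs) x"] act_closed s
  by (force simp: o_def)

lemma homotopic_paths_act:
  assumes s: "\<sigma> permutes {..<length xs}" and p: "homotopic_paths (elems P xs x) p p'"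
  shows "homotopic_paths (elems P (permute_list \<sigma> xs) x) (\<lambda>t. act P xs x \<sigma> (p t)) (\<lambda>t. act P xs x \<sigma> (p' t))"
  using homotopic_paths_continuous_image[OF p continuous_act[OF s]] act_closed s by (auto simp: o_def)

lemma ains_path_class:
  assumes i: "i < length xs" and p: "path_in (elems P xs x) p" and q: "path_in (elems P ys (xs ! i)) q"
  shows "ains \<pi> xs x i ys (path_class (elems P xs x) p) (path_class (elems P ys (xs ! i)) q)
    = path_class (elems P (graft xs i ys) x) (\<lambda>t. ins P xs x i ys (p t) (q t))"
proof -
  let ?S = "elems P (graft xs i ys) x"
  have "{h. \<exists>p'\<in>{p'. homotopic_paths (elems P xs x) p p'}. \<exists>q'\<in>{q'. homotopic_paths (elems P ys (xs ! i)) q q'}.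
      homotopic_paths ?S (\<lambda>t. ins P xs x i ys (p' t) (q' t)) h}
    = {h. homotopic_paths ?S (\<lambda>t. ins P xs x i ys (p t) (q t)) h}" (is "?L = ?R")
  proof
    show "?L \<subseteq> ?R" by (auto intro: homotopic_paths_trans[OF homotopic_paths_ins[OF i]])
    show "?R \<subseteq> ?L" using p q unfolding path_in_homotopic by blast
  qed
  then show ?thesis
    by (simp add: fundamental_groupoid_operad_def path_class_def pathstart_def pathfinish_def)
qed

lemma aact_path_class:
  assumes s: "\<sigma> permutes {..<length xs}" and p: "path_in (elems P xs x) p"
  shows "aact \<pi> xs x \<sigma> (path_class (elems P xs x) p)
    = path_class (elems P (permute_list \<sigma> xs) x) (\<lambda>t. act P xs x \<sigma> (p t))"
proof -
  let ?S = "elems P (permute_list \<sigma> xs) x"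
  have "{h. \<exists>p'\<in>{p'. homotopic_paths (elems P xs x) p p'}. homotopic_paths ?S (\<lambda>t. act P xs x \<sigma> (p' t)) h}
    = {h. homotopic_paths ?S (\<lambda>t. act P xs x \<sigma> (p t)) h}" (is "?L = ?R")
  proof
    show "?L \<subseteq> ?R" by (auto intro: homotopic_paths_trans[OF homotopic_paths_act[OF s]])
    show "?R \<subseteq> ?L" using p unfolding path_in_homotopic by blast
  qed
  then show ?thesis
    by (simp add: fundamental_groupoid_operad_def path_class_def pathstart_def pathfinish_def)
qed

lemma ar_pi [simp]: "ar \<pi> xs x = fundamental_groupoid (elems P xs x)"
  and oone_pi [simp]: "oone \<pi> = one P" and oins_pi [simp]: "oins \<pi> = ins P"
  and oact_pi [simp]: "oact \<pi> = act P"
  by (simp_all add: fundamental_groupoid_operad_def)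

lemma one_mor: "one (mor \<pi>) x = path_class (elems P [x] x) (\<lambda>_. one P x)"
  by (simp add: mor_def idn_fundamental_groupoid)

lemma elems_mor: "elems (mor \<pi>) xs x = path_class (elems P xs x) ` Collect (path_in (elems P xs x))"
  by (simp add: mor_def Arr_fundamental_groupoid)

lemma path_in_one: "path_in (elems P [x] x) (\<lambda>_. one P x)"
  by (rule path_in_const[OF one_closed])

text \<open>Representing paths satisfy each axiom at every time, since it holds in \<open>P\<close>;
  the classes then agree.\<close>

lemma symmetric_operad_mor: "symmetric_operad (mor \<pi>)"
proof
  have ins: "ins (mor \<pi>) = ains \<pi>" and act: "act (mor \<pi>) = aact \<pi>" by (simp_all add: mor_def)
  fix xs ys zs :: "color list" and x y :: color and i j k :: nat and \<sigma> \<tau> :: "nat \<Rightarrow> nat" and a b c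
  show "one (mor \<pi>) x \<in> elems (mor \<pi>) [x] x"
    using path_in_one by (auto simp: one_mor elems_mor)
  show "ins (mor \<pi>) xs x i ys a b \<in> elems (mor \<pi>) (graft xs i ys) x"
    if "a \<in> elems (mor \<pi>) xs x" "i < length xs" "b \<in> elems (mor \<pi>) ys (xs ! i)"
    using that by (auto simp: elems_mor ins ains_path_class path_in_ins)
  show "act (mor \<pi>) xs x \<sigma> a \<in> elems (mor \<pi>) (permute_list \<sigma> xs) x"
    if "a \<in> elems (mor \<pi>) xs x" "\<sigma> permutes {..<length xs}"
    using that by (auto simp: elems_mor act aact_path_class path_in_act)
  show "ins (mor \<pi>) xs x i [xs ! i] a (one (mor \<pi>) (xs ! i)) = a"
    if a: "a \<in> elems (mor \<pi>) xs x" and i: "i < length xs"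
  proof -
    obtain p where p: "path_in (elems P xs x) p" "a = path_class (elems P xs x) p"
      using a by (auto simp: elems_mor)
    have "graft xs i [xs ! i] = xs" using id_take_nth_drop[OF i] by (simp add: graft_def)
    then show ?thesis
      using p i path_in_ins[OF i p(1) path_in_one]
      by (auto simp: one_mor ins ains_path_class[OF i p(1) path_in_one] ins_one path_inD
          intro!: path_class_cong)
  qed
  show "ins (mor \<pi>) [x] x 0 xs (one (mor \<pi>) x) a = a" if a: "a \<in> elems (mor \<pi>) xs x"
  proof -
    obtain p where p: "path_in (elems P xs x) p" "a = path_class (elems P xs x) p"
      using a by (auto simp: elems_mor)
    have p': "path_in (elems P xs ([x] ! 0)) p" using p by simp
    have "graft [x] 0 xs = xs" by (simp add: graft_def)
    then show ?thesis
      using p path_in_ins[OF _ path_in_one p'] ains_path_class[OF _ path_in_one p']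
      by (auto simp: one_mor ins one_ins path_inD intro!: path_class_cong)
  qed
  show "ins (mor \<pi>) (graft xs i ys) x (i + j) zs (ins (mor \<pi>) xs x i ys a b) c
      = ins (mor \<pi>) xs x i (graft ys j zs) a (ins (mor \<pi>) ys (xs ! i) j zs b c)"
    if a: "a \<in> elems (mor \<pi>) xs x" and i: "i < length xs" and b: "b \<in> elems (mor \<pi>) ys (xs ! i)"
      and j: "j < length ys" and c: "c \<in> elems (mor \<pi>) zs (ys ! j)"
  proof -
    obtain p where p: "path_in (elems P xs x) p" "a = path_class (elems P xs x) p"
      using a by (auto simp: elems_mor)
    obtain q where q: "path_in (elems P ys (xs ! i)) q" "b = path_class (elems P ys (xs ! i)) q"
      using b by (auto simp: elems_mor)
    obtain r where r: "path_in (elems P zs (ys ! j)) r" "c = path_class (elems P zs (ys ! j)) r"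
      using c by (auto simp: elems_mor)
    have n: "graft xs i ys ! (i + j) = ys ! j" "i + j < length (graft xs i ys)"
      using i j by (simp_all add: nth_graft length_graft splice_def)
    then have r': "path_in (elems P zs (graft xs i ys ! (i + j))) r" using r by simp
    note L = path_in_ins[OF n(2) path_in_ins[OF i p(1) q(1)] r']
      ains_path_class[OF n(2) path_in_ins[OF i p(1) q(1)] r']
    note R = ains_path_class[OF i p(1) path_in_ins[OF j q(1) r(1)]]
    show ?thesis
      using p q r L(2) R
      by (auto simp: ins ains_path_class[OF i p(1) q(1)] ains_path_class[OF j q(1) r(1)] n(1)
          graft_sequential[OF i j] ins_sequential[OF path_inD[OF p(1)] i path_inD[OF q(1)] j path_inD[OF r(1)]]
          intro!: path_class_cong L(1)[unfolded graft_sequential[OF i j]])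
  qed
  show "ins (mor \<pi>) (graft xs i ys) x (k + length ys - 1) zs (ins (mor \<pi>) xs x i ys a b) c
      = ins (mor \<pi>) (graft xs k zs) x i ys (ins (mor \<pi>) xs x k zs a c) b"
    if a: "a \<in> elems (mor \<pi>) xs x" and ik: "i < k" and k: "k < length xs"
      and b: "b \<in> elems (mor \<pi>) ys (xs ! i)" and c: "c \<in> elems (mor \<pi>) zs (xs ! k)"
  proof -
    have i: "i < length xs" using ik k by simp
    obtain p where p: "path_in (elems P xs x) p" "a = path_class (elems P xs x) p"
      using a by (auto simp: elems_mor)
    obtain q where q: "path_in (elems P ys (xs ! i)) q" "b = path_class (elems P ys (xs ! i)) q"
      using b by (auto simp: elems_mor)
    obtain r where r: "path_in (elems P zs (xs ! k)) r" "c = path_class (elems P zs (xs ! k)) r"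
      using c by (auto simp: elems_mor)
    let ?k = "k + length ys - 1"
    have n: "graft xs i ys ! ?k = xs ! k" "?k < length (graft xs i ys)"
      "graft xs k zs ! i = xs ! i" "i < length (graft xs k zs)"
      using i k ik by (auto simp: nth_graft length_graft splice_def)
    have r': "path_in (elems P zs (graft xs i ys ! ?k)) r" unfolding n(1) by (rule r)
    have q': "path_in (elems P ys (graft xs k zs ! i)) q" unfolding n(3) by (rule q)
    note L = path_in_ins[OF n(2) path_in_ins[OF i p(1) q(1)] r']
      ains_path_class[OF n(2) path_in_ins[OF i p(1) q(1)] r', unfolded n(1)]
    note R = ains_path_class[OF n(4) path_in_ins[OF k p(1) r(1)] q', unfolded n(3)]
    have "path_class (elems P (graft (graft xs i ys) ?k zs) x)
        (\<lambda>t. ins P (graft xs i ys) x ?k zs (ins P xs x i ys (p t) (q t)) (r t))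
      = path_class (elems P (graft (graft xs k zs) i ys) x)
        (\<lambda>t. ins P (graft xs k zs) x i ys (ins P xs x k zs (p t) (r t)) (q t))"
      unfolding graft_parallel[OF ik k]
      by (rule path_class_cong[OF L(1)[unfolded graft_parallel[OF ik k]]])
        (rule ins_parallel[OF path_inD[OF p(1)] ik k path_inD[OF q(1)] path_inD[OF r(1)]])
    then show ?thesis
      unfolding ins p(2) q(2) r(2) ains_path_class[OF i p(1) q(1)] ains_path_class[OF k p(1) r(1)] L(2) R .
  qed
  show "act (mor \<pi>) xs x id a = a" if a: "a \<in> elems (mor \<pi>) xs x"
  proof -
    obtain p where p: "path_in (elems P xs x) p" "a = path_class (elems P xs x) p"
      using a by (auto simp: elems_mor)
    show ?thesis
      using p path_in_act[OF permutes_id p(1)]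
      by (auto simp: act aact_path_class[OF permutes_id p(1)] act_id path_inD intro!: path_class_cong)
  qed
  show "act (mor \<pi>) (permute_list \<sigma> xs) x \<tau> (act (mor \<pi>) xs x \<sigma> a) = act (mor \<pi>) xs x (\<sigma> \<circ> \<tau>) a"
    if a: "a \<in> elems (mor \<pi>) xs x" and s: "\<sigma> permutes {..<length xs}" and t: "\<tau> permutes {..<length xs}"
  proof -
    obtain p where p: "path_in (elems P xs x) p" "a = path_class (elems P xs x) p"
      using a by (auto simp: elems_mor)
    have t': "\<tau> permutes {..<length (permute_list \<sigma> xs)}" using t by simp
    note pl = permute_list_compose[OF t, of \<sigma>]
    show ?thesis
      unfolding act p(2) aact_path_class[OF s p(1)] aact_path_class[OF t' path_in_act[OF s p(1)]]
        aact_path_class[OF permutes_compose[OF t s] p(1)] pl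
      by (rule path_class_cong[OF path_in_act[OF t' path_in_act[OF s p(1)]]])
        (rule act_act[OF path_inD[OF p(1)] s t])
  qed
  show "ins (mor \<pi>) (permute_list \<sigma> xs) x i (permute_list \<tau> ys)
        (act (mor \<pi>) xs x \<sigma> a) (act (mor \<pi>) ys (xs ! \<sigma> i) \<tau> b)
      = act (mor \<pi>) (graft xs (\<sigma> i) ys) x (block_perm i (length ys) \<sigma> \<tau>) (ins (mor \<pi>) xs x (\<sigma> i) ys a b)"
    if a: "a \<in> elems (mor \<pi>) xs x" and s: "\<sigma> permutes {..<length xs}" and i: "i < length xs"
      and b: "b \<in> elems (mor \<pi>) ys (xs ! \<sigma> i)" and t: "\<tau> permutes {..<length ys}"
  proof -
    obtain p where p: "path_in (elems P xs x) p" "a = path_class (elems P xs x) p"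
      using a by (auto simp: elems_mor)
    obtain q where q: "path_in (elems P ys (xs ! \<sigma> i)) q" "b = path_class (elems P ys (xs ! \<sigma> i)) q"
      using b by (auto simp: elems_mor)
    have si: "\<sigma> i < length xs" using permutes_in_image[OF s] i by auto
    have n: "permute_list \<sigma> xs ! i = xs ! \<sigma> i" using s i by (simp add: permute_list_nth)
    have i': "i < length (permute_list \<sigma> xs)" using i by simp
    have bp: "block_perm i (length ys) \<sigma> \<tau> permutes {..<length (graft xs (\<sigma> i) ys)}"
      using block_perm_permutes[OF s t i] si by (simp add: length_graft)
    note pl = permute_list_graft[OF s t i]
    note q' = path_in_act[OF t q(1)]
    have q'': "path_in (elems P (permute_list \<tau> ys) (permute_list \<sigma> xs ! i)) (\<lambda>u. act P ys (xs ! \<sigma> i) \<tau> (q u))"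
      unfolding n by (rule q')
    note L = ains_path_class[OF i' path_in_act[OF s p(1)] q'', unfolded n]
    show ?thesis
      unfolding act ins p(2) q(2) aact_path_class[OF s p(1)] aact_path_class[OF t q(1)]
        ains_path_class[OF si p(1) q(1)] aact_path_class[OF bp path_in_ins[OF si p(1) q(1)]] pl L
      by (rule path_class_cong[OF path_in_ins[OF i' path_in_act[OF s p(1)] q'']])
        (rule ins_act[OF path_inD[OF p(1)] s i path_inD[OF q(1)] t])
  qed
qed

lemma fundamental_groupoid_ins_functor:
  assumes i: "i < length xs"
  shows "groupoid_functor (prod_groupoid (ar \<pi> xs x) (ar \<pi> ys (xs ! i))) (ar \<pi> (graft xs i ys) x)
        (\<lambda>(a, b). oins \<pi> xs x i ys a b) (\<lambda>(f, g). ains \<pi> xs x i ys f g)"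
proof (intro groupoid_functor.intro groupoid_prod groupoid_functor_axioms.intro)
  let ?S = "elems P xs x" and ?T = "elems P ys (xs ! i)"
  show "(case a of (a, b) \<Rightarrow> oins \<pi> xs x i ys a b) \<in> Obj (ar \<pi> (graft xs i ys) x)"
    if "a \<in> Obj (prod_groupoid (ar \<pi> xs x) (ar \<pi> ys (xs ! i)))" for a
    using that i by (auto simp: prod_groupoid_def ins_closed)
  show "(case f of (f, g) \<Rightarrow> ains \<pi> xs x i ys f g) \<in> hom (ar \<pi> (graft xs i ys) x)
      (case a of (a, b) \<Rightarrow> oins \<pi> xs x i ys a b) (case b of (a, b) \<Rightarrow> oins \<pi> xs x i ys a b)"
    if f: "f \<in> hom (prod_groupoid (ar \<pi> xs x) (ar \<pi> ys (xs ! i))) a b" for f a b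
  proof -
    obtain f1 f2 where Pair: "f = (f1, f2)" by (cases f)
    then obtain p q where p: "path_in ?S p" "f1 = path_class ?S p" "pathstart p = fst a" "pathfinish p = fst b"
      and q: "path_in ?T q" "f2 = path_class ?T q" "pathstart q = snd a" "pathfinish q = snd b"
      using f by (auto simp: hom_prod_groupoid hom_fundamental_groupoid)
    show ?thesis
      using p q path_in_ins[OF i p(1) q(1)]
      by (cases a; cases b)
        (auto simp: Pair ains_path_class[OF i p(1) q(1)] hom_fundamental_groupoid pathstart_def pathfinish_def)
  qed
  show "(case idn (prod_groupoid (ar \<pi> xs x) (ar \<pi> ys (xs ! i))) a of (f, g) \<Rightarrow> ains \<pi> xs x i ys f g) =
      idn (ar \<pi> (graft xs i ys) x) (case a of (a, b) \<Rightarrow> oins \<pi> xs x i ys a b)"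
    if "a \<in> Obj (prod_groupoid (ar \<pi> xs x) (ar \<pi> ys (xs ! i)))" for a
    using that i by (auto simp: prod_groupoid_def idn_fundamental_groupoid ains_path_class path_in_const)
  show "(case cmp (prod_groupoid (ar \<pi> xs x) (ar \<pi> ys (xs ! i))) g f of (f, g) \<Rightarrow> ains \<pi> xs x i ys f g) =
      cmp (ar \<pi> (graft xs i ys) x) (case g of (f, g) \<Rightarrow> ains \<pi> xs x i ys f g)
        (case f of (f, g) \<Rightarrow> ains \<pi> xs x i ys f g)"
    if f: "f \<in> hom (prod_groupoid (ar \<pi> xs x) (ar \<pi> ys (xs ! i))) a b"
      and g: "g \<in> hom (prod_groupoid (ar \<pi> xs x) (ar \<pi> ys (xs ! i))) b c" for f g a b c
  proof -
    obtain p q where p: "path_in ?S p" "fst f = path_class ?S p" "pathstart p = fst a" "pathfinish p = fst b"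
      and q: "path_in ?T q" "snd f = path_class ?T q" "pathstart q = snd a" "pathfinish q = snd b"
      using f by (cases f) (auto simp: hom_prod_groupoid hom_fundamental_groupoid)
    obtain p' q' where p': "path_in ?S p'" "fst g = path_class ?S p'" "pathstart p' = fst b" "pathfinish p' = fst c"
      and q': "path_in ?T q'" "snd g = path_class ?T q'" "pathstart q' = snd b" "pathfinish q' = snd c"
      using g by (cases g) (auto simp: hom_prod_groupoid hom_fundamental_groupoid)
    have fg: "f = (path_class ?S p, path_class ?T q)" "g = (path_class ?S p', path_class ?T q')"
      using p(2) q(2) p'(2) q'(2) by (metis prod.collapse)+
    have 1: "path_in ?S (p +++ p')" "path_in ?T (q +++ q')"
      using p q p' q' by (auto intro: path_in_join)
    have 2: "pathfinish (\<lambda>t. ins P xs x i ys (p t) (q t)) = pathstart (\<lambda>t. ins P xs x i ys (p' t) (q' t))"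
      using p q p' q' by (auto simp: pathstart_def pathfinish_def)
    \<comment> \<open>Both joins switch at the same time, so the interchange of insertion and
      concatenation is an equality of functions.\<close>
    have "(\<lambda>t. ins P xs x i ys ((p +++ p') t) ((q +++ q') t))
        = (\<lambda>t. ins P xs x i ys (p t) (q t)) +++ (\<lambda>t. ins P xs x i ys (p' t) (q' t))"
      by (auto simp: joinpaths_def)
    then show ?thesis
      using p q p' q' 1 2 i
      by (simp add: fg prod_groupoid_def cmp_fundamental_groupoid ains_path_class path_in_ins)
  qed
qed (simp_all add: groupoid_fundamental_groupoid)

lemma fundamental_groupoid_act_functor:
  assumes s: "\<sigma> permutes {..<length xs}"
  shows "groupoid_functor (ar \<pi> xs x) (ar \<pi> (permute_list \<sigma> xs) x) (oact \<pi> xs x \<sigma>) (aact \<pi> xs x \<sigma>)"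
proof (intro groupoid_functor.intro groupoid_functor_axioms.intro)
  let ?S = "elems P xs x"
  show "oact \<pi> xs x \<sigma> a \<in> Obj (ar \<pi> (permute_list \<sigma> xs) x)" if "a \<in> Obj (ar \<pi> xs x)" for a
    using that s by (auto simp: act_closed)
  show "aact \<pi> xs x \<sigma> f \<in> hom (ar \<pi> (permute_list \<sigma> xs) x) (oact \<pi> xs x \<sigma> a) (oact \<pi> xs x \<sigma> b)"
    if "f \<in> hom (ar \<pi> xs x) a b" for f a b
    using that path_in_act[OF s]
    by (auto simp: hom_fundamental_groupoid aact_path_class[OF s] pathstart_def pathfinish_def)
  show "aact \<pi> xs x \<sigma> (idn (ar \<pi> xs x) a) = idn (ar \<pi> (permute_list \<sigma> xs) x) (oact \<pi> xs x \<sigma> a)"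
    if "a \<in> Obj (ar \<pi> xs x)" for a
    using that by (auto simp: idn_fundamental_groupoid aact_path_class[OF s] path_in_const)
  show "aact \<pi> xs x \<sigma> (cmp (ar \<pi> xs x) g f) =
      cmp (ar \<pi> (permute_list \<sigma> xs) x) (aact \<pi> xs x \<sigma> g) (aact \<pi> xs x \<sigma> f)"
    if f: "f \<in> hom (ar \<pi> xs x) a b" and g: "g \<in> hom (ar \<pi> xs x) b c" for f g a b c
  proof -
    obtain p q where p: "path_in ?S p" "f = path_class ?S p" and q: "path_in ?S q" "g = path_class ?S q"
      and e: "pathfinish p = pathstart q"
      using f g by (auto simp: hom_fundamental_groupoid)
    have 2: "pathfinish (\<lambda>t. act P xs x \<sigma> (p t)) = pathstart (\<lambda>t. act P xs x \<sigma> (q t))"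
      using e by (auto simp: pathstart_def pathfinish_def)
    have "(\<lambda>t. act P xs x \<sigma> ((p +++ q) t)) = (\<lambda>t. act P xs x \<sigma> (p t)) +++ (\<lambda>t. act P xs x \<sigma> (q t))"
      by (auto simp: joinpaths_def)
    then show ?thesis
      using p q e 2 s by (simp add: cmp_fundamental_groupoid aact_path_class path_in_join path_in_act)
  qed
qed (simp_all add: groupoid_fundamental_groupoid)

lemma relative_groupoid_operad_pi: "relative_groupoid_operad \<pi>"
proof (rule relative_groupoid_operad.intro)
  have "ob \<pi> = \<lparr> elems = elems P, one = one P, ins = ins P, act = act P \<rparr>"
    by (simp add: ob_def)
  also have "\<dots> = P" by simp
  finally show "symmetric_operad (ob \<pi>)" by (simp add: symmetric_operad_axioms)
  show "groupoid (ar \<pi> xs x)" for xs x by (simp add: groupoid_fundamental_groupoid)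
  show "Obj (ar \<pi> xs Cl) = {}" if "Op \<in> set xs" for xs by (simp add: relative[OF that])
qed (rule symmetric_operad_mor fundamental_groupoid_ins_functor fundamental_groupoid_act_functor; assumption)+

end


section \<open>The Swiss-Cheese operad\<close>

lemma renumber_eq_iff: "k \<noteq> i \<Longrightarrow> l \<noteq> i \<Longrightarrow> renumber i m k = renumber i m l \<longleftrightarrow> k = l"
  by (auto simp: renumber_def)

lemma splice_renumber: "l \<noteq> i \<Longrightarrow> splice i m f g (renumber i m l) = f l"
  by (auto simp: splice_def renumber_def)

lemma splice_add: "r < m \<Longrightarrow> splice i m f g (i + r) = g r"
  by (auto simp: splice_def)

lemma renumber_less: "l \<noteq> i \<Longrightarrow> i < n \<Longrightarrow> l < n \<Longrightarrow> renumber i m l < n + m - 1"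
  by (auto simp: renumber_def)

text \<open>An input of a graft is either an old input, renumbered, or an input of the inserted
  operation. This case split replaces the arithmetic of positions in later proofs about
  insertion.\<close>

lemma splice_index_cases [consumes 2, case_names outer inner]:
  assumes "j < n + m - 1" "i < n"
  obtains (outer) l where "l < n" "l \<noteq> i" "j = renumber i m l" | (inner) r where "r < m" "j = i + r"
proof -
  consider "j < i" | "i \<le> j" "j < i + m" | "i + m \<le> j" by linarith
  then show thesis
  proof cases
    case 1
    then show ?thesis using assms by (intro outer[of j]) (auto simp: renumber_def)
  next
    case 2
    then show ?thesis by (intro inner[of "j - i"]) auto
  next
    case 3
    then show ?thesis using assms by (intro outer[of "j + 1 - m"]) (auto simp: renumber_def)
  qed
qed

lemma splice_sequential:
  assumes "j < m" "0 < l"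
  shows "splice (i + j) l (splice i m a b) c = splice i (m + l - 1) a (splice j l b c)"
proof (rule ext)
  fix k
  consider "k < i" | "i \<le> k" "k < i + j" | "i + j \<le> k" "k < i + j + l"
    | "i + j + l \<le> k" "k < i + m + l - 1" | "i + m + l - 1 \<le> k" "i + j + l \<le> k" using assms by linarith
  then show "splice (i + j) l (splice i m a b) c k = splice i (m + l - 1) a (splice j l b c) k"
    using assms by cases (auto simp: splice_def add_ac)
qed

lemma splice_parallel:
  assumes "i < k" "0 < m" "0 < l"
  shows "splice (k + m - 1) l (splice i m a b) c = splice i m (splice k l a c) b"
proof (rule ext)
  fix t
  consider "t < i" | "i \<le> t" "t < i + m" | "i + m \<le> t" "t < k + m - 1"
    | "k + m - 1 \<le> t" "t < k + m - 1 + l" | "k + m - 1 + l \<le> t" using assms by linarith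
  then show "splice (k + m - 1) l (splice i m a b) c t = splice i m (splice k l a c) b t"
    using assms by cases (auto simp: splice_def add_ac)
qed

lemma nth_graft_renumber: "i < length xs \<Longrightarrow> l < length xs \<Longrightarrow> l \<noteq> i \<Longrightarrow>
    graft xs i ys ! renumber i (length ys) l = xs ! l"
  by (subst nth_graft) (auto simp: splice_renumber simp del: One_nat_def intro: renumber_less)

lemma nth_graft_add: "i < length xs \<Longrightarrow> r < length ys \<Longrightarrow> graft xs i ys ! (i + r) = ys ! r"
  by (simp add: nth_graft splice_add)

lemma splice_extensional:
  "i < n \<Longrightarrow> 0 < m \<Longrightarrow> f \<in> extensional {..<n} \<Longrightarrow> splice i m f g \<in> extensional {..<n + m - 1}"
  by (auto simp: extensional_def splice_def)

lemma admissible_nonempty: "admissible xs x \<Longrightarrow> 0 < length xs"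
  by (simp add: admissible_def)

lemma admissible_graft:
  assumes "admissible xs x" "i < length xs" "admissible ys (xs ! i)"
  shows "admissible (graft xs i ys) x"
proof -
  have "set (graft xs i ys) \<subseteq> set xs \<union> set ys"
    by (auto simp: graft_def dest: in_set_takeD in_set_dropD)
  moreover have "xs ! i = Cl" if "x = Cl"
    using assms that nth_mem[OF assms(2)] by (cases "xs ! i") (auto simp: admissible_def)
  ultimately show ?thesis
    using assms by (auto simp: admissible_def graft_def)
qed

lemma admissible_permute:
  "\<sigma> permutes {..<length xs} \<Longrightarrow> admissible (permute_list \<sigma> xs) x \<longleftrightarrow> admissible xs x"
  by (simp add: admissible_def) (metis length_0_conv length_permute_list)

section \<open>Disks and half-disks described by inequalities\<close>

lemma mem_affine_image:
  assumes "fst d > 0"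
  shows "z \<in> affine_map d ` A \<longleftrightarrow> (z - snd d) / of_real (fst d) \<in> A"
proof
  assume "(z - snd d) / of_real (fst d) \<in> A"
  then show "z \<in> affine_map d ` A"
    using assms by (intro image_eqI[of _ _ "(z - snd d) / of_real (fst d)"]) (auto simp: affine_map_def)
qed (use assms in \<open>auto simp: affine_map_def\<close>)

text \<open>A half-disk has its center on the real axis, so the positive homothety preserves the
  upper half-plane.\<close>

lemma affine_image_disk:
  assumes "fst d > 0" "c = Op \<longrightarrow> Im (snd d) = 0"
  shows "affine_map d ` disk c = {z \<in> cball (snd d) (fst d). c = Op \<longrightarrow> Im z \<ge> 0}"
proof -
  have "norm ((z - snd d) / of_real (fst d)) \<le> 1 \<longleftrightarrow> dist (snd d) z \<le> fst d" for z
    using assms(1) by (simp add: norm_divide dist_norm norm_minus_commute)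
  moreover have "0 \<le> Im ((z - snd d) / of_real (fst d)) \<longleftrightarrow> 0 \<le> Im z" if "c = Op" for z
    unfolding Im_divide_of_real using assms that by (simp add: pos_le_divide_eq)
  ultimately show ?thesis
    unfolding set_eq_iff mem_affine_image[OF assms(1)] mem_Collect_eq mem_cball
    by (cases c) (simp_all only: disk.simps mem_Collect_eq mem_cball_0, simp_all)
qed

text \<open>Two bounds suffice to decide disjointness: the upper one shows that disjoint open balls
  leave no common interior point, the lower one certifies a common interior point when the balls
  overlap.\<close>

lemma interior_affine_image_disk:
  assumes "fst d > 0" "c = Op \<longrightarrow> Im (snd d) = 0"
  shows "interior (affine_map d ` disk c) \<subseteq> ball (snd d) (fst d)"
    "{z \<in> ball (snd d) (fst d). c = Op \<longrightarrow> Im z > 0} \<subseteq> interior (affine_map d ` disk c)"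
proof -
  have "affine_map d ` disk c \<subseteq> cball (snd d) (fst d)"
    using affine_image_disk[OF assms] by auto
  then show "interior (affine_map d ` disk c) \<subseteq> ball (snd d) (fst d)"
    using interior_mono[of _ "cball (snd d) (fst d)"] by (simp only: interior_cball)
  have "open {z. c = Op \<longrightarrow> Im z > 0}"
    using open_halfspace_Im_gt[of 0] by (cases c) auto
  then have "open (ball (snd d) (fst d) \<inter> {z. c = Op \<longrightarrow> Im z > 0})" by blast
  moreover have "ball (snd d) (fst d) \<inter> {z. c = Op \<longrightarrow> Im z > 0} \<subseteq> affine_map d ` disk c"
    unfolding affine_image_disk[OF assms] by auto
  ultimately have "ball (snd d) (fst d) \<inter> {z. c = Op \<longrightarrow> Im z > 0} \<subseteq> interior (affine_map d ` disk c)"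
    by (rule interior_maximal[rotated])
  then show "{z \<in> ball (snd d) (fst d). c = Op \<longrightarrow> Im z > 0} \<subseteq> interior (affine_map d ` disk c)"
    by auto
qed

text \<open>Inclusion in the unit disk is tested at the point of the image that is farthest from the
  origin, and inclusion of a full disk in the half-plane at its lowest point.\<close>

lemma affine_image_subset_disk:
  assumes l: "fst d > 0" and o: "c = Op \<longrightarrow> Im (snd d) = 0" and x: "x = Cl \<longrightarrow> c = Cl"
  shows "affine_map d ` disk c \<subseteq> disk x \<longleftrightarrow>
    norm (snd d) + fst d \<le> 1 \<and> (x = Op \<and> c = Cl \<longrightarrow> fst d \<le> Im (snd d))" (is "?L \<longleftrightarrow> ?R")
proof
  assume R: ?R
  then have "cball (snd d) (fst d) \<subseteq> cball 0 1"
    using l by (simp add: cball_subset_cball_iff)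
  moreover have "0 \<le> Im z" if "x = Op" "c = Cl" "dist (snd d) z \<le> fst d" for z
  proof -
    have "\<bar>Im (snd d) - Im z\<bar> \<le> fst d"
      using abs_Im_le_cmod[of "snd d - z"] that by (simp add: dist_norm)
    then show ?thesis using that R by linarith
  qed
  ultimately show ?L
    unfolding affine_image_disk[OF l o] using x by (cases x; cases c) auto
next
  assume L: ?L
  let ?l = "of_real (fst d) :: complex"
  \<comment> \<open>The farthest point lies in the direction of the center. For center
    \<open>0\<close> every direction is extremal; \<open>1\<close> is real and hence available in a
    half-disk.\<close>
  define u where "u = snd d + ?l * (if snd d = 0 then 1 else sgn (snd d))"
  have "u = (1 + ?l / of_real (norm (snd d))) * snd d" if "snd d \<noteq> 0"
    using that by (simp add: u_def sgn_div_norm scaleR_conv_of_real field_simps)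
  then have "norm u = norm (snd d) + fst d"
  proof (cases "snd d = 0")
    case False
    then have "u = of_real ((norm (snd d) + fst d) / norm (snd d)) * snd d"
      by (simp add: u_def sgn_div_norm scaleR_conv_of_real field_simps)
    moreover have "norm (of_real ((norm (snd d) + fst d) / norm (snd d)) * snd d) = norm (snd d) + fst d"
      using False l unfolding norm_mult norm_of_real by (simp add: abs_of_pos add_pos_nonneg)
    ultimately show ?thesis by simp
  qed (use l in \<open>simp add: u_def\<close>)
  moreover have "u \<in> affine_map d ` disk c"
  proof -
    have "norm (if snd d = 0 then 1 else sgn (snd d)) = 1" by (simp add: norm_sgn)
    then have "dist (snd d) u \<le> fst d" using l by (simp add: u_def dist_norm norm_mult)
    moreover have "Im u = 0" if "c = Op" using that o by (simp add: u_def sgn_div_norm)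
    ultimately show ?thesis unfolding affine_image_disk[OF l o] by auto
  qed
  moreover have "disk x \<subseteq> cball 0 1" by (cases x) auto
  ultimately have "norm (snd d) + fst d \<le> 1"
    using L by (metis mem_cball_0 subsetD)
  moreover have "fst d \<le> Im (snd d)" if "x = Op" "c = Cl"
  proof -
    \<comment> \<open>The lowest point of the full disk.\<close>
    have "snd d - \<i> * ?l \<in> affine_map d ` disk c"
      unfolding affine_image_disk[OF l o] using that l by (auto simp: dist_norm norm_mult)
    then have "snd d - \<i> * ?l \<in> disk x" using L by blast
    then show ?thesis using that by simp
  qed
  ultimately show ?R by blast
qed

text \<open>If two open balls overlap, the point that divides the segment of the centers in the
  ratio of the radii lies in both. When a half-disk is involved, a common point strictly above the
  real axis has to be found, because only such points are known to be interior.\<close>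

lemma disjoint_interior_disks:
  assumes d: "fst d > 0" "c = Op \<longrightarrow> Im (snd d) = 0" and e: "fst e > 0" "c' = Op \<longrightarrow> Im (snd e) = 0"
    and o: "x = Op \<and> c = Cl \<longrightarrow> fst d \<le> Im (snd d)" "x = Op \<and> c' = Cl \<longrightarrow> fst e \<le> Im (snd e)"
    and x: "x = Cl \<longrightarrow> c = Cl \<and> c' = Cl"
  shows "interior (affine_map d ` disk c) \<inter> interior (affine_map e ` disk c') = {} \<longleftrightarrow>
    fst d + fst e \<le> dist (snd d) (snd e)" (is "?L \<longleftrightarrow> ?R")
proof
  assume ?R
  then have "ball (snd d) (fst d) \<inter> ball (snd e) (fst e) = {}" by (rule disjoint_ballI)
  then show ?L
    using interior_affine_image_disk(1)[OF d] interior_affine_image_disk(1)[OF e] by blast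
next
  assume L: ?L
  show ?R
  proof (rule ccontr)
    assume "\<not> ?R"
    then have less: "dist (snd d) (snd e) < fst d + fst e" by simp
    define s where "s = fst d / (fst d + fst e)"
    have s: "0 < s" "s < 1" "1 - s = fst e / (fst d + fst e)" using d e by (auto simp: s_def field_simps)
    define z where "z = snd d + of_real s * (snd e - snd d)"
    have "snd d - z = - (of_real s * (snd e - snd d))" "snd e - z = of_real (1 - s) * (snd e - snd d)"
      by (simp_all add: z_def algebra_simps)
    then have "dist (snd d) z = s * dist (snd d) (snd e)" "dist (snd e) z = (1 - s) * dist (snd d) (snd e)"
      using s(1,2) unfolding dist_norm
      by (simp_all only: norm_minus_cancel norm_mult norm_of_real norm_minus_commute[of "snd d"])
    moreover have "s * dist (snd d) (snd e) < fst d" "(1 - s) * dist (snd d) (snd e) < fst e"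
      using mult_strict_left_mono[OF less d(1)] mult_strict_left_mono[OF less e(1)] d(1) e(1)
      unfolding s(3) unfolding s_def by (simp_all add: field_simps)
    ultimately have z: "z \<in> ball (snd d) (fst d) \<inter> ball (snd e) (fst e)" by simp
    have Im: "Im z = (1 - s) * Im (snd d) + s * Im (snd e)" by (simp add: z_def algebra_simps)
    have "\<exists>w \<in> ball (snd d) (fst d) \<inter> ball (snd e) (fst e). (c = Op \<longrightarrow> Im w > 0) \<and> (c' = Op \<longrightarrow> Im w > 0)"
    proof (cases "c = Op \<and> c' = Op")
      case True
      obtain r where r: "r > 0" "ball z r \<subseteq> ball (snd d) (fst d) \<inter> ball (snd e) (fst e)"
        using z by (metis open_Int open_ball open_contains_ball)
      \<comment> \<open>Both centers are real here, so \<open>z\<close> is pushed up slightly inside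
        the open intersection.\<close>
      have "z + \<i> * of_real (r / 2) \<in> ball z r" using r by (simp add: dist_norm norm_mult)
      moreover have "Im (z + \<i> * of_real (r / 2)) > 0" using True Im d e r by simp
      ultimately show ?thesis using r(2) by blast
    next
      case False
      \<comment> \<open>With exactly one half-disk, the center of the full disk lies strictly above
        the axis, and so does every proper convex combination of the two centers.\<close>
      have "Im z > 0" if "c = Op \<or> c' = Op"
      proof -
        have "x = Op" using that x by (cases x) auto
        then have "(Im (snd d) = 0 \<and> Im (snd e) > 0) \<or> (Im (snd e) = 0 \<and> Im (snd d) > 0)"
          using that False o d e by (cases c; cases c') auto
        then show ?thesis using s(1,2) unfolding Im by auto
      qed
      then show ?thesis using z by blast
    qed
    then show False
      using L interior_affine_image_disk(2)[OF d] interior_affine_image_disk(2)[OF e] by blast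
  qed
qed

text \<open>The conditions on a single disk. They are convex in the pair of radius and center, which
  \<open>disk_ok_mix\<close> exploits for deformations.\<close>

definition disk_ok :: "color \<Rightarrow> color \<Rightarrow> real \<times> complex \<Rightarrow> bool" where
  "disk_ok c x d \<longleftrightarrow> 0 < fst d \<and> norm (snd d) + fst d \<le> 1 \<and> (c = Op \<longrightarrow> Im (snd d) = 0) \<and>
     (x = Op \<and> c = Cl \<longrightarrow> fst d \<le> Im (snd d))"

text \<open>From here on membership is used in this form, without images and interiors: one convex
  condition per disk, and one bound on the distance of each pair of centers.\<close>

lemma swiss_cheese_iff:
  "d \<in> swiss_cheese xs x \<longleftrightarrow> d \<in> extensional {..<length xs} \<and> admissible xs x \<and>
    (\<forall>i<length xs. disk_ok (xs ! i) x (d i)) \<and>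
    (\<forall>i<length xs. \<forall>j<length xs. i \<noteq> j \<longrightarrow> fst (d i) + fst (d j) \<le> dist (snd (d i)) (snd (d j)))"
proof (cases "admissible xs x")
  case True
  have x: "x = Cl \<longrightarrow> xs ! i = Cl" if "i < length xs" for i
    using True nth_mem[OF that] by (cases "xs ! i") (auto simp: admissible_def)
  have ok: "disk_ok (xs ! i) x (d i) \<longleftrightarrow> fst (d i) > 0 \<and> (xs ! i = Op \<longrightarrow> Im (snd (d i)) = 0) \<and>
        affine_map (d i) ` disk (xs ! i) \<subseteq> disk x" if "i < length xs" for i
    using affine_image_subset_disk[of "d i" "xs ! i" x] x[OF that] unfolding disk_ok_def by blast
  have disj: "interior (affine_map (d i) ` disk (xs ! i)) \<inter> interior (affine_map (d j) ` disk (xs ! j)) = {}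
      \<longleftrightarrow> fst (d i) + fst (d j) \<le> dist (snd (d i)) (snd (d j))"
    if "i < length xs" "j < length xs" "disk_ok (xs ! i) x (d i)" "disk_ok (xs ! j) x (d j)" for i j
    using that x by (intro disjoint_interior_disks[of _ _ _ _ x]) (auto simp: disk_ok_def)
  have 1: "(\<forall>i<length xs. 0 < fst (d i) \<and> (xs ! i = Op \<longrightarrow> Im (snd (d i)) = 0) \<and>
      affine_map (d i) ` disk (xs ! i) \<subseteq> disk x) \<longleftrightarrow> (\<forall>i<length xs. disk_ok (xs ! i) x (d i))"
    using ok by blast
  have 2: "(\<forall>i<length xs. \<forall>j<length xs. i \<noteq> j \<longrightarrow>
        interior (affine_map (d i) ` disk (xs ! i)) \<inter> interior (affine_map (d j) ` disk (xs ! j)) = {})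
    \<longleftrightarrow> (\<forall>i<length xs. \<forall>j<length xs. i \<noteq> j \<longrightarrow> fst (d i) + fst (d j) \<le> dist (snd (d i)) (snd (d j)))"
    if "\<forall>i<length xs. disk_ok (xs ! i) x (d i)"
    using disj that by auto
  show ?thesis
    unfolding swiss_cheese_def mem_Collect_eq 1 using 2 by blast
qed (simp add: swiss_cheese_def)

section \<open>Composition of disks and the operad axioms\<close>

lemma affine_comp_assoc: "affine_comp (affine_comp a b) c = affine_comp a (affine_comp b c)"
  by (simp add: affine_comp_def algebra_simps)

lemma affine_comp_one [simp]: "affine_comp a (1, 0) = a" "affine_comp (1, 0) a = a"
  by (simp_all add: affine_comp_def)

lemma disk_ok_comp:
  assumes d: "disk_ok c x d" and e: "disk_ok c' c e" and c: "c = Cl \<longrightarrow> c' = Cl"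
  shows "disk_ok c' x (affine_comp d e)"
proof -
  have l: "0 < fst d" "0 < fst e" using d e by (simp_all add: disk_ok_def)
  have "norm (of_real (fst d) * snd e + snd d) \<le> fst d * norm (snd e) + norm (snd d)"
    using norm_triangle_ineq[of "of_real (fst d) * snd e" "snd d"] l by (simp add: norm_mult)
  moreover have "fst d * norm (snd e) \<le> fst d * (1 - fst e)"
    using l e by (intro mult_left_mono) (auto simp: disk_ok_def)
  ultimately have n: "norm (of_real (fst d) * snd e + snd d) + fst d * fst e \<le> 1"
    using d by (simp add: disk_ok_def algebra_simps)
  have "fst d * fst e \<le> fst d * Im (snd e) + Im (snd d)" if "x = Op" "c' = Cl"
  proof (cases c)
    case Cl
    \<comment> \<open>The center of \<open>e\<close> may lie below that of the full disk, but at
      most \<open>1 - fst e\<close> below; after scaling by \<open>fst d\<close> the loss is covered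
      by \<open>fst d \<le> Im (snd d)\<close>.\<close>
    have "- Im (snd e) \<le> norm (snd e)" using abs_Im_le_cmod[of "snd e"] by linarith
    then have "fst d * - Im (snd e) \<le> fst d * (1 - fst e)"
      using l e by (intro mult_left_mono) (auto simp: disk_ok_def)
    then show ?thesis using d that Cl by (simp add: disk_ok_def algebra_simps)
  next
    case Op
    then show ?thesis using d e that l by (simp add: disk_ok_def)
  qed
  moreover have "Im (snd d) = 0 \<and> Im (snd e) = 0 \<or> c' = Cl" if "x = Op" "c = Op"
    using that d e by (cases c') (auto simp: disk_ok_def)
  ultimately show ?thesis
    using l n d e c by (cases c'; cases c) (auto simp: disk_ok_def affine_comp_def)
qed

text \<open>A disk inserted in \<open>d\<close> stays inside the ball of \<open>d\<close>; with the
  triangle inequality it therefore keeps its distance from the other disks.\<close>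

lemma dist_affine_comp:
  assumes "disk_ok c' c e" "0 < fst d"
  shows "dist (snd d) (snd (affine_comp d e)) \<le> fst d - fst (affine_comp d e)"
proof -
  have "dist (snd d) (snd (affine_comp d e)) = fst d * norm (snd e)"
    using assms by (simp add: affine_comp_def dist_norm norm_mult)
  also have "\<dots> \<le> fst d * (1 - fst e)"
    using assms by (intro mult_left_mono) (auto simp: disk_ok_def)
  finally show ?thesis by (simp add: affine_comp_def algebra_simps)
qed

lemma swiss_cheese_ins:
  assumes d: "d \<in> swiss_cheese xs x" and i: "i < length xs" and e: "e \<in> swiss_cheese ys (xs ! i)"
  shows "splice i (length ys) d (\<lambda>r. affine_comp (d i) (e r)) \<in> swiss_cheese (graft xs i ys) x"
    (is "?s \<in> _")
proof -
  let ?m = "length ys"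
  have m: "0 < ?m" using e by (auto simp: swiss_cheese_iff dest: admissible_nonempty)
  have ok: "disk_ok (xs ! l) x (d l)" if "l < length xs" for l using that d by (simp add: swiss_cheese_iff)
  have ok': "disk_ok (ys ! r) (xs ! i) (e r)" if "r < ?m" for r using that e by (simp add: swiss_cheese_iff)
  have cl: "xs ! i = Cl \<longrightarrow> ys ! r = Cl" if "r < ?m" for r
    using e nth_mem[OF that] by (cases "ys ! r") (auto simp: swiss_cheese_iff admissible_def)
  have li: "0 < fst (d i)" using ok[OF i] by (simp add: disk_ok_def)
  have dd: "fst (d k) + fst (d l) \<le> dist (snd (d k)) (snd (d l))" if "k < length xs" "l < length xs" "k \<noteq> l" for k l
    using that d by (simp add: swiss_cheese_iff)
  have ee: "fst (e k) + fst (e l) \<le> dist (snd (e k)) (snd (e l))" if "k < ?m" "l < ?m" "k \<noteq> l" for k l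
    using that e by (simp add: swiss_cheese_iff)
  have de: "fst (d l) + fst (affine_comp (d i) (e r)) \<le> dist (snd (d l)) (snd (affine_comp (d i) (e r)))"
    if "l < length xs" "l \<noteq> i" "r < ?m" for l r
    using dist_affine_comp[OF ok'[OF that(3)] li] dd[OF that(1) i that(2)]
      dist_triangle[of "snd (d l)" "snd (d i)" "snd (affine_comp (d i) (e r))"]
    by (simp add: dist_commute)
  have ce: "fst (affine_comp (d i) (e k)) + fst (affine_comp (d i) (e l))
      \<le> dist (snd (affine_comp (d i) (e k))) (snd (affine_comp (d i) (e l)))"
    if "k < ?m" "l < ?m" "k \<noteq> l" for k l
  proof -
    have "of_real (fst (d i)) * snd (e k) + snd (d i) - (of_real (fst (d i)) * snd (e l) + snd (d i))
      = of_real (fst (d i)) * (snd (e k) - snd (e l))" by (simp add: algebra_simps)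
    then have "dist (snd (affine_comp (d i) (e k))) (snd (affine_comp (d i) (e l)))
      = fst (d i) * dist (snd (e k)) (snd (e l))"
      using li by (simp add: affine_comp_def dist_norm norm_mult)
    then show ?thesis
      using mult_left_mono[OF ee[OF that], of "fst (d i)"] li by (simp add: affine_comp_def algebra_simps)
  qed
  show ?thesis
    unfolding swiss_cheese_iff length_graft[OF i]
  proof (intro conjI allI impI)
    show "?s \<in> extensional {..<length xs + ?m - 1}"
      using d i m by (intro splice_extensional) (auto simp: swiss_cheese_iff)
    show "admissible (graft xs i ys) x"
      using d e i by (intro admissible_graft) (auto simp: swiss_cheese_iff)
    show "disk_ok (graft xs i ys ! j) x (?s j)" if "j < length xs + ?m - 1" for j
      using that i
    proof (cases rule: splice_index_cases)
      case (outer l)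
      then show ?thesis using ok i by (simp add: nth_graft_renumber splice_renumber)
    next
      case (inner r)
      then show ?thesis using disk_ok_comp[OF ok[OF i] ok' cl] i by (simp add: nth_graft_add splice_add)
    qed
    show "fst (?s j) + fst (?s k) \<le> dist (snd (?s j)) (snd (?s k))"
      if j: "j < length xs + ?m - 1" and k: "k < length xs + ?m - 1" and jk: "j \<noteq> k" for j k
      using j i
    proof (cases rule: splice_index_cases)
      case j: (outer l)
      show ?thesis using k i
      proof (cases rule: splice_index_cases)
        case (outer l')
        then show ?thesis using j dd[of l l'] jk by (auto simp: splice_renumber)
      next
        case (inner r)
        then show ?thesis using j de[of l r] by (auto simp: splice_renumber splice_add)
      qed
    next
      case j: (inner r)
      show ?thesis using k i
      proof (cases rule: splice_index_cases)
        case (outer l)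
        then show ?thesis using j de[of l r] by (auto simp: splice_renumber splice_add dist_commute add.commute)
      next
        case (inner r')
        then show ?thesis using j ce[of r r'] jk by (auto simp: splice_add)
      qed
    qed
  qed
qed

lemma elems_SC [simp]: "elems SC = swiss_cheese"
  and one_SC: "one SC x = (\<lambda>i\<in>{..<1}. (1, 0))"
  and ins_SC: "ins SC xs x i ys d e = splice i (length ys) d (\<lambda>r. affine_comp (d i) (e r))"
  and act_SC: "act SC xs x \<sigma> d = d \<circ> \<sigma>"
  by (simp_all add: SC_def)

lemma permute_extensional:
  "d \<in> extensional {..<n} \<Longrightarrow> \<sigma> permutes {..<n} \<Longrightarrow> d \<circ> \<sigma> \<in> extensional {..<n}"
  by (auto simp: extensional_def permutes_not_in)

lemma symmetric_operad_SC: "symmetric_operad SC"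
proof
  fix xs ys zs :: "color list" and x :: color and i j k :: nat and \<sigma> \<tau> :: "nat \<Rightarrow> nat"
    and a b c :: "nat \<Rightarrow> real \<times> complex"
  have el: "a \<in> extensional {..<length xs}" "0 < length xs" if "a \<in> elems SC xs x" for a xs x
    using that by (auto simp: swiss_cheese_iff dest: admissible_nonempty)
  show "one SC x \<in> elems SC [x] x"
    by (cases x) (auto simp: one_SC swiss_cheese_iff admissible_def disk_ok_def)
  show "ins SC xs x i ys a b \<in> elems SC (graft xs i ys) x"
    if "a \<in> elems SC xs x" "i < length xs" "b \<in> elems SC ys (xs ! i)"
    using that by (simp add: ins_SC swiss_cheese_ins)
  show "act SC xs x \<sigma> a \<in> elems SC (permute_list \<sigma> xs) x"
    if "a \<in> elems SC xs x" and s: "\<sigma> permutes {..<length xs}"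
  proof -
    have "\<sigma> i < length xs" if "i < length xs" for i using permutes_in_image[OF s] that by auto
    moreover have "\<sigma> i = \<sigma> j \<longleftrightarrow> i = j" for i j using permutes_inj[OF s] by (auto dest: injD)
    ultimately show ?thesis
      using that by (auto simp: act_SC swiss_cheese_iff admissible_permute permute_list_nth permute_extensional)
  qed
  show "ins SC xs x i [xs ! i] a (one SC (xs ! i)) = a"
    by (rule ext) (auto simp: ins_SC one_SC splice_def less_Suc_eq)
  show "ins SC [x] x 0 xs (one SC x) a = a" if "a \<in> elems SC xs x"
    using el[OF that] by (auto simp: ins_SC one_SC splice_def extensional_def)
  show "ins SC (graft xs i ys) x (i + j) zs (ins SC xs x i ys a b) c
        = ins SC xs x i (graft ys j zs) a (ins SC ys (xs ! i) j zs b c)"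
    if "i < length xs" "j < length ys" "c \<in> elems SC zs (ys ! j)"
  proof -
    have "splice (i + j) l (splice i m a b) c = splice i (m + l - 1) a (splice j l b c)"
      if "j < m" "0 < l" for m l and a b c :: "nat \<Rightarrow> real \<times> complex"
      using that by (rule splice_sequential)
    moreover have "(\<lambda>r. affine_comp (a i) (splice j l b c r)) =
        splice j l (\<lambda>r. affine_comp (a i) (b r)) (\<lambda>r. affine_comp (a i) (c r))" for l and b c
      by (auto simp: splice_def)
    ultimately show ?thesis
      using that el(2)[OF that(3)]
      by (simp add: ins_SC length_graft splice_add affine_comp_assoc del: One_nat_def)
  qed
  show "ins SC (graft xs i ys) x (k + length ys - 1) zs (ins SC xs x i ys a b) c
        = ins SC (graft xs k zs) x i ys (ins SC xs x k zs a c) b"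
    if "i < k" "k < length xs" "b \<in> elems SC ys (xs ! i)" "c \<in> elems SC zs (xs ! k)"
  proof -
    have "splice (k + m - 1) l (splice i m a b) c = splice i m (splice k l a c) b"
      if "0 < m" "0 < l" for m l and a b c :: "nat \<Rightarrow> real \<times> complex"
      using that \<open>i < k\<close> by (intro splice_parallel)
    moreover have "splice i m a b (k + m - 1) = a k" "splice k l a b i = a i"
      for m l and a b :: "nat \<Rightarrow> real \<times> complex"
      using \<open>i < k\<close> by (auto simp: splice_def)
    ultimately show ?thesis
      using el(2)[OF that(3)] el(2)[OF that(4)] by (simp add: ins_SC)
  qed
  show "act SC xs x id a = a" by (simp add: act_SC)
  show "act SC (permute_list \<sigma> xs) x \<tau> (act SC xs x \<sigma> a) = act SC xs x (\<sigma> \<circ> \<tau>) a"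
    by (simp add: act_SC o_assoc)
  show "ins SC (permute_list \<sigma> xs) x i (permute_list \<tau> ys) (act SC xs x \<sigma> a) (act SC ys (xs ! \<sigma> i) \<tau> b)
        = act SC (graft xs (\<sigma> i) ys) x (block_perm i (length ys) \<sigma> \<tau>) (ins SC xs x (\<sigma> i) ys a b)"
    if s: "\<sigma> permutes {..<length xs}" and t: "\<tau> permutes {..<length ys}"
  proof (rule ext)
    fix j
    have sinj: "\<sigma> a = \<sigma> b \<longleftrightarrow> a = b" for a b using permutes_inj[OF s] by (auto dest: injD)
    have tm: "\<tau> j < length ys" if "j < length ys" for j using permutes_in_image[OF t] that by auto
    consider "j < i" | "i \<le> j" "j < i + length ys" | "i + length ys \<le> j" by linarith
    then show "ins SC (permute_list \<sigma> xs) x i (permute_list \<tau> ys) (act SC xs x \<sigma> a) (act SC ys (xs ! \<sigma> i) \<tau> b) j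
        = act SC (graft xs (\<sigma> i) ys) x (block_perm i (length ys) \<sigma> \<tau>) (ins SC xs x (\<sigma> i) ys a b) j"
    proof cases
      case 1
      then show ?thesis using sinj[of j i] by (simp add: ins_SC act_SC block_perm_def splice_def[of i] splice_renumber)
    next
      case 2
      then show ?thesis using tm[of "j - i"]
        by (simp add: ins_SC act_SC block_perm_def splice_def[of i] splice_add)
    next
      case 3
      then show ?thesis using sinj[of "j + 1 - length ys" i]
        by (simp add: ins_SC act_SC block_perm_def splice_def[of i] splice_renumber)
    qed
  qed
qed

interpretation SC: topological_operad SC
proof (intro topological_operad.intro symmetric_operad_SC topological_operad_axioms.intro)
  fix xs ys :: "color list" and x :: color and i :: nat and \<sigma> :: "nat \<Rightarrow> nat"
  have c: "continuous_on S (\<lambda>y. f y j)" if "continuous_on S f"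
    for S :: "'x::topological_space set" and f :: "'x \<Rightarrow> nat \<Rightarrow> real \<times> complex" and j
    using that by (rule continuous_on_product_then_coordinatewise)
  have "continuous_on S (\<lambda>y. splice i m (fst y) (\<lambda>r. affine_comp (fst y i) (snd y r)) j)"
    for S :: "((nat \<Rightarrow> real \<times> complex) \<times> (nat \<Rightarrow> real \<times> complex)) set" and j m
  proof -
    have [continuous_intros]: "continuous_on S (\<lambda>y. fst y k)" "continuous_on S (\<lambda>y. snd y k)" for k
      by (rule c[OF continuous_on_fst[OF continuous_on_id]] c[OF continuous_on_snd[OF continuous_on_id]])+
    show ?thesis
      unfolding splice_def affine_comp_def
      by (cases "j < i"; cases "j < i + m") (auto intro!: continuous_intros)
  qed
  then show "continuous_on (elems SC xs x \<times> elems SC ys (xs ! i)) (\<lambda>(a, b). ins SC xs x i ys a b)"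
    unfolding case_prod_unfold ins_SC by (rule continuous_on_coordinatewise_then_product)
  show "continuous_on (elems SC xs x) (act SC xs x \<sigma>)"
    unfolding act_SC o_def by (rule continuous_on_coordinatewise_then_product) (rule c[OF continuous_on_id])
  show "elems SC xs Cl = {}" if "Op \<in> set xs"
    using that by (auto simp: swiss_cheese_iff admissible_def)
qed


section \<open>Trees and their embedding into the Swiss-Cheese operad\<close>

lemma leaves_nonempty [simp]: "leaves t \<noteq> []"
  by (induction t) auto

lemma leaves_map_tree: "leaves (map_tree f t) = map f (leaves t)"
  by (induction t) auto

lemma leaves_subst_leaves: "leaves (subst_leaves f t) = concat (map (leaves \<circ> f) (leaves t))"
  by (induction t) auto

lemma typed_leaf: "typed xs t x \<Longrightarrow> l \<in> set (leaves t) \<Longrightarrow> l < length xs \<and> (x = Cl \<longrightarrow> xs ! l = Cl)"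
  by (induction t arbitrary: x) auto

lemma typed_subst_leaves:
  "typed xs t x \<Longrightarrow> (\<And>l. l < length xs \<Longrightarrow> typed zs (f l) (xs ! l)) \<Longrightarrow> typed zs (subst_leaves f t) x"
  by (induction t arbitrary: x) auto

lemma typed_map_tree:
  "typed xs t x \<Longrightarrow> (\<And>l. l < length xs \<Longrightarrow> f l < length zs \<and> zs ! f l = xs ! l) \<Longrightarrow>
    typed zs (map_tree f t) x"
  by (induction t arbitrary: x) auto

lemma typed_leaf_disk_ok:
  "typed xs t x \<Longrightarrow> l \<in> set (leaves t) \<Longrightarrow> disk_ok (xs ! l) x (leaf_map t l)"
proof (induction t arbitrary: x)
  case (Leaf i)
  then show ?case by (cases x) (auto simp: disk_ok_def)
next
  case (MuC s t)
  have "disk_ok Cl Cl (1/2, -1/2)" "disk_ok Cl Cl (1/2, 1/2)" by (auto simp: disk_ok_def)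
  then show ?case using MuC typed_leaf[of xs s Cl l] typed_leaf[of xs t Cl l] by (auto intro!: disk_ok_comp)
next
  case (F s)
  have "disk_ok Cl Op (1/2, \<i>/2)" by (auto simp: disk_ok_def norm_divide)
  then show ?case using F typed_leaf[of xs s Cl l] by (auto intro!: disk_ok_comp)
next
  case (MuO s t)
  have "disk_ok Op Op (1/2, -1/2)" "disk_ok Op Op (1/2, 1/2)" by (auto simp: disk_ok_def)
  then show ?case using MuO by (auto intro!: disk_ok_comp)
qed

lemma disk_ok_center:
  assumes "disk_ok c x d"
  shows "norm (snd d) < 1" "fst d \<le> 1" "\<bar>Re (snd d)\<bar> + fst d \<le> 1"
  using assms abs_Re_le_cmod[of "snd d"] norm_ge_zero[of "snd d"] unfolding disk_ok_def by linarith+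

text \<open>This separates the projections of whole disks to the real axis and not merely their
  centers. It yields disjointness in \<open>left_of_dist\<close>, and room for insertion at full
  radius in \<open>conf_ins_centers\<close>.\<close>

definition left_of :: "real \<times> complex \<Rightarrow> real \<times> complex \<Rightarrow> bool" where
  "left_of d e \<longleftrightarrow> Re (snd d) + fst d \<le> Re (snd e) - fst e"

lemma left_of_affine_comp: "0 \<le> fst d \<Longrightarrow> left_of a b \<Longrightarrow> left_of (affine_comp d a) (affine_comp d b)"
  unfolding left_of_def affine_comp_def
  using mult_left_mono[of "Re (snd a) + fst a" "Re (snd b) - fst b" "fst d"] by (simp add: algebra_simps)

text \<open>As \<open>|Re| + radius \<le> 1\<close> for both disks, the first image lies in
  \<open>Re \<le> 0\<close> and the second in \<open>Re \<ge> 0\<close>.\<close>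

lemma left_of_halves:
  assumes "disk_ok c x a" "disk_ok c' x' b"
  shows "left_of (affine_comp (1/2, -1/2) a) (affine_comp (1/2, 1/2) b)"
  using disk_ok_center(3)[OF assms(1)] disk_ok_center(3)[OF assms(2)]
  by (simp add: left_of_def affine_comp_def)

text \<open>Common outer maps preserve \<open>left_of\<close>, so two leaves are separated at the
  product node where their branches part. The vertical shift of \<open>F\<close> does not affect
  real parts.\<close>

lemma leaf_map_sorted:
  "typed xs t x \<Longrightarrow> distinct (leaves t) \<Longrightarrow> sorted_wrt (\<lambda>i j. left_of (leaf_map t i) (leaf_map t j)) (leaves t)"
proof (induction t arbitrary: x)
  case (MuC s t)
  have "left_of (leaf_map (MuC s t) i) (leaf_map (MuC s t) j)" if "i \<in> set (leaves s)" "j \<in> set (leaves t)" for i j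
    using MuC.prems that left_of_halves[OF typed_leaf_disk_ok typed_leaf_disk_ok, of xs s Cl i xs t Cl j] by auto
  moreover have "sorted_wrt (\<lambda>i j. left_of (leaf_map (MuC s t) i) (leaf_map (MuC s t) j)) (leaves s)"
    by (rule sorted_wrt_mono_rel[OF _ MuC.IH(1)]) (use MuC.prems in \<open>auto intro: left_of_affine_comp\<close>)
  moreover have "sorted_wrt (\<lambda>i j. left_of (leaf_map (MuC s t) i) (leaf_map (MuC s t) j)) (leaves t)"
    by (rule sorted_wrt_mono_rel[OF _ MuC.IH(2)]) (use MuC.prems in \<open>auto intro: left_of_affine_comp\<close>)
  ultimately show ?case by (simp add: sorted_wrt_append)
next
  case (MuO s t)
  have "left_of (leaf_map (MuO s t) i) (leaf_map (MuO s t) j)" if "i \<in> set (leaves s)" "j \<in> set (leaves t)" for i j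
    using MuO.prems that left_of_halves[OF typed_leaf_disk_ok typed_leaf_disk_ok, of xs s Op i xs t Op j] by auto
  moreover have "sorted_wrt (\<lambda>i j. left_of (leaf_map (MuO s t) i) (leaf_map (MuO s t) j)) (leaves s)"
    by (rule sorted_wrt_mono_rel[OF _ MuO.IH(1)]) (use MuO.prems in \<open>auto intro: left_of_affine_comp\<close>)
  moreover have "sorted_wrt (\<lambda>i j. left_of (leaf_map (MuO s t) i) (leaf_map (MuO s t) j)) (leaves t)"
    by (rule sorted_wrt_mono_rel[OF _ MuO.IH(2)]) (use MuO.prems in \<open>auto intro: left_of_affine_comp\<close>)
  ultimately show ?case by (simp add: sorted_wrt_append)
next
  case (F s)
  then show ?case by (auto intro!: sorted_wrt_mono_rel[OF _ F.IH] left_of_affine_comp)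
qed auto

lemma sorted_wrt_total:
  assumes "sorted_wrt R w" "i \<in> set w" "j \<in> set w" "i \<noteq> j"
  shows "R i j \<or> R j i"
proof -
  obtain k l where "k < length w" "l < length w" "w ! k = i" "w ! l = j"
    using assms by (metis in_set_conv_nth)
  then show ?thesis
    using assms sorted_wrt_nth_less[OF assms(1), of k l] sorted_wrt_nth_less[OF assms(1), of l k]
    by (metis linorder_neqE_nat)
qed

lemma left_of_dist: "left_of d e \<Longrightarrow> fst d + fst e \<le> dist (snd d) (snd e)"
  using abs_Re_le_cmod[of "snd e - snd d"] by (simp add: left_of_def dist_norm norm_minus_commute)

section \<open>The tree operad and its morphisms to words and to disks\<close>

abbreviation "trees \<equiv> elems OmegaOmega"

lemma trees_iff: "t \<in> trees xs x \<longleftrightarrow> typed xs t x \<and> distinct (leaves t) \<and> set (leaves t) = {..<length xs}"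
  by (simp add: OmegaOmega_def)

lemma length_leaves: "t \<in> trees xs x \<Longrightarrow> length (leaves t) = length xs"
  using distinct_card[of "leaves t"] by (simp add: trees_iff)

lemma trees_admissible: "t \<in> trees xs x \<Longrightarrow> admissible xs x"
  using typed_leaf[of xs t x] leaves_nonempty[of t]
  by (auto simp: trees_iff admissible_def in_set_conv_nth)

lemma embed_sorted:
  assumes "t \<in> trees xs x"
  shows "sorted_wrt (\<lambda>i j. left_of (embed xs x t i) (embed xs x t j)) (leaves t)"
  by (rule sorted_wrt_mono_rel[OF _ leaf_map_sorted]) (use assms in \<open>auto simp: trees_iff embed_def\<close>)

lemma embed_swiss_cheese:
  assumes t: "t \<in> trees xs x"
  shows "embed xs x t \<in> swiss_cheese xs x"
  unfolding swiss_cheese_iff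
proof (intro conjI allI impI)
  show "disk_ok (xs ! i) x (embed xs x t i)" if "i < length xs" for i
    using that t typed_leaf_disk_ok[of xs t x i] by (auto simp: embed_def trees_iff)
  show "fst (embed xs x t i) + fst (embed xs x t j) \<le> dist (snd (embed xs x t i)) (snd (embed xs x t j))"
    if "i < length xs" "j < length xs" "i \<noteq> j" for i j
    using sorted_wrt_total[OF embed_sorted[OF t], of i j] that t
      left_of_dist[of "embed xs x t i" "embed xs x t j"] left_of_dist[of "embed xs x t j" "embed xs x t i"]
    by (auto simp: trees_iff dist_commute add.commute)
qed (use t trees_admissible in \<open>auto simp: embed_def\<close>)

text \<open>\<open>leaf_map\<close> decides between branches by testing membership in the left one,
  so relabeling has to be injective to keep its decisions.\<close>

lemma leaf_map_map_tree: "inj f \<Longrightarrow> leaf_map (map_tree f t) (f l) = leaf_map t l"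
  by (induction t) (auto simp: leaves_map_tree inj_image_mem_iff)

text \<open>The first assumption makes \<open>leaf_map\<close> take the same branches for
  \<open>k\<close> after substitution as for \<open>l\<close> before it: \<open>k\<close> occurs in
  a substituted subtree exactly if \<open>l\<close> occurs in the original one.\<close>

lemma leaf_map_subst_leaves:
  assumes "\<And>l l'. l \<noteq> l' \<Longrightarrow> set (leaves (f l)) \<inter> set (leaves (f l')) = {}"
    and "l \<in> set (leaves t)" "k \<in> set (leaves (f l))"
  shows "leaf_map (subst_leaves f t) k = affine_comp (leaf_map t l) (leaf_map (f l) k)"
proof -
  have mem: "k \<in> set (leaves (subst_leaves f s)) \<longleftrightarrow> l \<in> set (leaves s)" for s
  proof -
    have "k \<in> set (leaves (f l')) \<longleftrightarrow> l' = l" for l' using assms(1)[of l' l] assms(3) by blast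
    then show ?thesis by (simp add: leaves_subst_leaves)
  qed
  show ?thesis
    using assms(2) by (induction t) (auto simp: affine_comp_assoc mem)
qed

lemma word_ins_decomp:
  assumes "i \<notin> set w1" "i \<notin> set w2"
  shows "word_ins i (w1 @ i # w2) v
    = map (renumber i (length v)) w1 @ map ((+) i) v @ map (renumber i (length v)) w2"
proof -
  have "concat (map (\<lambda>l. if l = i then map ((+) i) v else [renumber i (length v) l]) w) = map (renumber i (length v)) w"
    if "i \<notin> set w" for w using that by (induction w) auto
  then show ?thesis using assms by (simp add: word_ins_def)
qed

text \<open>The inserted letters fill the interval \<open>{i..<i + length ys}\<close>, which is
  exactly what \<open>renumber\<close> leaves free.\<close>

lemma word_ins_words:
  assumes w: "w \<in> words xs x" and i: "i < length xs" and v: "v \<in> words ys (xs ! i)"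
  shows "word_ins i w v \<in> words (graft xs i ys) x"
proof -
  have wv: "distinct w" "set w = {..<length xs}" "distinct v" "set v = {..<length ys}"
    using w v by (auto simp: words_def)
  have len: "length v = length ys" using wv distinct_card[of v] by simp
  obtain w1 w2 where d: "w = w1 @ i # w2" using i wv(2) by (metis lessThan_iff split_list)
  have n: "i \<notin> set w1" "i \<notin> set w2" using wv(1) d by auto
  note e = word_ins_decomp[OF n, of v, folded d, unfolded len]
  have ni: "renumber i (length ys) l \<noteq> i + r" if "l \<noteq> i" "r < length ys" for l r
    using that by (auto simp: renumber_def)
  have inj: "inj_on (renumber i (length ys)) A" if "i \<notin> A" for A
    using that by (intro inj_onI) (metis renumber_eq_iff)
  have A: "set w1 \<union> set w2 = {..<length xs} - {i}" using wv(1,2) d by auto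
  have "set (word_ins i w v) = renumber i (length ys) ` ({..<length xs} - {i}) \<union> (+) i ` {..<length ys}"
    using A wv(4) unfolding e by (simp add: image_Un[symmetric] Un_ac)
  also have "\<dots> = {..<length xs + length ys - 1}"
  proof (intro equalityI subsetI)
    fix j assume "j \<in> {..<length xs + length ys - 1}"
    then have "j < length xs + length ys - 1" by simp
    then show "j \<in> renumber i (length ys) ` ({..<length xs} - {i}) \<union> (+) i ` {..<length ys}"
      using i by (cases rule: splice_index_cases) auto
  qed (use i renumber_less in auto)
  finally have "set (word_ins i w v) = {..<length xs + length ys - 1}" .
  moreover have "distinct (word_ins i w v)"
    using wv d n ni inj unfolding e
    by (auto simp: distinct_map renumber_eq_iff inj_on_def) (metis renumber_eq_iff disjoint_iff)+
  ultimately show ?thesis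
    using w v i admissible_graft by (simp add: words_def length_graft)
qed

lemma omega_words: "t \<in> trees xs x \<Longrightarrow> omega xs x t \<in> words xs x"
  using trees_admissible by (auto simp: words_def omega_def trees_iff)

abbreviation graft_leaves :: "nat \<Rightarrow> nat \<Rightarrow> nat tree \<Rightarrow> nat \<Rightarrow> nat tree" where
  "graft_leaves i m s l \<equiv> (if l = i then map_tree (\<lambda>r. i + r) s else Leaf (renumber i m l))"

lemma trees_ins: "ins OmegaOmega xs x i ys t s = subst_leaves (graft_leaves i (length ys) s) t"
  and trees_one: "one OmegaOmega x = Leaf 0"
  and trees_act: "act OmegaOmega xs x \<sigma> t = map_tree (inv \<sigma>) t"
  by (simp_all add: OmegaOmega_def)

lemma omega_ins:
  "s \<in> trees ys y \<Longrightarrow> omega (graft xs i ys) x (ins OmegaOmega xs x i ys t s) = word_ins i (omega xs x t) (omega ys y s)"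
  by (auto simp: trees_ins omega_def leaves_subst_leaves word_ins_def leaves_map_tree length_leaves
      intro!: arg_cong[of _ _ concat] map_cong)

lemma trees_ins_closed:
  assumes t: "t \<in> trees xs x" and i: "i < length xs" and s: "s \<in> trees ys (xs ! i)"
  shows "ins OmegaOmega xs x i ys t s \<in> trees (graft xs i ys) x"
proof -
  have "typed (graft xs i ys) (subst_leaves (graft_leaves i (length ys) s) t) x"
  proof (rule typed_subst_leaves)
    show "typed xs t x" using t by (simp add: trees_iff)
    fix l assume l: "l < length xs"
    show "typed (graft xs i ys) (graft_leaves i (length ys) s l) (xs ! l)"
    proof (cases "l = i")
      case True
      have "typed (graft xs i ys) (map_tree (\<lambda>r. i + r) s) (xs ! i)"
        by (rule typed_map_tree[of ys]) (use s i in \<open>auto simp: trees_iff length_graft nth_graft_add\<close>)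
      then show ?thesis using True by simp
    next
      case False
      then show ?thesis using l i renumber_less[of l i "length xs" "length ys"]
        by (simp add: nth_graft_renumber length_graft)
    qed
  qed
  \<comment> \<open>Distinctness and the label set concern the word of leaves only, and are known
    from \<open>word_ins_words\<close>.\<close>
  then show ?thesis
    using word_ins_words[OF omega_words[OF t] i omega_words[OF s]] omega_ins[OF s, of xs i x t]
    by (simp add: trees_iff trees_ins omega_def words_def)
qed

lemma trees_act_closed:
  assumes t: "t \<in> trees xs x" and s: "\<sigma> permutes {..<length xs}"
  shows "act OmegaOmega xs x \<sigma> t \<in> trees (permute_list \<sigma> xs) x"
proof -
  note s' = permutes_inv[OF s]
  have i: "inv \<sigma> l < length xs" if "l < length xs" for l using permutes_in_image[OF s'] that by auto
  have "typed (permute_list \<sigma> xs) (map_tree (inv \<sigma>) t) x"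
    by (rule typed_map_tree[of xs])
      (use t i s in \<open>auto simp: trees_iff permute_list_nth permutes_inverses\<close>)
  moreover have "distinct (map (inv \<sigma>) (leaves t))"
    using t permutes_inj[OF s'] by (auto simp: trees_iff distinct_map inj_on_def dest: injD)
  moreover have "inv \<sigma> ` {..<length xs} = {..<length xs}" using permutes_image[OF s'] .
  ultimately show ?thesis using t by (simp add: trees_iff trees_act leaves_map_tree)
qed

lemma embed_ins:
  assumes t: "t \<in> trees xs x" and i: "i < length xs" and s: "s \<in> trees ys (xs ! i)"
  shows "embed (graft xs i ys) x (ins OmegaOmega xs x i ys t s)
    = ins SC xs x i ys (embed xs x t) (embed ys (xs ! i) s)"
proof (rule ext)
  fix j
  let ?f = "graft_leaves i (length ys) s"
  have m: "0 < length ys" using admissible_nonempty[OF trees_admissible[OF s]] .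
  have lt: "set (leaves t) = {..<length xs}" and ls: "set (leaves s) = {..<length ys}"
    using t s by (auto simp: trees_iff)
  have L: "set (leaves (?f l)) = (if l = i then (+) i ` {..<length ys} else {renumber i (length ys) l})" for l
    by (simp add: leaves_map_tree ls)
  have ni: "renumber i (length ys) l \<notin> (+) i ` {..<length ys}" if "l \<noteq> i" for l
    using that by (auto simp: renumber_def)
  have disj: "set (leaves (?f l)) \<inter> set (leaves (?f l')) = {}" if "l \<noteq> l'" for l l'
    unfolding L using that ni[of l] ni[of l'] renumber_eq_iff[of l i l' "length ys"]
    by (cases "l = i"; cases "l' = i") simp_all
  show "embed (graft xs i ys) x (ins OmegaOmega xs x i ys t s) j
      = ins SC xs x i ys (embed xs x t) (embed ys (xs ! i) s) j"
  proof (cases "j < length xs + length ys - 1")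
    case True
    then have j: "embed (graft xs i ys) x (ins OmegaOmega xs x i ys t s) j = leaf_map (subst_leaves ?f t) j"
      using i by (simp add: embed_def trees_ins length_graft)
    show ?thesis
      using True i
    proof (cases rule: splice_index_cases)
      case (outer l)
      then show ?thesis
        unfolding j using leaf_map_subst_leaves[of ?f l t j, OF disj] lt i
        by (simp add: ins_SC splice_renumber embed_def)
    next
      case (inner r)
      have "leaf_map (map_tree (\<lambda>r. i + r) s) (i + r) = leaf_map s r"
        by (rule leaf_map_map_tree) (simp add: inj_def)
      then show ?thesis
        unfolding j using leaf_map_subst_leaves[of ?f i t j, OF disj] lt ls i inner
        by (simp add: ins_SC splice_add embed_def leaves_map_tree)
    qed
  next
    case False
    then show ?thesis
      using i m splice_extensional[of i "length xs" "length ys" "embed xs x t"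
          "\<lambda>r. affine_comp (embed xs x t i) (embed ys (xs ! i) s r)"]
      by (simp add: embed_def ins_SC length_graft extensional_def)
  qed
qed

lemma embed_act:
  assumes s: "\<sigma> permutes {..<length xs}"
  shows "embed (permute_list \<sigma> xs) x (act OmegaOmega xs x \<sigma> t) = act SC xs x \<sigma> (embed xs x t)"
proof (rule ext)
  fix j
  have "leaf_map (map_tree (inv \<sigma>) t) (inv \<sigma> (\<sigma> j)) = leaf_map t (\<sigma> j)"
    by (rule leaf_map_map_tree) (rule permutes_inj[OF permutes_inv[OF s]])
  then show "embed (permute_list \<sigma> xs) x (act OmegaOmega xs x \<sigma> t) j = act SC xs x \<sigma> (embed xs x t) j"
    using permutes_in_image[OF s, of j] by (auto simp: embed_def trees_act act_SC permutes_inverses[OF s])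
qed

lemma embed_one: "embed [x] x (one OmegaOmega x) = one SC x"
  by (auto simp: embed_def trees_one one_SC)

text \<open>A tree with closed output is built from \<open>MuC\<close> alone, and the two maps of
  \<open>MuC\<close> have real centers. This is what distinguishes \<open>F\<close> from
  \<open>MuO\<close> at the root.\<close>

lemma typed_Cl_Im: "typed xs t Cl \<Longrightarrow> l \<in> set (leaves t) \<Longrightarrow> Im (snd (leaf_map t l)) = 0"
proof (induction t)
  case (MuC s t)
  then show ?case by (auto simp: affine_comp_def)
qed auto

lemma affine_comp_cancel: "affine_comp (1/2, b) d = affine_comp (1/2, b) e \<Longrightarrow> d = e"
  by (auto simp: affine_comp_def prod_eq_iff)

text \<open>Centers have norm below 1, so the outer map makes the real part strictly negative on the
  left branch and strictly positive on the right one. The sign recovers the partition of the leaves,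
  and the outer map is then cancelled.\<close>

lemma halves_cancel:
  assumes AB: "A \<inter> B = {}" "A' \<inter> B' = {}" "A \<union> B = A' \<union> B'"
    and ok: "\<And>l. l \<in> A \<Longrightarrow> disk_ok (c l) x (d l)" "\<And>l. l \<in> B \<Longrightarrow> disk_ok (c l) x (e l)"
      "\<And>l. l \<in> A' \<Longrightarrow> disk_ok (c l) x (d' l)" "\<And>l. l \<in> B' \<Longrightarrow> disk_ok (c l) x (e' l)"
    and eq: "\<And>l. l \<in> A \<union> B \<Longrightarrow>
      (if l \<in> A then affine_comp (1/2, -1/2) (d l) else affine_comp (1/2, 1/2) (e l)) =
      (if l \<in> A' then affine_comp (1/2, -1/2) (d' l) else affine_comp (1/2, 1/2) (e' l))"
  shows "A = A'" "B = B'" "\<And>l. l \<in> A \<Longrightarrow> d l = d' l" "\<And>l. l \<in> B \<Longrightarrow> e l = e' l"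
proof -
  have neg: "Re (snd (affine_comp (1/2, -1/2) a)) < 0" and pos: "0 < Re (snd (affine_comp (1/2, 1/2) a))"
    if "disk_ok c x a" for a c
    using disk_ok_center(1)[OF that] abs_Re_le_cmod[of "snd a"] by (auto simp: affine_comp_def)
  have "l \<in> A \<longleftrightarrow> l \<in> A'" if l: "l \<in> A \<union> B" for l
  proof (cases "l \<in> A"; cases "l \<in> A'")
    assume a: "l \<in> A" "l \<notin> A'"
    then have b: "l \<in> B'" using l AB by blast
    have "affine_comp (1/2, -1/2) (d l) = affine_comp (1/2, 1/2) (e' l)" using eq[OF l] by (simp only: a if_True if_False)
    from arg_cong[OF this, of "\<lambda>y. Re (snd y)"] have False
      using neg[OF ok(1)[OF a(1)]] pos[OF ok(4)[OF b]] by linarith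
    then show ?thesis ..
  next
    assume a: "l \<notin> A" "l \<in> A'"
    then have b: "l \<in> B" using l by blast
    have "affine_comp (1/2, 1/2) (e l) = affine_comp (1/2, -1/2) (d' l)" using eq[OF l] by (simp only: a if_True if_False)
    from arg_cong[OF this, of "\<lambda>y. Re (snd y)"] have False
      using neg[OF ok(3)[OF a(2)]] pos[OF ok(2)[OF b]] by linarith
    then show ?thesis ..
  qed auto
  then show A: "A = A'" using AB(3) by blast
  have "B = (A \<union> B) - A" "B' = (A' \<union> B') - A'" using AB(1,2) by blast+
  then show "B = B'" using A AB(3) by simp
  show "d l = d' l" if "l \<in> A" for l
    by (rule affine_comp_cancel[of "-1/2"]) (use eq[of l] that A in \<open>simp only: Un_iff if_True simp_thms\<close>)
  show "e l = e' l" if "l \<in> B" for l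
  proof -
    have "l \<notin> A" "l \<notin> A'" using that AB A by auto
    show ?thesis
      by (rule affine_comp_cancel[of "1/2"]) (use \<open>l \<notin> A\<close> \<open>l \<notin> A'\<close> eq[of l] that in \<open>simp only: Un_iff if_False simp_thms\<close>)
  qed
qed

text \<open>
  The positions determine the root of the tree: all centers have imaginary part \<open>1/2\<close> below \<open>F\<close> and
  less than \<open>1/2\<close> below \<open>MuO\<close>, and the sign of the real part separates the two branches of a product.
\<close>

lemma leaf_map_inj:
  "typed xs t x \<Longrightarrow> typed xs t' x \<Longrightarrow> set (leaves t) = set (leaves t') \<Longrightarrow> distinct (leaves t) \<Longrightarrow>
    distinct (leaves t') \<Longrightarrow> (\<And>l. l \<in> set (leaves t) \<Longrightarrow> leaf_map t l = leaf_map t' l) \<Longrightarrow> t = t'"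
proof (induction t arbitrary: t' x)
  case (Leaf i)
  \<comment> \<open>A bare leaf is the only tree with a disk of radius 1, since every generator
    halves the radii.\<close>
  have p: "fst (leaf_map t' i) = 1" by (metis Leaf.prems(6) fst_conv leaf_map.simps(1) leaves.simps(1) list.set_intros(1))
  have one: "leaf_map t' i \<noteq> affine_comp (1/2, b) (leaf_map s i)"
    if "typed xs s y" "i \<in> set (leaves s)" for s b y
    using disk_ok_center(2)[OF typed_leaf_disk_ok[OF that]] p
    by (auto simp: affine_comp_def)
  show ?case
  proof (cases t')
    case (MuC s1 s2)
    then have "i \<in> set (leaves s1) \<or> i \<in> set (leaves s2)" using Leaf.prems(3) by auto
    then show ?thesis using MuC Leaf.prems(2) one[of s1 Cl "-1/2"] one[of s2 Cl "1/2"]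
      by (cases "i \<in> set (leaves s1)") simp_all
  next
    case (MuO s1 s2)
    then have "i \<in> set (leaves s1) \<or> i \<in> set (leaves s2)" using Leaf.prems(3) by auto
    then show ?thesis using MuO Leaf.prems(2) one[of s1 Op "-1/2"] one[of s2 Op "1/2"]
      by (cases "i \<in> set (leaves s1)") simp_all
  next
    case (F s)
    then show ?thesis using Leaf.prems(2,3) one[of s Cl] by auto
  qed (use Leaf.prems in auto)
next
  case (MuC s1 s2)
  show ?case
  proof (cases t')
    case (Leaf i)
    then have "i \<in> set (leaves s1) \<or> i \<in> set (leaves s2)" using MuC.prems(3) by auto
    moreover have "fst (affine_comp (1/2, b) (leaf_map s i)) < 1" if "typed xs s Cl" "i \<in> set (leaves s)" for s b
      using disk_ok_center(2)[OF typed_leaf_disk_ok[OF that]] by (simp add: affine_comp_def)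
    ultimately show ?thesis using MuC.prems(1,3) MuC.prems(6)[of i] Leaf
      by (auto split: if_splits) (metis fst_conv less_irrefl)+
  next
    case t': (MuC s1' s2')
    let ?A = "set (leaves s1)" and ?B = "set (leaves s2)"
      and ?A' = "set (leaves s1')" and ?B' = "set (leaves s2')"
    have ty: "typed xs s1 Cl" "typed xs s2 Cl" "typed xs s1' Cl" "typed xs s2' Cl"
      using MuC.prems(1,2) t' by simp_all
    have dj: "?A \<inter> ?B = {}" "?A' \<inter> ?B' = {}" and un: "?A \<union> ?B = ?A' \<union> ?B'"
      using MuC.prems(3-5) t' by simp_all
    have eq: "(if l \<in> ?A then affine_comp (1/2, -1/2) (leaf_map s1 l) else affine_comp (1/2, 1/2) (leaf_map s2 l)) =
      (if l \<in> ?A' then affine_comp (1/2, -1/2) (leaf_map s1' l) else affine_comp (1/2, 1/2) (leaf_map s2' l))"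
      if "l \<in> ?A \<union> ?B" for l
      using MuC.prems(6)[of l] that unfolding t' leaf_map.simps leaves.simps set_append by blast
    note L = halves_cancel[OF dj un typed_leaf_disk_ok[OF ty(1)] typed_leaf_disk_ok[OF ty(2)]
        typed_leaf_disk_ok[OF ty(3)] typed_leaf_disk_ok[OF ty(4)] eq]
    have "s1 = s1'"
      by (rule MuC.IH(1)[of Cl]) (use MuC.prems(4,5) ty t' L in simp_all)
    moreover have "s2 = s2'"
      by (rule MuC.IH(2)[of Cl]) (use MuC.prems(4,5) ty t' L in simp_all)
    ultimately show ?thesis using t' by simp
  qed (use MuC.prems in auto)
next
  case (F s)
  have x: "x = Op" using F.prems by simp
  show ?case
  proof (cases t')
    case (Leaf i)
    then show ?thesis using F.prems(1,3) F.prems(6)[of i] disk_ok_center(2)[OF typed_leaf_disk_ok, of xs s Cl i]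
      by (auto simp: affine_comp_def)
  next
    case t': (F s')
    have "s = s'"
    proof (rule F.IH[of Cl])
      show "typed xs s Cl" "typed xs s' Cl" "set (leaves s) = set (leaves s')"
        "distinct (leaves s)" "distinct (leaves s')"
        using F.prems(1-5) t' by simp_all
      show "leaf_map s l = leaf_map s' l" if "l \<in> set (leaves s)" for l
        by (rule affine_comp_cancel[of "\<i>/2"]) (use F.prems(6)[of l] that t' in simp)
    qed
    then show ?thesis using t' by simp
  next
    case t': (MuO s1 s2)
    obtain l where l: "l \<in> set (leaves s1)" using leaves_nonempty[of s1] by (cases "leaves s1") auto
    then have "Im (snd (leaf_map t' l)) < 1/2"
      using disk_ok_center(1)[OF typed_leaf_disk_ok, of xs s1 Op l] F.prems(2) t'
        abs_Im_le_cmod[of "snd (leaf_map s1 l)"] by (auto simp: affine_comp_def)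
    moreover have "Im (snd (leaf_map (F s) l)) = 1/2"
      using typed_Cl_Im[of xs s l] F.prems(1,3) l t' by (auto simp: affine_comp_def)
    ultimately show ?thesis using F.prems(3,6) l t' by auto
  qed (use F.prems in auto)
next
  case (MuO s1 s2)
  show ?case
  proof (cases t')
    case (Leaf i)
    then have "i \<in> set (leaves s1) \<or> i \<in> set (leaves s2)" using MuO.prems(3) by auto
    moreover have "fst (affine_comp (1/2, b) (leaf_map s i)) < 1" if "typed xs s Op" "i \<in> set (leaves s)" for s b
      using disk_ok_center(2)[OF typed_leaf_disk_ok[OF that]] by (simp add: affine_comp_def)
    ultimately show ?thesis using MuO.prems(1,3) MuO.prems(6)[of i] Leaf
      by (auto split: if_splits) (metis fst_conv less_irrefl)+
  next
    case t': (F s)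
    obtain l where l: "l \<in> set (leaves s1)" using leaves_nonempty[of s1] by (cases "leaves s1") auto
    then have "Im (snd (leaf_map (MuO s1 s2) l)) < 1/2"
      using disk_ok_center(1)[OF typed_leaf_disk_ok, of xs s1 Op l] MuO.prems(1)
        abs_Im_le_cmod[of "snd (leaf_map s1 l)"] by (auto simp: affine_comp_def)
    moreover have "Im (snd (leaf_map t' l)) = 1/2"
      using typed_Cl_Im[of xs s l] MuO.prems(2,3) l t' by (auto simp: affine_comp_def)
    ultimately show ?thesis using MuO.prems(6)[of l] l by auto
  next
    case t': (MuO s1' s2')
    let ?A = "set (leaves s1)" and ?B = "set (leaves s2)"
      and ?A' = "set (leaves s1')" and ?B' = "set (leaves s2')"
    have ty: "typed xs s1 Op" "typed xs s2 Op" "typed xs s1' Op" "typed xs s2' Op"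
      using MuO.prems(1,2) t' by simp_all
    have dj: "?A \<inter> ?B = {}" "?A' \<inter> ?B' = {}" and un: "?A \<union> ?B = ?A' \<union> ?B'"
      using MuO.prems(3-5) t' by simp_all
    have eq: "(if l \<in> ?A then affine_comp (1/2, -1/2) (leaf_map s1 l) else affine_comp (1/2, 1/2) (leaf_map s2 l)) =
      (if l \<in> ?A' then affine_comp (1/2, -1/2) (leaf_map s1' l) else affine_comp (1/2, 1/2) (leaf_map s2' l))"
      if "l \<in> ?A \<union> ?B" for l
      using MuO.prems(6)[of l] that unfolding t' leaf_map.simps leaves.simps set_append by blast
    note L = halves_cancel[OF dj un typed_leaf_disk_ok[OF ty(1)] typed_leaf_disk_ok[OF ty(2)]
        typed_leaf_disk_ok[OF ty(3)] typed_leaf_disk_ok[OF ty(4)] eq]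
    have "s1 = s1'"
      by (rule MuO.IH(1)[of Op]) (use MuO.prems(4,5) ty t' L in simp_all)
    moreover have "s2 = s2'"
      by (rule MuO.IH(2)[of Op]) (use MuO.prems(4,5) ty t' L in simp_all)
    ultimately show ?thesis using t' by simp
  qed (use MuO.prems in auto)
qed

lemma embed_inj: "inj_on (embed xs x) (trees xs x)"
proof (rule inj_onI)
  fix t t' assume t: "t \<in> trees xs x" "t' \<in> trees xs x" and eq: "embed xs x t = embed xs x t'"
  show "t = t'"
  proof (rule leaf_map_inj[of xs t x])
    show "leaf_map t l = leaf_map t' l" if "l \<in> set (leaves t)" for l
      using that t fun_cong[OF eq, of l] by (simp add: trees_iff embed_def)
  qed (use t in \<open>auto simp: trees_iff\<close>)
qed

text \<open>The tree is a right comb of products over the letters of \<open>w\<close>, with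
  \<open>F\<close> on each closed letter when the output is open.\<close>

lemma tree_with_leaves:
  "w \<noteq> [] \<Longrightarrow> (\<And>i. i \<in> set w \<Longrightarrow> i < length xs \<and> (x = Cl \<longrightarrow> xs ! i = Cl)) \<Longrightarrow>
    \<exists>t. typed xs t x \<and> leaves t = w"
proof (induction w)
  case (Cons i w)
  have i: "\<exists>t. typed xs t x \<and> leaves t = [i]"
  proof (cases "xs ! i = x")
    case True
    then show ?thesis using Cons.prems by (intro exI[of _ "Leaf i"]) auto
  next
    case False
    then have "x = Op" "xs ! i = Cl" using Cons.prems(2)[of i] by (cases x; cases "xs ! i"; auto)+
    then show ?thesis using Cons.prems by (intro exI[of _ "tree.F (Leaf i)"]) auto
  qed
  show ?case
  proof (cases "w = []")
    case False
    then obtain s t where "typed xs s x" "leaves s = [i]" "typed xs t x" "leaves t = w"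
      using i Cons by auto
    then show ?thesis
      by (cases x; intro exI[of _ "(if x = Cl then MuC else MuO) s t"]) auto
  qed (use i in auto)
qed simp

lemma omega_image: "omega xs x ` trees xs x = words xs x"
proof
  show "words xs x \<subseteq> omega xs x ` trees xs x"
  proof
    fix w assume w: "w \<in> words xs x"
    have a: "admissible xs x" using w by (simp add: words_def)
    have "xs ! i = Cl" if "i < length xs" "x = Cl" for i
      using a that(2) nth_mem[OF that(1)] by (cases "xs ! i") (auto simp: admissible_def)
    moreover have sw: "set w = {..<length xs}" using w by (simp add: words_def)
    then have "w \<noteq> []" using admissible_nonempty[OF a] by (metis empty_iff empty_set lessThan_iff)
    ultimately obtain t where t: "typed xs t x" "leaves t = w"
      using tree_with_leaves[of w xs x] sw by blast
    have "distinct w" using w by (simp add: words_def)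
    then have "t \<in> trees xs x" unfolding trees_iff t(2) using t(1) sw by blast
    then show "w \<in> omega xs x ` trees xs x"
      unfolding omega_def t(2)[symmetric] by (rule imageI)
  qed
qed (auto intro: omega_words)


section \<open>Homotopies with end points in prescribed sets\<close>

text \<open>The relation behind \<open>braid_homotopic\<close> for one fixed pair of end sets, with
  the homotopy written as a map on the unit square whose first coordinate is the homotopy
  time.\<close>

definition end_homotopic ::
  "'a::topological_space set \<Rightarrow> 'a set \<Rightarrow> 'a set \<Rightarrow> (real \<Rightarrow> 'a) \<Rightarrow> (real \<Rightarrow> 'a) \<Rightarrow> bool" where
  "end_homotopic X A B p q \<longleftrightarrow> (\<exists>h. continuous_on ({0..1} \<times> {0..1}) h \<and> h ` ({0..1} \<times> {0..1}) \<subseteq> X \<and>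
     (\<forall>t\<in>{0..1}. h (0, t) = p t \<and> h (1, t) = q t) \<and> (\<forall>s\<in>{0..1::real}. h (s, 0) \<in> A \<and> h (s, 1) \<in> B))"

lemma end_homotopic_iff:
  "end_homotopic X A B p q \<longleftrightarrow>
    homotopic_with_canon (\<lambda>h. pathstart h \<in> A \<and> pathfinish h \<in> B) {0..1} X p q"
proof -
  have "homotopic_with_canon (\<lambda>h. pathstart h \<in> A \<and> pathfinish h \<in> B) {0..1} X p q \<longleftrightarrow>
    (\<exists>h. continuous_map (prod_topology (top_of_set {0..1::real}) (top_of_set {0..1::real})) (top_of_set X) h \<and>
      (\<forall>x\<in>{0..1}. h (0, x) = p x) \<and> (\<forall>x\<in>{0..1}. h (1, x) = q x) \<and>
      (\<forall>t\<in>{0..1}. pathstart (\<lambda>x. h (t, x)) \<in> A \<and> pathfinish (\<lambda>x. h (t, x)) \<in> B))"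
    by (subst homotopic_with) (simp_all add: pathstart_def pathfinish_def)
  also have "prod_topology (top_of_set {0..1::real}) (top_of_set {0..1::real}) = top_of_set ({0..1} \<times> {0..1})"
    by simp
  finally show ?thesis
    unfolding end_homotopic_def pathstart_def pathfinish_def
    by (simp add: image_subset_iff_funcset[symmetric] conj_assoc ball_conj_distrib)
qed

lemma end_homotopic_sym: "end_homotopic X A B p q \<Longrightarrow> end_homotopic X A B q p"
  unfolding end_homotopic_iff by (rule homotopic_with_symD)

lemma end_homotopic_trans [trans]:
  "end_homotopic X A B p q \<Longrightarrow> end_homotopic X A B q r \<Longrightarrow> end_homotopic X A B p r"
  unfolding end_homotopic_iff by (rule homotopic_with_trans)

lemma end_homotopic_path_in:
  assumes "end_homotopic X A B p q"
  shows "path_in X p" "p 0 \<in> A" "p 1 \<in> B"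
proof -
  have "end_homotopic X A B p p" using assms end_homotopic_sym end_homotopic_trans by blast
  then show "path_in X p" "p 0 \<in> A" "p 1 \<in> B"
    by (auto simp: end_homotopic_iff path_in_iff pathstart_def pathfinish_def)
qed

lemma end_homotopic_refl: "path_in X p \<Longrightarrow> p 0 \<in> A \<Longrightarrow> p 1 \<in> B \<Longrightarrow> end_homotopic X A B p p"
  by (auto simp: end_homotopic_iff path_in_iff pathstart_def pathfinish_def)

lemma end_homotopic_homotopic_paths:
  assumes "homotopic_paths X p q" "p 0 \<in> A" "p 1 \<in> B"
  shows "end_homotopic X A B p q"
  using assms unfolding end_homotopic_iff homotopic_paths_def
  by (auto simp: pathstart_def pathfinish_def elim!: homotopic_with_mono)

text \<open>An initial piece that stays in \<open>A\<close> is removed by letting the starting point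
  slide along it.\<close>

lemma end_homotopic_absorb_left:
  assumes p: "path_in X p" "p 1 \<in> B" and a: "path_in X a" "a ` {0..1} \<subseteq> A" "a 1 = p 0"
  shows "end_homotopic X A B (a +++ p) p"
proof -
  have j: "path_in X (a +++ p)" using assms by (intro path_in_join) (auto simp: pathstart_def pathfinish_def)
  \<comment> \<open>At homotopy time \<open>s\<close> the path time runs through
    \<open>[s/2, 1]\<close>; at \<open>s = 1\<close> only the second half of the join, that is
    \<open>p\<close>, is left.\<close>
  let ?\<tau> = "\<lambda>y::real \<times> real. fst y / 2 + snd y * (1 - fst y / 2)"
  have r: "?\<tau> y \<in> {0..1}" if y: "y \<in> {0..1} \<times> {0..1}" for y
  proof -
    have "snd y * (1 - fst y / 2) \<le> 1 * (1 - fst y / 2)" "0 \<le> snd y * (1 - fst y / 2)"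
      using y by (auto intro!: mult_right_mono)
    then show ?thesis using y by auto
  qed
  have "continuous_on ({0..1} \<times> {0..1}) (\<lambda>y. (a +++ p) (?\<tau> y))"
  proof (rule continuous_on_compose2[of "{0..1}" "a +++ p"])
    show "continuous_on {0..1} (a +++ p)" using j by (simp add: path_in_iff)
    show "continuous_on ({0..1} \<times> {0..1}) ?\<tau>" by (intro continuous_intros) simp_all
    show "?\<tau> ` ({0..1} \<times> {0..1}) \<subseteq> {0..1}" using r by blast
  qed
  moreover have "(a +++ p) (?\<tau> (1, t)) = p t" if "t \<in> {0..1}" for t
  proof (cases "t = 0")
    case False
    then have "\<not> ?\<tau> (1, t) \<le> 1/2" "2 * ?\<tau> (1, t) - 1 = t" using that by (auto simp: field_simps)
    then show ?thesis by (simp add: joinpaths_def)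
  qed (use a(3) in \<open>simp add: joinpaths_def\<close>)
  moreover have "(a +++ p) (?\<tau> (s, 0)) \<in> A" "(a +++ p) (?\<tau> (s, 1)) \<in> B" if "s \<in> {0..1}" for s
    using that a p by (auto simp: joinpaths_def)
  ultimately show ?thesis
    unfolding end_homotopic_def using j r
    by (intro exI[of _ "\<lambda>y. (a +++ p) (?\<tau> y)"]) (auto simp: path_in_iff)
qed

lemma end_homotopic_reverse:
  assumes "end_homotopic X A B p q"
  shows "end_homotopic X B A (reversepath p) (reversepath q)"
proof -
  obtain h where h: "continuous_on ({0..1} \<times> {0..1}) h" "h ` ({0..1} \<times> {0..1}) \<subseteq> X"
     "\<forall>t\<in>{0..1}. h (0, t) = p t \<and> h (1, t) = q t" "\<forall>s\<in>{0..1::real}. h (s, 0) \<in> A \<and> h (s, 1) \<in> B"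
    using assms unfolding end_homotopic_def by blast
  have "continuous_on ({0..1} \<times> {0..1}) (\<lambda>y. h (fst y, 1 - snd y))"
    by (rule continuous_on_compose2[OF h(1)]) (auto intro!: continuous_intros)
  then show ?thesis
    unfolding end_homotopic_def using h(2-4)
    by (intro exI[of _ "\<lambda>y. h (fst y, 1 - snd y)"]) (auto simp: reversepath_def)
qed

lemma end_homotopic_absorb_right:
  assumes "path_in X p" "p 0 \<in> A" "path_in X b" "b ` {0..1} \<subseteq> B" "b 0 = p 1"
  shows "end_homotopic X A B (p +++ b) p"
proof -
  have *: "path_image (reversepath b) \<subseteq> B" using assms by (simp add: path_image_def[of b])
  have "end_homotopic X B A (reversepath b +++ reversepath p) (reversepath p)"
    using assms * by (intro end_homotopic_absorb_left path_in_reverse) (auto simp: reversepath_def path_image_def)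
  moreover have "pathfinish (reversepath b) = pathstart (reversepath p)"
    using assms(5) by (simp add: pathstart_def pathfinish_def reversepath_def)
  ultimately show ?thesis
    using end_homotopic_reverse reversepath_joinpaths by (metis reversepath_reversepath)
qed

subsection \<open>Convex combinations of finite tuples\<close>

text \<open>Tuples are \<open>undefined\<close> outside \<open>{..<n}\<close>, so a combination has
  to be restricted in order to be a tuple again.\<close>

definition mix :: "nat \<Rightarrow> real \<Rightarrow> (nat \<Rightarrow> 'v::real_vector) \<Rightarrow> (nat \<Rightarrow> 'v) \<Rightarrow> nat \<Rightarrow> 'v" where
  "mix n t f g = (\<lambda>i\<in>{..<n}. (1 - t) *\<^sub>R f i + t *\<^sub>R g i)"

lemma mix_extensional [simp]: "mix n t f g \<in> extensional {..<n}"
  by (simp add: mix_def)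

lemma mix_0 [simp]: "f \<in> extensional {..<n} \<Longrightarrow> mix n 0 f g = f"
  and mix_1 [simp]: "g \<in> extensional {..<n} \<Longrightarrow> mix n 1 f g = g"
  and mix_same [simp]: "f \<in> extensional {..<n} \<Longrightarrow> mix n t f f = f"
  by (auto simp: mix_def extensional_def algebra_simps)

lemma mix_nth: "i < n \<Longrightarrow> mix n t f g i = (1 - t) *\<^sub>R f i + t *\<^sub>R g i"
  by (simp add: mix_def)

text \<open>Coordinates beyond \<open>n\<close> are constantly \<open>undefined\<close>, so finitely
  many coordinates remain to be examined.\<close>

lemma continuous_on_tuple:
  fixes f :: "'x::topological_space \<Rightarrow> nat \<Rightarrow> 'v::topological_space"
  assumes "\<And>i. i < n \<Longrightarrow> continuous_on S (\<lambda>y. f y i)" "\<And>y. y \<in> S \<Longrightarrow> f y \<in> extensional {..<n}"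
  shows "continuous_on S f"
proof (rule continuous_on_coordinatewise_then_product)
  fix i show "continuous_on S (\<lambda>y. f y i)"
  proof (cases "i < n")
    case False
    then have "continuous_on S (\<lambda>y. f y i) \<longleftrightarrow> continuous_on S (\<lambda>y. undefined :: 'v)"
      using assms(2) by (intro continuous_on_cong) (auto simp: extensional_def)
    then show ?thesis by simp
  qed (rule assms)
qed

lemma continuous_on_mix:
  fixes f g :: "'x::topological_space \<Rightarrow> nat \<Rightarrow> 'v::real_normed_vector"
  assumes "continuous_on S f" "continuous_on S g" "continuous_on S t"
  shows "continuous_on S (\<lambda>y. mix n (t y) (f y) (g y))"
proof (rule continuous_on_tuple[of n])
  have [continuous_intros]: "continuous_on S (\<lambda>y. f y i)" "continuous_on S (\<lambda>y. g y i)" for i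
    using assms by (auto intro: continuous_on_product_then_coordinatewise)
  show "continuous_on S (\<lambda>y. mix n (t y) (f y) (g y) i)" if "i < n" for i
    using that assms(3) by (auto simp: mix_nth intro!: continuous_intros)
qed simp

text \<open>The counterpart of convexity in the space of \<open>n\<close>-tuples; it will be applied
  to cells.\<close>

definition mix_closed :: "nat \<Rightarrow> (nat \<Rightarrow> 'v::real_normed_vector) set \<Rightarrow> bool" where
  "mix_closed n A \<longleftrightarrow> A \<subseteq> extensional {..<n} \<and> (\<forall>f\<in>A. \<forall>g\<in>A. \<forall>t\<in>{0..1}. mix n t f g \<in> A)"

lemma path_in_mix:
  fixes f g :: "nat \<Rightarrow> 'v::real_normed_vector"
  assumes "\<And>t. t \<in> {0..1} \<Longrightarrow> mix n t f g \<in> A"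
  shows "path_in A (\<lambda>t. mix n t f g)"
  unfolding path_in_iff
  by (intro conjI ballI assms continuous_on_mix continuous_on_const continuous_on_id)

text \<open>Every point of the loop moves straight to \<open>a\<close>; the ends are already there,
  so they stay fixed.\<close>

lemma homotopic_paths_mix_closed:
  fixes p :: "real \<Rightarrow> nat \<Rightarrow> 'v::real_normed_vector"
  assumes A: "mix_closed n A" and p: "path_in A p" "p 0 = a" "p 1 = a"
  shows "homotopic_paths A p (\<lambda>_. a)"
  unfolding homotopic_paths
proof (intro exI conjI ballI)
  let ?h = "\<lambda>y. mix n (fst y) (p (snd y)) a"
  have a: "a \<in> A" using path_inD[OF p(1), of 0] p(2) by simp
  have e: "p t \<in> extensional {..<n}" if "t \<in> {0..1}" for t
    using path_inD[OF p(1) that] A by (auto simp: mix_closed_def)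
  have "continuous_on ({0..1} \<times> {0..1}) (\<lambda>y::real \<times> real. p (snd y))"
    by (rule continuous_on_compose2[of "{0..1}" p])
      (use p in \<open>auto simp: path_in_iff intro!: continuous_on_snd continuous_on_id\<close>)
  then show "continuous_on ({0..1} \<times> {0..1}) ?h"
    by (intro continuous_on_mix continuous_on_fst continuous_on_snd continuous_on_id continuous_on_const)
  show "?h \<in> {0..1} \<times> {0..1} \<rightarrow> A"
    using A a path_inD[OF p(1)] by (auto simp: mix_closed_def)
  show "?h (0, t) = p t" if "t \<in> {0..1}" for t using e[OF that] by simp
  show "?h (1, t) = a" for t using a A by (auto simp: mix_closed_def)
  show "pathstart (?h \<circ> Pair t) = pathstart p" "pathfinish (?h \<circ> Pair t) = pathfinish p" for t
    using a A p by (auto simp: mix_closed_def pathstart_def pathfinish_def subset_iff)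
qed

text \<open>At intermediate times the first homotopy ends and the second starts at possibly
  different points of \<open>B\<close>, so they cannot be joined directly. Convexity of
  \<open>B\<close> supplies a segment between these points.\<close>

lemma end_homotopic_join:
  fixes p q r s :: "real \<Rightarrow> nat \<Rightarrow> 'v::real_normed_vector"
  assumes pq: "end_homotopic X A B p q" and rs: "end_homotopic X B C r s"
    and B: "mix_closed n B" "B \<subseteq> X" and e: "p 1 = r 0" "q 1 = s 0"
  shows "end_homotopic X A C (p +++ r) (q +++ s)"
proof -
  obtain h where h: "continuous_on ({0..1} \<times> {0..1}) h" "h ` ({0..1} \<times> {0..1}) \<subseteq> X"
     "\<forall>t\<in>{0..1}. h (0, t) = p t \<and> h (1, t) = q t" "\<forall>s\<in>{0..1::real}. h (s, 0) \<in> A \<and> h (s, 1) \<in> B"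
    using pq unfolding end_homotopic_def by blast
  obtain k where k: "continuous_on ({0..1} \<times> {0..1}) k" "k ` ({0..1} \<times> {0..1}) \<subseteq> X"
     "\<forall>t\<in>{0..1}. k (0, t) = r t \<and> k (1, t) = s t" "\<forall>s\<in>{0..1::real}. k (s, 0) \<in> B \<and> k (s, 1) \<in> C"
    using rs unfolding end_homotopic_def by blast
  \<comment> \<open>The bridging segment, which is constant at homotopy times 0 and 1 because of
    \<open>e\<close>.\<close>
  let ?m = "\<lambda>u t. mix n t (h (u, 1)) (k (u, 0))"
  let ?j = "\<lambda>u. ((\<lambda>t. h (u, t)) +++ ?m u) +++ (\<lambda>t. k (u, t))"
  have c: "continuous_on ({0..1} \<times> {0..1}) (\<lambda>y. h (fst y, snd y))"
    "continuous_on ({0..1} \<times> {0..1}) (\<lambda>y. k (fst y, snd y))" using h(1) k(1) by simp_all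
  have "continuous_on ({0..1} \<times> {0..1}) (\<lambda>y::real \<times> real. h (fst y, 1))"
    "continuous_on ({0..1} \<times> {0..1}) (\<lambda>y::real \<times> real. k (fst y, 0))"
    by (rule continuous_on_compose2[OF h(1)] continuous_on_compose2[OF k(1)];
        auto intro!: continuous_intros)+
  then have m: "continuous_on ({0..1} \<times> {0..1}) (\<lambda>y::real \<times> real. ?m (fst y) (snd y))"
    by (intro continuous_on_mix continuous_on_fst continuous_on_snd continuous_on_id continuous_on_const)
  have ends: "h (u, 1) \<in> B" "k (u, 0) \<in> B" "h (u, 1) \<in> extensional {..<n}" "k (u, 0) \<in> extensional {..<n}"
    if "u \<in> {0..1}" for u using h(4) k(4) that B(1) by (auto simp: mix_closed_def)
  have "continuous_on ({0..1} \<times> {0..1}) (\<lambda>y. ?j (fst y) (snd y))"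
    by (intro continuous_on_homotopic_join_lemma c m) (use ends in \<open>auto simp: pathstart_def pathfinish_def joinpaths_def\<close>)
  moreover have "?j u t \<in> X" if "u \<in> {0..1}" "t \<in> {0..1}" for u t
  proof -
    have "?m u t' \<in> X" if "t' \<in> {0..1}" for t'
      using ends[OF \<open>u \<in> {0..1}\<close>] B that by (auto simp: mix_closed_def)
    then show ?thesis using h(2) k(2) that by (auto simp: joinpaths_def)
  qed
  moreover have "?j u 0 \<in> A" "?j u 1 \<in> C" if "u \<in> {0..1}" for u
    using h(4) k(4) that by (auto simp: joinpaths_def)
  ultimately have J: "end_homotopic X A C (?j 0) (?j 1)"
    unfolding end_homotopic_def by (intro exI[of _ "\<lambda>y. ?j (fst y) (snd y)"]) auto
  \<comment> \<open>At the two extreme times the bridge is constant and can be removed up to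
    homotopy with fixed ends.\<close>
  have K: "end_homotopic X A C (?j u) (f +++ g)"
    if u: "u \<in> {0..1}" and f: "\<forall>t\<in>{0..1}. h (u, t) = f t" "\<forall>t\<in>{0..1}. k (u, t) = g t" and fg: "f 1 = g 0"
      and P: "path_in X f" "path_in X g" for u f g
  proof -
    have "path_in X ((f +++ (\<lambda>_. pathfinish f)) +++ g)"
      using P path_in_ends[OF P(1)] fg
      by (intro path_in_join path_in_const) (auto simp: pathstart_def pathfinish_def joinpaths_def)
    moreover have "?m u t = f 1" for t
      using f fg ends[OF u] by simp
    then have "((f +++ (\<lambda>_. pathfinish f)) +++ g) t = ?j u t" if "t \<in> {0..1}" for t
      using f that by (auto simp: joinpaths_def pathfinish_def)
    ultimately have "homotopic_paths X ((f +++ (\<lambda>_. pathfinish f)) +++ g) (?j u)"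
      by (intro homotopic_paths_eq) (auto simp: path_in_def)
    moreover have "homotopic_paths X ((f +++ (\<lambda>_. pathfinish f)) +++ g) (f +++ g)"
      using P fg homotopic_paths_const_right[OF P(1)]
      by (intro homotopic_paths_join) (auto simp: path_in_homotopic pathstart_def pathfinish_def joinpaths_def)
    ultimately have "homotopic_paths X (?j u) (f +++ g)"
      using homotopic_paths_sym homotopic_paths_trans by blast
    moreover have "?j u 0 \<in> A" "?j u 1 \<in> C"
      using h(4) k(4) u by (auto simp: joinpaths_def)
    ultimately show ?thesis by (rule end_homotopic_homotopic_paths)
  qed
  have "end_homotopic X A C (?j 0) (p +++ r)"
    using h(3) k(3) e by (intro K end_homotopic_path_in(1)[OF pq] end_homotopic_path_in(1)[OF rs]) auto
  moreover have "end_homotopic X A C (?j 1) (q +++ s)"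
    using h(3) k(3) e
    by (intro K end_homotopic_path_in(1)[OF end_homotopic_sym[OF pq]]
        end_homotopic_path_in(1)[OF end_homotopic_sym[OF rs]]) auto
  ultimately show ?thesis
    using J end_homotopic_sym end_homotopic_trans by blast
qed

lemma end_homotopic_image:
  assumes "end_homotopic X A B p q" "continuous_on X f" "f ` X \<subseteq> Y" "f ` (X \<inter> A) \<subseteq> A'" "f ` (X \<inter> B) \<subseteq> B'"
  shows "end_homotopic Y A' B' (f \<circ> p) (f \<circ> q)"
proof -
  obtain h where h: "continuous_on ({0..1} \<times> {0..1}) h" "h ` ({0..1} \<times> {0..1}) \<subseteq> X"
     "\<forall>t\<in>{0..1}. h (0, t) = p t \<and> h (1, t) = q t" "\<forall>s\<in>{0..1::real}. h (s, 0) \<in> A \<and> h (s, 1) \<in> B"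
    using assms(1) unfolding end_homotopic_def by blast
  have "continuous_on ({0..1} \<times> {0..1}) (f \<circ> h)"
    using continuous_on_compose[OF h(1)] continuous_on_subset[OF assms(2) h(2)] by blast
  then show ?thesis
    unfolding end_homotopic_def using h(2-4) assms(3-5)
    by (intro exI[of _ "f \<circ> h"]) (auto simp: image_subset_iff)
qed


section \<open>Configurations and the centers of disks\<close>

lemma Conf_iff: "z \<in> Conf xs x \<longleftrightarrow> z \<in> extensional {..<length xs} \<and> admissible xs x \<and>
    (\<forall>i<length xs. \<forall>j<length xs. i \<noteq> j \<longrightarrow> z i \<noteq> z j) \<and> (\<forall>i<length xs. z i \<in> place (xs ! i) x)"
  by (auto simp: Conf_def inj_on_def)

lemma place_iff: "z \<in> place c x \<longleftrightarrow> norm z \<le> 1 \<and> (x = Cl \<longrightarrow> norm z < 1) \<and>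
    (x = Op \<and> c = Cl \<longrightarrow> Im z > 0) \<and> (x = Op \<and> c = Op \<longrightarrow> Im z = 0)"
  by (cases c; cases x) auto

lemma cellD: "z \<in> cell xs x w \<Longrightarrow> z \<in> Conf xs x"
  by (simp add: cell_def)

text \<open>The strict order of the real parts survives convex combinations and keeps the points
  distinct along a segment; without a common order points could collide on the way.\<close>

lemma mix_closed_cell:
  assumes w: "w \<in> words xs x"
  shows "mix_closed (length xs) (cell xs x w)"
  unfolding mix_closed_def
proof (intro conjI ballI)
  show "cell xs x w \<subseteq> extensional {..<length xs}" by (auto simp: cell_def Conf_iff)
  fix f g and t :: real assume f: "f \<in> cell xs x w" and g: "g \<in> cell xs x w" and t: "t \<in> {0..1}"
  let ?m = "mix (length xs) t f g"
  have less: "(1 - t) * a + t * b < (1 - t) * c + t * d" if "a < c" "b < d" for a b c d :: real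
  proof (cases "t = 0")
    case False
    then have "t * b < t * d" "(1 - t) * a \<le> (1 - t) * c" using t that by (auto intro: mult_left_mono)
    then show ?thesis by linarith
  qed (use that in simp)
  have sorted: "sorted_wrt (\<lambda>i j. Re (?m i) < Re (?m j)) w"
  proof -
    have "sorted_wrt (\<lambda>i j. Re (f i) < Re (f j) \<and> Re (g i) < Re (g j)) w"
      using f g by (auto simp: cell_def sorted_wrt_iff_nth_less)
    then show ?thesis
      by (rule sorted_wrt_mono_rel[rotated]) (use w less in \<open>auto simp: words_def mix_nth\<close>)
  qed
  have "?m i \<noteq> ?m j" if "i < length xs" "j < length xs" "i \<noteq> j" for i j
  proof -
    have "i \<in> set w" "j \<in> set w" using w that(1,2) by (simp_all add: words_def)
    from sorted_wrt_total[OF sorted this that(3)] show ?thesis by force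
  qed
  moreover have "?m i \<in> place (xs ! i) x" if i: "i < length xs" for i
  proof -
    have p: "f i \<in> place (xs ! i) x" "g i \<in> place (xs ! i) x" using f g i by (auto simp: cell_def Conf_iff)
    have "norm (?m i) \<le> (1 - t) * norm (f i) + t * norm (g i)"
      using t i norm_triangle_ineq[of "(1 - t) *\<^sub>R f i" "t *\<^sub>R g i"] by (simp add: mix_nth)
    moreover have "(1 - t) * norm (f i) + t * norm (g i) \<le> (1 - t) * 1 + t * 1"
      using p t by (intro add_mono mult_left_mono) (auto simp: place_iff)
    moreover have "(1 - t) * norm (f i) + t * norm (g i) < (1 - t) * 1 + t * 1" if "x = Cl"
      using p that by (intro less) (auto simp: place_iff)
    moreover have "(1 - t) * 0 + t * 0 < (1 - t) * Im (f i) + t * Im (g i)" if "x = Op" "xs ! i = Cl"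
      using p that by (intro less) (auto simp: place_iff)
    ultimately show ?thesis
      using p i by (auto simp: place_iff mix_nth)
  qed
  ultimately show "?m \<in> cell xs x w"
    using f sorted by (simp add: cell_def Conf_iff)
qed

text \<open>Sorting the real parts recovers the word. Hence the two words quantified in
  \<open>braid_homotopic\<close> are determined by either of its paths.\<close>

lemma cell_unique:
  assumes z: "z \<in> cell xs x w" "z \<in> cell xs x w'" and w: "w \<in> words xs x" "w' \<in> words xs x"
  shows "w = w'"
proof -
  have s: "sorted_wrt (<) (map (Re \<circ> z) w)" "sorted_wrt (<) (map (Re \<circ> z) w')"
    using z by (auto simp: cell_def sorted_wrt_map)
  moreover have "set (map (Re \<circ> z) w) = set (map (Re \<circ> z) w')" using w by (simp add: words_def)
  ultimately have "map (Re \<circ> z) w = map (Re \<circ> z) w'"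
    unfolding strict_sorted_iff by (blast intro: sorted_distinct_set_unique)
  moreover have "inj_on (Re \<circ> z) (set w \<union> set w')"
    using s(1) w by (auto simp: words_def strict_sorted_iff distinct_map)
  ultimately show ?thesis by (simp add: inj_on_map_eq_map)
qed

lemma braid_homotopicI:
  "w \<in> words xs x \<Longrightarrow> w' \<in> words xs x \<Longrightarrow>
    end_homotopic (Conf xs x) (cell xs x w) (cell xs x w') p q \<Longrightarrow> braid_homotopic xs x p q"
  unfolding braid_homotopic_def end_homotopic_iff by blast

lemma braid_homotopic_iff:
  assumes "w \<in> words xs x" "w' \<in> words xs x" "p 0 \<in> cell xs x w" "p 1 \<in> cell xs x w'"
  shows "braid_homotopic xs x p q \<longleftrightarrow> end_homotopic (Conf xs x) (cell xs x w) (cell xs x w') p q"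
proof
  assume "braid_homotopic xs x p q"
  then obtain v v' where v: "v \<in> words xs x" "v' \<in> words xs x"
    "end_homotopic (Conf xs x) (cell xs x v) (cell xs x v') p q"
    unfolding braid_homotopic_def end_homotopic_iff by blast
  then have "v = w" "v' = w'"
    using assms cell_unique end_homotopic_path_in(2,3)[OF v(3)] by blast+
  then show "end_homotopic (Conf xs x) (cell xs x w) (cell xs x w') p q" using v by simp
qed (use braid_homotopicI assms in blast)

lemma braid_homotopic_sym: "braid_homotopic xs x p q \<Longrightarrow> braid_homotopic xs x q p"
  unfolding braid_homotopic_def by (meson homotopic_with_symD)

text \<open>The two homotopies come with words of their own; the middle path forces these to
  agree.\<close>

lemma braid_homotopic_trans:
  assumes pq: "braid_homotopic xs x p q" and qr: "braid_homotopic xs x q r"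
  shows "braid_homotopic xs x p r"
proof -
  obtain w w' where w: "w \<in> words xs x" "w' \<in> words xs x"
    "end_homotopic (Conf xs x) (cell xs x w) (cell xs x w') p q"
    using pq unfolding braid_homotopic_def end_homotopic_iff by blast
  have "end_homotopic (Conf xs x) (cell xs x w) (cell xs x w') q r"
    using braid_homotopic_iff[OF w(1,2)] qr end_homotopic_path_in(2,3)[OF end_homotopic_sym[OF w(3)]] by blast
  then show ?thesis using end_homotopic_trans[OF w(3)] braid_homotopicI w by blast
qed

section \<open>The configuration of centers of an operation\<close>

definition centers :: "color list \<Rightarrow> (nat \<Rightarrow> real \<times> complex) \<Rightarrow> nat \<Rightarrow> complex" where
  "centers xs d = (\<lambda>i\<in>{..<length xs}. snd (d i))"

lemma centers_nth: "i < length xs \<Longrightarrow> centers xs d i = snd (d i)"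
  by (simp add: centers_def)

lemma centers_Conf:
  assumes d: "d \<in> swiss_cheese xs x"
  shows "centers xs d \<in> Conf xs x"
  unfolding Conf_iff
proof (intro conjI allI impI)
  show "centers xs d \<in> extensional {..<length xs}" by (simp add: centers_def)
  show "admissible xs x" using d by (simp add: swiss_cheese_iff)
  have ok: "disk_ok (xs ! i) x (d i)" if "i < length xs" for i using d that by (simp add: swiss_cheese_iff)
  show "centers xs d i \<noteq> centers xs d j" if "i < length xs" "j < length xs" "i \<noteq> j" for i j
  proof -
    have "fst (d i) + fst (d j) \<le> dist (snd (d i)) (snd (d j))"
      using d that by (simp add: swiss_cheese_iff)
    then show ?thesis
      using ok[OF that(1)] ok[OF that(2)] that by (auto simp: centers_nth disk_ok_def)
  qed
  show "centers xs d i \<in> place (xs ! i) x" if "i < length xs" for i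
    using ok[OF that] disk_ok_center(1)[OF ok[OF that]] that by (auto simp: place_iff centers_nth disk_ok_def)
qed

lemma norm_centers: "d \<in> swiss_cheese xs x \<Longrightarrow> i < length xs \<Longrightarrow> norm (centers xs d i) < 1"
  using disk_ok_center(1)[of "xs ! i" x "d i"] by (simp add: swiss_cheese_iff centers_nth)

lemma continuous_on_nth:
  "continuous_on S f \<Longrightarrow> continuous_on S (\<lambda>y. f y i)"
  for f :: "'x::topological_space \<Rightarrow> nat \<Rightarrow> 'v::topological_space"
  by (rule continuous_on_product_then_coordinatewise)

lemma continuous_on_centers:
  assumes "continuous_on S f"
  shows "continuous_on S (\<lambda>y. centers xs (f y))"
  by (rule continuous_on_tuple[of "length xs"])
    (auto simp: centers_def intro!: continuous_on_snd continuous_on_nth[OF assms])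

lemma centers_embed:
  assumes t: "t \<in> trees xs x"
  shows "centers xs (embed xs x t) \<in> cell xs x (leaves t)"
proof -
  note e = embed_swiss_cheese[OF t]
  have pos: "0 < fst (embed xs x t i)" if "i < length xs" for i
    using e that by (simp add: swiss_cheese_iff disk_ok_def)
  have "sorted_wrt (\<lambda>i j. Re (centers xs (embed xs x t) i) < Re (centers xs (embed xs x t) j)) (leaves t)"
  proof (rule sorted_wrt_mono_rel[OF _ embed_sorted[OF t]])
    fix i j assume "i \<in> set (leaves t)" "j \<in> set (leaves t)" "left_of (embed xs x t i) (embed xs x t j)"
    then show "Re (centers xs (embed xs x t) i) < Re (centers xs (embed xs x t) j)"
      using pos[of i] pos[of j] t by (simp add: left_of_def centers_nth trees_iff)
  qed
  then show ?thesis using centers_Conf[OF e] by (simp add: cell_def)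
qed

subsection \<open>A section of the centers map\<close>

text \<open>
  A continuous common radius that makes the disks around the points of a configuration, scaled by
  one half, an operation of the Swiss-Cheese operad. Products replace minima, which is possible because
  all factors are at most 1.
\<close>

definition factor :: "color list \<Rightarrow> color \<Rightarrow> (nat \<Rightarrow> complex) \<Rightarrow> nat \<times> nat \<Rightarrow> real" where
  "factor xs x z = (\<lambda>(i, j). if i = j
     then (1 - norm (z i)) * (if x = Op \<and> xs ! i = Cl then Im (z i) else 1)
     else dist (z i) (z j) / 2)"

definition radius :: "color list \<Rightarrow> color \<Rightarrow> (nat \<Rightarrow> complex) \<Rightarrow> real" where
  "radius xs x z = (\<Prod>k\<in>{..<length xs} \<times> {..<length xs}. factor xs x z k)"

lemma prod_le_factor:
  fixes f :: "'k \<Rightarrow> real"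
  assumes "finite K" "k \<in> K" "\<And>l. l \<in> K \<Longrightarrow> 0 < f l \<and> f l \<le> 1"
  shows "prod f K \<le> f k"
proof -
  have "prod f (K - {k}) \<le> 1" using assms by (intro prod_le_1) (auto intro: less_imp_le)
  then show ?thesis
    using assms(2,3) by (simp add: prod.remove[OF assms(1,2)] mult_left_le)
qed

text \<open>Norms below 1 keep the diagonal factors positive and every distance below 2. Halving the
  distance thus bounds the factor by 1, and a radius below this factor is what two disjoint disks of
  equal size demand.\<close>

lemma factor_bounds:
  assumes z: "z \<in> Conf xs x" "\<forall>i<length xs. norm (z i) < 1" and ij: "i < length xs" "j < length xs"
  shows "0 < factor xs x z (i, j) \<and> factor xs x z (i, j) \<le> 1"
proof (cases "i = j")
  case True
  have "Im (z i) \<le> 1" using abs_Im_le_cmod[of "z i"] z(2) ij by (smt (verit))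
  moreover have "Im (z i) > 0" if "x = Op" "xs ! i = Cl"
    using z(1) ij that by (auto simp: Conf_iff place_iff)
  ultimately show ?thesis
    using True z(2) ij mult_le_one[of "1 - norm (z i)" "Im (z i)"] by (auto simp: factor_def)
next
  case False
  then have "z i \<noteq> z j" using z ij by (simp add: Conf_iff)
  moreover have "dist (z i) (z j) \<le> norm (z i) + norm (z j)"
    by (simp add: dist_norm norm_triangle_ineq4)
  moreover have "norm (z i) < 1" "norm (z j) < 1" using z(2) ij by auto
  ultimately show ?thesis using False by (simp add: factor_def)
qed

lemma radius_bounds:
  assumes z: "z \<in> Conf xs x" "\<forall>i<length xs. norm (z i) < 1"
  shows "0 < radius xs x z"
    and "i < length xs \<Longrightarrow> norm (z i) + radius xs x z \<le> 1"
    and "i < length xs \<Longrightarrow> x = Op \<Longrightarrow> xs ! i = Cl \<Longrightarrow> radius xs x z \<le> Im (z i)"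
    and "i < length xs \<Longrightarrow> j < length xs \<Longrightarrow> i \<noteq> j \<Longrightarrow> 2 * radius xs x z \<le> dist (z i) (z j)"
proof -
  have b: "0 < factor xs x z k \<and> factor xs x z k \<le> 1" if "k \<in> {..<length xs} \<times> {..<length xs}" for k
    using factor_bounds[OF z] that by auto
  show "0 < radius xs x z" unfolding radius_def using b by (intro prod_pos) auto
  have le: "radius xs x z \<le> factor xs x z (i, j)" if "i < length xs" "j < length xs" for i j
    unfolding radius_def by (rule prod_le_factor) (use that b in auto)
  show "2 * radius xs x z \<le> dist (z i) (z j)" if "i < length xs" "j < length xs" "i \<noteq> j"
    using le[OF that(1,2)] that by (simp add: factor_def)
  have n: "norm (z i) < 1" "Im (z i) \<le> 1" if "i < length xs"
    using z(2) abs_Im_le_cmod[of "z i"] that by (auto intro: order_trans less_imp_le)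
  have I: "Im (z i) > 0" if "i < length xs" "x = Op" "xs ! i = Cl"
    using z(1) that by (auto simp: Conf_iff place_iff)
  show "norm (z i) + radius xs x z \<le> 1" if "i < length xs"
  proof -
    have "(1 - norm (z i)) * Im (z i) \<le> 1 - norm (z i)"
      using n[OF that] by (intro mult_left_le) auto
    then show ?thesis using le[OF that that] by (auto simp: factor_def split: if_splits)
  qed
  show "radius xs x z \<le> Im (z i)" if "i < length xs" "x = Op" "xs ! i = Cl"
  proof -
    have "(1 - norm (z i)) * Im (z i) \<le> Im (z i)"
      using n[OF that(1)] I[OF that] by (intro mult_left_le_one_le) auto
    then show ?thesis using le[OF that(1,1)] that by (simp add: factor_def)
  qed
qed

lemma continuous_on_radius:
  assumes "continuous_on S f"
  shows "continuous_on S (\<lambda>y. radius xs x (f y))"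
proof -
  have [continuous_intros]: "continuous_on S (\<lambda>y. f y i)" for i by (rule continuous_on_nth[OF assms])
  show ?thesis
    unfolding radius_def
  proof (rule continuous_on_prod)
    fix k
    obtain i j :: nat where k: "k = (i, j)" by (cases k)
    show "continuous_on S (\<lambda>y. factor xs x (f y) k)"
      unfolding k factor_def by (cases "i = j"; cases "x = Op \<and> xs ! i = Cl") (auto intro!: continuous_intros)
  qed
qed

definition scale :: "nat \<Rightarrow> real \<Rightarrow> (nat \<Rightarrow> complex) \<Rightarrow> nat \<Rightarrow> complex" where
  "scale n c z = (\<lambda>i\<in>{..<n}. of_real c * z i)"

lemma scale_nth: "i < n \<Longrightarrow> scale n c z i = of_real c * z i"
  by (simp add: scale_def)

lemma scale_1 [simp]: "z \<in> extensional {..<n} \<Longrightarrow> scale n 1 z = z"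
  by (auto simp: scale_def extensional_def)

lemma continuous_on_scale:
  assumes "continuous_on S f" "continuous_on S c"
  shows "continuous_on S (\<lambda>y. scale n (c y) (f y))"
  by (rule continuous_on_tuple[of n])
    (auto simp: scale_def intro!: continuous_on_mult continuous_on_of_real assms(2) continuous_on_nth[OF assms(1)])

lemma scale_Conf:
  assumes z: "z \<in> Conf xs x" and c: "0 < c" "c \<le> 1"
  shows "scale (length xs) c z \<in> Conf xs x"
proof -
  have "of_real c * z i \<in> place (xs ! i) x" if "i < length xs" for i
  proof -
    have "c * norm (z i) \<le> norm (z i)" using c by (simp add: mult_left_le_one_le)
    moreover have "z i \<in> place (xs ! i) x" using z that by (simp add: Conf_iff)
    ultimately show ?thesis using c by (auto simp: place_iff norm_mult)
  qed
  then show ?thesis using z c by (auto simp: Conf_iff scale_nth) (simp add: scale_def)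
qed

lemma scale_cell:
  assumes z: "z \<in> cell xs x w" and w: "w \<in> words xs x" and c: "0 < c" "c \<le> 1"
  shows "scale (length xs) c z \<in> cell xs x w"
proof -
  have "sorted_wrt (\<lambda>i j. Re (scale (length xs) c z i) < Re (scale (length xs) c z j)) w"
    by (rule sorted_wrt_mono_rel[of _ "\<lambda>i j. Re (z i) < Re (z j)"])
      (use z w c in \<open>auto simp: cell_def words_def scale_nth\<close>)
  then show ?thesis using z scale_Conf[OF _ c] by (simp add: cell_def)
qed

text \<open>With open output, points of a configuration may lie on the unit circle, where no disk
  fits; after halving, all norms are at most \<open>1/2\<close>. In consequence
  \<open>centers\<close> after \<open>thicken\<close> is scaling by \<open>1/2\<close> instead of
  the identity.\<close>

definition thicken :: "color list \<Rightarrow> color \<Rightarrow> (nat \<Rightarrow> complex) \<Rightarrow> nat \<Rightarrow> real \<times> complex" where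
  "thicken xs x z = (\<lambda>i\<in>{..<length xs}. (radius xs x (scale (length xs) (1/2) z), z i / 2))"

lemma
  assumes z: "z \<in> Conf xs x"
  shows scale_half_Conf: "scale (length xs) (1/2) z \<in> Conf xs x"
    and norm_scale_half: "\<forall>i<length xs. norm (scale (length xs) (1/2) z i) < 1"
proof -
  show "scale (length xs) (1/2) z \<in> Conf xs x" using scale_Conf[OF z] by simp
  have "norm (z i) \<le> 1" if "i < length xs" for i using z that by (simp add: Conf_iff place_iff)
  then show "\<forall>i<length xs. norm (scale (length xs) (1/2) z i) < 1"
    by (force simp: scale_nth norm_mult norm_divide)
qed

lemma disk_ok_mix:
  assumes "disk_ok c x d" "disk_ok c x e" "t \<in> {0..1}"
  shows "disk_ok c x ((1 - t) *\<^sub>R d + t *\<^sub>R e)"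
proof -
  have le: "(1 - t) * a + t * b \<le> (1 - t) * c + t * d" if "a \<le> c" "b \<le> d" for a b c d :: real
    using assms(3) that by (intro add_mono mult_left_mono) auto
  have "norm ((1 - t) *\<^sub>R snd d + t *\<^sub>R snd e) \<le> (1 - t) * norm (snd d) + t * norm (snd e)"
    using assms(3) norm_triangle_ineq[of "(1 - t) *\<^sub>R snd d" "t *\<^sub>R snd e"] by simp
  moreover have "(1 - t) * (norm (snd d) + fst d) + t * (norm (snd e) + fst e) \<le> (1 - t) * 1 + t * 1"
    using assms by (intro le) (auto simp: disk_ok_def)
  moreover have "0 < (1 - t) * fst d + t * fst e"
  proof (cases "t = 0")
    case False
    then show ?thesis using assms by (intro add_nonneg_pos) (auto simp: disk_ok_def)
  qed (use assms in \<open>simp add: disk_ok_def\<close>)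
  moreover have "(1 - t) * fst d + t * fst e \<le> (1 - t) * Im (snd d) + t * Im (snd e)" if "x = Op \<and> c = Cl"
    using assms that by (intro le) (auto simp: disk_ok_def)
  ultimately show ?thesis
    using assms by (auto simp: disk_ok_def algebra_simps)
qed

lemma thicken_disk_ok:
  assumes z: "z \<in> Conf xs x" and i: "i < length xs"
  shows "disk_ok (xs ! i) x (thicken xs x z i)"
proof -
  note h = scale_half_Conf[OF z] norm_scale_half[OF z]
  have "Im (z i) = 0" if "xs ! i = Op"
  proof -
    have "z i \<in> place (xs ! i) x" "x = Op"
      using z i that nth_mem[OF i] by (cases x; auto simp: Conf_iff admissible_def)+
    then show ?thesis using that by (simp add: place_iff)
  qed
  then show ?thesis
    using radius_bounds(1)[OF h] radius_bounds(2,3)[OF h i] i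
    by (simp add: thicken_def disk_ok_def scale_nth norm_mult norm_divide)
qed

lemma thicken_dist:
  assumes z: "z \<in> Conf xs x" and i: "i < length xs" "j < length xs" "i \<noteq> j"
  shows "fst (thicken xs x z i) + fst (thicken xs x z j) \<le> dist (z i) (z j) / 2"
proof -
  note h = scale_half_Conf[OF z] norm_scale_half[OF z]
  have "dist (of_real (1/2) * z i) (of_real (1/2) * z j) = dist (z i) (z j) / 2"
    by (simp add: dist_norm flip: right_diff_distrib diff_divide_distrib)
  then show ?thesis
    using radius_bounds(4)[OF h i] i by (simp add: thicken_def scale_nth)
qed

lemma thicken_swiss_cheese:
  assumes z: "z \<in> Conf xs x"
  shows "thicken xs x z \<in> swiss_cheese xs x"
  unfolding swiss_cheese_iff
proof (intro conjI allI impI thicken_disk_ok z)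
  have dd: "dist (z i / 2) (z j / 2) = dist (z i) (z j) / 2" for i j
    by (simp add: dist_norm norm_divide flip: diff_divide_distrib)
  show "fst (thicken xs x z i) + fst (thicken xs x z j) \<le> dist (snd (thicken xs x z i)) (snd (thicken xs x z j))"
    if "i < length xs" "j < length xs" "i \<noteq> j" for i j
    using thicken_dist[OF z that] that dd[of i j] by (simp add: thicken_def)
qed (use z in \<open>auto simp: thicken_def Conf_iff\<close>)

lemma centers_thicken: "centers xs (thicken xs x z) = scale (length xs) (1/2) z"
  by (auto simp: centers_def thicken_def scale_def)

lemma continuous_on_thicken:
  assumes "continuous_on S f"
  shows "continuous_on S (\<lambda>y. thicken xs x (f y))"
proof (rule continuous_on_tuple[of "length xs"])
  have "continuous_on S (\<lambda>y. radius xs x (scale (length xs) (1/2) (f y)))"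
    by (intro continuous_on_radius continuous_on_scale assms continuous_on_const)
  moreover have "continuous_on S (\<lambda>y. f y i / 2)" for i
    by (intro continuous_on_divide continuous_on_nth[OF assms] continuous_on_const) simp
  ultimately show "continuous_on S (\<lambda>y. thicken xs x (f y) i)" if "i < length xs" for i
    using that by (simp add: thicken_def continuous_on_Pair)
qed (simp add: thicken_def)

text \<open>
  All conditions on the disks of an operation with given centers are linear in the centers and
  the radii, once the mutual directions of the centers are fixed.
\<close>

lemma mix_thicken_swiss_cheese:
  assumes d: "d \<in> swiss_cheese xs x" and t: "t \<in> {0..1}"
  shows "mix (length xs) t d (thicken xs x (centers xs d)) \<in> swiss_cheese xs x" (is "?m \<in> _")
  unfolding swiss_cheese_iff
proof (intro conjI allI impI)
  note c = centers_Conf[OF d]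
  let ?s = "thicken xs x (centers xs d)"
  show "disk_ok (xs ! i) x (?m i)" if "i < length xs" for i
    using that d t thicken_disk_ok[OF c that] by (simp add: mix_nth disk_ok_mix swiss_cheese_iff)
  show "fst (?m i) + fst (?m j) \<le> dist (snd (?m i)) (snd (?m j))"
    if ij: "i < length xs" "j < length xs" "i \<noteq> j" for i j
  proof -
    let ?D = "dist (snd (d i)) (snd (d j))"
    \<comment> \<open>Thickened centers are half the given ones, so differences of centers are only
      rescaled, by \<open>1 - t / 2\<close>, and the distance condition becomes linear in the
      radii.\<close>
    have eq: "snd (?m i) - snd (?m j) = of_real (1 - t / 2) * (snd (d i) - snd (d j))"
      using ij by (simp add: mix_nth thicken_def centers_nth scaleR_conv_of_real algebra_simps add_divide_distrib)
    have "dist (snd (?m i)) (snd (?m j)) = (1 - t / 2) * ?D"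
      using t unfolding dist_norm eq norm_mult norm_of_real by simp
    moreover have "fst (d i) + fst (d j) \<le> ?D" using d ij by (simp add: swiss_cheese_iff)
    then have "(1 - t) * (fst (d i) + fst (d j)) \<le> (1 - t) * ?D"
      using t by (intro mult_left_mono) auto
    moreover have "t * (fst (?s i) + fst (?s j)) \<le> t * (?D / 2)"
      using t thicken_dist[OF c ij] ij by (intro mult_left_mono) (auto simp: centers_nth)
    ultimately show ?thesis using ij by (simp add: mix_nth algebra_simps)
  qed
qed (use d in \<open>auto simp: swiss_cheese_iff\<close>)


section \<open>Lifting paths of configurations to the Swiss-Cheese operad\<close>

lemma homotopic_paths_square_sides:
  fixes h :: "real \<times> real \<Rightarrow> 'b::topological_space"
  assumes h: "continuous_on ({0..1} \<times> {0..1}) h" "h ` ({0..1} \<times> {0..1}) \<subseteq> S"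
    and sides: "\<And>t. t \<in> {0..1} \<Longrightarrow> h (0, t) = p t \<and> h (1, t) = q t \<and> h (t, 0) = a t \<and> h (t, 1) = b t"
  shows "homotopic_paths S (p +++ b) (a +++ q)"
proof -
  note sq = homotopic_paths_square[OF h]
  have "homotopic_paths S ((\<lambda>t. h (0, t)) +++ (\<lambda>s. h (s, 1))) (p +++ b)"
    using homotopic_paths_path_in[OF sq] sides
    by (intro homotopic_paths_eq) (auto simp: path_in_def joinpaths_def)
  moreover have "homotopic_paths S ((\<lambda>s. h (s, 0)) +++ (\<lambda>t. h (1, t))) (a +++ q)"
    using homotopic_paths_path_in[OF sq] sides
    by (intro homotopic_paths_eq) (auto simp: path_in_def joinpaths_def)
  ultimately show ?thesis
    using sq homotopic_paths_sym homotopic_paths_trans by blast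
qed

definition thickening_path :: "color list \<Rightarrow> color \<Rightarrow> (nat \<Rightarrow> real \<times> complex) \<Rightarrow> real \<Rightarrow> nat \<Rightarrow> real \<times> complex" where
  "thickening_path xs x d = (\<lambda>t. mix (length xs) t d (thicken xs x (centers xs d)))"

lemma swiss_cheese_extensional: "d \<in> swiss_cheese xs x \<Longrightarrow> d \<in> extensional {..<length xs}"
  by (simp add: swiss_cheese_iff)

lemma thicken_extensional [simp]: "thicken xs x z \<in> extensional {..<length xs}"
  by (simp add: thicken_def)

lemma thickening_path:
  assumes d: "d \<in> swiss_cheese xs x"
  shows "path_in (swiss_cheese xs x) (thickening_path xs x d)"
    "thickening_path xs x d 0 = d" "thickening_path xs x d 1 = thicken xs x (centers xs d)"
  using mix_thicken_swiss_cheese[OF d] swiss_cheese_extensional[OF d]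
  by (auto simp: thickening_path_def intro!: path_in_mix)

lemma path_in_thicken:
  assumes "path_in (Conf xs x) k"
  shows "path_in (swiss_cheese xs x) (thicken xs x \<circ> k)"
  by (rule path_in_compose[OF assms continuous_on_thicken[OF continuous_on_id]])
    (auto intro: thicken_swiss_cheese)

lemma path_in_centers:
  assumes "path_in (swiss_cheese xs x) p"
  shows "path_in (Conf xs x) (centers xs \<circ> p)"
  by (rule path_in_compose[OF assms continuous_on_centers[OF continuous_on_id]])
    (auto intro: centers_Conf)

text \<open>Thickening all operations on \<open>p\<close> simultaneously fills a square with these
  four sides; this is the naturality of \<open>thickening_path\<close>.\<close>

lemma homotopic_thickening:
  assumes p: "path_in (swiss_cheese xs x) p"
  shows "homotopic_paths (swiss_cheese xs x) (p +++ thickening_path xs x (p 1))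
    (thickening_path xs x (p 0) +++ (thicken xs x \<circ> (centers xs \<circ> p)))"
proof (rule homotopic_paths_square_sides)
  let ?h = "\<lambda>y. mix (length xs) (fst y) (p (snd y)) (thicken xs x (centers xs (p (snd y))))"
  have c: "continuous_on ({0..1} \<times> {0..1}) (\<lambda>y::real \<times> real. p (snd y))"
    by (rule continuous_on_compose2[of "{0..1}" p])
      (use p in \<open>auto simp: path_in_iff intro!: continuous_on_snd continuous_on_id\<close>)
  show "continuous_on ({0..1} \<times> {0..1}) ?h"
    by (intro continuous_on_mix continuous_on_thicken continuous_on_centers c continuous_on_fst continuous_on_id)
  show "?h ` ({0..1} \<times> {0..1}) \<subseteq> swiss_cheese xs x"
    using path_inD[OF p] mix_thicken_swiss_cheese by auto
  show "?h (0, t) = p t \<and> ?h (1, t) = (thicken xs x \<circ> (centers xs \<circ> p)) t \<and>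
      ?h (t, 0) = thickening_path xs x (p 0) t \<and> ?h (t, 1) = thickening_path xs x (p 1) t"
    if "t \<in> {0..1}" for t
    using swiss_cheese_extensional[OF path_inD[OF p that]] by (simp add: thickening_path_def)
qed

text \<open>The lift is \<open>thicken\<close> along \<open>k\<close>, connected to the prescribed
  ends by thickening paths. Over the cells the connecting pieces are absorbed. The clause on cells
  has hypotheses of its own because \<open>path_to_tree\<close> also lifts paths that may start
  outside every cell.\<close>

lemma lift_path:
  assumes k: "path_in (Conf xs x) k" and a: "a \<in> swiss_cheese xs x" "centers xs a = k 0"
    and b: "b \<in> swiss_cheese xs x" "centers xs b = k 1"
  obtains p where "path_in (swiss_cheese xs x) p" "p 0 = a" "p 1 = b"
    "\<And>w w'. w \<in> words xs x \<Longrightarrow> w' \<in> words xs x \<Longrightarrow> k 0 \<in> cell xs x w \<Longrightarrow> k 1 \<in> cell xs x w' \<Longrightarrow>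
      end_homotopic (Conf xs x) (cell xs x w) (cell xs x w') (centers xs \<circ> p) k"
proof -
  let ?n = "length xs" and ?S = "swiss_cheese xs x"
  let ?a = "thickening_path xs x a" and ?b = "thickening_path xs x b"
  let ?k = "thicken xs x \<circ> k"
  define p where "p = ?a +++ (?k +++ reversepath ?b)"
  note ta = thickening_path[OF a(1)] and tb = thickening_path[OF b(1)]
  note rb = path_in_reverse[OF tb(1)]
  have ends: "pathfinish ?a = pathstart ?k" "pathfinish ?k = pathstart (reversepath ?b)"
    using ta tb a b by (simp_all add: pathstart_def pathfinish_def reversepath_def)
  have kb: "path_in ?S (?k +++ reversepath ?b)"
    by (rule path_in_join[OF path_in_thicken[OF k] rb ends(2)])
  have p: "path_in ?S p"
    unfolding p_def by (rule path_in_join[OF ta(1) kb]) (simp add: ends(1))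
  have "p 0 = a" "p 1 = b"
    using ta tb by (simp_all add: p_def joinpaths_def reversepath_def)
  moreover have "end_homotopic (Conf xs x) (cell xs x w) (cell xs x w') (centers xs \<circ> p) k"
    if w: "w \<in> words xs x" "w' \<in> words xs x" and kw: "k 0 \<in> cell xs x w" "k 1 \<in> cell xs x w'" for w w'
  proof -
    let ?X = "Conf xs x" and ?A = "cell xs x w" and ?B = "cell xs x w'"
    \<comment> \<open>Along a thickening path the centers are merely scaled, and cells are stable
      under scaling.\<close>
    have c: "centers xs (thickening_path xs x d t) = scale ?n (1 - t / 2) (centers xs d)" for d t
      by (auto simp: thickening_path_def centers_def scale_def mix_def thicken_def scaleR_conv_of_real algebra_simps)
    have ck: "centers xs \<circ> ?k = (\<lambda>t. scale ?n (1/2) (k t))"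
      by (auto simp: centers_thicken)
    have pk: "path_in ?X (centers xs \<circ> ?k)" by (rule path_in_centers[OF path_in_thicken[OF k]])
    have kAB: "(centers xs \<circ> ?k) 0 \<in> ?A" "(centers xs \<circ> ?k) 1 \<in> ?B"
      unfolding ck using scale_cell[OF kw(1) w(1)] scale_cell[OF kw(2) w(2)] by auto
    have "end_homotopic ?X ?A ?B (centers xs \<circ> p) ((centers xs \<circ> ?k) +++ (centers xs \<circ> reversepath ?b))"
      unfolding p_def path_compose_join
    proof (rule end_homotopic_absorb_left)
      show "path_in ?X ((centers xs \<circ> ?k) +++ (centers xs \<circ> reversepath ?b))"
        using path_in_centers[OF kb] by (simp add: path_compose_join)
      show "((centers xs \<circ> ?k) +++ (centers xs \<circ> reversepath ?b)) 1 \<in> ?B"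
        using kw b tb by (simp add: joinpaths_def reversepath_def)
      show "path_in ?X (centers xs \<circ> ?a)" by (rule path_in_centers[OF ta(1)])
      show "(centers xs \<circ> ?a) ` {0..1} \<subseteq> ?A"
        using kw a scale_cell[OF kw(1) w(1)] by (auto simp: c)
      show "(centers xs \<circ> ?a) 1 = ((centers xs \<circ> ?k) +++ (centers xs \<circ> reversepath ?b)) 0"
        using ta a by (simp add: joinpaths_def)
    qed
    also have "end_homotopic ?X ?A ?B \<dots> (centers xs \<circ> ?k)"
    proof (rule end_homotopic_absorb_right[OF pk kAB(1)])
      show "path_in ?X (centers xs \<circ> reversepath ?b)" by (rule path_in_centers[OF rb])
      show "(centers xs \<circ> reversepath ?b) ` {0..1} \<subseteq> ?B"
        using kw b scale_cell[OF kw(2) w(2)] by (auto simp: c reversepath_def)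
      show "(centers xs \<circ> reversepath ?b) 0 = (centers xs \<circ> ?k) 1"
        using tb b by (simp add: reversepath_def)
    qed
    also have "end_homotopic ?X ?A ?B \<dots> k"
      unfolding end_homotopic_def ck
    proof (intro exI conjI ballI)
      \<comment> \<open>This undoes the halving: the factor grows from \<open>1/2\<close> to
        \<open>1\<close>.\<close>
      let ?h = "\<lambda>y. scale ?n ((1 + fst y) / 2) (k (snd y))"
      have "continuous_on ({0..1} \<times> {0..1}) (\<lambda>y::real \<times> real. k (snd y))"
        by (rule continuous_on_compose2[of "{0..1}" k])
          (use k in \<open>auto simp: path_in_iff intro!: continuous_on_snd continuous_on_id\<close>)
      then show "continuous_on ({0..1} \<times> {0..1}) ?h"
        by (intro continuous_on_scale continuous_on_divide continuous_on_add continuous_on_fst continuous_on_id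
            continuous_on_const) simp_all
      show "?h ` ({0..1} \<times> {0..1}) \<subseteq> ?X" using path_inD[OF k] by (auto intro!: scale_Conf)
      show "?h (0, t) = scale ?n (1/2) (k t)" for t by simp
      show "?h (1, t) = k t" if "t \<in> {0..1}" for t
        using path_inD[OF k that] by (simp add: Conf_iff)
      show "?h (s, 0) \<in> ?A" "?h (s, 1) \<in> ?B" if "s \<in> {0..1}" for s
        using that scale_cell[OF kw(1) w(1)] scale_cell[OF kw(2) w(2)] by auto
    qed
    finally show ?thesis .
  qed
  ultimately show thesis using that p by blast
qed

text \<open>\<open>lift_path\<close> wants the ends of the path to be exactly the given centers.
  Segments inside the two cells lead there from the ends of \<open>k\<close>, and they are absorbed
  afterwards.\<close>

lemma centers_full:
  assumes w: "w \<in> words xs x" "w' \<in> words xs x"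
    and k: "path_in (Conf xs x) k" "k 0 \<in> cell xs x w" "k 1 \<in> cell xs x w'"
    and a: "a \<in> swiss_cheese xs x" "centers xs a \<in> cell xs x w"
    and b: "b \<in> swiss_cheese xs x" "centers xs b \<in> cell xs x w'"
  obtains p where "path_in (swiss_cheese xs x) p" "p 0 = a" "p 1 = b"
    "end_homotopic (Conf xs x) (cell xs x w) (cell xs x w') (centers xs \<circ> p) k"
proof -
  let ?n = "length xs" and ?X = "Conf xs x" and ?A = "cell xs x w" and ?B = "cell xs x w'"
  let ?a = "\<lambda>t. mix ?n t (centers xs a) (k 0)" and ?b = "\<lambda>t. mix ?n t (k 1) (centers xs b)"
  have ex: "k 0 \<in> extensional {..<?n}" "k 1 \<in> extensional {..<?n}"
    using k(2,3) by (auto simp: cell_def Conf_iff)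
  have exc: "centers xs d \<in> extensional {..<?n}" for d by (simp add: centers_def)
  have A: "?a t \<in> ?A" and B: "?b t \<in> ?B" if "t \<in> {0..1}" for t
    using mix_closed_cell[OF w(1)] mix_closed_cell[OF w(2)] k a b that by (auto simp: mix_closed_def)
  have pa: "path_in ?X ?a" and pb: "path_in ?X ?b"
    by (rule path_in_mix, rule cellD, erule A B)+
  let ?k = "?a +++ (k +++ ?b)"
  have kb: "path_in ?X (k +++ ?b)"
    using k pb ex by (intro path_in_join) (auto simp: pathstart_def pathfinish_def)
  have akb: "path_in ?X ?k"
    by (rule path_in_join[OF pa kb]) (simp add: pathstart_def pathfinish_def joinpaths_def ex)
  have ends: "?k 0 = centers xs a" "?k 1 = centers xs b" using ex exc by (auto simp: joinpaths_def)
  obtain p where p: "path_in (swiss_cheese xs x) p" "p 0 = a" "p 1 = b"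
    "end_homotopic ?X ?A ?B (centers xs \<circ> p) ?k"
    using lift_path[OF akb a(1) _ b(1)] ends w a b by metis
  have "end_homotopic ?X ?A ?B ?k (k +++ ?b)"
    by (rule end_homotopic_absorb_left[OF kb _ pa]) (use A B ex in \<open>auto simp: joinpaths_def exc b\<close>)
  moreover have "end_homotopic ?X ?A ?B (k +++ ?b) k"
    by (rule end_homotopic_absorb_right[OF k(1,2) pb]) (use B ex in auto)
  ultimately show thesis using that p end_homotopic_trans by blast
qed

lemma centers_homotopic:
  assumes "homotopic_paths (swiss_cheese xs x) p q" "centers xs (p 0) \<in> cell xs x w" "centers xs (p 1) \<in> cell xs x w'"
  shows "end_homotopic (Conf xs x) (cell xs x w) (cell xs x w') (centers xs \<circ> p) (centers xs \<circ> q)"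
  using homotopic_paths_continuous_image[OF assms(1) continuous_on_centers[OF continuous_on_id, where xs = xs],
      where t = "Conf xs x"] assms(2,3)
  by (intro end_homotopic_homotopic_paths) (auto intro: centers_Conf)

text \<open>Two corrections are made. The thickened homotopy moves the end points, but along loops
  that contract because cells are convex. And \<open>p\<close>, \<open>q\<close> differ from their
  thickened versions by thickening paths, which coincide at the common ends and cancel.\<close>

lemma centers_faithful:
  assumes p: "path_in (swiss_cheese xs x) p" and q: "path_in (swiss_cheese xs x) q"
    and e: "p 0 = q 0" "p 1 = q 1" and w: "w \<in> words xs x" "w' \<in> words xs x"
    and eh: "end_homotopic (Conf xs x) (cell xs x w) (cell xs x w') (centers xs \<circ> p) (centers xs \<circ> q)"
  shows "homotopic_paths (swiss_cheese xs x) p q"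
proof -
  let ?S = "swiss_cheese xs x" and ?T = "thicken xs x"
  obtain h where h: "continuous_on ({0..1} \<times> {0..1}) h" "h ` ({0..1} \<times> {0..1}) \<subseteq> Conf xs x"
     "\<forall>t\<in>{0..1}. h (0, t) = (centers xs \<circ> p) t \<and> h (1, t) = (centers xs \<circ> q) t"
     "\<forall>s\<in>{0..1::real}. h (s, 0) \<in> cell xs x w \<and> h (s, 1) \<in> cell xs x w'"
    using eh unfolding end_homotopic_def by blast
  let ?tp = "?T \<circ> (centers xs \<circ> p)" and ?tq = "?T \<circ> (centers xs \<circ> q)"
  have tp: "path_in ?S ?tp" "path_in ?S ?tq"
    using path_in_thicken[OF path_in_centers] p q by blast+
  \<comment> \<open>Since \<open>p\<close> and \<open>q\<close> share their ends, each of these two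
    sides of the homotopy is a loop inside one cell.\<close>
  have side: "homotopic_paths ?S (\<lambda>s. ?T (h (s, r))) (\<lambda>_. ?T (centers xs (p r)))"
    if r: "r = 0 \<or> r = 1" for r
  proof -
    obtain v where v: "v \<in> words xs x" "\<forall>s\<in>{0..1}. h (s, r) \<in> cell xs x v" using r h(4) w by blast
    have "continuous_on {0..1} (\<lambda>s. h (s, r))"
      by (rule continuous_on_compose2[OF h(1)])
        (use r in \<open>auto intro!: continuous_on_Pair continuous_on_id continuous_on_const\<close>)
    then have "path_in (cell xs x v) (\<lambda>s. h (s, r))" using v by (simp add: path_in_iff)
    moreover have "h (0, r) = centers xs (p r)" "h (1, r) = centers xs (p r)"
      using r h(3) e by auto
    ultimately have "homotopic_paths (cell xs x v) (\<lambda>s. h (s, r)) (\<lambda>_. centers xs (p r))"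
      by (intro homotopic_paths_mix_closed[OF mix_closed_cell[OF v(1)]])
    from homotopic_paths_continuous_image[OF this continuous_on_thicken[OF continuous_on_id, where xs = xs and x = x],
        where t = ?S]
    show ?thesis by (auto simp: o_def intro: thicken_swiss_cheese dest: cellD)
  qed
  have sq: "homotopic_paths ?S (?tp +++ (\<lambda>s. ?T (h (s, 1)))) ((\<lambda>s. ?T (h (s, 0))) +++ ?tq)"
    by (rule homotopic_paths_square_sides[of "\<lambda>y. ?T (h y)"])
      (use h(2,3) in \<open>auto intro!: continuous_on_thicken h(1) thicken_swiss_cheese\<close>)
  have hp: "homotopic_paths ?S ?tp ?tq"
  proof -
    have "homotopic_paths ?S ?tp (?tp +++ (\<lambda>_. ?T (centers xs (p 1))))"
      by (rule homotopic_paths_sym) (use homotopic_paths_const_right[OF tp(1)] in \<open>simp add: pathfinish_def\<close>)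
    also have "homotopic_paths ?S \<dots> (?tp +++ (\<lambda>s. ?T (h (s, 1))))"
      using tp homotopic_paths_sym[OF side[of 1]] by (intro homotopic_paths_join)
        (auto simp: path_in_homotopic pathfinish_def pathstart_def)
    also note sq
    also have "homotopic_paths ?S ((\<lambda>s. ?T (h (s, 0))) +++ ?tq) ((\<lambda>_. ?T (centers xs (p 0))) +++ ?tq)"
      using tp side[of 0] h(3) by (intro homotopic_paths_join)
        (auto simp: path_in_homotopic pathfinish_def pathstart_def)
    also have "homotopic_paths ?S \<dots> ?tq"
      using homotopic_paths_const_left[OF tp(2)] e by (simp add: pathstart_def)
    finally show ?thesis .
  qed
  note P = homotopic_thickening[OF p] and Q = homotopic_thickening[OF q]
  have a: "p 0 \<in> ?S" "p 1 \<in> ?S" using path_inD[OF p] by auto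
  have "homotopic_paths ?S (thickening_path xs x (p 0) +++ ?tp) (thickening_path xs x (q 0) +++ ?tq)"
    using hp thickening_path[OF a(1)] e
    by (intro homotopic_paths_join) (auto simp: path_in_homotopic pathstart_def pathfinish_def)
  then have "homotopic_paths ?S (p +++ thickening_path xs x (p 1)) (q +++ thickening_path xs x (p 1))"
    using homotopic_paths_trans[OF P homotopic_paths_trans[OF _ homotopic_paths_sym[OF Q]]] e by simp
  then show ?thesis
    by (rule homotopic_paths_cancel_right)
      (use p q thickening_path[OF a(2)] e in \<open>auto simp: pathstart_def pathfinish_def\<close>)
qed

subsection \<open>Generic position\<close>

lemma sorted_word:
  assumes z: "z \<in> Conf xs x" and d: "inj_on (\<lambda>i. Re (z i)) {..<length xs}"
  obtains w where "w \<in> words xs x" "z \<in> cell xs x w"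
proof
  let ?w = "sort_key (\<lambda>i. Re (z i)) [0..<length xs]"
  have s: "set ?w = {..<length xs}" by auto
  show "?w \<in> words xs x" unfolding words_def using z s by (simp add: Conf_iff)
  have "distinct (map (\<lambda>i. Re (z i)) ?w)"
    unfolding distinct_map s using d by simp
  then have "sorted_wrt (<) (map (\<lambda>i. Re (z i)) ?w)" by (simp add: strict_sorted_iff)
  then show "z \<in> cell xs x ?w" using z by (simp add: cell_def sorted_wrt_map)
qed

text \<open>The factor \<open>1 / (1 + e)\<close> compensates the growth of norms,
  \<open>|z + e * Im z| \<le> (1 + e) * |z|\<close>, so that the result stays in the disk.\<close>

definition shear :: "nat \<Rightarrow> real \<Rightarrow> (nat \<Rightarrow> complex) \<Rightarrow> nat \<Rightarrow> complex" where
  "shear n e z = (\<lambda>i\<in>{..<n}. of_real (1 / (1 + e)) * (z i + of_real (e * Im (z i))))"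

lemma shear_Conf:
  assumes z: "z \<in> Conf xs x" and e: "0 \<le> e"
  shows "shear (length xs) e z \<in> Conf xs x"
  unfolding Conf_iff
proof (intro conjI allI impI)
  show "shear (length xs) e z i \<noteq> shear (length xs) e z j"
    if "i < length xs" "j < length xs" "i \<noteq> j" for i j
  proof
    assume "shear (length xs) e z i = shear (length xs) e z j"
    moreover have "complex_of_real (1 / (1 + e)) \<noteq> 0" using e by (simp del: of_real_divide of_real_add)
    ultimately have eq: "z i + of_real (e * Im (z i)) = z j + of_real (e * Im (z j))"
      using that unfolding shear_def by (metis (no_types, lifting) lessThan_iff mult_left_cancel restrict_apply')
    then have "Im (z i) = Im (z j)" by (auto dest: arg_cong[of _ _ Im])
    then show False using eq z that by (simp add: Conf_iff)
  qed
  fix i assume i: "i < length xs"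
  have Im: "Im (shear (length xs) e z i) = Im (z i) / (1 + e)" using i by (simp add: shear_def)
  have "norm (shear (length xs) e z i) = norm (z i + of_real (e * Im (z i))) / (1 + e)"
  proof -
    have "norm (shear (length xs) e z i) = \<bar>1 / (1 + e)\<bar> * norm (z i + of_real (e * Im (z i)))"
      using i unfolding shear_def by (simp only: restrict_apply lessThan_iff if_True norm_mult norm_of_real)
    then show ?thesis using e by simp
  qed
  also have "\<dots> \<le> norm (z i)"
  proof -
    have "norm (z i + of_real (e * Im (z i))) \<le> norm (z i) + e * \<bar>Im (z i)\<bar>"
      using norm_triangle_ineq[of "z i" "of_real (e * Im (z i))"] e by (simp add: abs_mult flip: of_real_mult)
    also have "\<dots> \<le> norm (z i) + e * norm (z i)"
      using e abs_Im_le_cmod[of "z i"] by (intro add_left_mono mult_left_mono)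
    finally show ?thesis using e by (simp add: divide_le_eq algebra_simps)
  qed
  finally have "norm (shear (length xs) e z i) \<le> norm (z i)" .
  moreover have "z i \<in> place (xs ! i) x" using z i by (simp add: Conf_iff)
  ultimately show "shear (length xs) e z i \<in> place (xs ! i) x"
    using e by (auto simp: place_iff Im)
qed (use z in \<open>auto simp: Conf_iff shear_def\<close>)

text \<open>
  A shear keeps the open points on the real axis. Two distinct points have the same real part for at
  most one value of its parameter.
\<close>

lemma generic_position:
  assumes z: "z \<in> Conf xs x"
  obtains w k where "w \<in> words xs x" "path_in (Conf xs x) k" "k 0 = z" "k 1 \<in> cell xs x w"
proof -
  let ?n = "length xs"
  define bad where "bad i j = {e::real. Re (z i) + e * Im (z i) = Re (z j) + e * Im (z j)}" for i j
  have "finite (bad i j)" if "i < ?n" "j < ?n" "i \<noteq> j" for i j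
  proof (cases "Im (z i) = Im (z j)")
    case True
    then have "Re (z i) \<noteq> Re (z j)" using z that by (auto simp: Conf_iff complex_eq_iff)
    then show ?thesis using True by (simp add: bad_def)
  next
    case False
    then have "bad i j \<subseteq> {(Re (z j) - Re (z i)) / (Im (z i) - Im (z j))}"
      by (auto simp: bad_def field_simps)
    then show ?thesis by (rule finite_subset) simp
  qed
  then have fin: "finite (\<Union>i\<in>{..<?n}. \<Union>j\<in>{..<?n} - {i}. bad i j)" by auto
  define U where "U = (\<Union>i\<in>{..<?n}. \<Union>j\<in>{..<?n} - {i}. bad i j)"
  have "infinite ({0<..} - U)"
    by (rule Diff_infinite_finite) (simp_all add: fin U_def infinite_Ioi)
  then have "{0<..} - U \<noteq> {}" by (rule infinite_imp_nonempty)
  then obtain e where eU: "e \<in> {0<..} - U" by blast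
  have e: "0 < e" "\<And>i j. i < ?n \<Longrightarrow> j < ?n \<Longrightarrow> i \<noteq> j \<Longrightarrow> e \<notin> bad i j"
  proof -
    show "0 < e" using eU by simp
    show "e \<notin> bad i j" if "i < ?n" "j < ?n" "i \<noteq> j" for i j
      using eU that unfolding U_def by blast
  qed
  have Re: "Re (shear ?n e z i) = (Re (z i) + e * Im (z i)) / (1 + e)" if "i < ?n" for i
    using that by (simp add: shear_def del: of_real_divide of_real_add of_real_mult)
  have "inj_on (\<lambda>i. Re (shear ?n e z i)) {..<?n}"
  proof (rule inj_onI)
    fix i j assume ij: "i \<in> {..<?n}" "j \<in> {..<?n}" and "Re (shear ?n e z i) = Re (shear ?n e z j)"
    then have "e \<in> bad i j" using e(1) by (simp add: Re bad_def)
    then show "i = j" using e(2)[of i j] ij by auto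
  qed
  then obtain w where w: "w \<in> words xs x" "shear ?n e z \<in> cell xs x w"
    using sorted_word[OF shear_Conf[OF z]] e(1) by (metis less_imp_le)
  have "continuous_on {0..1} (\<lambda>t. shear ?n (t * e) z)"
  proof (rule continuous_on_tuple[of ?n])
    have "1 + t * e \<noteq> 0" if "t \<in> {0..1}" for t using that e(1) by (smt (verit) atLeastAtMost_iff mult_nonneg_nonneg)
    then have "1 + complex_of_real t * complex_of_real e \<noteq> 0" if "t \<in> {0..1}" for t
      using that by (metis of_real_1 of_real_add of_real_mult of_real_eq_0_iff)
    then show "continuous_on {0..1} (\<lambda>t. shear ?n (t * e) z i)" if "i < ?n" for i
      using that by (auto simp: shear_def intro!: continuous_intros)
  qed (simp add: shear_def)
  then have "path_in (Conf xs x) (\<lambda>t. shear ?n (t * e) z)"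
    using shear_Conf[OF z] e(1) by (simp add: path_in_iff)
  moreover have "shear ?n (0 * e) z = z"
    using z by (auto simp: shear_def Conf_iff extensional_def)
  ultimately show thesis using that[of w "\<lambda>t. shear ?n (t * e) z"] w by simp
qed

text \<open>From a configuration in generic position, a segment inside its cell leads to the centers
  of a tree with the same word. The resulting path of centers is lifted and reversed.\<close>

lemma path_to_tree:
  assumes d: "d \<in> swiss_cheese xs x"
  obtains t p where "t \<in> trees xs x" "path_in (swiss_cheese xs x) p" "p 0 = embed xs x t" "p 1 = d"
proof -
  obtain w k where k: "w \<in> words xs x" "path_in (Conf xs x) k" "k 0 = centers xs d" "k 1 \<in> cell xs x w"
    using generic_position[OF centers_Conf[OF d]] by blast
  obtain t where t: "t \<in> trees xs x" "leaves t = w"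
    using k(1) unfolding omega_image[of xs x, symmetric] omega_def by blast
  let ?m = "\<lambda>s. mix (length xs) s (k 1) (centers xs (embed xs x t))"
  have c: "centers xs (embed xs x t) \<in> cell xs x w" using centers_embed[OF t(1)] t(2) by simp
  have "path_in (Conf xs x) ?m"
    using mix_closed_cell[OF k(1)] k(4) c
    by (auto intro!: path_in_mix cellD[of _ xs x w] simp: mix_closed_def)
  moreover have ex: "k 1 \<in> extensional {..<length xs}" "centers xs (embed xs x t) \<in> extensional {..<length xs}"
    using k(4) c by (auto simp: cell_def Conf_iff)
  ultimately have km: "path_in (Conf xs x) (k +++ ?m)"
    using k by (intro path_in_join) (auto simp: pathstart_def pathfinish_def)
  have ends: "(k +++ ?m) 0 = centers xs d" "(k +++ ?m) 1 = centers xs (embed xs x t)"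
    using ex k by (auto simp: joinpaths_def)
  obtain p where p: "path_in (swiss_cheese xs x) p" "p 0 = d" "p 1 = embed xs x t"
    using lift_path[OF km d _ embed_swiss_cheese[OF t(1)]] ends by metis
  show thesis
    using that[OF t(1) path_in_reverse[OF p(1)]] p by (simp add: reversepath_def)
qed


section \<open>Insertion of configurations\<close>

lemma conf_ins_renumber: "l \<noteq> i \<Longrightarrow> conf_ins \<epsilon> i m z u (renumber i m l) = z l"
  and conf_ins_add: "r < m \<Longrightarrow> conf_ins \<epsilon> i m z u (i + r) = z i + of_real \<epsilon> * u r"
  by (simp_all add: conf_ins_def splice_renumber splice_add)

text \<open>Points of \<open>u\<close> have norm below 1, so the inserted points lie in the open
  ball of radius \<epsilon> about \<open>z i\<close>. The remaining hypotheses keep this ball inside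
  the unit disk, free of the other points and, at a closed input of an open output, above the real
  axis.\<close>

lemma conf_ins_Conf:
  assumes z: "z \<in> Conf xs x" and i: "i < length xs" and u: "u \<in> Conf ys (xs ! i)"
    and n: "\<And>r. r < length ys \<Longrightarrow> norm (u r) < 1" and e: "0 < \<epsilon>" "norm (z i) + \<epsilon> \<le> 1"
    and I: "x = Op \<Longrightarrow> xs ! i = Cl \<Longrightarrow> \<epsilon> \<le> Im (z i)"
    and d: "\<And>j. j < length xs \<Longrightarrow> j \<noteq> i \<Longrightarrow> \<epsilon> \<le> dist (z i) (z j)"
  shows "conf_ins \<epsilon> i (length ys) z u \<in> Conf (graft xs i ys) x" (is "?c \<in> _")
proof -
  let ?m = "length ys"
  have a: "admissible xs x" "admissible ys (xs ! i)" using z u by (simp_all add: Conf_iff)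
  have m: "0 < ?m" using admissible_nonempty[OF a(2)] .
  have small: "norm (of_real \<epsilon> * u r) < \<epsilon>" if "r < ?m" for r
    using n[OF that] e by (simp add: norm_mult)
  have ne: "z j \<noteq> z i + of_real \<epsilon> * u r" if "j < length xs" "j \<noteq> i" "r < ?m" for j r
  proof
    assume "z j = z i + of_real \<epsilon> * u r"
    then have "dist (z i) (z j) = norm (of_real \<epsilon> * u r)" by (simp add: dist_norm)
    then show False using d[OF that(1,2)] small[OF that(3)] by simp
  qed
  have pl: "z i + of_real \<epsilon> * u r \<in> place (ys ! r) x" if r: "r < ?m" for r
  proof -
    have pz: "z i \<in> place (xs ! i) x" and pu: "u r \<in> place (ys ! r) (xs ! i)"
      using z u i r by (simp_all add: Conf_iff)
    have "norm (z i + of_real \<epsilon> * u r) < 1"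
      using norm_triangle_ineq[of "z i" "of_real \<epsilon> * u r"] small[OF r] e(2) by linarith
    moreover have "Im (z i + of_real \<epsilon> * u r) > 0" if "x = Op" "ys ! r = Cl"
    proof (cases "xs ! i")
      case Cl
      have "\<bar>Im (of_real \<epsilon> * u r)\<bar> < \<epsilon>" using abs_Im_le_cmod[of "of_real \<epsilon> * u r"] small[OF r] by linarith
      then show ?thesis using I[OF that(1) Cl] by simp
    next
      case Op
      then show ?thesis using pz pu that e(1) by (simp add: place_iff)
    qed
    moreover have "Im (z i + of_real \<epsilon> * u r) = 0" if "x = Op" "ys ! r = Op"
    proof -
      have "xs ! i = Op" using a(2) nth_mem[OF r] that(2) by (cases "xs ! i") (auto simp: admissible_def)
      then show ?thesis using pz pu that by (simp add: place_iff)
    qed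
    ultimately show ?thesis by (simp add: place_iff)
  qed
  show ?thesis
    unfolding Conf_iff length_graft[OF i]
  proof (intro conjI allI impI)
    show "?c \<in> extensional {..<length xs + ?m - 1}"
      unfolding conf_ins_def using z i m by (intro splice_extensional) (auto simp: Conf_iff)
    show "admissible (graft xs i ys) x" using admissible_graft[OF a(1) i a(2)] .
    show "?c j \<in> place (graft xs i ys ! j) x" if "j < length xs + ?m - 1" for j
      using that i
    proof (cases rule: splice_index_cases)
      case (outer l)
      then show ?thesis using z i by (simp add: conf_ins_renumber nth_graft_renumber Conf_iff)
    next
      case (inner r)
      then show ?thesis using pl i by (simp add: conf_ins_add nth_graft_add)
    qed
    show "?c j \<noteq> ?c k"
      if j: "j < length xs + ?m - 1" and k: "k < length xs + ?m - 1" and jk: "j \<noteq> k" for j k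
      using j i
    proof (cases rule: splice_index_cases)
      case j: (outer l)
      show ?thesis using k i
      proof (cases rule: splice_index_cases)
        case (outer l')
        then show ?thesis using j z jk by (auto simp: conf_ins_renumber Conf_iff)
      next
        case (inner r)
        then show ?thesis using j ne by (simp add: conf_ins_renumber conf_ins_add)
      qed
    next
      case j: (inner r)
      show ?thesis using k i
      proof (cases rule: splice_index_cases)
        case (outer l)
        then show ?thesis using j ne[of l r] by (simp add: conf_ins_renumber conf_ins_add)
      next
        case (inner r')
        then have "u r \<noteq> u r'" using j jk u by (auto simp: Conf_iff)
        then show ?thesis using inner j e by (simp add: conf_ins_add)
      qed
    qed
  qed
qed

text \<open>By \<open>d\<close> the inserted points occupy a vertical strip that contains no other
  point, so reading from left to right substitutes one word into the other.\<close>

lemma conf_ins_cell: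
  assumes z: "z \<in> cell xs x w" "w \<in> words xs x" and i: "i < length xs"
    and u: "u \<in> cell ys (xs ! i) v" "v \<in> words ys (xs ! i)"
    and n: "\<And>r. r < length ys \<Longrightarrow> norm (u r) < 1" and e: "0 < \<epsilon>"
    and d: "\<And>j. j < length xs \<Longrightarrow> j \<noteq> i \<Longrightarrow> \<epsilon> \<le> \<bar>Re (z i) - Re (z j)\<bar>"
    and C: "conf_ins \<epsilon> i (length ys) z u \<in> Conf (graft xs i ys) x"
  shows "conf_ins \<epsilon> i (length ys) z u \<in> cell (graft xs i ys) x (word_ins i w v)" (is "?c \<in> _")
proof -
  have wv: "distinct w" "set w = {..<length xs}" "distinct v" "set v = {..<length ys}"
    using z u by (auto simp: words_def)
  have len: "length v = length ys" using wv distinct_card[of v] by simp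
  obtain w1 w2 where w: "w = w1 @ i # w2" using i wv(2) by (metis lessThan_iff split_list)
  have ni: "i \<notin> set w1" "i \<notin> set w2" using wv(1) w by auto
  have lw: "l < length xs \<and> l \<noteq> i" if "l \<in> set w1 \<union> set w2" for l
    using that wv(2) w ni by auto
  have lv: "r < length ys" if "r \<in> set v" for r using that wv(4) by auto
  note de = word_ins_decomp[OF ni, of v, folded w, unfolded len]
  have sz: "sorted_wrt (\<lambda>i j. Re (z i) < Re (z j)) (w1 @ i # w2)" using z w by (simp add: cell_def)
  have outer: "Re (?c (renumber i (length ys) l)) = Re (z l)" if "l \<in> set w1 \<union> set w2" for l
    using lw[OF that] by (simp add: conf_ins_renumber)
  have inner: "Re (?c (i + r)) = Re (z i) + \<epsilon> * Re (u r)" if "r \<in> set v" for r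
    using lv[OF that] by (simp add: conf_ins_add)
  have near: "\<bar>\<epsilon> * Re (u r)\<bar> < \<epsilon>" if "r \<in> set v" for r
    using n[OF lv[OF that]] abs_Re_le_cmod[of "u r"] e by (simp add: abs_mult)
  have 1: "Re (z l) < Re (z i) + \<epsilon> * Re (u r)" if "l \<in> set w1" "r \<in> set v" for l r
    using sz near[OF that(2)] d[of l] lw[of l] that by (auto simp: sorted_wrt_append)
  have 2: "Re (z i) + \<epsilon> * Re (u r) < Re (z l)" if "l \<in> set w2" "r \<in> set v" for l r
    using sz near[OF that(2)] d[of l] lw[of l] that by (auto simp: sorted_wrt_append)
  have 3: "sorted_wrt (\<lambda>a b. Re (?c (i + a)) < Re (?c (i + b))) v"
    by (rule sorted_wrt_mono_rel[of _ "\<lambda>a b. Re (u a) < Re (u b)"]) (use u e inner in \<open>auto simp: cell_def\<close>)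
  have 4: "sorted_wrt (\<lambda>a b. Re (?c (renumber i (length ys) a)) < Re (?c (renumber i (length ys) b))) w'"
    if "w' = w1 \<or> w' = w2" for w'
    by (rule sorted_wrt_mono_rel[of _ "\<lambda>a b. Re (z a) < Re (z b)"])
      (use that sz outer in \<open>auto simp: sorted_wrt_append\<close>)
  have "Re (z a) < Re (z b)" if "a \<in> set w1" "b \<in> set w2" for a b
    using sz that by (auto simp: sorted_wrt_append)
  then have "sorted_wrt (\<lambda>i j. Re (?c i) < Re (?c j)) (word_ins i w v)"
    unfolding de sorted_wrt_append sorted_wrt_map using 1 2 3 4 outer inner by auto
  then show ?thesis using C by (simp add: cell_def)
qed

lemma continuous_on_conf_ins:
  assumes f: "continuous_on S f" and g: "continuous_on S g" and e: "continuous_on S e"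
  shows "continuous_on S (\<lambda>y. conf_ins (e y) i m (f y) (g y))"
proof (rule continuous_on_coordinatewise_then_product)
  fix j
  have [continuous_intros]: "continuous_on S (\<lambda>y. f y k)" "continuous_on S (\<lambda>y. g y k)" for k
    using f g by (auto intro: continuous_on_nth)
  show "continuous_on S (\<lambda>y. conf_ins (e y) i m (f y) (g y) j)"
    unfolding conf_ins_def splice_def
    by (cases "j < i"; cases "j < i + m") (auto intro!: continuous_intros e)
qed

text \<open>A continuous substitute for the minimal difference of real parts, formed as a product in
  the manner of \<open>radius\<close>; halving keeps the factors at most 1 in the open disk.\<close>

definition gap :: "nat \<Rightarrow> (nat \<Rightarrow> complex) \<Rightarrow> real" where
  "gap n z = (\<Prod>(i, j)\<in>{..<n} \<times> {..<n}. if i = j then 1 else \<bar>Re (z i) - Re (z j)\<bar> / 2)"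

lemma gap_bounds:
  assumes z: "z \<in> cell xs x w" "w \<in> words xs x" and n: "\<And>i. i < length xs \<Longrightarrow> norm (z i) < 1"
  shows "0 < gap (length xs) z"
    and "i < length xs \<Longrightarrow> j < length xs \<Longrightarrow> i \<noteq> j \<Longrightarrow> gap (length xs) z \<le> \<bar>Re (z i) - Re (z j)\<bar>"
proof -
  let ?f = "\<lambda>(i, j). if i = j then 1 else \<bar>Re (z i) - Re (z j)\<bar> / 2"
  have b: "0 < ?f k \<and> ?f k \<le> 1" if k: "k \<in> {..<length xs} \<times> {..<length xs}" for k
  proof -
    obtain i j where ij: "k = (i, j)" "i < length xs" "j < length xs" using k by auto
    have "\<bar>Re (z i)\<bar> < 1" "\<bar>Re (z j)\<bar> < 1"
      using n[OF ij(2)] n[OF ij(3)] abs_Re_le_cmod[of "z i"] abs_Re_le_cmod[of "z j"] by linarith+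
    moreover have "Re (z i) \<noteq> Re (z j)" if "i \<noteq> j"
    proof -
      have "i \<in> set w" "j \<in> set w" using z(2) ij by (simp_all add: words_def)
      then show ?thesis using sorted_wrt_total[of _ w i j] z(1) that unfolding cell_def by fastforce
    qed
    ultimately show ?thesis using ij by auto
  qed
  show "0 < gap (length xs) z" unfolding gap_def using b by (intro prod_pos) auto
  show "gap (length xs) z \<le> \<bar>Re (z i) - Re (z j)\<bar>" if "i < length xs" "j < length xs" "i \<noteq> j"
  proof -
    have "gap (length xs) z \<le> ?f (i, j)"
      unfolding gap_def by (rule prod_le_factor) (use that b in auto)
    then show ?thesis using that by simp
  qed
qed

lemma continuous_on_gap:
  assumes "continuous_on S f"
  shows "continuous_on S (\<lambda>y. gap n (f y))"
proof -
  have [continuous_intros]: "continuous_on S (\<lambda>y. f y i)" for i by (rule continuous_on_nth[OF assms])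
  show ?thesis
    unfolding gap_def
  proof (rule continuous_on_prod)
    fix k :: "nat \<times> nat"
    obtain i j where k: "k = (i, j)" by (cases k)
    show "continuous_on S (\<lambda>y. case k of (i, j) \<Rightarrow> if i = j then 1 else \<bar>Re (f y i) - Re (f y j)\<bar> / 2)"
      unfolding k by (cases "i = j") (auto intro!: continuous_intros)
  qed
qed

lemma positive_lower_bound:
  fixes f :: "'a::topological_space \<Rightarrow> real"
  assumes "compact K" "continuous_on K f" "\<And>y. y \<in> K \<Longrightarrow> 0 < f y"
  obtains e where "0 < e" "\<And>y. y \<in> K \<Longrightarrow> e \<le> f y"
proof (cases "K = {}")
  case False
  then obtain y where "y \<in> K" "\<forall>z\<in>K. f y \<le> f z" using continuous_attains_inf[OF assms(1) _ assms(2)] by blast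
  then show ?thesis using that[of "f y"] assms(3) by blast
qed (use that[of 1] in auto)

text \<open>
  A homotopy between paths in the open disk can be pushed into the open disk, by scaling it with
  \<open>1 - s (1 - s)\<close> at time \<open>s\<close>.
\<close>

lemma end_homotopic_open:
  assumes eh: "end_homotopic (Conf xs x) (cell xs x w) (cell xs x w') p q"
    and w: "w \<in> words xs x" "w' \<in> words xs x"
    and n: "\<And>t i. t \<in> {0..1} \<Longrightarrow> i < length xs \<Longrightarrow> norm (p t i) < 1 \<and> norm (q t i) < 1"
  shows "\<exists>h. continuous_on ({0..1} \<times> {0..1}) h \<and> h ` ({0..1} \<times> {0..1}) \<subseteq> Conf xs x \<and>
    (\<forall>t\<in>{0..1}. h (0, t) = p t \<and> h (1, t) = q t) \<and>
    (\<forall>s\<in>{0..1::real}. h (s, 0) \<in> cell xs x w \<and> h (s, 1) \<in> cell xs x w') \<and>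
    (\<forall>y\<in>{0..1} \<times> {0..1}. \<forall>i<length xs. norm (h y i) < 1)"
proof -
  obtain h where h: "continuous_on ({0..1} \<times> {0..1}) h" "h ` ({0..1} \<times> {0..1}) \<subseteq> Conf xs x"
     "\<forall>t\<in>{0..1}. h (0, t) = p t \<and> h (1, t) = q t"
     "\<forall>s\<in>{0..1::real}. h (s, 0) \<in> cell xs x w \<and> h (s, 1) \<in> cell xs x w'"
    using eh unfolding end_homotopic_def by blast
  \<comment> \<open>The factor is 1 at both ends, so \<open>p\<close> and \<open>q\<close> are
    unchanged, and it lies in \<open>[3/4, 1)\<close> in between, where \<open>h\<close> may touch
    the unit circle.\<close>
  define c :: "real \<Rightarrow> real" where "c s = 1 - s * (1 - s)" for s
  have c: "0 < c s" "c s \<le> 1" if "s \<in> {0..1}" for s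
  proof -
    have "s * (1 - s) \<le> 1 / 4" using zero_le_power2[of "s - 1/2"] by (simp add: power2_eq_square algebra_simps)
    then show "0 < c s" by (simp add: c_def)
    show "c s \<le> 1" using that by (simp add: c_def)
  qed
  have c1: "c s < 1" if "s \<in> {0<..<1}" for s using that by (simp add: c_def)
  let ?k = "\<lambda>y. scale (length xs) (c (fst y)) (h y)"
  have "continuous_on ({0..1} \<times> {0..1}) ?k"
    unfolding c_def
    by (intro continuous_on_scale h(1) continuous_on_diff continuous_on_mult continuous_on_fst
        continuous_on_id continuous_on_const)
  moreover have "?k ` ({0..1} \<times> {0..1}) \<subseteq> Conf xs x" using h(2) c by (auto intro!: scale_Conf)
  moreover have "?k (0, t) = p t" "?k (1, t) = q t" if "t \<in> {0..1}" for t
  proof -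
    have "h (0, t) \<in> Conf xs x" "h (1, t) \<in> Conf xs x" using h(2) that by (auto simp: image_subset_iff)
    then have "h (0, t) \<in> extensional {..<length xs}" "h (1, t) \<in> extensional {..<length xs}"
      by (simp_all add: Conf_iff)
    then show "?k (0, t) = p t" "?k (1, t) = q t" using h(3) that by (auto simp: c_def)
  qed
  moreover have "?k (s, 0) \<in> cell xs x w" "?k (s, 1) \<in> cell xs x w'" if "s \<in> {0..1}" for s
    using h(4) that c[OF that] w by (auto intro!: scale_cell)
  moreover have "norm (?k y i) < 1" if y: "y \<in> {0..1} \<times> {0..1}" and i: "i < length xs" for y i
  proof -
    obtain s t where st: "y = (s, t)" "s \<in> {0..1}" "t \<in> {0..1}" using y by auto
    have "h y \<in> Conf xs x" using h(2) y by blast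
    then have "norm (h y i) \<le> 1" using i by (simp add: Conf_iff place_iff)
    moreover have "norm (?k y i) = c s * norm (h y i)"
      using i st c(1)[OF st(2)] by (simp add: scale_nth norm_mult)
    moreover have "norm (h y i) < 1" if "s = 0 \<or> s = 1" using that st h(3) n[OF st(3) i] by auto
    moreover have "s = 0 \<or> s = 1 \<or> s \<in> {0<..<1}" using st by auto
    moreover have "c s * norm (h y i) \<le> c s" if "norm (h y i) \<le> 1"
      using that c(1)[OF st(2)] by (intro mult_left_le) auto
    moreover have "c 0 = 1" "c 1 = 1" by (simp_all add: c_def)
    ultimately show ?thesis using c1[of s] by fastforce
  qed
  ultimately show ?thesis by (intro exI[of _ ?k]) blast
qed

text \<open>One scale has to work for a whole homotopy. Inside the open disk \<open>radius\<close>
  is positive, hence bounded below on the compact square, and likewise \<open>gap\<close> on the two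
  sides where the ends move. Any smaller \<epsilon> keeps the points distinct throughout and the
  words unchanged at the ends.\<close>

lemma conf_ins_homotopic:
  assumes i: "i < length xs"
    and p: "end_homotopic (Conf xs x) (cell xs x w) (cell xs x w') p p'" "w \<in> words xs x" "w' \<in> words xs x"
      "\<And>t i. t \<in> {0..1} \<Longrightarrow> i < length xs \<Longrightarrow> norm (p t i) < 1 \<and> norm (p' t i) < 1"
    and q: "end_homotopic (Conf ys (xs ! i)) (cell ys (xs ! i) v) (cell ys (xs ! i) v') q q'"
      "v \<in> words ys (xs ! i)" "v' \<in> words ys (xs ! i)"
      "\<And>t i. t \<in> {0..1} \<Longrightarrow> i < length ys \<Longrightarrow> norm (q t i) < 1 \<and> norm (q' t i) < 1"
  shows "\<forall>\<^sub>F \<epsilon> in at_right 0. end_homotopic (Conf (graft xs i ys) x)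
    (cell (graft xs i ys) x (word_ins i w v)) (cell (graft xs i ys) x (word_ins i w' v'))
    (\<lambda>t. conf_ins \<epsilon> i (length ys) (p t) (q t)) (\<lambda>t. conf_ins \<epsilon> i (length ys) (p' t) (q' t))"
proof -
  let ?Q = "{0..1::real} \<times> {0..1::real}"
  have "\<exists>h. continuous_on ?Q h \<and> h ` ?Q \<subseteq> Conf xs x \<and> (\<forall>t\<in>{0..1}. h (0, t) = p t \<and> h (1, t) = p' t) \<and>
      (\<forall>s\<in>{0..1::real}. h (s, 0) \<in> cell xs x w \<and> h (s, 1) \<in> cell xs x w') \<and>
      (\<forall>y\<in>?Q. \<forall>i<length xs. norm (h y i) < 1)"
    by (rule end_homotopic_open[OF p(1-3)]) (rule p(4))
  then obtain h where h0: "continuous_on ?Q h \<and> h ` ?Q \<subseteq> Conf xs x \<and> (\<forall>t\<in>{0..1}. h (0, t) = p t \<and> h (1, t) = p' t) \<and>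
      (\<forall>s\<in>{0..1::real}. h (s, 0) \<in> cell xs x w \<and> h (s, 1) \<in> cell xs x w') \<and>
      (\<forall>y\<in>?Q. \<forall>i<length xs. norm (h y i) < 1)" ..
  have h: "continuous_on ?Q h" "h ` ?Q \<subseteq> Conf xs x"
    "\<And>t. t \<in> {0..1} \<Longrightarrow> h (0, t) = p t" "\<And>t. t \<in> {0..1} \<Longrightarrow> h (1, t) = p' t"
    "\<And>s. s \<in> {0..1} \<Longrightarrow> h (s, 0) \<in> cell xs x w" "\<And>s. s \<in> {0..1} \<Longrightarrow> h (s, 1) \<in> cell xs x w'"
    "\<And>y i. y \<in> ?Q \<Longrightarrow> i < length xs \<Longrightarrow> norm (h y i) < 1"
    using h0 by auto
  have "\<exists>h. continuous_on ?Q h \<and> h ` ?Q \<subseteq> Conf ys (xs ! i) \<and> (\<forall>t\<in>{0..1}. h (0, t) = q t \<and> h (1, t) = q' t) \<and>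
      (\<forall>s\<in>{0..1::real}. h (s, 0) \<in> cell ys (xs ! i) v \<and> h (s, 1) \<in> cell ys (xs ! i) v') \<and>
      (\<forall>y\<in>?Q. \<forall>i<length ys. norm (h y i) < 1)"
    by (rule end_homotopic_open[OF q(1-3)]) (rule q(4))
  then obtain k where k0: "continuous_on ?Q k \<and> k ` ?Q \<subseteq> Conf ys (xs ! i) \<and> (\<forall>t\<in>{0..1}. k (0, t) = q t \<and> k (1, t) = q' t) \<and>
      (\<forall>s\<in>{0..1::real}. k (s, 0) \<in> cell ys (xs ! i) v \<and> k (s, 1) \<in> cell ys (xs ! i) v') \<and>
      (\<forall>y\<in>?Q. \<forall>i<length ys. norm (k y i) < 1)" ..
  have k: "continuous_on ?Q k" "k ` ?Q \<subseteq> Conf ys (xs ! i)"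
    "\<And>t. t \<in> {0..1} \<Longrightarrow> k (0, t) = q t" "\<And>t. t \<in> {0..1} \<Longrightarrow> k (1, t) = q' t"
    "\<And>s. s \<in> {0..1} \<Longrightarrow> k (s, 0) \<in> cell ys (xs ! i) v" "\<And>s. s \<in> {0..1} \<Longrightarrow> k (s, 1) \<in> cell ys (xs ! i) v'"
    "\<And>y i. y \<in> ?Q \<Longrightarrow> i < length ys \<Longrightarrow> norm (k y i) < 1"
    using k0 by auto
  have rb: "h y \<in> Conf xs x" "\<forall>j<length xs. norm (h y j) < 1" if "y \<in> ?Q" for y
    using h(2,7) that by auto
  obtain e1 where e1: "0 < e1" "\<And>y. y \<in> ?Q \<Longrightarrow> e1 \<le> radius xs x (h y)"
    using positive_lower_bound[OF compact_Times[OF compact_Icc compact_Icc] continuous_on_radius[OF h(1)]]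
      radius_bounds(1)[OF rb] by blast
  have cs: "continuous_on {0..1} (\<lambda>s::real. h (s, 0))" "continuous_on {0..1} (\<lambda>s::real. h (s, 1))"
    by (rule continuous_on_compose2[OF h(1)];
        auto intro!: continuous_on_Pair continuous_on_id continuous_on_const)+
  have "0 < gap (length xs) (h (s, 0))" if "s \<in> {0..1}" for s
    by (rule gap_bounds(1)[OF h(5)[OF that] p(2) h(7)]) (use that in auto)
  then obtain e2 where e2: "0 < e2" "\<And>s. s \<in> {0..1} \<Longrightarrow> e2 \<le> gap (length xs) (h (s, 0))"
    using positive_lower_bound[OF compact_Icc continuous_on_gap[OF cs(1)]] by blast
  have "0 < gap (length xs) (h (s, 1))" if "s \<in> {0..1}" for s
    by (rule gap_bounds(1)[OF h(6)[OF that] p(3) h(7)]) (use that in auto)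
  then obtain e3 where e3: "0 < e3" "\<And>s. s \<in> {0..1} \<Longrightarrow> e3 \<le> gap (length xs) (h (s, 1))"
    using positive_lower_bound[OF compact_Icc continuous_on_gap[OF cs(2)]] by blast
  show ?thesis
  proof (rule eventually_at_rightI)
    show "0 < min e1 (min e2 e3)" using e1 e2 e3 by simp
    fix \<epsilon> assume "\<epsilon> \<in> {0<..<min e1 (min e2 e3)}"
    then have e: "0 < \<epsilon>" "\<epsilon> < e1" "\<epsilon> < e2" "\<epsilon> < e3" by auto
    let ?g = "\<lambda>y. conf_ins \<epsilon> i (length ys) (h y) (k y)"
    have C: "?g y \<in> Conf (graft xs i ys) x" if y: "y \<in> ?Q" for y
    proof (rule conf_ins_Conf[OF _ i])
      note r = radius_bounds[OF rb[OF y]]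
      have er: "\<epsilon> \<le> radius xs x (h y)" using e e1(2)[OF y] by simp
      show "norm (h y i) + \<epsilon> \<le> 1" using r(2)[OF i] er by simp
      show "\<epsilon> \<le> Im (h y i)" if "x = Op" "xs ! i = Cl" using r(3)[OF i that] er by simp
      show "\<epsilon> \<le> dist (h y i) (h y j)" if "j < length xs" "j \<noteq> i" for j
        using r(4)[OF i that(1)] that er e(1) by simp
    qed (use y h k e in auto)
    have A: "?g (s, 0) \<in> cell (graft xs i ys) x (word_ins i w v)" if s: "s \<in> {0..1}" for s
    proof (rule conf_ins_cell[OF h(5)[OF s] p(2) i k(5)[OF s] q(2) _ e(1) _ C])
      show "\<epsilon> \<le> \<bar>Re (h (s, 0) i) - Re (h (s, 0) j)\<bar>" if "j < length xs" "j \<noteq> i" for j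
        using gap_bounds(2)[OF h(5)[OF s] p(2) h(7) i that(1)] e2(2)[OF s] e s that by auto
    qed (use k(7) s in auto)
    have B: "?g (s, 1) \<in> cell (graft xs i ys) x (word_ins i w' v')" if s: "s \<in> {0..1}" for s
    proof (rule conf_ins_cell[OF h(6)[OF s] p(3) i k(6)[OF s] q(3) _ e(1) _ C])
      show "\<epsilon> \<le> \<bar>Re (h (s, 1) i) - Re (h (s, 1) j)\<bar>" if "j < length xs" "j \<noteq> i" for j
        using gap_bounds(2)[OF h(6)[OF s] p(3) h(7) i that(1)] e3(2)[OF s] e s that by auto
    qed (use k(7) s in auto)
    show "end_homotopic (Conf (graft xs i ys) x)
      (cell (graft xs i ys) x (word_ins i w v)) (cell (graft xs i ys) x (word_ins i w' v'))
      (\<lambda>t. conf_ins \<epsilon> i (length ys) (p t) (q t)) (\<lambda>t. conf_ins \<epsilon> i (length ys) (p' t) (q' t))"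
      unfolding end_homotopic_def
    proof (intro exI conjI ballI)
      show "continuous_on ?Q ?g" by (intro continuous_on_conf_ins h(1) k(1) continuous_on_const)
      show "?g ` ?Q \<subseteq> Conf (graft xs i ys) x" using C by blast
    qed (use h(3,4) k(3,4) A B in auto)
  qed
qed

text \<open>The scale of the inserted configuration can be enlarged up to the radius of the disk.\<close>

lemma conf_ins_centers:
  assumes i: "i < length xs"
    and p: "path_in (swiss_cheese xs x) p" "p 0 = embed xs x t" "p 1 = embed xs x t'"
      "t \<in> trees xs x" "t' \<in> trees xs x"
    and q: "path_in (swiss_cheese ys (xs ! i)) q" "q 0 = embed ys (xs ! i) s" "q 1 = embed ys (xs ! i) s'"
      "s \<in> trees ys (xs ! i)" "s' \<in> trees ys (xs ! i)"
  shows "\<forall>\<^sub>F \<epsilon> in at_right 0. end_homotopic (Conf (graft xs i ys) x)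
    (cell (graft xs i ys) x (word_ins i (leaves t) (leaves s)))
    (cell (graft xs i ys) x (word_ins i (leaves t') (leaves s')))
    (\<lambda>r. conf_ins \<epsilon> i (length ys) (centers xs (p r)) (centers ys (q r)))
    (centers (graft xs i ys) \<circ> (\<lambda>r. ins SC xs x i ys (p r) (q r)))"
proof -
  let ?G = "graft xs i ys" and ?m = "length ys"
  have cont: "continuous_on {0..1} p" "continuous_on {0..1} q" using p q by (auto simp: path_in_iff)
  have P: "p r \<in> swiss_cheese xs x" and Q: "q r \<in> swiss_cheese ys (xs ! i)" if "r \<in> {0..1}" for r
    using path_inD[OF p(1) that] path_inD[OF q(1) that] by auto
  have m: "0 < ?m" using Q[of 0] by (auto simp: swiss_cheese_iff dest: admissible_nonempty)
  have ok: "disk_ok (xs ! i) x (p r i)" if "r \<in> {0..1}" for r using P[OF that] i by (simp add: swiss_cheese_iff)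
  have "continuous_on {0..1} (\<lambda>r. fst (p r i))" by (rule continuous_on_fst[OF continuous_on_nth[OF cont(1)]])
  moreover have "0 < fst (p r i)" if "r \<in> {0..1}" for r using ok[OF that] by (simp add: disk_ok_def)
  ultimately obtain e0 where e0: "0 < e0" "\<And>r. r \<in> {0..1} \<Longrightarrow> e0 \<le> fst (p r i)"
    using positive_lower_bound[of "{0..1}" "\<lambda>r. fst (p r i)"] by blast
  have C: "conf_ins \<delta> i ?m (centers xs (p r)) (centers ys (q r)) \<in> Conf ?G x"
    if r: "r \<in> {0..1}" and d: "0 < \<delta>" "\<delta> \<le> fst (p r i)" for r \<delta>
  proof (rule conf_ins_Conf[OF centers_Conf[OF P[OF r]] i centers_Conf[OF Q[OF r]] norm_centers[OF Q[OF r]] d(1)])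
    show "norm (centers xs (p r) i) + \<delta> \<le> 1" using ok[OF r] i d by (simp add: disk_ok_def centers_nth)
    show "\<delta> \<le> Im (centers xs (p r) i)" if "x = Op" "xs ! i = Cl"
      using ok[OF r] i d that by (simp add: disk_ok_def centers_nth)
    show "\<delta> \<le> dist (centers xs (p r) i) (centers xs (p r) j)" if "j < length xs" "j \<noteq> i" for j
    proof -
      have "fst (p r i) + fst (p r j) \<le> dist (snd (p r i)) (snd (p r j))" "disk_ok (xs ! j) x (p r j)"
        using P[OF r] that i by (auto simp: swiss_cheese_iff)
      then show ?thesis using d that i by (simp add: disk_ok_def centers_nth)
    qed
  qed
  have cell: "conf_ins \<delta> i ?m (centers xs (p r)) (centers ys (q r)) \<in> cell ?G x (word_ins i (leaves u) (leaves v))"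
    if r: "r \<in> {0..1}" and d: "0 < \<delta>" "\<delta> \<le> fst (p r i)" and u: "p r = embed xs x u" "u \<in> trees xs x"
      and v: "q r = embed ys (xs ! i) v" "v \<in> trees ys (xs ! i)" for r \<delta> u v
  proof (rule conf_ins_cell[OF _ _ i _ _ norm_centers[OF Q[OF r]] d(1) _ C[OF r d]])
    show "centers xs (p r) \<in> cell xs x (leaves u)" using centers_embed[OF u(2)] u by simp
    show "centers ys (q r) \<in> cell ys (xs ! i) (leaves v)" using centers_embed[OF v(2)] v by simp
    show "leaves u \<in> words xs x" "leaves v \<in> words ys (xs ! i)"
      using omega_words[OF u(2)] omega_words[OF v(2)] by (simp_all add: omega_def)
    \<comment> \<open>In a tree whole disks are separated horizontally, so every scale up to the
      radius preserves the order of real parts.\<close>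
    show "\<delta> \<le> \<bar>Re (centers xs (p r) i) - Re (centers xs (p r) j)\<bar>" if j: "j < length xs" "j \<noteq> i" for j
    proof -
      have "i \<in> set (leaves u)" "j \<in> set (leaves u)" using u i j by (simp_all add: trees_iff)
      then have "left_of (p r i) (p r j) \<or> left_of (p r j) (p r i)"
        using sorted_wrt_total[OF embed_sorted[OF u(2)], of i j] j(2) u(1) by auto
      moreover have "0 < fst (p r j)" using P[OF r] j by (simp add: swiss_cheese_iff disk_ok_def)
      ultimately show ?thesis using d i j by (auto simp: left_of_def centers_nth)
    qed
  qed
  \<comment> \<open>The largest scale turns insertion of centers into composition of affine maps;
    the homotopy ends here.\<close>
  have top: "conf_ins (fst (p r i)) i ?m (centers xs (p r)) (centers ys (q r)) =
      centers ?G (ins SC xs x i ys (p r) (q r))" if r: "r \<in> {0..1}" for r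
  proof (rule ext)
    fix j
    show "conf_ins (fst (p r i)) i ?m (centers xs (p r)) (centers ys (q r)) j =
      centers ?G (ins SC xs x i ys (p r) (q r)) j"
    proof (cases "j < length xs + ?m - 1")
      case True
      then show ?thesis
        using i
      proof (cases rule: splice_index_cases)
        case (outer l)
        then show ?thesis using True i
          by (simp add: conf_ins_renumber ins_SC splice_renumber centers_def length_graft del: One_nat_def)
      next
        case (inner l)
        then show ?thesis using True i
          by (simp add: conf_ins_add ins_SC splice_add centers_def length_graft affine_comp_def
              del: One_nat_def)
      qed
    next
      case False
      have "conf_ins (fst (p r i)) i ?m (centers xs (p r)) (centers ys (q r)) \<in> extensional {..<length xs + ?m - 1}"
        unfolding conf_ins_def using i m by (intro splice_extensional) (auto simp: centers_def)
      then show ?thesis using False i by (simp add: extensional_def centers_def length_graft)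
    qed
  qed
  show ?thesis
  proof (rule eventually_at_rightI)
    show "0 < e0" by (rule e0)
    fix \<epsilon> assume "\<epsilon> \<in> {0<..<e0}"
    then have e: "0 < \<epsilon>" "\<And>r. r \<in> {0..1} \<Longrightarrow> \<epsilon> \<le> fst (p r i)" using e0 by force+
    \<comment> \<open>The scale interpolates between \<epsilon> and the radius, which varies along
      the path.\<close>
    let ?d = "\<lambda>y. (1 - fst y) * \<epsilon> + fst y * fst (p (snd y) i)"
    have d: "0 < ?d y" "?d y \<le> fst (p (snd y) i)" if y: "y \<in> {0..1} \<times> {0..1}" for y
    proof -
      have "\<epsilon> \<le> fst (p (snd y) i)" using e(2)[of "snd y"] y by auto
      then have "fst y * \<epsilon> \<le> fst y * fst (p (snd y) i)" "(1 - fst y) * \<epsilon> \<le> (1 - fst y) * fst (p (snd y) i)"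
        using y by (auto intro!: mult_left_mono)
      then show "0 < ?d y" "?d y \<le> fst (p (snd y) i)" using e(1) by (auto simp: algebra_simps)
    qed
    let ?g = "\<lambda>y. conf_ins (?d y) i ?m (centers xs (p (snd y))) (centers ys (q (snd y)))"
    have c2: "continuous_on ({0..1} \<times> {0..1}) (\<lambda>y::real \<times> real. f (snd y))"
      if "continuous_on {0..1} f" for f :: "real \<Rightarrow> nat \<Rightarrow> real \<times> complex"
      by (rule continuous_on_compose2[OF that]) (auto intro!: continuous_on_snd continuous_on_id)
    show "end_homotopic (Conf ?G x)
      (cell ?G x (word_ins i (leaves t) (leaves s))) (cell ?G x (word_ins i (leaves t') (leaves s')))
      (\<lambda>r. conf_ins \<epsilon> i ?m (centers xs (p r)) (centers ys (q r)))
      (centers ?G \<circ> (\<lambda>r. ins SC xs x i ys (p r) (q r)))"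
      unfolding end_homotopic_def
    proof (intro exI conjI ballI)
      have "continuous_on ({0..1} \<times> {0..1}) ?d"
        by (intro continuous_on_add continuous_on_mult continuous_on_diff continuous_on_const
            continuous_on_fst[OF continuous_on_id] continuous_on_fst[OF continuous_on_nth[OF c2[OF cont(1)]]])
      then show "continuous_on ({0..1} \<times> {0..1}) ?g"
        by (intro continuous_on_conf_ins continuous_on_centers c2[OF cont(1)] c2[OF cont(2)])
      show "?g ` ({0..1} \<times> {0..1}) \<subseteq> Conf ?G x" using C d by auto
      show "?g (0, r) = conf_ins \<epsilon> i ?m (centers xs (p r)) (centers ys (q r))" for r by simp
      show "?g (1, r) = (centers ?G \<circ> (\<lambda>r. ins SC xs x i ys (p r) (q r))) r" if "r \<in> {0..1}" for r
        using top[OF that] by simp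
      show "?g (a, 0) \<in> cell ?G x (word_ins i (leaves t) (leaves s))" if "a \<in> {0..1}" for a
        using d[of "(a, 0)"] that by (intro cell) (auto simp: p q)
      show "?g (a, 1) \<in> cell ?G x (word_ins i (leaves t') (leaves s'))" if "a \<in> {0..1}" for a
        using d[of "(a, 1)"] that by (intro cell) (auto simp: p q)
    qed
  qed
qed


section \<open>From the Swiss-Cheese operad to colored braids\<close>

definition tree_of :: "color list \<Rightarrow> color \<Rightarrow> (nat \<Rightarrow> real \<times> complex) \<Rightarrow> nat tree" where
  "tree_of xs x = the_inv_into (trees xs x) (embed xs x)"

text \<open>The set in the middle collects the braids of all representatives in \<open>K\<close>; by
  \<open>braid_of_class\<close> any single one of them determines it. The outer trees are the tags
  that arrows of \<open>PaPB\<close> carry.\<close>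

definition braid_of ::
  "color list \<Rightarrow> color \<Rightarrow> (nat \<Rightarrow> real \<times> complex) \<times> (real \<Rightarrow> nat \<Rightarrow> real \<times> complex) set \<times> (nat \<Rightarrow> real \<times> complex) \<Rightarrow>
    nat tree \<times> (nat list \<times> (real \<Rightarrow> nat \<Rightarrow> complex) set \<times> nat list) \<times> nat tree" where
  "braid_of xs x = (\<lambda>(a, K, b). (tree_of xs x a,
     (leaves (tree_of xs x a), {h. \<exists>p\<in>K. braid_homotopic xs x (centers xs \<circ> p) h}, leaves (tree_of xs x b)),
     tree_of xs x b))"

lemma tree_of_embed [simp]: "t \<in> trees xs x \<Longrightarrow> tree_of xs x (embed xs x t) = t"
  by (simp add: tree_of_def the_inv_into_f_f embed_inj)

section \<open>Arrows of \<open>CoPB\<close> as classes of paths\<close>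

definition word_path :: "color list \<Rightarrow> color \<Rightarrow> nat list \<Rightarrow> nat list \<Rightarrow> (real \<Rightarrow> nat \<Rightarrow> complex) \<Rightarrow> bool" where
  "word_path xs x w w' p \<longleftrightarrow> w \<in> words xs x \<and> w' \<in> words xs x \<and> path_in (Conf xs x) p \<and>
     p 0 \<in> cell xs x w \<and> p 1 \<in> cell xs x w'"

definition braid_class :: "color list \<Rightarrow> color \<Rightarrow> nat list \<Rightarrow> nat list \<Rightarrow> (real \<Rightarrow> nat \<Rightarrow> complex) \<Rightarrow>
    nat list \<times> (real \<Rightarrow> nat \<Rightarrow> complex) set \<times> nat list" where
  "braid_class xs x w w' p = (w, {h. braid_homotopic xs x p h}, w')"

lemma braid_homotopic_word_path:
  "word_path xs x w w' p \<Longrightarrow> braid_homotopic xs x p q \<longleftrightarrow>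
    end_homotopic (Conf xs x) (cell xs x w) (cell xs x w') p q"
  unfolding word_path_def by (intro braid_homotopic_iff) auto

lemma braid_homotopic_refl: "word_path xs x w w' p \<Longrightarrow> braid_homotopic xs x p p"
  using braid_homotopic_word_path by (metis end_homotopic_refl word_path_def)

lemma braid_homotopic_reflD:
  assumes "braid_homotopic xs x p p" "p 0 \<in> cell xs x w" "w \<in> words xs x" "p 1 \<in> cell xs x w'" "w' \<in> words xs x"
  shows "word_path xs x w w' p"
  using assms end_homotopic_path_in(1) by (auto simp: word_path_def braid_homotopic_iff[OF assms(3,5,2,4)])

lemma braid_class_eq_iff:
  assumes "word_path xs x w w' p"
  shows "{h. braid_homotopic xs x p h} = {h. braid_homotopic xs x q h} \<longleftrightarrow> braid_homotopic xs x p q"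
proof
  assume "{h. braid_homotopic xs x p h} = {h. braid_homotopic xs x q h}"
  then show "braid_homotopic xs x p q" using braid_homotopic_refl[OF assms] braid_homotopic_sym by blast
qed (use braid_homotopic_sym braid_homotopic_trans in blast)

lemma ar_CoPB: "ar CoPB xs x = path_groupoid (braid_homotopic xs x) (words xs x) (cell xs x)"
  by (simp add: CoPB_def)

text \<open>\<open>braid_homotopic\<close> relates a path to itself only if it runs in
  \<open>Conf xs x\<close> between cells, so the reflexivity condition in
  \<open>path_groupoid\<close> singles out the word paths.\<close>

lemma hom_CoPB:
  "hom (ar CoPB xs x) w w' = braid_class xs x w w' ` Collect (word_path xs x w w')"
proof -
  have "f \<in> hom (ar CoPB xs x) w w' \<longleftrightarrow> (\<exists>p. f = braid_class xs x w w' p \<and> word_path xs x w w' p)" for f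
    unfolding hom_def ar_CoPB path_groupoid_def braid_class_def pathstart_def pathfinish_def
    using braid_homotopic_reflD braid_homotopic_refl unfolding word_path_def by fastforce
  then show ?thesis by blast
qed

lemma Obj_CoPB [simp]: "Obj (ar CoPB xs x) = words xs x"
  by (simp add: ar_CoPB path_groupoid_def)

text \<open>The identity of \<open>path_groupoid\<close> is a union over all points of the cell.
  Constant paths at two of them are homotopic by moving the point along a segment in the
  cell.\<close>

lemma idn_CoPB:
  assumes w: "w \<in> words xs x" and z: "z \<in> cell xs x w"
  shows "idn (ar CoPB xs x) w = braid_class xs x w w (\<lambda>_. z)"
proof -
  have wp: "word_path xs x w w (\<lambda>_. y)" if "y \<in> cell xs x w" for y
    using that w by (auto simp: word_path_def intro!: path_in_const dest: cellD)
  have "braid_homotopic xs x (\<lambda>_. z) (\<lambda>_. y)" if y: "y \<in> cell xs x w" for y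
    unfolding braid_homotopic_word_path[OF wp[OF z]] end_homotopic_def
  proof (intro exI conjI ballI)
    let ?h = "\<lambda>u::real \<times> real. mix (length xs) (fst u) z y"
    have e: "z \<in> extensional {..<length xs}" "y \<in> extensional {..<length xs}"
      using y z by (auto simp: cell_def Conf_iff)
    show "continuous_on ({0..1} \<times> {0..1}) ?h"
      by (intro continuous_on_mix continuous_on_const continuous_on_fst continuous_on_id)
    show "?h (0, t) = z" "?h (1, t) = y" for t using e by simp_all
    show "?h (s, 0) \<in> cell xs x w" "?h (s, 1) \<in> cell xs x w" if "s \<in> {0..1}" for s
      using mix_closed_cell[OF w] y z that by (auto simp: mix_closed_def)
    show "?h ` ({0..1} \<times> {0..1}) \<subseteq> Conf xs x"
      using mix_closed_cell[OF w] y z by (auto simp: mix_closed_def intro!: cellD[of _ xs x w])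
  qed
  then have "{q. \<exists>y\<in>cell xs x w. braid_homotopic xs x (\<lambda>_. y) q} = {h. braid_homotopic xs x (\<lambda>_. z) h}"
    using z braid_homotopic_trans by blast
  then show ?thesis by (simp add: ar_CoPB path_groupoid_def braid_class_def)
qed

text \<open>Representatives are joined only if their ends match. That all such joins agree is
  \<open>end_homotopic_join\<close>, with the middle cell as the convex set.\<close>

lemma cmp_CoPB:
  assumes p: "word_path xs x w w' p" and q: "word_path xs x w' w'' q" and e: "p 1 = q 0"
  shows "cmp (ar CoPB xs x) (braid_class xs x w' w'' q) (braid_class xs x w w' p) = braid_class xs x w w'' (p +++ q)"
proof -
  have w: "w' \<in> words xs x" using p by (simp add: word_path_def)
  have pq: "word_path xs x w w'' (p +++ q)"
    using p q e path_in_join[of "Conf xs x" p q]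
    by (auto simp: word_path_def joinpaths_def pathstart_def pathfinish_def)
  have join: "braid_homotopic xs x (p +++ q) (p' +++ q')"
    if "braid_homotopic xs x p p'" "braid_homotopic xs x q q'" "p' 1 = q' 0" for p' q'
    using that(1,2) unfolding braid_homotopic_word_path[OF p] braid_homotopic_word_path[OF q] braid_homotopic_word_path[OF pq]
    using end_homotopic_join[of "Conf xs x" "cell xs x w" "cell xs x w'" p p' "cell xs x w''" q q' "length xs"]
      mix_closed_cell[OF w] e that(3) cellD by blast
  have "{h. \<exists>p'\<in>{h. braid_homotopic xs x p h}. \<exists>q'\<in>{h. braid_homotopic xs x q h}.
        pathfinish p' = pathstart q' \<and> braid_homotopic xs x (p' +++ q') h}
      = {h. braid_homotopic xs x (p +++ q) h}" (is "?L = ?R")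
  proof
    show "?L \<subseteq> ?R" using join braid_homotopic_trans unfolding pathstart_def pathfinish_def by blast
    show "?R \<subseteq> ?L"
      using braid_homotopic_refl[OF p] braid_homotopic_refl[OF q] e unfolding pathstart_def pathfinish_def by blast
  qed
  then show ?thesis by (simp add: ar_CoPB path_groupoid_def braid_class_def)
qed

section \<open>From paths between trees to arrows of \<open>PaPB\<close>\<close>

lemma ar_PaPB:
  "Obj (ar PaPB xs x) = trees xs x"
  "f \<in> hom (ar PaPB xs x) u v \<longleftrightarrow> u \<in> trees xs x \<and> v \<in> trees xs x \<and>
     (\<exists>g\<in>hom (ar CoPB xs x) (leaves u) (leaves v). f = (u, g, v))"
  by (auto simp: PaPB_def pullback_operad_def omega_def hom_def)

lemma hom_piSC: "hom (ar piSC xs x) a b =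
    path_class (swiss_cheese xs x) ` {p. path_in (swiss_cheese xs x) p \<and> p 0 = a \<and> p 1 = b}"
  by (simp add: piSC_def hom_fundamental_groupoid pathstart_def pathfinish_def)

definition tree_path :: "color list \<Rightarrow> color \<Rightarrow> nat tree \<Rightarrow> nat tree \<Rightarrow> (real \<Rightarrow> nat \<Rightarrow> real \<times> complex) \<Rightarrow> bool" where
  "tree_path xs x u v p \<longleftrightarrow> u \<in> trees xs x \<and> v \<in> trees xs x \<and> path_in (swiss_cheese xs x) p \<and>
     p 0 = embed xs x u \<and> p 1 = embed xs x v"

abbreviation SC_class where "SC_class xs x \<equiv> path_class (swiss_cheese xs x)"

lemma tree_path_word_path:
  assumes "tree_path xs x u v p"
  shows "word_path xs x (leaves u) (leaves v) (centers xs \<circ> p)"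
  using assms omega_words[of u xs x] omega_words[of v xs x]
  by (auto simp: tree_path_def word_path_def omega_def centers_embed intro: path_in_centers)

lemma braid_of_class:
  assumes p: "tree_path xs x u v p"
  shows "braid_of xs x (SC_class xs x p) = (u, braid_class xs x (leaves u) (leaves v) (centers xs \<circ> p), v)"
proof -
  note wp = tree_path_word_path[OF p]
  have "braid_homotopic xs x (centers xs \<circ> p) (centers xs \<circ> q)"
    if "homotopic_paths (swiss_cheese xs x) p q" for q
    unfolding braid_homotopic_word_path[OF wp]
    by (rule centers_homotopic[OF that]) (use wp in \<open>auto simp: word_path_def\<close>)
  moreover have "homotopic_paths (swiss_cheese xs x) p p"
    using p unfolding tree_path_def path_in_homotopic by blast
  ultimately have "{h. \<exists>q\<in>{q. homotopic_paths (swiss_cheese xs x) p q}. braid_homotopic xs x (centers xs \<circ> q) h}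
      = {h. braid_homotopic xs x (centers xs \<circ> p) h}"
    using braid_homotopic_trans by blast
  then show ?thesis
    using p by (simp add: braid_of_def path_class_def braid_class_def tree_path_def pathstart_def pathfinish_def)
qed

lemma Obj_piSC_OmegaOmega: "Obj (ar piSC_OmegaOmega xs x) = embed xs x ` trees xs x"
  using embed_swiss_cheese by (auto simp: piSC_OmegaOmega_def full_suboperad_def piSC_def)

lemma hom_piSC_OmegaOmega:
  assumes "u \<in> trees xs x" "v \<in> trees xs x"
  shows "hom (ar piSC_OmegaOmega xs x) (embed xs x u) (embed xs x v) = SC_class xs x ` Collect (tree_path xs x u v)"
proof -
  have "hom (ar piSC_OmegaOmega xs x) (embed xs x u) (embed xs x v) = hom (ar piSC xs x) (embed xs x u) (embed xs x v)"
    using assms by (auto simp: piSC_OmegaOmega_def full_suboperad_def hom_def)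
  moreover have "Collect (tree_path xs x u v) =
      {p. path_in (swiss_cheese xs x) p \<and> p 0 = embed xs x u \<and> p 1 = embed xs x v}"
    using assms by (auto simp: tree_path_def)
  ultimately show ?thesis by (simp add: hom_piSC)
qed

lemma Arr_piSC_OmegaOmega: "Arr (ar piSC_OmegaOmega xs x) = {SC_class xs x p | u v p. tree_path xs x u v p}"
proof -
  have "f \<in> Arr (ar piSC_OmegaOmega xs x) \<longleftrightarrow>
    (\<exists>u\<in>trees xs x. \<exists>v\<in>trees xs x. f \<in> hom (ar piSC_OmegaOmega xs x) (embed xs x u) (embed xs x v))" for f
    by (auto simp: piSC_OmegaOmega_def full_suboperad_def hom_def)
  note Arr = this
  have "f \<in> Arr (ar piSC_OmegaOmega xs x) \<longleftrightarrow> (\<exists>u v p. f = SC_class xs x p \<and> tree_path xs x u v p)" for f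
  proof
    assume "f \<in> Arr (ar piSC_OmegaOmega xs x)"
    then show "\<exists>u v p. f = SC_class xs x p \<and> tree_path xs x u v p"
      unfolding Arr using hom_piSC_OmegaOmega by blast
  next
    assume "\<exists>u v p. f = SC_class xs x p \<and> tree_path xs x u v p"
    then obtain u v p where p: "f = SC_class xs x p" "tree_path xs x u v p" by blast
    then have "u \<in> trees xs x" "v \<in> trees xs x" by (simp_all add: tree_path_def)
    then show "f \<in> Arr (ar piSC_OmegaOmega xs x)"
      unfolding Arr using hom_piSC_OmegaOmega p by blast
  qed
  then show ?thesis by blast
qed

lemma relative_groupoid_operad_piSC: "relative_groupoid_operad piSC"
  unfolding piSC_def by (rule SC.relative_groupoid_operad_pi)

lemma one_trees: "one OmegaOmega x \<in> trees [x] x"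
  by (simp add: trees_iff trees_one lessThan_Suc)

text \<open>The embedded trees are closed under the operations because \<open>embed\<close> commutes
  with them.\<close>

lemma piSC_OmegaOmega_suboperad:
  shows "relative_groupoid_operad piSC_OmegaOmega"
    and "operad_morphism piSC_OmegaOmega piSC (\<lambda>xs x a. a) (\<lambda>xs x f. f)"
proof -
  have 1: "oone piSC x \<in> embed [x] x ` trees [x] x" for x
    using one_trees[of x] by (auto simp: piSC_def embed_one[symmetric])
  have 2: "oins piSC xs x i ys a b \<in> embed (graft xs i ys) x ` trees (graft xs i ys) x"
    if "a \<in> Obj (ar piSC xs x) \<inter> embed xs x ` trees xs x" "i < length xs"
      "b \<in> Obj (ar piSC ys (xs ! i)) \<inter> embed ys (xs ! i) ` trees ys (xs ! i)" for xs x i ys a b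
    using that trees_ins_closed by (auto simp: piSC_def embed_ins[symmetric])
  have 3: "oact piSC xs x \<sigma> a \<in> embed (permute_list \<sigma> xs) x ` trees (permute_list \<sigma> xs) x"
    if "a \<in> Obj (ar piSC xs x) \<inter> embed xs x ` trees xs x" "\<sigma> permutes {..<length xs}" for xs x \<sigma> a
    using that trees_act_closed by (auto simp: piSC_def embed_act[symmetric])
  show "relative_groupoid_operad piSC_OmegaOmega"
    "operad_morphism piSC_OmegaOmega piSC (\<lambda>xs x a. a) (\<lambda>xs x f. f)"
    unfolding piSC_OmegaOmega_def
    by (rule full_suboperad[OF relative_groupoid_operad_piSC 1 2 3]; assumption)+
qed

text \<open>Essential surjectivity is the point, and \<open>path_to_tree\<close> connects each
  operation to a tree.\<close>

lemma piSC_OmegaOmega_equivalence: "categorical_equivalence piSC_OmegaOmega piSC (\<lambda>xs x a. a) (\<lambda>xs x f. f)"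
  unfolding piSC_OmegaOmega_def
proof (rule full_suboperad_equivalence[OF relative_groupoid_operad_piSC piSC_OmegaOmega_suboperad(2)[unfolded piSC_OmegaOmega_def]])
  fix xs x b assume "b \<in> Obj (ar piSC xs x)"
  then have "b \<in> swiss_cheese xs x" by (simp add: piSC_def)
  then obtain t p where t: "t \<in> trees xs x" "path_in (swiss_cheese xs x) p" "p 0 = embed xs x t" "p 1 = b"
    by (rule path_to_tree)
  then have "hom (ar piSC xs x) (embed xs x t) b \<noteq> {}" unfolding hom_piSC by blast
  then show "\<exists>a\<in>Obj (ar piSC xs x) \<inter> embed xs x ` trees xs x. hom (ar piSC xs x) a b \<noteq> {}"
    using t(1) embed_swiss_cheese by (auto simp: piSC_def)
qed

lemma piSC_OmegaOmega_simps:
  "idn (ar piSC_OmegaOmega xs x) = idn (fundamental_groupoid (swiss_cheese xs x))"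
  "cmp (ar piSC_OmegaOmega xs x) = cmp (fundamental_groupoid (swiss_cheese xs x))"
  "oone piSC_OmegaOmega = one SC" "oins piSC_OmegaOmega = ins SC" "oact piSC_OmegaOmega = act SC"
  "ains piSC_OmegaOmega = ains SC.\<pi>" "aact piSC_OmegaOmega = aact SC.\<pi>"
  by (simp_all add: piSC_OmegaOmega_def full_suboperad_def piSC_def)

lemma PaPB_simps:
  "idn (ar PaPB xs x) u = (u, idn (ar CoPB xs x) (leaves u), u)"
  "cmp (ar PaPB xs x) (v, g, w) (u, f, v') = (u, cmp (ar CoPB xs x) g f, w)"
  "oone PaPB = one OmegaOmega" "oins PaPB = ins OmegaOmega" "oact PaPB = act OmegaOmega"
  "ains PaPB xs x i ys (u, f, v) (u', f', v') =
    (ins OmegaOmega xs x i ys u u', ains CoPB xs x i ys f f', ins OmegaOmega xs x i ys v v')"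
  "aact PaPB xs x \<sigma> (u, f, v) = (act OmegaOmega xs x \<sigma> u, aact CoPB xs x \<sigma> f, act OmegaOmega xs x \<sigma> v)"
  by (simp_all add: PaPB_def pullback_operad_def omega_def)

text \<open>By \<open>centers_full\<close>, every braid between the words of two trees is, up to
  moving its ends in cells, the path of centers of a path between the embedded trees.\<close>

lemma braid_of_full:
  assumes u: "u \<in> trees xs x" "v \<in> trees xs x"
  shows "braid_of xs x ` hom (ar piSC_OmegaOmega xs x) (embed xs x u) (embed xs x v) = hom (ar PaPB xs x) u v"
proof (intro equalityI subsetI)
  fix f assume "f \<in> braid_of xs x ` hom (ar piSC_OmegaOmega xs x) (embed xs x u) (embed xs x v)"
  then obtain p where p: "tree_path xs x u v p" "f = braid_of xs x (SC_class xs x p)"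
    unfolding hom_piSC_OmegaOmega[OF u] by blast
  show "f \<in> hom (ar PaPB xs x) u v"
    unfolding p(2) braid_of_class[OF p(1)] ar_PaPB hom_CoPB using u tree_path_word_path[OF p(1)] by blast
next
  fix f assume "f \<in> hom (ar PaPB xs x) u v"
  then obtain k where k: "word_path xs x (leaves u) (leaves v) k"
    "f = (u, braid_class xs x (leaves u) (leaves v) k, v)"
    unfolding ar_PaPB hom_CoPB by blast
  obtain p where p: "path_in (swiss_cheese xs x) p" "p 0 = embed xs x u" "p 1 = embed xs x v"
    "end_homotopic (Conf xs x) (cell xs x (leaves u)) (cell xs x (leaves v)) (centers xs \<circ> p) k"
    using k(1) centers_full[of "leaves u" xs x "leaves v" k "embed xs x u" "embed xs x v"]
      centers_embed u embed_swiss_cheese unfolding word_path_def by metis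
  have tp: "tree_path xs x u v p" using u p by (simp add: tree_path_def)
  have "braid_homotopic xs x (centers xs \<circ> p) k"
    using p(4) braid_homotopic_word_path[OF tree_path_word_path[OF tp]] by simp
  then have S: "{h. braid_homotopic xs x (centers xs \<circ> p) h} = {h. braid_homotopic xs x k h}"
    using braid_class_eq_iff[OF tree_path_word_path[OF tp]] by blast
  have "f = braid_of xs x (SC_class xs x p)"
    unfolding braid_of_class[OF tp] k(2) braid_class_def S ..
  then show "f \<in> braid_of xs x ` hom (ar piSC_OmegaOmega xs x) (embed xs x u) (embed xs x v)"
    unfolding hom_piSC_OmegaOmega[OF u] using tp by blast
qed

lemma braid_of_idn:
  assumes "u \<in> trees xs x"
  shows "braid_of xs x (idn (ar piSC_OmegaOmega xs x) (embed xs x u)) = idn (ar PaPB xs x) u"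
proof -
  have tp: "tree_path xs x u u (\<lambda>_. embed xs x u)"
    using assms embed_swiss_cheese[OF assms] by (simp add: tree_path_def path_in_const)
  have w: "leaves u \<in> words xs x" using omega_words[OF assms] by (simp add: omega_def)
  show ?thesis
    unfolding piSC_OmegaOmega_simps idn_fundamental_groupoid braid_of_class[OF tp] PaPB_simps
      idn_CoPB[OF w centers_embed[OF assms]] by (simp add: o_def)
qed

lemma braid_of_cmp:
  assumes p: "tree_path xs x u v p" and q: "tree_path xs x v w q"
  shows "braid_of xs x (cmp (ar piSC_OmegaOmega xs x) (SC_class xs x q) (SC_class xs x p)) =
    cmp (ar PaPB xs x) (braid_of xs x (SC_class xs x q)) (braid_of xs x (SC_class xs x p))"
proof -
  have e: "pathfinish p = pathstart q" using p q by (simp add: tree_path_def pathstart_def pathfinish_def)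
  have pq: "tree_path xs x u w (p +++ q)"
    using p q path_in_join[OF _ _ e, of "swiss_cheese xs x"] by (simp add: tree_path_def joinpaths_def)
  have c: "cmp (fundamental_groupoid (swiss_cheese xs x)) (SC_class xs x q) (SC_class xs x p) = SC_class xs x (p +++ q)"
    using p q e by (intro cmp_fundamental_groupoid) (auto simp: tree_path_def)
  have e': "(centers xs \<circ> p) 1 = (centers xs \<circ> q) 0" using p q by (simp add: tree_path_def)
  show ?thesis
    unfolding piSC_OmegaOmega_simps c braid_of_class[OF pq] braid_of_class[OF p] braid_of_class[OF q] PaPB_simps
      cmp_CoPB[OF tree_path_word_path[OF p] tree_path_word_path[OF q] e'] path_compose_join ..
qed

text \<open>For small \<epsilon>, inserting arbitrary representatives is homotopic to inserting the
  centers at the same scale (\<open>conf_ins_homotopic\<close>), and this to the centers of the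
  inserted operations (\<open>conf_ins_centers\<close>). The germ is thus compared with one fixed
  path, and the scale disappears.\<close>

lemma ains_CoPB:
  assumes i: "i < length xs" and p: "tree_path xs x u v p" and q: "tree_path ys (xs ! i) s t q"
  shows "ains CoPB xs x i ys (braid_class xs x (leaves u) (leaves v) (centers xs \<circ> p))
      (braid_class ys (xs ! i) (leaves s) (leaves t) (centers ys \<circ> q)) =
    braid_class (graft xs i ys) x (word_ins i (leaves u) (leaves s)) (word_ins i (leaves v) (leaves t))
      (centers (graft xs i ys) \<circ> (\<lambda>r. ins SC xs x i ys (p r) (q r)))"
proof -
  let ?G = "graft xs i ys" and ?c = "centers (graft xs i ys) \<circ> (\<lambda>r. ins SC xs x i ys (p r) (q r))"
  note wp = tree_path_word_path[OF p] and wq = tree_path_word_path[OF q]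
  have w: "word_ins i (leaves u) (leaves s) \<in> words ?G x" "word_ins i (leaves v) (leaves t) \<in> words ?G x"
    using wp wq i by (auto simp: word_path_def intro: word_ins_words)
  have np: "norm ((centers xs \<circ> p) r j) < 1" if "r \<in> {0..1}" "j < length xs" for r j
    using norm_centers[OF path_inD[of "swiss_cheese xs x" p, OF _ that(1)] that(2)] p by (simp add: tree_path_def)
  have nq: "norm ((centers ys \<circ> q) r j) < 1" if "r \<in> {0..1}" "j < length ys" for r j
    using norm_centers[OF path_inD[of "swiss_cheese ys (xs ! i)" q, OF _ that(1)] that(2)] q by (simp add: tree_path_def)
  have big: "\<forall>\<^sub>F \<epsilon> in at_right 0. braid_homotopic ?G x
      (\<lambda>r. conf_ins \<epsilon> i (length ys) ((centers xs \<circ> p) r) ((centers ys \<circ> q) r)) ?c"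
    using conf_ins_centers[OF i, of x p u v ys q s t] p q
    by (auto simp: tree_path_def elim!: eventually_mono intro!: braid_homotopicI[OF w])
  have compat: "\<forall>\<^sub>F \<epsilon> in at_right 0. braid_homotopic ?G x (\<lambda>r. conf_ins \<epsilon> i (length ys) (p' r) (q' r)) ?c"
    if p': "braid_homotopic xs x (centers xs \<circ> p) p'" and q': "braid_homotopic ys (xs ! i) (centers ys \<circ> q) q'"
      and n: "\<forall>r\<in>{0..1}. (\<forall>j<length xs. norm (p' r j) < 1) \<and> (\<forall>j<length ys. norm (q' r j) < 1)" for p' q'
  proof -
    have "\<forall>\<^sub>F \<epsilon> in at_right 0. end_homotopic (Conf ?G x)
      (cell ?G x (word_ins i (leaves u) (leaves s))) (cell ?G x (word_ins i (leaves v) (leaves t)))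
      (\<lambda>r. conf_ins \<epsilon> i (length ys) (p' r) (q' r))
      (\<lambda>r. conf_ins \<epsilon> i (length ys) ((centers xs \<circ> p) r) ((centers ys \<circ> q) r))"
    proof (rule conf_ins_homotopic[OF i])
      show "end_homotopic (Conf xs x) (cell xs x (leaves u)) (cell xs x (leaves v)) p' (centers xs \<circ> p)"
        using p' braid_homotopic_word_path[OF wp] end_homotopic_sym by blast
      show "end_homotopic (Conf ys (xs ! i)) (cell ys (xs ! i) (leaves s)) (cell ys (xs ! i) (leaves t)) q' (centers ys \<circ> q)"
        using q' braid_homotopic_word_path[OF wq] end_homotopic_sym by blast
    qed (use wp wq np nq n in \<open>auto simp: word_path_def\<close>)
    then show ?thesis
      using big by eventually_elim (blast intro: braid_homotopic_trans braid_homotopicI[OF w])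
  qed
  have "{h. \<exists>p'\<in>{h. braid_homotopic xs x (centers xs \<circ> p) h}. \<exists>q'\<in>{h. braid_homotopic ys (xs ! i) (centers ys \<circ> q) h}.
      (\<forall>r\<in>{0..1}. (\<forall>j<length xs. norm (p' r j) < 1) \<and> (\<forall>j<length ys. norm (q' r j) < 1)) \<and>
      (\<forall>\<^sub>F \<epsilon> in at_right 0. braid_homotopic ?G x (\<lambda>r. conf_ins \<epsilon> i (length ys) (p' r) (q' r)) h)}
    = {h. braid_homotopic ?G x ?c h}" (is "?L = ?R")
  proof (intro equalityI subsetI)
    fix h assume "h \<in> ?L"
    then obtain p' q' where pq: "braid_homotopic xs x (centers xs \<circ> p) p'" "braid_homotopic ys (xs ! i) (centers ys \<circ> q) q'"
      "\<forall>r\<in>{0..1}. (\<forall>j<length xs. norm (p' r j) < 1) \<and> (\<forall>j<length ys. norm (q' r j) < 1)"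
      and ev: "\<forall>\<^sub>F \<epsilon> in at_right 0. braid_homotopic ?G x (\<lambda>r. conf_ins \<epsilon> i (length ys) (p' r) (q' r)) h"
      by blast
    have "\<forall>\<^sub>F \<epsilon> in at_right (0::real). braid_homotopic ?G x ?c h"
      using ev compat[OF pq] by eventually_elim (blast intro: braid_homotopic_trans braid_homotopic_sym)
    \<comment> \<open>The statement no longer contains \<epsilon>, and \<open>at_right 0\<close> is
      a proper filter, so holding eventually means holding.\<close>
    then show "h \<in> ?R" by (simp add: eventually_const_iff trivial_limit_at_right_real)
  next
    fix h assume "h \<in> ?R"
    then have "\<forall>\<^sub>F \<epsilon> in at_right 0. braid_homotopic ?G x
        (\<lambda>r. conf_ins \<epsilon> i (length ys) ((centers xs \<circ> p) r) ((centers ys \<circ> q) r)) h"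
      using big by (auto elim!: eventually_mono intro: braid_homotopic_trans)
    then show "h \<in> ?L"
      using braid_homotopic_refl[OF wp] braid_homotopic_refl[OF wq] np nq by blast
  qed
  then show ?thesis by (simp add: CoPB_def braid_class_def)
qed

text \<open>Relabeling is a continuous map of configurations that carries cells to cells, and it
  commutes with taking centers exactly.\<close>

lemma aact_CoPB:
  assumes s: "\<sigma> permutes {..<length xs}" and p: "tree_path xs x u v p"
  shows "aact CoPB xs x \<sigma> (braid_class xs x (leaves u) (leaves v) (centers xs \<circ> p)) =
    braid_class (permute_list \<sigma> xs) x (map (inv \<sigma>) (leaves u)) (map (inv \<sigma>) (leaves v))
      (centers (permute_list \<sigma> xs) \<circ> (\<lambda>r. act SC xs x \<sigma> (p r)))"
proof -
  let ?X = "permute_list \<sigma> xs"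
  note wp = tree_path_word_path[OF p]
  have sn: "\<sigma> i < length xs \<longleftrightarrow> i < length xs" for i using permutes_in_image[OF s] by auto
  have sinj: "\<sigma> i = \<sigma> j \<longleftrightarrow> i = j" for i j using permutes_inj[OF s] by (auto dest: injD)
  have C: "z \<circ> \<sigma> \<in> Conf ?X x" if "z \<in> Conf xs x" for z
    using that s by (auto simp: Conf_iff permute_extensional admissible_permute permute_list_nth sn sinj)
  have c: "z \<circ> \<sigma> \<in> cell ?X x (map (inv \<sigma>) w)" if "z \<in> cell xs x w" for z w
    using that C by (auto simp: cell_def sorted_wrt_map permutes_inverses[OF s])
  have w: "map (inv \<sigma>) w \<in> words ?X x" if "w \<in> words xs x" for w
    using that s permutes_inj_on[OF permutes_inv[OF s]] permutes_image[OF permutes_inv[OF s]]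
    by (auto simp: words_def admissible_permute distinct_map)
  have "continuous_on S (\<lambda>z. z \<circ> \<sigma>)" for S :: "(nat \<Rightarrow> complex) set"
    unfolding o_def by (rule continuous_on_coordinatewise_then_product) (rule continuous_on_nth[OF continuous_on_id])
  note cont = this
  have bh: "braid_homotopic ?X x (\<lambda>r. centers xs (p r) \<circ> \<sigma>) (\<lambda>r. q r \<circ> \<sigma>)"
    if q: "braid_homotopic xs x (centers xs \<circ> p) q" for q
  proof (rule braid_homotopicI[OF w w])
    show "leaves u \<in> words xs x" "leaves v \<in> words xs x" using wp by (simp_all add: word_path_def)
    have "end_homotopic (Conf ?X x) (cell ?X x (map (inv \<sigma>) (leaves u))) (cell ?X x (map (inv \<sigma>) (leaves v)))
      ((\<lambda>z. z \<circ> \<sigma>) \<circ> (centers xs \<circ> p)) ((\<lambda>z. z \<circ> \<sigma>) \<circ> q)"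
      by (rule end_homotopic_image[OF braid_homotopic_word_path[OF wp, THEN iffD1, OF q] cont]) (auto intro: C c)
    then show "end_homotopic (Conf ?X x) (cell ?X x (map (inv \<sigma>) (leaves u))) (cell ?X x (map (inv \<sigma>) (leaves v)))
      (\<lambda>r. centers xs (p r) \<circ> \<sigma>) (\<lambda>r. q r \<circ> \<sigma>)"
      by (simp add: comp_def)
  qed
  have eq: "(\<lambda>r. centers xs (p r) \<circ> \<sigma>) = centers ?X \<circ> (\<lambda>r. act SC xs x \<sigma> (p r))"
    by (auto simp: fun_eq_iff centers_def act_SC sn)
  have "{h. \<exists>p'\<in>{h. braid_homotopic xs x (centers xs \<circ> p) h}. braid_homotopic ?X x (\<lambda>r. p' r \<circ> \<sigma>) h} =
      {h. braid_homotopic ?X x (centers ?X \<circ> (\<lambda>r. act SC xs x \<sigma> (p r))) h}" (is "?L = ?R")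
  proof
    show "?L \<subseteq> ?R" using bh unfolding eq by (blast intro: braid_homotopic_trans)
    show "?R \<subseteq> ?L" unfolding eq[symmetric] using braid_homotopic_refl[OF wp] by (auto simp: o_def)
  qed
  then show ?thesis by (simp add: CoPB_def braid_class_def)
qed

section \<open>Assembly of the operad morphisms\<close>

lemma tree_path_ins:
  assumes i: "i < length xs" and p: "tree_path xs x u v p" and q: "tree_path ys (xs ! i) s t q"
  shows "tree_path (graft xs i ys) x (ins OmegaOmega xs x i ys u s) (ins OmegaOmega xs x i ys v t)
    (\<lambda>r. ins SC xs x i ys (p r) (q r))"
  using SC.path_in_ins[OF i, of x p ys q] p q i
  by (simp add: tree_path_def embed_ins trees_ins_closed)

lemma tree_path_act:
  assumes s: "\<sigma> permutes {..<length xs}" and p: "tree_path xs x u v p"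
  shows "tree_path (permute_list \<sigma> xs) x (act OmegaOmega xs x \<sigma> u) (act OmegaOmega xs x \<sigma> v)
    (\<lambda>r. act SC xs x \<sigma> (p r))"
  using SC.path_in_act[OF s, of x p] p s
  by (simp add: tree_path_def embed_act trees_act_closed)

text \<open>This is the first use of \<open>groupoid_operad_transfer\<close>. Fullness comes from
  \<open>braid_of_full\<close>, compatibility with insertion and action from
  \<open>ains_CoPB\<close> and \<open>aact_CoPB\<close>.\<close>

lemma PaPB_operad:
  shows "relative_groupoid_operad PaPB" and "operad_morphism piSC_OmegaOmega PaPB tree_of braid_of"
proof -
  let ?P = piSC_OmegaOmega
  have obj: "tree_of xs x ` Obj (ar ?P xs x) = Obj (ar PaPB xs x)" for xs x
    by (force simp: Obj_piSC_OmegaOmega ar_PaPB image_image)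
  have closed: "src (ar PaPB xs x) f \<in> Obj (ar PaPB xs x) \<and> tgt (ar PaPB xs x) f \<in> Obj (ar PaPB xs x)"
    if "f \<in> Arr (ar PaPB xs x)" for xs x f
    using that by (auto simp: PaPB_def pullback_operad_def)
  have full: "braid_of xs x ` hom (ar ?P xs x) u v = hom (ar PaPB xs x) (tree_of xs x u) (tree_of xs x v)"
    if u: "u \<in> Obj (ar ?P xs x)" "v \<in> Obj (ar ?P xs x)" for xs x u v
  proof -
    obtain s t where "s \<in> trees xs x" "u = embed xs x s" "t \<in> trees xs x" "v = embed xs x t"
      using u unfolding Obj_piSC_OmegaOmega by blast
    then show ?thesis by (simp add: braid_of_full)
  qed
  have idn: "braid_of xs x (idn (ar ?P xs x) u) = idn (ar PaPB xs x) (tree_of xs x u)"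
    if "u \<in> Obj (ar ?P xs x)" for xs x u
    using that braid_of_idn by (auto simp: Obj_piSC_OmegaOmega)
  have cmp: "braid_of xs x (cmp (ar ?P xs x) g f) = cmp (ar PaPB xs x) (braid_of xs x g) (braid_of xs x f)"
    if f: "f \<in> hom (ar ?P xs x) a b" and g: "g \<in> hom (ar ?P xs x) b c" for xs x a b c f g
  proof -
    have "a \<in> Obj (ar ?P xs x)" "b \<in> Obj (ar ?P xs x)" "c \<in> Obj (ar ?P xs x)"
      using f g groupoid.src_closed[OF relative_groupoid_operad.arity_groupoid[OF piSC_OmegaOmega_suboperad(1)]]
        groupoid.tgt_closed[OF relative_groupoid_operad.arity_groupoid[OF piSC_OmegaOmega_suboperad(1)]] homD by metis+
    then obtain u v w where u: "u \<in> trees xs x" "a = embed xs x u" "v \<in> trees xs x" "b = embed xs x v"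
      "w \<in> trees xs x" "c = embed xs x w" by (auto simp: Obj_piSC_OmegaOmega)
    obtain p q where "tree_path xs x u v p" "f = SC_class xs x p" "tree_path xs x v w q" "g = SC_class xs x q"
      using f g hom_piSC_OmegaOmega[OF u(1,3)] hom_piSC_OmegaOmega[OF u(3,5)] u by auto
    then show ?thesis using braid_of_cmp by simp
  qed
  have one: "tree_of [x] x (oone ?P x) = oone PaPB x" for x
    by (simp add: piSC_OmegaOmega_simps PaPB_simps one_trees flip: embed_one)
  have oins: "tree_of (graft xs i ys) x (oins ?P xs x i ys a b) = oins PaPB xs x i ys (tree_of xs x a) (tree_of ys (xs ! i) b)"
    if "a \<in> Obj (ar ?P xs x)" "i < length xs" "b \<in> Obj (ar ?P ys (xs ! i))" for xs x i ys a b
    using that by (auto simp: Obj_piSC_OmegaOmega piSC_OmegaOmega_simps PaPB_simps trees_ins_closed simp flip: embed_ins)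
  have oact: "tree_of (permute_list \<sigma> xs) x (oact ?P xs x \<sigma> a) = oact PaPB xs x \<sigma> (tree_of xs x a)"
    if "a \<in> Obj (ar ?P xs x)" "\<sigma> permutes {..<length xs}" for xs x \<sigma> a
    using that by (auto simp: Obj_piSC_OmegaOmega piSC_OmegaOmega_simps PaPB_simps trees_act_closed simp flip: embed_act)
  have ains: "braid_of (graft xs i ys) x (ains ?P xs x i ys f g) = ains PaPB xs x i ys (braid_of xs x f) (braid_of ys (xs ! i) g)"
    if f: "f \<in> Arr (ar ?P xs x)" and i: "i < length xs" and g: "g \<in> Arr (ar ?P ys (xs ! i))" for xs x i ys f g
  proof -
    obtain u v p s t q where p: "tree_path xs x u v p" "f = SC_class xs x p"
      and q: "tree_path ys (xs ! i) s t q" "g = SC_class ys (xs ! i) q"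
      using f g unfolding Arr_piSC_OmegaOmega by blast
    have "ains SC.\<pi> xs x i ys f g = SC_class (graft xs i ys) x (\<lambda>r. ins SC xs x i ys (p r) (q r))"
      using SC.ains_path_class[OF i, of x p ys q] p q by (simp add: tree_path_def)
    moreover have "leaves (ins OmegaOmega xs x i ys u s) = word_ins i (leaves u) (leaves s)"
      "leaves (ins OmegaOmega xs x i ys v t) = word_ins i (leaves v) (leaves t)"
      using omega_ins[of _ ys "xs ! i" xs i x] q by (auto simp: omega_def tree_path_def)
    ultimately show ?thesis
      by (simp add: piSC_OmegaOmega_simps braid_of_class[OF tree_path_ins[OF i p(1) q(1)]] p(2) q(2)
          braid_of_class[OF p(1)] braid_of_class[OF q(1)] PaPB_simps ains_CoPB[OF i p(1) q(1)])
  qed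
  have aact: "braid_of (permute_list \<sigma> xs) x (aact ?P xs x \<sigma> f) = aact PaPB xs x \<sigma> (braid_of xs x f)"
    if f: "f \<in> Arr (ar ?P xs x)" and s: "\<sigma> permutes {..<length xs}" for xs x \<sigma> f
  proof -
    obtain u v p where p: "tree_path xs x u v p" "f = SC_class xs x p"
      using f unfolding Arr_piSC_OmegaOmega by blast
    have "aact SC.\<pi> xs x \<sigma> f = SC_class (permute_list \<sigma> xs) x (\<lambda>r. act SC xs x \<sigma> (p r))"
      using SC.aact_path_class[OF s, of x p] p by (simp add: tree_path_def)
    then show ?thesis
      by (simp add: piSC_OmegaOmega_simps braid_of_class[OF tree_path_act[OF s p(1)]] p(2)
          braid_of_class[OF p(1)] PaPB_simps aact_CoPB[OF s p(1)] trees_act leaves_map_tree)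
  qed
  show "relative_groupoid_operad PaPB" "operad_morphism ?P PaPB tree_of braid_of"
    by (rule groupoid_operad_transfer[OF piSC_OmegaOmega_suboperad(1) obj closed full idn cmp one oins oact ains aact]; assumption)+
qed

text \<open>Beyond the morphism, injectivity on arrows is the new input, and it is provided by
  \<open>centers_faithful\<close>.\<close>

lemma PaPB_isomorphic: "operads_isomorphic PaPB piSC_OmegaOmega"
proof (rule operads_isomorphicI[OF PaPB_operad(2)])
  fix xs x
  show "bij_betw (tree_of xs x) (Obj (ar piSC_OmegaOmega xs x)) (Obj (ar PaPB xs x))"
    unfolding tree_of_def ar_PaPB Obj_piSC_OmegaOmega using bij_betw_the_inv_into[OF inj_on_imp_bij_betw[OF embed_inj]] .
  show "bij_betw (braid_of xs x) (Arr (ar piSC_OmegaOmega xs x)) (Arr (ar PaPB xs x))"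
  proof (rule bij_betw_imageI)
    show "inj_on (braid_of xs x) (Arr (ar piSC_OmegaOmega xs x))"
    proof (rule inj_onI)
      fix f g assume "f \<in> Arr (ar piSC_OmegaOmega xs x)" "g \<in> Arr (ar piSC_OmegaOmega xs x)"
        and eq: "braid_of xs x f = braid_of xs x g"
      then obtain u v p u' v' q where p: "tree_path xs x u v p" "f = SC_class xs x p"
        and q: "tree_path xs x u' v' q" "g = SC_class xs x q"
        unfolding Arr_piSC_OmegaOmega by blast
      note wp = tree_path_word_path[OF p(1)]
      have e: "u = u'" "v = v'" and bh: "braid_homotopic xs x (centers xs \<circ> p) (centers xs \<circ> q)"
        using eq unfolding p(2) q(2) braid_of_class[OF p(1)] braid_of_class[OF q(1)] braid_class_def
        by (auto simp: braid_class_eq_iff[OF wp])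
      have "homotopic_paths (swiss_cheese xs x) p q"
        using p(1) q(1) e wp bh unfolding braid_homotopic_word_path[OF wp]
        by (intro centers_faithful[of xs x p q "leaves u" "leaves v"]) (auto simp: tree_path_def word_path_def)
      then show "f = g" unfolding p(2) q(2) by (rule path_class_eqI)
    qed
    show "braid_of xs x ` Arr (ar piSC_OmegaOmega xs x) = Arr (ar PaPB xs x)"
    proof (intro equalityI subsetI)
      fix f assume "f \<in> braid_of xs x ` Arr (ar piSC_OmegaOmega xs x)"
      then obtain u v p where p: "tree_path xs x u v p" "f = braid_of xs x (SC_class xs x p)"
        unfolding Arr_piSC_OmegaOmega by blast
      then have "f \<in> hom (ar PaPB xs x) u v"
        using braid_of_full[of u xs x v] hom_piSC_OmegaOmega[of u xs x v] by (auto simp: tree_path_def)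
      then show "f \<in> Arr (ar PaPB xs x)" by (simp add: hom_def)
    next
      fix f assume f: "f \<in> Arr (ar PaPB xs x)"
      let ?u = "src (ar PaPB xs x) f" and ?v = "tgt (ar PaPB xs x) f"
      have uv: "?u \<in> trees xs x" "?v \<in> trees xs x" using f by (auto simp: PaPB_def pullback_operad_def)
      have "f \<in> hom (ar PaPB xs x) ?u ?v" using f by (simp add: hom_def)
      then show "f \<in> braid_of xs x ` Arr (ar piSC_OmegaOmega xs x)"
        unfolding braid_of_full[OF uv, symmetric] by (auto simp: hom_def)
    qed
  qed
qed

text \<open>Hom-sets of the pullback are those of \<open>CoPB\<close> with tags, and every word is
  read off from some tree. The same two facts feed the second use of
  \<open>groupoid_operad_transfer\<close>, which also shows that \<open>CoPB\<close> is an
  operad.\<close>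

lemma PaPB_equivalence: "categorical_equivalence PaPB CoPB omega (\<lambda>xs x (u, f, v). f)"
proof -
  let ?F = "\<lambda>(u, f, v). f"
  have closed: "src (ar CoPB xs x) f \<in> Obj (ar CoPB xs x) \<and> tgt (ar CoPB xs x) f \<in> Obj (ar CoPB xs x)"
    if "f \<in> Arr (ar CoPB xs x)" for xs x f
    using that by (auto simp: ar_CoPB path_groupoid_def)
  have full: "?F ` hom (ar PaPB xs x) u v = hom (ar CoPB xs x) (omega xs x u) (omega xs x v)"
    if "u \<in> Obj (ar PaPB xs x)" "v \<in> Obj (ar PaPB xs x)" for xs x u v
    using that by (force simp: ar_PaPB omega_def image_iff)
  have Arr: "\<exists>u g v. f = (u, g, v) \<and> u \<in> trees xs x \<and> v \<in> trees xs x" if "f \<in> Arr (ar PaPB xs x)" for xs x f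
    using that by (auto simp: PaPB_def pullback_operad_def)
  have mor: "operad_morphism PaPB CoPB omega (\<lambda>xs x. ?F)"
  proof (rule groupoid_operad_transfer(2)[OF PaPB_operad(1) _ closed full])
    show "omega xs x ` Obj (ar PaPB xs x) = Obj (ar CoPB xs x)" for xs x
      by (simp add: ar_PaPB omega_image)
    show "?F (idn (ar PaPB xs x) u) = idn (ar CoPB xs x) (omega xs x u)" for xs x u
      by (simp add: PaPB_simps omega_def)
    show "?F (cmp (ar PaPB xs x) g f) = cmp (ar CoPB xs x) (?F g) (?F f)" for xs x f g
      by (auto simp: PaPB_def pullback_operad_def split: prod.split)
    show "omega [x] x (oone PaPB x) = oone CoPB x" for x
      by (simp add: PaPB_simps trees_one omega_def CoPB_def)
    show "omega (graft xs i ys) x (oins PaPB xs x i ys a b) = oins CoPB xs x i ys (omega xs x a) (omega ys (xs ! i) b)"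
      if "b \<in> Obj (ar PaPB ys (xs ! i))" for xs x i ys a b
      using that omega_ins by (simp add: PaPB_simps ar_PaPB CoPB_def)
    show "omega (permute_list \<sigma> xs) x (oact PaPB xs x \<sigma> a) = oact CoPB xs x \<sigma> (omega xs x a)" for xs x \<sigma> a
      by (simp add: PaPB_simps trees_act omega_def leaves_map_tree CoPB_def)
    show "?F (ains PaPB xs x i ys f g) = ains CoPB xs x i ys (?F f) (?F g)" for xs x i ys f g
      by (cases f; cases g) (simp add: PaPB_simps)
    show "?F (aact PaPB xs x \<sigma> f) = aact CoPB xs x \<sigma> (?F f)" for xs x \<sigma> f
      by (cases f) (simp add: PaPB_simps)
  qed
  show ?thesis
    unfolding categorical_equivalence_def
  proof (intro conjI allI mor equivalence_of_groupoidsI)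
    fix xs x
    show "groupoid_functor (ar PaPB xs x) (ar CoPB xs x) (omega xs x) ?F"
      using mor by (simp add: operad_morphism_def)
    show "bij_betw ?F (hom (ar PaPB xs x) u v) (hom (ar CoPB xs x) (omega xs x u) (omega xs x v))"
      if "u \<in> Obj (ar PaPB xs x)" "v \<in> Obj (ar PaPB xs x)" for u v
      using full[OF that] by (intro bij_betw_imageI inj_onI) (auto simp: ar_PaPB)
    show "\<exists>a\<in>Obj (ar PaPB xs x). hom (ar CoPB xs x) (omega xs x a) b \<noteq> {}" if b: "b \<in> Obj (ar CoPB xs x)" for b
    proof -
      \<comment> \<open>The transfer is the source of the groupoid laws of \<open>CoPB\<close>; in
        particular the identity of \<open>b\<close> is an arrow, and it connects \<open>b\<close> to
        the word of a tree.\<close>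
      have "relative_groupoid_operad CoPB" using mor by (simp add: operad_morphism_def)
      then have "idn (ar CoPB xs x) b \<in> hom (ar CoPB xs x) b b"
        using groupoid.idn_hom[OF relative_groupoid_operad.arity_groupoid b] by blast
      moreover obtain a where "a \<in> trees xs x" "omega xs x a = b" using b unfolding Obj_CoPB omega_image[symmetric] by blast
      ultimately show ?thesis by (auto simp: ar_PaPB)
    qed
  qed
qed

theorem theorem3p10:
  shows "operads_isomorphic PaPB piSC_OmegaOmega
    \<and> categorical_equivalence piSC_OmegaOmega piSC (\<lambda>xs x a. a) (\<lambda>xs x f. f)
    \<and> categorical_equivalence PaPB CoPB omega (\<lambda>xs x (u, f, v). f)"
  using PaPB_isomorphic piSC_OmegaOmega_equivalence PaPB_equivalence by blast

end
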